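(* Let $m\ge 1$, let $V\subset\mathbb{R}^m$ be a centrally symmetric (with respect to the origin) closed convex body satisfying the $\Pi$-condition, let $p\in[1,\infty)$, and let $\lambda_j\ge 0$, $1\le j\le m$. Then $$\lim_{a\to\infty}a^{-\left(m+2\sum_{j=1}^m\lambda_j\right)/p}\,\mathcal{N}\left(\mathcal{P}_{aV},L_{p,\prod_{j=1}^m(1-x_j^2)^{\lambda_j-1/2}}(Q^m)\right)=2^{m/p}\,\mathcal{N}_0\left(B_V\cap L_{p,\prod_{j=1}^m|t_j|^{2\lambda_j}}(\mathbb{R}^m),\,L_{p,\prod_{j=1}^m|t_j|^{2\lambda_j}}(\mathbb{R}^m)\right).$$ In addition, there exists a function $f_0\in\left(B_V\cap L_{p,\prod_{j=1}^m|t_j|^{2\lambda_j}}(\mathbb{R}^m)\right)\setminus\{0\}$ such that $$\lim_{a\to\infty}a^{-\left(m+2\sum_{j=1}^m\lambda_j\right)/p}\,\mathcal{N}\left(\mathcal{P}_{aV},L_{p,\prod_{j=1}^m(1-x_j^2)^{\lambda_j-1/2}}(Q^m)\right)=2^{m/p}\,|f_0(0)|\,/\,\|f_0\|_{L_{p,\prod_{j=1}^m|t_j|^{2\lambda_j}}(\mathbb{R}^m)}.$$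
   Context: $Q^m=[-1,1]^m\subset\mathbb{R}^m$. A convex body is a compact convex set with nonempty interior. $V$ satisfies the $\Pi$-condition if for every $t\in V\setminus\{0\}$ the set $\{s\in\mathbb{R}^m:|s_j|\le|t_j|,\,1\le j\le m\}$ is contained in $V$. For a measurable $\Omega\subseteq\mathbb{R}^m$ and a locally integrable weight $W:\Omega\to[0,\infty]$, $L_{r,W}(\Omega)$, $0<r<\infty$, is the space of measurable $F:\Omega\to\mathbb{C}$ with $\|F\|_{L_{r,W}(\Omega)}:=\left(\int_\Omega|F(x)|^rW(x)\,dx\right)^{1/r}<\infty$; $\|F\|_{L_\infty(\Omega)}:=\operatorname{ess\,sup}_{x\in\Omega}|F(x)|$. In $L_{p,\prod_j(1-x_j^2)^{\lambda_j-1/2}}(Q^m)$ the weight is written as a function of the variable $x\in Q^m$, and in $L_{p,\prod_j|t_j|^{2\lambda_j}}(\mathbb{R}^m)$ as a function of $t\in\mathbb{R}^m$. For a subspace $B$ of $L_{p,W}(\Omega)$ ($\Omega$ closed) and a fixed point $x_0\in\Omega$, $$\mathcal{N}_{x_0}(B,L_{p,W}(\Omega)):=\sup_{h\in B\setminus\{0\}}\frac{|h(x_0)|}{\|h\|_{L_{p,W}(\Omega)}},\qquad \mathcal{N}(B,L_{p,W}(\Omega)):=\sup_{h\in B\setminus\{0\}}\frac{\|h\|_{L_\infty(\Omega)}}{\|h\|_{L_{p,W}(\Omega)}};$$ $\mathcal{N}_0$ is the case where $x_0$ is the origin. For a real $a\ge0$, $\mathcal{P}_{aV}$ is the set of all polynomials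 $P(x)=\sum_{k\in aV\cap\mathbb{Z}^m_+}c_kx^k$ in $m$ variables with complex coefficients, where $\mathbb{Z}^m_+$ is the set of integer points with nonnegative coordinates and $x^k=x_1^{k_1}\cdots x_m^{k_m}$. For $z\in\mathbb{C}^m$ let $\|z\|_V^*:=\sup_{t\in V}\left|\sum_{j=1}^mt_jz_j\right|$. $B_V$ is the set of all entire functions $f:\mathbb{C}^m\to\mathbb{C}$ of exponential type $V$, i.e. such that for every $\varepsilon>0$ there is a constant $C_0(\varepsilon,f)>0$ with $|f(z)|\le C_0(\varepsilon,f)\exp\left((1+\varepsilon)\|z\|_V^*\right)$ for all $z\in\mathbb{C}^m$. A function $f\in B_V$ is identified with its restriction to $\mathbb{R}^m$ when writing $B_V\cap L_{p,W}(\mathbb{R}^m)$. *)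

theory Defs
  imports "HOL-Probability.Essential_Supremum"
begin

section \<open>Weighted Lebesgue spaces\<close>

text \<open>Functions on \<Omega> are represented by total functions of which only the values on \<Omega> are used.
  All norms, and hence the suprema of quotients of norms below, are extended nonnegative reals.\<close>

definition wnorm :: "real \<Rightarrow> (real^'m \<Rightarrow> ennreal) \<Rightarrow> (real^'m) set \<Rightarrow> (real^'m \<Rightarrow> complex) \<Rightarrow> ennreal" where
  "wnorm r W \<Omega> F =
     (let I = (\<integral>\<^sup>+ x. ennreal (norm (F x) powr r) * W x \<partial>lebesgue_on \<Omega>)
      in if I = \<infinity> then \<infinity> else ennreal (enn2real I powr (1 / r)))"

definition wLp :: "real \<Rightarrow> (real^'m \<Rightarrow> ennreal) \<Rightarrow> (real^'m) set \<Rightarrow> (real^'m \<Rightarrow> complex) set" where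
  "wLp r W \<Omega> = {F. F \<in> borel_measurable (lebesgue_on \<Omega>) \<and> wnorm r W \<Omega> F < \<infinity>}"

definition Linf_norm :: "(real^'m) set \<Rightarrow> (real^'m \<Rightarrow> complex) \<Rightarrow> ennreal" where
  "Linf_norm \<Omega> F = esssup (lebesgue_on \<Omega>) (\<lambda>x. ennreal (norm (F x)))"

definition cube :: "(real^'m) set" where
  "cube = {x. \<forall>j. \<bar>x $ j\<bar> \<le> 1}"

text \<open>Where a base vanishes, \<open>powr\<close> has the value 0 whatever the exponent, so there the two weights
  below may differ from their usual values (\<open>\<infinity>\<close> for a negative exponent, 1 for the exponent 0).
  This only concerns null sets, and weights only occur under integrals.\<close>

definition jacobi_weight :: "('m \<Rightarrow> real) \<Rightarrow> real^'m \<Rightarrow> ennreal" where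
  "jacobi_weight l x = (\<Prod>j\<in>UNIV. ennreal ((1 - (x $ j)\<^sup>2) powr (l j - 1/2)))"

definition power_weight :: "('m \<Rightarrow> real) \<Rightarrow> real^'m \<Rightarrow> ennreal" where
  "power_weight l t = (\<Prod>j\<in>UNIV. ennreal (\<bar>t $ j\<bar> powr (2 * l j)))"

section \<open>Sharp constants\<close>

definition nonzero_on :: "(real^'m) set \<Rightarrow> (real^'m \<Rightarrow> complex) set \<Rightarrow> (real^'m \<Rightarrow> complex) set" where
  "nonzero_on \<Omega> B = {h \<in> B. \<exists>x\<in>\<Omega>. h x \<noteq> 0}"

definition nikolskii_at ::
  "real^'m \<Rightarrow> (real^'m \<Rightarrow> complex) set \<Rightarrow> real \<Rightarrow> (real^'m \<Rightarrow> ennreal) \<Rightarrow> (real^'m) set \<Rightarrow> ennreal" where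
  "nikolskii_at x0 B p W \<Omega> = (SUP h\<in>nonzero_on \<Omega> B. ennreal (norm (h x0)) / wnorm p W \<Omega> h)"

definition nikolskii ::
  "(real^'m \<Rightarrow> complex) set \<Rightarrow> real \<Rightarrow> (real^'m \<Rightarrow> ennreal) \<Rightarrow> (real^'m) set \<Rightarrow> ennreal" where
  "nikolskii B p W \<Omega> = (SUP h\<in>nonzero_on \<Omega> B. Linf_norm \<Omega> h / wnorm p W \<Omega> h)"

section \<open>Convex bodies, polynomials and entire functions of exponential type\<close>

definition convex_body :: "(real^'m) set \<Rightarrow> bool" where
  "convex_body V \<longleftrightarrow> compact V \<and> convex V \<and> interior V \<noteq> {}"

definition centrally_symmetric :: "(real^'m) set \<Rightarrow> bool" where
  "centrally_symmetric V \<longleftrightarrow> (\<forall>t\<in>V. - t \<in> V)"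

definition Pi_condition :: "(real^'m) set \<Rightarrow> bool" where
  "Pi_condition V \<longleftrightarrow> (\<forall>t\<in>V - {0}. {s. \<forall>j. \<bar>s $ j\<bar> \<le> \<bar>t $ j\<bar>} \<subseteq> V)"

text \<open>The index set of the sum is finite whenever \<open>V\<close> is bounded.\<close>

definition poly_space :: "real \<Rightarrow> (real^'m) set \<Rightarrow> (real^'m \<Rightarrow> complex) set" where
  "poly_space a V =
     {P. \<exists>c :: ('m \<Rightarrow> nat) \<Rightarrow> complex.
           P = (\<lambda>x. \<Sum>k | (\<chi> j. real (k j)) \<in> (\<lambda>t. a *\<^sub>R t) ` V.
                      c k * (\<Prod>j\<in>UNIV. complex_of_real (x $ j) ^ k j))}"

definition entire :: "(complex^'m \<Rightarrow> complex) \<Rightarrow> bool" where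
  "entire f \<longleftrightarrow>
     (\<forall>z. \<exists>D. (f has_derivative D) (at z) \<and> (\<forall>c v. D (c *s v) = c * D v))"

definition dual_norm :: "(real^'m) set \<Rightarrow> complex^'m \<Rightarrow> real" where
  "dual_norm V z = (SUP t\<in>V. norm (\<Sum>j\<in>UNIV. complex_of_real (t $ j) * z $ j))"

definition exp_type :: "(real^'m) set \<Rightarrow> (complex^'m \<Rightarrow> complex) set" where
  "exp_type V =
     {f. entire f \<and>
         (\<forall>\<epsilon>>0. \<exists>C>0. \<forall>z. norm (f z) \<le> C * exp ((1 + \<epsilon>) * dual_norm V z))}"

definition exp_type_real :: "(real^'m) set \<Rightarrow> (real^'m \<Rightarrow> complex) set" where
  "exp_type_real V = (\<lambda>f t. f (\<chi> j. complex_of_real (t $ j))) ` exp_type V"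

end

theory Submission
  imports Defs "HOL-Probability.Sinc_Integral" "HOL-Complex_Analysis.Complex_Analysis"
    "HOL-Real_Asymp.Real_Asymp"
begin

text \<open>Write \<open>M(a)\<close> for the scaled constant \<open>a powr (-(m + 2 * sum l)/p) * N(P_{aV})\<close> on the left, \<open>N_0\<close> for the constant of
entire functions on the right, and \<open>ratio f = |f 0| / norm f\<close>. It is shown that \<open>2 powr (m/p) * ratio f\<close> is at most the lower limit of
\<open>M(a)\<close> for every admissible entire function \<open>f\<close>, and that some \<open>f\<close> has \<open>2 powr (m/p) * ratio f\<close> at least the
upper limit along a given sequence \<open>a\<^sub>n\<close>. As \<open>ratio f \<le> N_0\<close>, the limit exists, equals \<open>2 powr (m/p) * N_0\<close>, and the second \<open>f\<close> is
extremal.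

The bridge between the cube and the whole space is the substitution \<open>x\<^sub>j = cos (t\<^sub>j / a)\<close>. It turns the scaled weighted norm of a
polynomial \<open>P\<close> into the integral of \<open>|P(cos (t/a))| powr p\<close> over the box \<open>(0, pi a)^m\<close> with the weight
\<open>\<Prod>j. (a sin (t\<^sub>j/a)) powr (2 l\<^sub>j)\<close> (\<open>cube_integral_scaled\<close>). As \<open>a \<rightarrow> \<infinity>\<close> the boxes exhaust the positive orthant and the weight tends
to \<open>\<Prod>j. t\<^sub>j powr (2 l\<^sub>j)\<close>. The functions of \<open>t\<close> that occur are even in each variable, so their integral over the orthant is \<open>2^(-m)\<close> times the
integral over the space; this is the origin of the factor \<open>2 powr (m/p)\<close>.

Lower bound (\<open>liminf_scaled_const_ge\<close>). An entire function \<open>f\<close> of type \<open>V\<close> with finite norm has to be imitated by polynomials.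
Averaging \<open>f\<close> over dilations of the coordinates by factors of either sign and of modulus close to 1 makes it even and lowers its type, at a
negligible cost in the norm. The average grows polynomially on the real space, hence, by a Phragmen-Lindelof argument, its growth elsewhere is governed
by the imaginary part; a product of powers of sinc functions then provides as much decay as desired (\<open>even_decaying_approximation\<close>).
The sum of the translates of such a function by \<open>2 pi a n\<close>, \<open>n\<close> in the integer lattice, is periodic and even, and its
frequencies lie in \<open>V\<close>: a Fourier coefficient with frequency outside \<open>V\<close> is killed by shifting the contour in a
direction that separates the frequency from \<open>V\<close>. So the sum is a polynomial in the \<open>cos (t\<^sub>j/a)\<close>, and it lies in \<open>P_{aV}\<close>
because \<open>V\<close> is solid by the \<open>\<Pi>\<close>-condition (\<open>periodized_polynomial\<close>). It differs from the function by \<open>1/a\<close> times an integrable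
majorant, and dominated convergence applies.

Upper bound (\<open>limsup_scaled_const_le\<close>). A polynomial with nearly extremal quotient may attain its maximum anywhere in the
cube. Generalized translation moves the maximum to the vertex \<open>(1,...,1)\<close>, which corresponds to \<open>t = 0\<close>, without leaving \<open>P_{aV}\<close>
(\<open>gtrans_poly\<close>) and without increasing the norm (\<open>gtrans_contraction\<close>). In each variable it is the average of
\<open>P (y x + sqrt (1 - y^2) sqrt (1 - x^2) \<xi>)\<close> over \<open>\<xi>\<close>; geometrically the disc with density \<open>(1 - |w|^2) powr (\<mu> - 1)\<close> is rotated, and the
weight \<open>(1 - x^2) powr (\<mu> - 1/2)\<close> is its projection to the first coordinate. The density is integrable only for \<open>\<mu> > 0\<close>, so \<open>l\<^sub>j\<close> is replaced by
\<open>l\<^sub>j + \<epsilon>\<close> with \<open>\<epsilon> = a^(-2)\<close>, which costs a factor tending to 1 (\<open>near_extremal\<close>). The functions \<open>z \<mapsto> Q (cos (z/a))\<close> obtained from the normalized translated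
polynomials are entire of type \<open>V\<close> with a common bound (\<open>cos_extension\<close>). They form a normal family; the limit \<open>f\<close> of
a subsequence has type \<open>V\<close> and \<open>f 0 = 1\<close>, and by Fatou's lemma its norm is as small as required (\<open>scaled_const_limit_le\<close>).\<close>

no_notation fps_nth (infixl \<open>$\<close> 75)

section \<open>Integration coordinate by coordinate\<close>

lemma vec_component_measurable [measurable]: "(\<lambda>x::real^'m. x $ j) \<in> borel_measurable borel"
  by (intro borel_measurable_continuous_onI continuous_intros)

lemma vec_lambda_measurable [measurable (raw)]:
  fixes f :: "'a \<Rightarrow> 'm::finite \<Rightarrow> real"
  assumes "\<And>j. (\<lambda>x. f x j) \<in> borel_measurable M"
  shows "(\<lambda>x. \<chi> j. f x j) \<in> borel_measurable M"
proof (rule borel_measurable_euclidean_space[THEN iffD2], rule ballI)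
  fix b :: "real^'m" assume "b \<in> Basis"
  then obtain j where "b = axis j 1" by (auto simp: Basis_vec_def)
  then show "(\<lambda>x. (\<chi> j. f x j) \<bullet> b) \<in> borel_measurable M"
    using assms[of j] by (simp add: inner_axis)
qed

lemma prod_Basis_vec: "(\<Prod>b\<in>(Basis::(real^'m) set). F b) = (\<Prod>j\<in>UNIV. F (axis j 1))"
proof -
  have "Basis = range (\<lambda>j. axis j (1::real) :: real^'m)" by (auto simp: Basis_vec_def)
  moreover have "inj (\<lambda>j. axis j (1::real) :: real^'m)"
    by (auto simp: inj_def axis_eq_axis)
  ultimately show ?thesis
    using prod.reindex[of "\<lambda>j. axis j (1::real) :: real^'m" UNIV F] by (simp only: o_def)
qed

lemma nn_integral_prod_coords:
  fixes \<phi> :: "'m::finite \<Rightarrow> real \<Rightarrow> ennreal"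
  assumes "\<And>j. \<phi> j \<in> borel_measurable borel"
  shows "(\<integral>\<^sup>+t. (\<Prod>j\<in>UNIV. \<phi> j (t $ j)) \<partial>(lborel::(real^'m) measure)) = (\<Prod>j\<in>UNIV. \<integral>\<^sup>+s. \<phi> j s \<partial>lborel)"
proof -
  define f where "f b = \<phi> (SOME j. axis j (1::real) = b)" for b :: "real^'m"
  have f: "f (axis j 1) = \<phi> j" for j
    unfolding f_def by (rule arg_cong[where f=\<phi>]) (auto simp: axis_eq_axis)
  have "(\<integral>\<^sup>+x. (\<Prod>b\<in>Basis. f b (x \<bullet> b)) \<partial>(lborel::(real^'m) measure)) = (\<Prod>b\<in>Basis. (\<integral>\<^sup>+x. f b x \<partial>lborel))"
    by (rule nn_integral_lborel_prod) (auto simp: f_def assms)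
  then show ?thesis by (simp add: prod_Basis_vec f inner_axis)
qed

lemma indicator_box_vec:
  "indicator (box a b) (t::real^'m) = (\<Prod>j\<in>UNIV. indicator {a $ j<..<b $ j} (t $ j) :: ennreal)"
  by (auto simp: indicator_def mem_box_cart)

text \<open>A change of variables that acts on each coordinate separately. The hypothesis \<open>one\<close> says that in each coordinate the map pushes one
density to the other, tested on open intervals only; boxes generate the Borel sets, so the product measures agree as well. No
differentiability or injectivity enters, which suits the cosine.\<close>

lemma nn_integral_coordinatewise:
  fixes n1 n2 :: "'m::finite \<Rightarrow> real \<Rightarrow> ennreal" and T :: "'m \<Rightarrow> real \<Rightarrow> real"
  assumes n1[measurable]: "\<And>j. n1 j \<in> borel_measurable borel"
    and n2[measurable]: "\<And>j. n2 j \<in> borel_measurable borel"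
    and T[measurable]: "\<And>j. T j \<in> borel_measurable borel"
    and one: "\<And>j a b. (\<integral>\<^sup>+s. n1 j s * indicator {a<..<b} (T j s) \<partial>lborel) = (\<integral>\<^sup>+s. n2 j s * indicator {a<..<b} s \<partial>lborel)"
    and fin: "\<And>j. (\<integral>\<^sup>+s. n2 j s \<partial>lborel) < \<infinity>"
    and \<Phi>[measurable]: "\<Phi> \<in> borel_measurable borel"
  shows "(\<integral>\<^sup>+t. \<Phi> (\<chi> j. T j (t $ j)) * (\<Prod>j\<in>UNIV. n1 j (t $ j)) \<partial>lborel)
       = (\<integral>\<^sup>+t. \<Phi> t * (\<Prod>j\<in>UNIV. n2 j (t $ j)) \<partial>(lborel::(real^'m) measure))"
proof -
  define TT where "TT t = (\<chi> j. T j (t $ j))" for t :: "real^'m"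
  have TT[measurable]: "TT \<in> borel_measurable borel"
    unfolding TT_def by measurable
  have d1[measurable]: "(\<lambda>t::real^'m. \<Prod>j\<in>UNIV. n1 j (t $ j)) \<in> borel_measurable borel" by measurable
  have d2[measurable]: "(\<lambda>t::real^'m. \<Prod>j\<in>UNIV. n2 j (t $ j)) \<in> borel_measurable borel" by measurable
  let ?M1 = "distr (density lborel (\<lambda>t. \<Prod>j\<in>UNIV. n1 j (t $ j))) borel TT"
  let ?M2 = "density lborel (\<lambda>t::real^'m. \<Prod>j\<in>UNIV. n2 j (t $ j))"
  have box: "emeasure ?M2 (box a b) = emeasure ?M1 (box a b)" for a b
  proof -
    have "emeasure ?M1 (box a b) = (\<integral>\<^sup>+t. (\<Prod>j\<in>UNIV. n1 j (t $ j)) * indicator (box a b) (TT t) \<partial>lborel)"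
    proof -
      have "emeasure ?M1 (box a b) = (\<integral>\<^sup>+t. indicator (box a b) t \<partial>?M1)" by simp
      also have "\<dots> = (\<integral>\<^sup>+t. (\<Prod>j\<in>UNIV. n1 j (t $ j)) * indicator (box a b) (TT t) \<partial>lborel)"
        by (subst nn_integral_distr, measurable, subst nn_integral_density) auto
      finally show ?thesis .
    qed
    also have "\<dots> = (\<integral>\<^sup>+t. (\<Prod>j\<in>UNIV. n1 j (t $ j) * indicator {a $ j<..<b $ j} (T j (t $ j))) \<partial>(lborel::(real^'m) measure))"
      by (simp add: indicator_box_vec TT_def prod.distrib)
    also have "\<dots> = (\<Prod>j\<in>UNIV. \<integral>\<^sup>+s. n1 j s * indicator {a $ j<..<b $ j} (T j s) \<partial>lborel)"
      by (rule nn_integral_prod_coords) measurable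
    also have "\<dots> = (\<Prod>j\<in>UNIV. \<integral>\<^sup>+s. n2 j s * indicator {a $ j<..<b $ j} s \<partial>lborel)"
      by (simp add: one)
    also have "\<dots> = (\<integral>\<^sup>+t. (\<Prod>j\<in>UNIV. n2 j (t $ j) * indicator {a $ j<..<b $ j} (t $ j)) \<partial>(lborel::(real^'m) measure))"
      by (rule nn_integral_prod_coords[symmetric]) measurable
    also have "\<dots> = emeasure ?M2 (box a b)"
      by (subst emeasure_density) (auto simp: indicator_box_vec prod.distrib)
    finally show ?thesis by simp
  qed
  have M2fin: "emeasure ?M2 X < \<infinity>" if "X \<in> sets borel" for X
  proof -
    have "emeasure ?M2 X \<le> (\<integral>\<^sup>+t. (\<Prod>j\<in>UNIV. n2 j (t $ j)) \<partial>(lborel::(real^'m) measure))"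
      using that by (subst emeasure_density) (auto intro!: nn_integral_mono simp: indicator_def)
    also have "\<dots> = (\<Prod>j\<in>UNIV. \<integral>\<^sup>+s. n2 j s \<partial>lborel)"
      by (rule nn_integral_prod_coords) measurable
    also have "\<dots> < \<infinity>" using fin by (simp add: less_top[symmetric] ennreal_prod_eq_top)
    finally show ?thesis .
  qed
  have "?M2 = ?M1"
  proof (rule measure_eqI_generator_eq)
    let ?E = "range (\<lambda>(a, b). box a b::(real^'m) set)"
    show "Int_stable ?E" by (auto simp: Int_stable_def box_Int_box)
    show "?E \<subseteq> Pow UNIV" "sets ?M2 = sigma_sets UNIV ?E" "sets ?M1 = sigma_sets UNIV ?E"
      by (simp_all add: borel_eq_box)
    let ?A = "\<lambda>n::nat. box (- (real n *\<^sub>R One)) (real n *\<^sub>R One) :: (real^'m) set"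
    show "range ?A \<subseteq> ?E" "(\<Union>i. ?A i) = UNIV" unfolding UN_box_eq_UNIV by auto
    show "emeasure ?M2 (?A i) \<noteq> \<infinity>" for i using M2fin[of "?A i"] by auto
    show "emeasure ?M2 X = emeasure ?M1 X" if "X \<in> ?E" for X using that box by auto
  qed
  then have "(\<integral>\<^sup>+t. \<Phi> t \<partial>?M1) = (\<integral>\<^sup>+t. \<Phi> t \<partial>?M2)" by simp
  then show ?thesis
    by (simp add: nn_integral_distr nn_integral_density TT_def mult.commute)
qed

lemma nn_integral_dilate:
  fixes c :: "real^'m" and \<Phi> :: "real^'m \<Rightarrow> ennreal"
  assumes [measurable]: "\<Phi> \<in> borel_measurable borel" and c: "\<And>j. c $ j \<noteq> 0"
  shows "(\<integral>\<^sup>+t. \<Phi> t \<partial>lborel) = ennreal (\<Prod>j\<in>UNIV. \<bar>c $ j\<bar>) * (\<integral>\<^sup>+t. \<Phi> (d + c * t) \<partial>lborel)"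
proof -
  define T where "T x = d + (\<Sum>j\<in>Basis. ((c \<bullet> j) * (x \<bullet> j)) *\<^sub>R j)" for x :: "real^'m"
  have T: "T x = d + c * x" for x
  proof -
    have "(\<Sum>j\<in>Basis. ((c \<bullet> j) * (x \<bullet> j)) *\<^sub>R j) = (\<Sum>j\<in>Basis. ((c * x) \<bullet> j) *\<^sub>R j)"
      by (intro sum.cong refl) (auto simp: Basis_vec_def inner_axis)
    then show ?thesis by (simp add: T_def euclidean_representation)
  qed
  have [measurable]: "T \<in> borel_measurable borel" unfolding T_def by measurable
  have eq: "lborel = density (distr lborel borel T) (\<lambda>_. (\<Prod>j\<in>Basis. \<bar>c \<bullet> j\<bar>))"
    unfolding T_def by (rule lborel_affine_euclidean) (auto simp: Basis_vec_def inner_axis c)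
  have P: "(\<Prod>j\<in>Basis. \<bar>c \<bullet> j\<bar>) = (\<Prod>j\<in>UNIV. \<bar>c $ j\<bar>)"
    by (simp add: prod_Basis_vec inner_axis)
  show ?thesis
    by (subst eq) (simp add: nn_integral_density nn_integral_distr nn_integral_cmult P T)
qed

lemma AE_coordinate_nonzero: "AE t in lborel. (t::real^'m) $ k \<noteq> 0"
proof -
  have b: "{t::real^'m. t $ k = 0} \<in> sets borel"
    by (intro borel_closed closed_Collect_eq continuous_intros)
  define \<phi> :: "'m \<Rightarrow> real \<Rightarrow> ennreal" where "\<phi> j s = (if j = k then indicator {0} s else 1)" for j s
  have "emeasure lborel {t::real^'m. t $ k = 0} = (\<integral>\<^sup>+t. indicator {t. t $ k = 0} t \<partial>(lborel::(real^'m) measure))"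
    using b by simp
  also have "\<dots> = (\<integral>\<^sup>+t. (\<Prod>j\<in>UNIV. \<phi> j (t $ j)) \<partial>(lborel::(real^'m) measure))"
  proof (rule nn_integral_cong)
    fix t :: "real^'m"
    have "(\<Prod>j\<in>UNIV. \<phi> j (t $ j)) = (indicator {0} (t $ k) :: ennreal)"
      unfolding \<phi>_def by (subst prod.delta) auto
    then show "indicator {t. t $ k = 0} t = (\<Prod>j\<in>UNIV. \<phi> j (t $ j))"
      by (simp add: indicator_def)
  qed
  also have "\<dots> = (\<Prod>j\<in>UNIV. (\<integral>\<^sup>+s. \<phi> j s \<partial>lborel))"
    by (rule nn_integral_prod_coords) (auto simp: \<phi>_def[abs_def])
  also have "\<dots> = 0"
  proof (rule prod_zero)
    have "(\<integral>\<^sup>+s. \<phi> k s \<partial>lborel) = 0" by (simp add: \<phi>_def)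
    then show "\<exists>j\<in>UNIV. (\<integral>\<^sup>+s. \<phi> j s \<partial>lborel) = 0" by blast
  qed simp
  finally show ?thesis
    using b by (intro AE_I[where N="{t::real^'m. t $ k = 0}"]) auto
qed

text \<open>Reflecting one coordinate after the other: each reflection shows that half of the remaining integral lies where that coordinate is positive, the
hyperplane where it vanishes being a null set.\<close>

lemma nn_integral_flip_even:
  fixes g :: "real^'m \<Rightarrow> ennreal"
  assumes [measurable]: "g \<in> borel_measurable borel"
    and even: "\<And>j t. g (\<chi> i. if i = j then - t $ i else t $ i) = g t"
  shows "(\<integral>\<^sup>+t. g t \<partial>lborel) = 2 ^ CARD('m) * (\<integral>\<^sup>+t. g t * indicator {t. \<forall>j. 0 < t $ j} t \<partial>lborel)"
proof -
  have "finite J \<Longrightarrow> (\<integral>\<^sup>+t. g t \<partial>lborel) = 2 ^ card J * (\<integral>\<^sup>+t. g t * indicator {t. \<forall>j\<in>J. 0 < t $ j} t \<partial>lborel)" for J :: "'m set"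
  proof (induction J rule: finite_induct)
    case empty show ?case by simp
  next
    case (insert k J)
    let ?I = "\<lambda>t::real^'m. indicator {t. \<forall>j\<in>J. 0 < t $ j} t :: ennreal"
    define c :: "real^'m" where "c = (\<chi> i. if i = k then -1 else 1)"
    have cf: "c * t = (\<chi> i. if i = k then - t $ i else t $ i)" for t
      by (simp add: vec_eq_iff c_def)
    have "{t. \<forall>j\<in>J. 0 < t $ j} = (\<Inter>j\<in>J. {t::real^'m. 0 < t $ j})" by auto
    also have "open \<dots>"
      using insert.hyps by (intro open_INT ballI open_Collect_less continuous_intros)
    finally have I[measurable]: "?I \<in> borel_measurable borel"
      by (intro borel_measurable_indicator borel_open)
    have evc: "g (c * t) = g t" for t using even[of k t] by (simp only: cf)
    have J: "?I (c * t) = ?I t" for t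
      using insert.hyps by (auto simp: cf indicator_def)
    have nz: "AE t in lborel. (t::real^'m) $ k \<noteq> 0" by (rule AE_coordinate_nonzero)
    let ?P = "\<lambda>t. g t * ?I t * indicator {t. 0 < t $ k} t"
    let ?N = "\<lambda>t. g t * ?I t * indicator {t. t $ k < 0} t"
    have "(\<integral>\<^sup>+t. g t * ?I t \<partial>lborel) = (\<integral>\<^sup>+t. ?P t + ?N t \<partial>lborel)"
      using nz by (intro nn_integral_cong_AE) (auto elim!: eventually_mono simp: indicator_def)
    also have "\<dots> = (\<integral>\<^sup>+t. ?P t \<partial>lborel) + (\<integral>\<^sup>+t. ?N t \<partial>lborel)"
      by (rule nn_integral_add) measurable
    also have "(\<integral>\<^sup>+t. ?N t \<partial>lborel) = ennreal (\<Prod>j\<in>UNIV. \<bar>c $ j\<bar>) * (\<integral>\<^sup>+t. ?N (0 + c * t) \<partial>lborel)"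
      by (rule nn_integral_dilate) (auto simp: c_def)
    also have "(\<Prod>j\<in>UNIV. \<bar>c $ j\<bar>) = 1" by (rule prod.neutral) (auto simp: c_def)
    also have "(\<lambda>t. ?N (0 + c * t)) = ?P"
      by (rule ext) (simp only: add_0 evc J, simp add: c_def indicator_def)
    finally have "(\<integral>\<^sup>+t. g t * ?I t \<partial>lborel) = 2 * (\<integral>\<^sup>+t. ?P t \<partial>lborel)"
      by (simp add: mult_2)
    also have "?P = (\<lambda>t. g t * indicator {t. \<forall>j\<in>insert k J. 0 < t $ j} t)"
      by (rule ext) (auto simp: indicator_def)
    finally show ?case using insert.IH insert.hyps by (simp add: mult_ac)
  qed
  from this[of UNIV] show ?thesis by simp
qed

section \<open>Jensen's inequality for powers\<close>

lemma powr_tangent: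
  fixes c u p :: real assumes "1 \<le> p" "0 < c" "0 \<le> u"
  shows "c powr p + p * c powr (p - 1) * u \<le> u powr p + p * c powr p"
proof (cases "u = 0")
  case True
  have "c powr p \<le> p * c powr p" using assms by (simp add: mult_le_cancel_right1)
  then show ?thesis using True by simp
next
  case False
  have "u powr p - c powr p \<ge> (p * c powr (p - 1)) * (u - c)"
  proof (rule convex_on_imp_above_tangent[where A="{0<..}"])
    show "convex_on {0<..} (\<lambda>x. x powr p)" by (rule powr_convex) (use assms in auto)
    show "((\<lambda>x. x powr p) has_real_derivative p * c powr (p - 1)) (at c within {0<..})"
      by (rule has_field_derivative_at_within, rule has_real_derivative_powr) (use assms in auto)
  qed (use assms False in \<open>auto simp: interior_open\<close>)
  moreover have "p * c powr (p - 1) * c = p * c powr p"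
    using assms by (simp add: powr_diff)
  ultimately show ?thesis by (simp only: right_diff_distrib)
qed

text \<open>The tangent line of \<open>u powr p\<close> at \<open>c\<close>, the norm of the mean, is integrated; Jensen's inequality is needed for arbitrary integrable functions
into the complex numbers, where the right-hand side may be infinite.\<close>

lemma jensen_powr:
  fixes F :: "'a \<Rightarrow> complex"
  assumes M: "prob_space M" and F: "integrable M F" and p: "1 \<le> p"
  shows "ennreal (norm (integral\<^sup>L M F) powr p) \<le> (\<integral>\<^sup>+x. ennreal (norm (F x) powr p) \<partial>M)"
proof (cases "integral\<^sup>L M F = 0")
  case True then show ?thesis by simp
next
  case False
  interpret prob_space M by fact
  have [measurable]: "F \<in> borel_measurable M" using F by auto
  define c where "c = norm (integral\<^sup>L M F)"
  have c: "0 < c" using False by (simp add: c_def)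
  have "ennreal c \<le> ennreal (\<integral>x. norm (F x) \<partial>M)"
    unfolding c_def by (intro ennreal_leI integral_norm_bound)
  also have "\<dots> = (\<integral>\<^sup>+x. norm (F x) \<partial>M)"
    using F by (intro nn_integral_eq_integral[symmetric]) auto
  finally have c1: "ennreal c \<le> (\<integral>\<^sup>+x. norm (F x) \<partial>M)" .
  have cc: "p * c powr (p - 1) * c = p * c powr p"
    using c by (simp add: powr_diff)
  have "ennreal (c powr p) + ennreal (p * c powr p) = ennreal (c powr p) + ennreal (p * c powr (p - 1)) * ennreal c"
    using p c cc by (simp add: ennreal_mult'[symmetric])
  also have "\<dots> \<le> ennreal (c powr p) + ennreal (p * c powr (p - 1)) * (\<integral>\<^sup>+x. norm (F x) \<partial>M)"
    using c1 by (intro add_left_mono mult_left_mono) auto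
  also have "\<dots> = (\<integral>\<^sup>+x. ennreal (c powr p) + ennreal (p * c powr (p - 1)) * norm (F x) \<partial>M)"
    by (simp add: nn_integral_add nn_integral_cmult emeasure_space_1)
  also have "\<dots> \<le> (\<integral>\<^sup>+x. ennreal (norm (F x) powr p) + ennreal (p * c powr p) \<partial>M)"
  proof (rule nn_integral_mono)
    fix x
    have "ennreal (c powr p + p * c powr (p - 1) * norm (F x)) \<le> ennreal (norm (F x) powr p + p * c powr p)"
      using powr_tangent[OF p c norm_ge_zero] by (rule ennreal_leI)
    then show "ennreal (c powr p) + ennreal (p * c powr (p - 1)) * norm (F x) \<le> ennreal (norm (F x) powr p) + ennreal (p * c powr p)"
      using p c by (simp add: ennreal_plus ennreal_mult' )
  qed
  also have "\<dots> = (\<integral>\<^sup>+x. ennreal (norm (F x) powr p) \<partial>M) + ennreal (p * c powr p)"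
    by (simp add: nn_integral_add emeasure_space_1)
  finally show ?thesis unfolding c_def by (simp add: ennreal_add_left_cancel_le)
qed

section \<open>Holomorphic functions of one variable\<close>

text \<open>The case of growth of order two in a sector of opening \<open>pi/4\<close>. Since \<open>Re (s^3)\<close> is comparable to \<open>|s|^3\<close> there, the factor
\<open>exp (- \<delta> s^3)\<close> beats the growth and has modulus at most one, so the maximum principle on a truncated sector applies; then \<open>\<delta> \<rightarrow> 0\<close>.\<close>

lemma narrow_sector_bound:
  fixes F :: "complex \<Rightarrow> complex" and c B b M :: real
  assumes c: "c = sqrt 2 - 1" and hol: "F holomorphic_on U" and U: "open U" "{s. \<bar>Im s\<bar> \<le> c * Re s} \<subseteq> U"
    and growth: "\<And>s. \<bar>Im s\<bar> \<le> c * Re s \<Longrightarrow> norm (F s) \<le> B * exp (b * (norm s)\<^sup>2)"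
    and bdry: "\<And>s. \<bar>Im s\<bar> = c * Re s \<Longrightarrow> norm (F s) \<le> M"
    and M: "0 < M" and q: "\<bar>Im q\<bar> \<le> c * Re q"
  shows "norm (F q) \<le> M"
proof -
  define Sec where "Sec = {s. \<bar>Im s\<bar> \<le> c * Re s}"
  have c0: "0 < c" unfolding c by simp
  (* 0.172 is just above (sqrt 2 - 1)^2; any bound below 1/3 would keep Re (s^3) positive *)
  have c2: "c\<^sup>2 \<le> 172 / 1000"
  proof -
    have "(1.414::real) \<le> sqrt 2" by (rule real_le_rsqrt) (simp add: power2_eq_square)
    then show ?thesis unfolding c by (simp add: power2_diff)
  qed
  have cube: "(norm s) ^ 3 / 4 \<le> Re (s ^ 3)" if "s \<in> Sec" for s
  proof -
    define x y where "x = Re s" and "y = Im s"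
    have xy: "\<bar>y\<bar> \<le> c * x" using that by (simp add: Sec_def x_def y_def)
    then have x: "0 \<le> x" using c0 by (meson abs_ge_zero order_trans zero_le_mult_iff not_less)
    have "y\<^sup>2 \<le> (c * x)\<^sup>2" using xy by (metis abs_ge_zero power2_abs power_mono)
    also have "\<dots> \<le> 172/1000 * x\<^sup>2" unfolding power_mult_distrib by (rule mult_right_mono[OF c2 zero_le_power2])
    finally have y2: "y\<^sup>2 \<le> 172/1000 * x\<^sup>2" .
    have "(norm s)\<^sup>2 = x\<^sup>2 + y\<^sup>2" by (simp add: cmod_def x_def y_def)
    also have "\<dots> \<le> (6/5 * x)\<^sup>2" using y2 zero_le_square[of x] unfolding power_mult_distrib by (simp add: power2_eq_square del: zero_le_square)
    finally have "norm s \<le> 6/5 * x" by (rule power2_le_imp_le) (use x in simp)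
    then have "norm s ^ 3 \<le> (6/5 * x) ^ 3" by (rule power_mono) simp
    then have 1: "norm s ^ 3 / 4 \<le> 432/1000 * x ^ 3" by (simp add: power_mult_distrib power3_eq_cube)
    have "Re (s ^ 3) = x ^ 3 - 3 * x * y\<^sup>2"
      by (simp add: x_def y_def power3_eq_cube power2_eq_square algebra_simps)
    moreover have "3 * x * y\<^sup>2 \<le> 3 * x * (172/1000 * x\<^sup>2)" using y2 x by (intro mult_left_mono) auto
    moreover have "x * x\<^sup>2 = x ^ 3" by (simp add: power2_eq_square power3_eq_cube)
    moreover have "0 \<le> x ^ 3" using x by simp
    ultimately show ?thesis using 1 by linarith
  qed
  have key: "norm (F q) * exp (- \<delta> * Re (q ^ 3)) \<le> M" if \<delta>: "0 < \<delta>" for \<delta>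
  proof -
    have "((\<lambda>R. B * exp (b * R\<^sup>2 - \<delta> * R ^ 3 / 4)) \<longlongrightarrow> 0) at_top"
      using \<delta> by real_asymp
    then have "eventually (\<lambda>R. B * exp (b * R\<^sup>2 - \<delta> * R ^ 3 / 4) < M) at_top"
      using M by (rule order_tendstoD)
    then have "eventually (\<lambda>R. norm q < R \<and> B * exp (b * R\<^sup>2 - \<delta> * R ^ 3 / 4) < M) at_top"
      using eventually_gt_at_top[of "norm q"] by eventually_elim auto
    then obtain R where R: "norm q < R" "B * exp (b * R\<^sup>2 - \<delta> * R ^ 3 / 4) < M"
      by (auto dest: eventually_happens)
    (* truncate where the damped growth has fallen below M, beyond the point q *)
    define S where "S = Sec \<inter> cball 0 R"
    have clS: "closed S" unfolding S_def Sec_def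
      by (intro closed_Int closed_cball closed_Collect_le continuous_intros)
    define G where "G s = F s * exp (- of_real \<delta> * s ^ 3)" for s
    have holG: "G holomorphic_on U" unfolding G_def using hol by (intro holomorphic_intros)
    have nG: "norm (G s) = norm (F s) * exp (- \<delta> * Re (s ^ 3))" for s
      by (simp add: G_def norm_mult)
    have "norm (G q) \<le> M"
    proof (rule maximum_modulus_frontier[where S=S and f=G and \<xi>=q])
      show "G holomorphic_on interior S"
        by (rule holomorphic_on_subset[OF holG]) (use U interior_subset[of S] in \<open>auto simp: S_def Sec_def\<close>)
      show "continuous_on (closure S) G"
        using holomorphic_on_imp_continuous_on[OF holG] by (rule continuous_on_subset) (use U clS in \<open>auto simp: S_def Sec_def\<close>)
      show "bounded S" unfolding S_def by (simp add: bounded_Int)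
      show "q \<in> S" using q R by (simp add: S_def Sec_def)
      fix s assume s: "s \<in> frontier S"
      then have sS: "s \<in> S" and ni: "s \<notin> interior S"
        using clS by (auto simp: frontier_def)
      have "\<not> (\<bar>Im s\<bar> < c * Re s \<and> norm s < R)"
      proof
        assume a: "\<bar>Im s\<bar> < c * Re s \<and> norm s < R"
        have "open ({s. \<bar>Im s\<bar> < c * Re s} \<inter> ball 0 R)"
          by (intro open_Int open_ball open_Collect_less continuous_intros)
        moreover have "{s. \<bar>Im s\<bar> < c * Re s} \<inter> ball 0 R \<subseteq> S" by (auto simp: S_def Sec_def)
        ultimately have "s \<in> interior S" using a by (intro interiorI[of "{s. \<bar>Im s\<bar> < c * Re s} \<inter> ball 0 R"]) auto
        with ni show False by simp
      qed
      then consider "\<bar>Im s\<bar> = c * Re s" | "norm s = R" using sS by (fastforce simp: S_def Sec_def)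
      then show "norm (G s) \<le> M"
      proof cases
        case 1
        have "exp (- \<delta> * Re (s ^ 3)) \<le> 1" using cube[of s] sS \<delta>
          by (simp add: S_def) (smt (verit) zero_le_power norm_ge_zero mult_nonneg_nonneg divide_nonneg_pos)
        then have "norm (F s) * exp (- \<delta> * Re (s ^ 3)) \<le> M * 1"
          using bdry[OF 1] M by (intro mult_mono) auto
        then show ?thesis by (simp add: nG)
      next
        case 2
        have "norm (G s) \<le> (B * exp (b * (norm s)\<^sup>2)) * exp (- \<delta> * ((norm s) ^ 3 / 4))"
          unfolding nG using growth[of s] cube[of s] sS \<delta>
          by (intro mult_mono) (auto simp: S_def Sec_def intro: order_trans[OF norm_ge_zero])
        also have "\<dots> = B * exp (b * R\<^sup>2 - \<delta> * R ^ 3 / 4)"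
          using 2 by (simp add: mult_exp_exp)
        finally show ?thesis using R by simp
      qed
    qed
    then show ?thesis by (simp add: nG)
  qed
  have "((\<lambda>\<delta>. norm (F q) * exp (- \<delta> * Re (q ^ 3))) \<longlongrightarrow> norm (F q) * exp (- 0 * Re (q ^ 3))) (at_right 0)"
    by (intro tendsto_intros)
  moreover have "eventually (\<lambda>\<delta>. norm (F q) * exp (- \<delta> * Re (q ^ 3)) \<le> M) (at_right 0)"
    using key by (auto simp: eventually_at_right_less intro: eventually_at_rightI[of 0 1])
  ultimately have "norm (F q) * exp (- 0 * Re (q ^ 3)) \<le> M"
    by (rule tendsto_upperbound) simp
  then show ?thesis by simp
qed

text \<open>A quadrant, rotated by \<open>\<omega>\<close> to the position \<open>|Im w| \<le> Re w\<close>, is the image under squaring of the sector \<open>|Im s| \<le> c Re s\<close> with \<open>c = tan (pi/8)\<close>,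
and exponential type becomes growth of order two.\<close>

lemma quadrant_bound:
  fixes u :: "complex \<Rightarrow> complex" and \<omega> :: complex
  assumes hol: "u holomorphic_on {z. Im z > - A}" and A: "0 < A"
    and growth: "\<And>z. 0 \<le> Im z \<Longrightarrow> norm (u z) \<le> B * exp (b * norm z)"
    and re: "\<And>z. Im z = 0 \<Longrightarrow> norm (u z) \<le> M"
    and im: "\<And>z. Re z = 0 \<Longrightarrow> 0 \<le> Im z \<Longrightarrow> norm (u z) \<le> M" and M: "0 < M"
    and \<omega>: "norm \<omega> = 1" "\<And>w. \<bar>Im w\<bar> \<le> Re w \<Longrightarrow> 0 \<le> Im (\<omega> * w)"
      "\<And>w. \<bar>Im w\<bar> = Re w \<Longrightarrow> Im (\<omega> * w) = 0 \<or> Re (\<omega> * w) = 0"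
    and w: "\<bar>Im w\<bar> \<le> Re w"
  shows "norm (u (\<omega> * w)) \<le> M"
proof -
  define c :: real where "c = sqrt 2 - 1"
  have c0: "0 < c" unfolding c_def by simp
  have cc: "c\<^sup>2 + 2 * c = 1" unfolding c_def by (simp add: power2_diff)
  have sec: "\<bar>Im (s\<^sup>2)\<bar> \<le> Re (s\<^sup>2)" if "\<bar>Im s\<bar> \<le> c * Re s" for s
  proof -
    have x: "0 \<le> Re s" using that c0 by (meson abs_ge_zero order_trans zero_le_mult_iff not_less)
    have "\<bar>Im (s\<^sup>2)\<bar> = 2 * Re s * \<bar>Im s\<bar>" using x by (simp add: power2_eq_square abs_mult)
    moreover have "Re (s\<^sup>2) = (Re s)\<^sup>2 - \<bar>Im s\<bar>\<^sup>2" by (simp add: power2_eq_square)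
    moreover have "\<bar>Im s\<bar>\<^sup>2 \<le> (c * Re s)\<^sup>2" using that by (intro power_mono) auto
    moreover have "2 * Re s * \<bar>Im s\<bar> \<le> 2 * Re s * (c * Re s)" using that x by (intro mult_left_mono) auto
    moreover have "(c * Re s)\<^sup>2 + 2 * Re s * (c * Re s) = (c\<^sup>2 + 2 * c) * (Re s)\<^sup>2" by (simp add: power2_eq_square algebra_simps)
    ultimately show ?thesis using cc by simp
  qed
  have secb: "\<bar>Im (s\<^sup>2)\<bar> = Re (s\<^sup>2)" if "\<bar>Im s\<bar> = c * Re s" for s
  proof -
    have x: "0 \<le> Re s" using that c0 by (metis abs_ge_zero zero_le_mult_iff not_less)
    have "\<bar>Im (s\<^sup>2)\<bar> = 2 * Re s * \<bar>Im s\<bar>" using x by (simp add: power2_eq_square abs_mult)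
    moreover have "Re (s\<^sup>2) = (Re s)\<^sup>2 - \<bar>Im s\<bar>\<^sup>2" by (simp add: power2_eq_square)
    moreover have "(c * Re s)\<^sup>2 + 2 * Re s * (c * Re s) = (c\<^sup>2 + 2 * c) * (Re s)\<^sup>2" by (simp add: power2_eq_square algebra_simps)
    ultimately show ?thesis using cc that by simp
  qed
  define s0 where "s0 = csqrt w"
  have s02: "s0\<^sup>2 = w" by (simp add: s0_def)
  have s0: "\<bar>Im s0\<bar> \<le> c * Re s0"
  proof (rule ccontr)
    assume n: "\<not> \<bar>Im s0\<bar> \<le> c * Re s0"
    have x: "0 \<le> Re s0" using csqrt_principal[of w] by (auto simp: s0_def)
    have "Re w = (Re s0)\<^sup>2 - \<bar>Im s0\<bar>\<^sup>2" "\<bar>Im w\<bar> = 2 * Re s0 * \<bar>Im s0\<bar>"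
      using x by (simp_all add: s02[symmetric] power2_eq_square abs_mult)
    moreover have "(c * Re s0)\<^sup>2 < \<bar>Im s0\<bar>\<^sup>2" using n x c0 by (intro power_strict_mono) auto
    moreover have "2 * Re s0 * (c * Re s0) \<le> 2 * Re s0 * \<bar>Im s0\<bar>" using n x by (intro mult_left_mono) auto
    moreover have "(c * Re s0)\<^sup>2 + 2 * Re s0 * (c * Re s0) = (c\<^sup>2 + 2 * c) * (Re s0)\<^sup>2" by (simp add: power2_eq_square algebra_simps)
    ultimately show False using w cc by simp
  qed
  define F where "F s = u (\<omega> * s\<^sup>2)" for s
  have "norm (F s0) \<le> M"
  proof (rule narrow_sector_bound[OF c_def, where F=F and q=s0 and U="{s. Im (\<omega> * s\<^sup>2) > - A}" and B=B and b=b])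
    have "(u \<circ> (\<lambda>s. \<omega> * s\<^sup>2)) holomorphic_on {s. Im (\<omega> * s\<^sup>2) > - A}"
      by (rule holomorphic_on_compose_gen[OF _ hol]) (auto intro!: holomorphic_intros)
    then show "F holomorphic_on {s. Im (\<omega> * s\<^sup>2) > - A}" unfolding F_def o_def .
    show "open {s. Im (\<omega> * s\<^sup>2) > - A}" by (intro open_Collect_less continuous_intros)
    show "{s. \<bar>Im s\<bar> \<le> c * Re s} \<subseteq> {s. Im (\<omega> * s\<^sup>2) > - A}"
      using \<omega>(2)[OF sec] A by (force intro: less_le_trans)
    show "norm (F s) \<le> B * exp (b * (norm s)\<^sup>2)" if "\<bar>Im s\<bar> \<le> c * Re s" for s
      using growth[OF \<omega>(2)[OF sec[of s]]] that \<omega>(1) by (simp add: F_def norm_mult norm_power)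
    show "norm (F s) \<le> M" if "\<bar>Im s\<bar> = c * Re s" for s
      using \<omega>(3)[OF secb[of s]] \<omega>(2)[OF sec[of s]] that re im by (auto simp: F_def)
    show "\<bar>Im s0\<bar> \<le> c * Re s0" by (rule s0)
  qed (use M in auto)
  then show ?thesis by (simp add: F_def s02)
qed

text \<open>The two quadrants give boundedness in the half-plane, but only by the larger of the two bounds on the real and the imaginary
axis. To get rid of \<open>Mi\<close>, the maximum principle is applied to \<open>u^n / (w + \<i>)\<close>, which is small on large half-circles; taking n-th
roots leaves only the bound on the real axis.\<close>

lemma halfplane_bound:
  fixes u :: "complex \<Rightarrow> complex"
  assumes hol: "u holomorphic_on {z. Im z > - A}" and A: "0 < A"
    and growth: "\<And>z. 0 \<le> Im z \<Longrightarrow> norm (u z) \<le> B * exp (b * norm z)"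
    and re: "\<And>z. Im z = 0 \<Longrightarrow> norm (u z) \<le> M" and M: "0 < M"
    and im: "\<And>z. Re z = 0 \<Longrightarrow> 0 \<le> Im z \<Longrightarrow> norm (u z) \<le> Mi"
    and z: "0 \<le> Im z"
  shows "norm (u z) \<le> M"
proof -
  define M' where "M' = max M Mi"
  have M': "0 < M'" "M \<le> M'" "Mi \<le> M'" using M by (auto simp: M'_def)
  define e where "e = complex_of_real (1 / sqrt 2)"
  have re': "norm (u z) \<le> M'" if "Im z = 0" for z using re[OF that] M' by simp
  have im': "norm (u z) \<le> M'" if "Re z = 0" "0 \<le> Im z" for z using im[OF that] M' by simp
  have e0: "0 < Re e" "Im e = 0" by (simp_all add: e_def)
  have bd: "norm (u z) \<le> M'" if z: "0 \<le> Im z" for z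
  proof -
    define \<tau> :: real where "\<tau> = (if 0 \<le> Re z then 1 else -1)"
    (* the bisector of the quadrant that contains z *)
    define \<omega> where "\<omega> = e * Complex \<tau> 1"
    have \<tau>: "\<tau> = 1 \<or> \<tau> = -1" "0 \<le> \<tau> * Re z" by (auto simp: \<tau>_def)
    have \<omega>0: "\<omega> \<noteq> 0" using e0 by (simp add: \<omega>_def e_def complex_eq_iff)
    have Re\<omega>: "Re (\<omega> * w) = Re e * (\<tau> * Re w - Im w)" and Im\<omega>: "Im (\<omega> * w) = Re e * (Re w + \<tau> * Im w)" for w
      using e0 by (simp_all add: \<omega>_def algebra_simps)
    have 1: "norm \<omega> = 1" using \<tau>(1) by (auto simp: \<omega>_def e_def norm_mult norm_divide cmod_def power_divide)
    have 2: "0 \<le> Im (\<omega> * w)" if "\<bar>Im w\<bar> \<le> Re w" for w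
      unfolding Im\<omega> using \<tau>(1) that e0 by (intro mult_nonneg_nonneg) auto
    have 3: "Im (\<omega> * w) = 0 \<or> Re (\<omega> * w) = 0" if "\<bar>Im w\<bar> = Re w" for w
      unfolding Im\<omega> Re\<omega> using \<tau>(1) that by auto
    have 4: "\<bar>Im (z / \<omega>)\<bar> \<le> Re (z / \<omega>)"
    proof -
      define w where "w = z / \<omega>"
      have zw: "z = \<omega> * w" using \<omega>0 by (simp add: w_def)
      have "0 \<le> Re w + \<tau> * Im w" using z e0 unfolding zw Im\<omega> by (simp add: zero_le_mult_iff)
      moreover have "0 \<le> Re e * (\<tau> * (\<tau> * Re w - Im w))" using \<tau>(2) unfolding zw Re\<omega> by (simp add: mult_ac)
      then have "0 \<le> \<tau> * (\<tau> * Re w - Im w)" using e0 by (simp add: zero_le_mult_iff)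
      ultimately show ?thesis using \<tau>(1) unfolding w_def[symmetric] by auto
    qed
    have "norm (u (\<omega> * (z / \<omega>))) \<le> M'"
      by (rule quadrant_bound[OF hol A growth re' im' M'(1) 1 2 3 4])
    then show ?thesis using \<omega>0 by simp
  qed
  have key: "norm (u z) ^ n \<le> M ^ n * norm (z + \<i>)" for n
  proof -
    define h where "h w = u w ^ n / (w + \<i>)" for w
    (* large enough that M'^n / (R - 1) is at most M^n *)
    define R where "R = max (norm z) (M' ^ n / M ^ n + 2)"
    define S where "S = {w. 0 \<le> Im w} \<inter> cball 0 R"
    have clS: "closed S" unfolding S_def
      by (intro closed_Int closed_cball closed_Collect_le continuous_intros)
    have nz: "w + \<i> \<noteq> 0" if "0 \<le> Im w" for w using that by (auto simp: complex_eq_iff)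
    have sub: "u holomorphic_on S" "u holomorphic_on interior S"
      using hol A by (auto elim!: holomorphic_on_subset simp: S_def dest: interior_subset[THEN subsetD])
    have "norm (h z) \<le> M ^ n"
    proof (rule maximum_modulus_frontier[where S=S and f=h and \<xi>=z])
      show "h holomorphic_on interior S" unfolding h_def
        using sub nz by (intro holomorphic_intros) (auto simp: S_def dest!: interior_subset[THEN subsetD])
      show "continuous_on (closure S) h" unfolding h_def closure_closed[OF clS]
        using holomorphic_on_imp_continuous_on[OF sub(1)] nz by (intro continuous_intros) (auto simp: S_def)
      show "bounded S" unfolding S_def by (simp add: bounded_Int)
      show "z \<in> S" using z by (simp add: S_def R_def)
      fix w assume s: "w \<in> frontier S"
      then have sS: "w \<in> S" and ni: "w \<notin> interior S"
        using clS by (auto simp: frontier_def)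
      have "\<not> (0 < Im w \<and> norm w < R)"
      proof
        assume a: "0 < Im w \<and> norm w < R"
        have "open ({s. 0 < Im s} \<inter> ball 0 R)"
          by (intro open_Int open_ball open_Collect_less continuous_intros)
        moreover have "{s. 0 < Im s} \<inter> ball 0 R \<subseteq> S" by (auto simp: S_def)
        ultimately have "w \<in> interior S" using a by (intro interiorI[of "{s. 0 < Im s} \<inter> ball 0 R"]) auto
        with ni show False by simp
      qed
      then consider "Im w = 0" | "norm w = R" using sS by (fastforce simp: S_def)
      then show "norm (h w) \<le> M ^ n"
      proof cases
        case 1
        have "1 \<le> norm (w + \<i>)" using abs_Im_le_cmod[of "w + \<i>"] 1 by simp
        moreover have "norm (u w) ^ n \<le> M ^ n" using re[OF 1] by (intro power_mono) auto
        ultimately have "norm (u w) ^ n / norm (w + \<i>) \<le> M ^ n / 1"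
          using M by (intro frac_le) auto
        then show ?thesis by (simp add: h_def norm_divide norm_power)
      next
        case 2
        have Rn: "R - 1 \<le> norm (w + \<i>)" using 2 norm_diff_ineq[of w \<i>] by simp
        have q: "0 \<le> M' ^ n / M ^ n" using M' M by simp
        have R: "M' ^ n / M ^ n \<le> R - 1" "0 < R - 1" using q by (auto simp: R_def)
        have "norm (u w) ^ n \<le> M' ^ n" using bd[of w] sS by (intro power_mono) (auto simp: S_def)
        then have "norm (u w) ^ n / norm (w + \<i>) \<le> M' ^ n / (R - 1)"
          using M' R Rn by (intro frac_le) auto
        also have "\<dots> \<le> M ^ n" using R M by (simp add: field_simps)
        finally show ?thesis by (simp add: h_def norm_divide norm_power)
      qed
    qed
    moreover have "0 < norm (z + \<i>)" using nz[OF z] by simp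
    ultimately show ?thesis by (simp add: h_def norm_divide norm_power field_simps)
  qed
  show ?thesis
  proof (rule ccontr)
    assume "\<not> norm (u z) \<le> M"
    then have "1 < norm (u z) / M" using M by simp
    then obtain n where "norm (z + \<i>) < (norm (u z) / M) ^ n"
      using real_arch_pow by blast
    with key[of n] M show False by (simp add: power_divide field_simps)
  qed
qed

text \<open>Multiplication by \<open>exp (\<i> \<sigma> w)\<close> removes the exponential growth along the imaginary axis and division by \<open>(w + \<i> A)^K\<close> the polynomial
growth on the real axis; the quotient is then bounded in the half-plane by its bound on the real axis.\<close>

text \<open>The real growth bound is transported along the complex line through \<open>x\<close> in the direction of \<open>y\<close>, where \<open>z = x + \<i> y\<close>: the one-variable estimate at the point \<open>\<i>\<close>
sees the type \<open>\<kappa> * dual_norm V y\<close> of the restriction. The bound therefore depends on the imaginary part of \<open>z\<close>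
only, up to a polynomial factor.\<close>

lemma phragmen_lindelof_line:
  fixes g :: "complex \<Rightarrow> complex"
  assumes hol: "g holomorphic_on UNIV" and growth: "\<And>z. norm (g z) \<le> B * exp (\<sigma> * norm z)"
    and re: "\<And>x::real. norm (g (of_real x)) \<le> C * (A + \<bar>x\<bar>) ^ K"
    and pos: "0 < A" "0 < C" "0 \<le> \<sigma>" and z: "0 \<le> Im z"
  shows "norm (g z) \<le> C * (2 * norm (z + \<i> * of_real A)) ^ K * exp (\<sigma> * Im z)"
proof -
  define u where "u w = g w * exp (\<i> * of_real \<sigma> * w) / (w + \<i> * of_real A) ^ K" for w
  have nu: "norm (u w) = norm (g w) * exp (- \<sigma> * Im w) / norm (w + \<i> * of_real A) ^ K" for w
    by (simp add: u_def norm_mult norm_divide norm_power)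
  have B: "0 \<le> B" using order_trans[OF norm_ge_zero growth[of 0]] by simp
  have Aw: "A \<le> norm (w + \<i> * of_real A)" if "0 \<le> Im w" for w
    using abs_Im_le_cmod[of "w + \<i> * of_real A"] that by simp
  have "norm (u z) \<le> C * 2 ^ K"
  proof (rule halfplane_bound[where u=u and z=z and A=A and B="B / A ^ K" and b=\<sigma> and Mi="B / A ^ K"])
    have nz: "w + \<i> * of_real A \<noteq> 0" if "- A < Im w" for w using that by (auto simp: complex_eq_iff)
    have "g holomorphic_on {z. - A < Im z}" using hol by (rule holomorphic_on_subset) auto
    then show "u holomorphic_on {z. - A < Im z}" unfolding u_def
      using nz by (intro holomorphic_intros) auto
    fix w
    show "norm (u w) \<le> B / A ^ K * exp (\<sigma> * norm w)" if w: "0 \<le> Im w"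
    proof -
      have "exp (- \<sigma> * Im w) \<le> 1" using pos w by simp
      then have "norm (g w) * exp (- \<sigma> * Im w) \<le> (B * exp (\<sigma> * norm w)) * 1"
        using growth[of w] B by (intro mult_mono) auto
      then have "norm (u w) \<le> (B * exp (\<sigma> * norm w)) / A ^ K"
        unfolding nu using pos Aw[OF w] B by (intro frac_le power_mono) auto
      then show ?thesis by simp
    qed
    show "norm (u w) \<le> B / A ^ K" if w: "Re w = 0" "0 \<le> Im w"
    proof -
      have "norm w = Im w" using w by (simp add: cmod_def)
      then have "norm (g w) * exp (- \<sigma> * Im w) \<le> (B * exp (\<sigma> * Im w)) * exp (- \<sigma> * Im w)"
        using growth[of w] by (intro mult_right_mono) auto
      also have "\<dots> = B" by (simp add: exp_minus)
      finally show ?thesis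
        unfolding nu using pos Aw[of w] w B by (intro frac_le power_mono) auto
    qed
    show "norm (u w) \<le> C * 2 ^ K" if w: "Im w = 0"
    proof -
      have "w = of_real (Re w)" using w by (simp add: complex_eq_iff)
      then have 1: "norm (g w) \<le> C * (A + \<bar>Re w\<bar>) ^ K" using re[of "Re w"] by simp
      have "A + \<bar>Re w\<bar> \<le> 2 * norm (w + \<i> * of_real A)"
        using abs_Re_le_cmod[of "w + \<i> * of_real A"] abs_Im_le_cmod[of "w + \<i> * of_real A"] w pos by simp
      then have "(A + \<bar>Re w\<bar>) ^ K \<le> (2 * norm (w + \<i> * of_real A)) ^ K"
        using pos by (intro power_mono) auto
      then have "norm (g w) \<le> C * (2 * norm (w + \<i> * of_real A)) ^ K"
        using 1 pos by (meson mult_left_mono order_trans less_imp_le)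
      moreover have "0 < norm (w + \<i> * of_real A)" using Aw[of w] w pos by linarith
      ultimately show ?thesis unfolding nu using w by (simp add: power_mult_distrib field_simps)
    qed
  qed (use pos z in auto)
  moreover have "0 < norm (z + \<i> * of_real A)" using Aw[OF z] pos by linarith
  ultimately have "norm (g z) * exp (- \<sigma> * Im z) \<le> C * (2 * norm (z + \<i> * of_real A)) ^ K"
    unfolding nu by (simp add: power_mult_distrib field_simps)
  then have "norm (g z) * exp (- \<sigma> * Im z) * exp (\<sigma> * Im z) \<le> C * (2 * norm (z + \<i> * of_real A)) ^ K * exp (\<sigma> * Im z)"
    by (rule mult_right_mono) simp
  then show ?thesis by (simp add: exp_minus field_simps)
qed

text \<open>Cauchy estimates on a circle of radius \<open>\<rho>\<close>. Applied to restrictions to complex lines, they give remainder bounds that are uniform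
over a family of entire functions.\<close>

lemma taylor_remainder_two:
  fixes \<phi> :: "complex \<Rightarrow> complex"
  assumes hol: "\<phi> holomorphic_on UNIV" and b: "\<And>\<zeta>. norm \<zeta> \<le> \<rho> \<Longrightarrow> norm (\<phi> \<zeta>) \<le> M" and \<rho>: "2 \<le> \<rho>"
  shows "norm (\<phi> 1 - \<phi> 0 - deriv \<phi> 0) \<le> 2 * M / \<rho>\<^sup>2" and "norm (deriv \<phi> 0) \<le> M / \<rho>"
proof -
  have M: "0 \<le> M" using b[of 0] \<rho> by (auto intro: order_trans[OF norm_ge_zero])
  have ce: "norm ((deriv ^^ n) \<phi> 0) \<le> fact n * M / \<rho> ^ n" for n
    by (rule Cauchy_inequality) (use hol \<rho> b in \<open>auto intro: holomorphic_on_subset holomorphic_on_imp_continuous_on continuous_on_subset\<close>)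
  show "norm (deriv \<phi> 0) \<le> M / \<rho>" using ce[of 1] by simp
  have "(\<lambda>n. (deriv ^^ n) \<phi> 0 / fact n * (1 - 0) ^ n) sums \<phi> 1"
    by (rule holomorphic_power_series[where r=2]) (use hol in \<open>auto intro: holomorphic_on_subset\<close>)
  then have s: "(\<lambda>n. (deriv ^^ n) \<phi> 0 / fact n) sums \<phi> 1" by simp
  have "(\<lambda>n. (deriv ^^ (n + 2)) \<phi> 0 / fact (n + 2)) sums (\<phi> 1 - (\<Sum>n<2. (deriv ^^ n) \<phi> 0 / fact n))"
    using s by (rule sums_split_initial_segment)
  then have s2: "(\<lambda>n. (deriv ^^ (n + 2)) \<phi> 0 / fact (n + 2)) sums (\<phi> 1 - \<phi> 0 - deriv \<phi> 0)"
    by (simp add: numeral_2_eq_2 algebra_simps)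
  have g: "(\<lambda>n. M / \<rho>\<^sup>2 * (1 / 2) ^ n) sums (M / \<rho>\<^sup>2 * (1 / (1 - 1 / 2)))"
    by (intro sums_mult geometric_sums) auto
  have le: "norm ((deriv ^^ (n + 2)) \<phi> 0 / fact (n + 2)) \<le> M / \<rho>\<^sup>2 * (1 / 2) ^ n" for n
  proof -
    have "norm ((deriv ^^ (n + 2)) \<phi> 0 / fact (n + 2)) \<le> M / \<rho> ^ (n + 2)"
    proof -
      have "norm ((deriv ^^ (n + 2)) \<phi> 0 / fact (n + 2)) = norm ((deriv ^^ (n + 2)) \<phi> 0) / fact (n + 2)"
        by (simp only: norm_divide norm_fact)
      also have "\<dots> \<le> (fact (n + 2) * M / \<rho> ^ (n + 2)) / fact (n + 2)"
        by (intro divide_right_mono ce) simp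
      finally show ?thesis by simp
    qed
    also have "\<dots> = M / \<rho>\<^sup>2 * (1 / \<rho>) ^ n" by (simp add: power_add power_divide power2_eq_square)
    also have "\<dots> \<le> M / \<rho>\<^sup>2 * (1 / 2) ^ n" using M \<rho> by (intro mult_left_mono power_mono) (auto simp: field_simps)
    finally show ?thesis .
  qed
  have "norm (\<phi> 1 - \<phi> 0 - deriv \<phi> 0) \<le> M / \<rho>\<^sup>2 * (1 / (1 - 1 / 2))"
    using norm_suminf_le[OF le sums_summable[OF g]] unfolding sums_unique[OF s2, symmetric] sums_unique[OF g, symmetric] .
  then show "norm (\<phi> 1 - \<phi> 0 - deriv \<phi> 0) \<le> 2 * M / \<rho>\<^sup>2" by (simp add: mult.commute)
qed

section \<open>Trigonometric interpolation of periodic entire functions\<close>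

lemma periodic_of_int:
  fixes g :: "complex \<Rightarrow> 'b"
  assumes per: "\<And>z. g (z + 2 * of_real pi) = g z"
  shows "g (z + of_int n * (2 * of_real pi)) = g z"
proof -
  have nat: "g (w + of_nat k * (2 * of_real pi)) = g w" for w k
  proof (induction k)
    case (Suc k)
    have "g (w + of_nat (Suc k) * (2 * of_real pi)) = g ((w + of_nat k * (2 * of_real pi)) + 2 * of_real pi)"
      by (simp add: algebra_simps)
    then show ?case using per Suc by simp
  qed simp
  show ?thesis
  proof (cases n)
    case (nonneg k) then show ?thesis using nat[of z k] by simp
  next
    case (neg k)
    have "of_int n = - (of_nat (Suc k) :: complex)" using neg by simp
    then have "z + of_int n * (2 * of_real pi) + of_nat (Suc k) * (2 * of_real pi) = z"
      by (simp only: mult_minus_left add.assoc left_minus add_0_right)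
    then show ?thesis using nat[of "z + of_int n * (2 * of_real pi)" "Suc k"] by (simp only:)
  qed
qed

text \<open>In the variable \<open>w = exp (\<i> z)\<close> the function becomes holomorphic in the punctured plane. The growth hypothesis bounds its product with
\<open>w^(L+1)\<close> near zero, where the singularity is removable, and by a power of degree \<open>2(L+1)\<close> near infinity, so the product is a
polynomial by Liouville's theorem. With \<open>L + 1\<close> in place of \<open>L\<close> the product tends to zero at the origin.\<close>

lemma periodic_exp_type_trig_poly:
  fixes g :: "complex \<Rightarrow> complex" and L :: nat
  assumes hol: "g holomorphic_on UNIV" and per: "\<And>z. g (z + 2 * of_real pi) = g z"
    and bd: "\<And>z. norm (g z) \<le> C * exp (real L * \<bar>Im z\<bar>)"
  obtains c :: "nat \<Rightarrow> complex" where
    "\<And>z. g z = (\<Sum>k\<le>2 * Suc L. c k * exp (\<i> * of_int (int k - int (Suc L)) * z))"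
proof -
  define K where "K = Suc L"
  define G where "G w = g (- \<i> * Ln w)" for w
  define h where "h w = w ^ K * G w" for w
  have C: "0 \<le> C" using order_trans[OF norm_ge_zero bd[of 0]] by simp
  (* periodicity makes G independent of the branch of the logarithm *)
  have Gexp: "G (exp v) = g (- \<i> * v)" for v
  proof -
    have "exp (Ln (exp v)) = exp v" by simp
    then obtain n :: int where "Ln (exp v) = v + (of_int (2 * n) * pi) * \<i>"
      unfolding exp_eq by blast
    then have "- \<i> * Ln (exp v) = - \<i> * v + of_int n * (2 * of_real pi)" by (simp add: algebra_simps)
    then show ?thesis unfolding G_def using periodic_of_int[of g "- \<i> * v" n, OF per] by (simp only:)
  qed
  have Gbd: "norm (G w) \<le> C * (norm w ^ L + 1 / norm w ^ L)" if "w \<noteq> 0" for w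
  proof -
    have "norm (G w) \<le> C * exp (real L * \<bar>ln (norm w)\<bar>)"
      unfolding G_def using bd[of "- \<i> * Ln w"] that by simp
    also have "exp (real L * \<bar>ln (norm w)\<bar>) \<le> exp (real L * ln (norm w)) + exp (- (real L * ln (norm w)))"
    proof (cases "0 \<le> ln (norm w)")
      case True then have "\<bar>ln (norm w)\<bar> = ln (norm w)" by simp
      then show ?thesis by (simp only: exp_ge_zero le_add_same_cancel1)
    next
      case False then have "\<bar>ln (norm w)\<bar> = - ln (norm w)" by simp
      then show ?thesis by (simp only: exp_ge_zero le_add_same_cancel2 mult_minus_right)
    qed
    also have "\<dots> = norm w ^ L + 1 / norm w ^ L"
    proof -
      have "exp (real L * ln (norm w)) = norm w ^ L" using that by (simp only: exp_of_nat_mult) simp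
      then show ?thesis by (simp only: exp_minus inverse_eq_divide)
    qed
    finally show ?thesis using C by (simp add: mult_left_mono)
  qed
  have hbd1: "norm (h w) \<le> 2 * C * norm w ^ (2 * K)" if "1 \<le> norm w" for w
  proof -
    have w: "w \<noteq> 0" using that by auto
    have a: "1 \<le> norm w ^ L" by (rule one_le_power[OF that])
    have "1 / norm w ^ L \<le> 1 / 1" using a by (intro divide_left_mono) auto
    then have "norm w ^ L + 1 / norm w ^ L \<le> 2 * norm w ^ L" using a by linarith
    then have "C * (norm w ^ L + 1 / norm w ^ L) \<le> C * (2 * norm w ^ L)" using C by (rule mult_left_mono)
    then have "norm (G w) \<le> C * (2 * norm w ^ L)"
      using Gbd[OF w] by simp
    also have "\<dots> \<le> C * (2 * norm w ^ K)" using that C unfolding K_def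
      by (intro mult_left_mono power_increasing) auto
    finally have "norm w ^ K * norm (G w) \<le> norm w ^ K * (C * (2 * norm w ^ K))" by (intro mult_left_mono) auto
    also have "\<dots> = 2 * C * norm w ^ (2 * K)" by (simp add: mult_2[of K] power_add)
    finally show ?thesis by (simp only: h_def norm_mult norm_power)
  qed
  have hbd0: "norm (h w) \<le> 2 * C * norm w" if "norm w \<le> 1" for w
  proof (cases "w = 0")
    case True then show ?thesis by (simp add: h_def K_def)
  next
    case False
    have "norm w ^ K * norm (G w) \<le> norm w ^ K * (C * (norm w ^ L + 1 / norm w ^ L))"
      using Gbd[OF False] by (intro mult_left_mono) auto
    also have "\<dots> = C * (norm w ^ (K + L) + norm w ^ K / norm w ^ L)"
      by (simp only: power_add distrib_left times_divide_eq_right mult_1_right) (simp only: mult_ac times_divide_eq_right)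
    also have "norm w ^ K / norm w ^ L = norm w" using False by (simp add: K_def)
    also have "C * (norm w ^ (K + L) + norm w) \<le> C * (norm w ^ 1 + norm w)"
      using that C by (intro mult_left_mono add_right_mono power_decreasing) (auto simp: K_def)
    also have "\<dots> = 2 * C * norm w" by simp
    finally show ?thesis by (simp only: h_def norm_mult norm_power)
  qed
  have holG: "G field_differentiable at w0" if w0: "w0 \<noteq> 0" for w0
  proof -
    (* a branch of the logarithm that is holomorphic near w0 *)
    define g1 where "g1 w = g (- \<i> * (Ln (w / w0) + Ln w0))" for w
    have eq: "g1 w = G w" if "w \<noteq> 0" for w
      using Gexp[of "Ln (w / w0) + Ln w0"] that w0 by (simp add: g1_def exp_add)
    have "(g \<circ> (\<lambda>w. - \<i> * (Ln (w / w0) + Ln w0))) holomorphic_on ball w0 (norm w0)"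
    proof (rule holomorphic_on_compose_gen[OF _ hol])
      have "w / w0 \<notin> \<real>\<^sub>\<le>\<^sub>0" if "w \<in> ball w0 (norm w0)" for w
      proof
        assume "w / w0 \<in> \<real>\<^sub>\<le>\<^sub>0"
        then obtain r where r: "r \<le> 0" "w / w0 = of_real r" by (auto elim!: nonpos_Reals_cases)
        then have "w = of_real r * w0" using w0 by (simp add: field_simps)
        then have "w0 - w = of_real (1 - r) * w0" by (simp add: algebra_simps)
        then have "norm (w0 - w) = (1 - r) * norm w0" using r by (simp add: norm_mult del: of_real_diff)
        moreover have "1 * norm w0 \<le> (1 - r) * norm w0" using r by (intro mult_right_mono) auto
        ultimately show False using that by (simp add: dist_norm)
      qed
      then show "(\<lambda>w. - \<i> * (Ln (w / w0) + Ln w0)) holomorphic_on ball w0 (norm w0)"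
        using w0 by (intro holomorphic_intros) auto
    qed auto
    then have "g1 holomorphic_on ball w0 (norm w0)" unfolding g1_def o_def .
    then have "G holomorphic_on ball w0 (norm w0)"
      by (rule holomorphic_transform) (auto intro!: eq)
    then show ?thesis
      using w0 by (intro holomorphic_on_imp_differentiable_at[of G "ball w0 (norm w0)"]) auto
  qed
  have holh: "h holomorphic_on UNIV"
  proof (rule no_isolated_singularity)
    have hd: "h field_differentiable at w" if "w \<noteq> 0" for w
      unfolding h_def using holG[OF that] by (intro derivative_intros)
    then show "h holomorphic_on UNIV - {0}"
      by (auto simp: holomorphic_on_def intro: field_differentiable_at_within)
    have "isCont h w" for w
    proof (cases "w = 0")
      case False then show ?thesis using hd field_differentiable_imp_continuous_at by blast
    next
      case True
      have h0: "h 0 = 0" by (simp add: h_def K_def)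
      have "(h \<longlongrightarrow> 0) (at 0)"
      proof (rule Lim_null_comparison)
        show "eventually (\<lambda>w. norm (h w) \<le> 2 * C * norm w) (at 0)"
          using hbd0 by (auto simp: eventually_at intro!: exI[of _ 1])
        show "((\<lambda>w::complex. 2 * C * norm w) \<longlongrightarrow> 0) (at 0)" by (auto intro!: tendsto_eq_intros)
      qed
      then show ?thesis using True h0 by (simp add: isCont_def)
    qed
    then show "continuous_on UNIV h" by (simp add: continuous_at_imp_continuous_on)
  qed auto
  define c where "c k = (deriv ^^ k) h 0 / fact k" for k
  have hpoly: "h w = (\<Sum>k\<le>2 * K. c k * w ^ k)" for w
    unfolding c_def by (rule Liouville_polynomial[OF holh hbd1])
  have "g z = (\<Sum>k\<le>2 * Suc L. c k * exp (\<i> * of_int (int k - int (Suc L)) * z))" for z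
  proof -
    define w where "w = exp (\<i> * z)"
    have wp: "w ^ k = exp (of_nat k * (\<i> * z))" for k by (simp add: w_def exp_of_nat_mult)
    have Gw: "G w = g z" unfolding w_def by (simp add: Gexp)
    have "exp (of_nat K * (\<i> * z)) * g z = (\<Sum>k\<le>2 * K. c k * exp (of_nat k * (\<i> * z)))"
      using hpoly[of w] unfolding h_def Gw wp .
    then have "exp (- (of_nat K * (\<i> * z))) * (exp (of_nat K * (\<i> * z)) * g z) = exp (- (of_nat K * (\<i> * z))) * (\<Sum>k\<le>2 * K. c k * exp (of_nat k * (\<i> * z)))"
      by simp
    also have "exp (- (of_nat K * (\<i> * z))) * (exp (of_nat K * (\<i> * z)) * g z) = g z"
      by (simp add: exp_minus)
    also have "exp (- (of_nat K * (\<i> * z))) * (\<Sum>k\<le>2 * K. c k * exp (of_nat k * (\<i> * z)))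
      = (\<Sum>k\<le>2 * K. c k * exp (\<i> * of_int (int k - int K) * z))"
      unfolding sum_distrib_left
    proof (rule sum.cong[OF refl])
      fix k
      have "exp (- (of_nat K * (\<i> * z))) * exp (of_nat k * (\<i> * z)) = exp (\<i> * of_int (int k - int K) * z)"
        unfolding exp_add[symmetric] by (rule arg_cong[where f=exp]) (simp add: algebra_simps)
      then show "exp (- (of_nat K * (\<i> * z))) * (c k * exp (of_nat k * (\<i> * z))) = c k * exp (\<i> * of_int (int k - int K) * z)"
        by (simp add: mult_ac)
    qed
    finally show ?thesis by (simp add: K_def)
  qed
  then show ?thesis by (rule that)
qed

definition interp_node :: "nat \<Rightarrow> nat \<Rightarrow> real" where
  "interp_node L r = 2 * pi * real r / real (2 * Suc L + 1)"

definition interp_kernel :: "nat \<Rightarrow> complex \<Rightarrow> complex" where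
  "interp_kernel L u = (\<Sum>k\<le>2 * Suc L. exp (\<i> * of_int (int k - int (Suc L)) * u)) / of_nat (2 * Suc L + 1)"

lemma node_orthogonality:
  assumes "k \<le> 2 * Suc L" "k' \<le> 2 * Suc L"
  shows "(\<Sum>r<2 * Suc L + 1. exp (\<i> * of_int (int k - int k') * of_real (interp_node L r)))
    = (if k = k' then of_nat (2 * Suc L + 1) else 0)"
proof -
  define N where "N = 2 * Suc L + 1"
  define x where "x = exp (\<i> * of_int (int k - int k') * (2 * pi / N))"
  have xr: "exp (\<i> * of_int (int k - int k') * of_real (interp_node L r)) = x ^ r" for r
    unfolding x_def exp_of_nat_mult[symmetric] interp_node_def N_def[symmetric] by (rule arg_cong[where f=exp]) simp
  show ?thesis
  proof (cases "k = k'")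
    case True then show ?thesis by simp
  next
    case False
    have "x \<noteq> 1"
    proof
      assume "x = 1"
      then obtain n :: int where "of_int (int k - int k') * (2 * pi / N) = of_int (2 * n) * pi"
        unfolding x_def exp_eq_1 by (auto simp: of_real_divide)
      then have "2 * pi * of_int (int k - int k') = 2 * pi * (of_int n * real N)"
        by (simp add: field_simps N_def)
      then have "real_of_int (int k - int k') = real_of_int (n * int N)" using pi_gt_zero by (simp del: of_int_diff)
      then have e: "int k - int k' = n * int N" by linarith
      then have "n \<noteq> 0" using False by auto
      then have "1 \<le> \<bar>n\<bar>" by linarith
      then have "int N \<le> \<bar>n * int N\<bar>" by (simp add: abs_mult mult_le_cancel_right1)
      then show False using e assms by (simp add: N_def)
    qed
    moreover have "x ^ N = 1"
    proof -
      have N0: "complex_of_nat N \<noteq> 0" by (simp add: N_def del: of_nat_Suc of_nat_add)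
      have "x ^ N = exp (of_int (2 * (int k - int k')) * of_real pi * \<i>)"
        unfolding x_def exp_of_nat_mult[symmetric] by (rule arg_cong[where f=exp]) (use N0 in \<open>simp add: field_simps\<close>)
      then show ?thesis by (auto simp: exp_eq_1 intro!: exI[of _ "int k - int k'"])
    qed
    ultimately have "(\<Sum>r<N. x ^ r) = 0" by (simp add: geometric_sum)
    then have "(\<Sum>r<2 * Suc L + 1. x ^ r) = 0" unfolding N_def .
    then show ?thesis unfolding xr using False by presburger
  qed
qed

text \<open>A trigonometric polynomial of degree \<open>n\<close> is determined by its values at \<open>2n + 1\<close> equidistant nodes. This expresses an entire function by
finitely many of its values on the real line, a form that can be iterated over several variables.\<close>

lemma trig_interpolation:
  fixes g :: "complex \<Rightarrow> complex" and L :: nat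
  assumes hol: "g holomorphic_on UNIV" and per: "\<And>z. g (z + 2 * of_real pi) = g z"
    and bd: "\<And>z. norm (g z) \<le> C * exp (real L * \<bar>Im z\<bar>)"
  shows "g z = (\<Sum>r<2 * Suc L + 1. g (of_real (interp_node L r)) * interp_kernel L (z - of_real (interp_node L r)))"
proof -
  define N where "N = 2 * Suc L + 1"
  define E where "E k u = exp (\<i> * of_int (int k - int (Suc L)) * u)" for k and u :: complex
  obtain c where c: "\<And>z. g z = (\<Sum>k\<le>2 * Suc L. c k * E k z)"
    using periodic_exp_type_trig_poly[OF assms] unfolding E_def by blast
  have Es: "E k' (z - v) * E k v = E k' z * exp (\<i> * of_int (int k - int k') * v)" for k k' v
    unfolding E_def exp_add[symmetric] by (rule arg_cong[where f=exp]) (simp add: algebra_simps)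
  have "(\<Sum>r<N. g (of_real (interp_node L r)) * interp_kernel L (z - of_real (interp_node L r)))
    = (\<Sum>r<N. \<Sum>k'\<le>2 * Suc L. \<Sum>k\<le>2 * Suc L. c k * E k' z * exp (\<i> * of_int (int k - int k') * of_real (interp_node L r)) / of_nat N)"
    unfolding c interp_kernel_def E_def[symmetric] N_def[symmetric] sum_distrib_right sum_distrib_left sum_divide_distrib
    using Es by (intro sum.cong refl) (simp add: mult_ac)
  also have "\<dots> = (\<Sum>k'\<le>2 * Suc L. \<Sum>k\<le>2 * Suc L. \<Sum>r<N. c k * E k' z * exp (\<i> * of_int (int k - int k') * of_real (interp_node L r)) / of_nat N)"
    by (subst sum.swap, rule sum.cong[OF refl], rule sum.swap)
  also have "\<dots> = (\<Sum>k'\<le>2 * Suc L. \<Sum>k\<le>2 * Suc L. if k = k' then c k * E k' z else 0)"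
  proof (intro sum.cong refl)
    fix k k' assume "k \<in> {..2 * Suc L}" "k' \<in> {..2 * Suc L}"
    then have "(\<Sum>r<N. exp (\<i> * of_int (int k - int k') * of_real (interp_node L r))) = (if k = k' then of_nat N else 0)"
      using node_orthogonality unfolding N_def by simp
    moreover have "(of_nat N :: complex) \<noteq> 0" unfolding N_def by (simp del: of_nat_Suc)
    ultimately show "(\<Sum>r<N. c k * E k' z * exp (\<i> * of_int (int k - int k') * of_real (interp_node L r)) / of_nat N) = (if k = k' then c k * E k' z else 0)"
      unfolding sum_divide_distrib[symmetric] sum_distrib_left[symmetric] by simp
  qed
  also have "\<dots> = g z" unfolding c by (intro sum.cong refl) (simp add: sum.delta)
  finally show ?thesis by (simp add: N_def)
qed

section \<open>The sinc function\<close>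

definition csinc :: "complex \<Rightarrow> complex" where
  "csinc z = (if z = 0 then 1 else sin z / z)"

lemma csinc_minus [simp]: "csinc (- z) = csinc z"
  by (simp add: csinc_def)

lemma csinc_0 [simp]: "csinc 0 = 1" by (simp add: csinc_def)

lemma csinc_real_le_1: "norm (csinc (of_real x)) \<le> 1"
proof (cases "x = 0")
  case False
  have "csinc (of_real x) = of_real (sin x / x)" using False by (simp add: csinc_def sin_of_real)
  then have "norm (csinc (of_real x)) = \<bar>sin x\<bar> / \<bar>x\<bar>" by (simp only: norm_of_real abs_divide)
  also have "\<dots> \<le> 1" using abs_sin_x_le_abs_x[of x] False by simp
  finally show ?thesis .
qed simp

lemma holomorphic_csinc: "csinc holomorphic_on UNIV"
proof (rule no_isolated_singularity')
  show "csinc holomorphic_on UNIV - {0}"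
  proof (rule holomorphic_transform)
    show "(\<lambda>z. sin z / z) holomorphic_on UNIV - {0}" by (intro holomorphic_intros) auto
  qed (auto simp: csinc_def)
  fix z :: complex assume "z \<in> {0}"
  have "((\<lambda>h. (sin (0 + h) - sin 0) / h) \<longlongrightarrow> cos (0::complex)) (at 0)"
    using DERIV_sin[of "0::complex"] by (simp add: DERIV_def)
  then have "((\<lambda>h. sin h / h) \<longlongrightarrow> (1::complex)) (at 0)" by simp
  then have "(csinc \<longlongrightarrow> 1) (at 0)"
    by (rule Lim_transform_eventually) (auto simp: csinc_def eventually_at intro!: exI[of _ 1])
  then show "(csinc \<longlongrightarrow> csinc z) (at z within UNIV)" using \<open>z \<in> {0}\<close> by simp
qed auto

text \<open>Away from the unit disc this is the bound of \<open>sin\<close> divided by \<open>|z|\<close>; inside, continuity on a compact set.\<close>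

lemma csinc_bound:
  obtains C where "0 < C" "\<And>z. norm (csinc z) \<le> C * exp \<bar>Im z\<bar> / (1 + norm z)"
proof -
  have "compact (csinc ` cball 0 1)"
    by (intro compact_continuous_image holomorphic_on_imp_continuous_on holomorphic_on_subset[OF holomorphic_csinc]) auto
  then obtain B where B: "\<And>z. norm z \<le> 1 \<Longrightarrow> norm (csinc z) \<le> B"
    by (force dest!: compact_imp_bounded simp: bounded_iff)
  define C where "C = max 2 (2 * B)"
  have "norm (csinc z) \<le> C * exp \<bar>Im z\<bar> / (1 + norm z)" for z
  proof (cases "norm z \<le> 1")
    case True
    have "norm (csinc z) * (1 + norm z) \<le> (C / 2) * 2"
      using B[OF True] True by (intro mult_mono) (auto simp: C_def)
    also have "C / 2 * 2 = C * 1" by simp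
    also have "C * 1 \<le> C * exp \<bar>Im z\<bar>" by (intro mult_left_mono) (auto simp: C_def)
    finally have "norm (csinc z) * (1 + norm z) \<le> C * exp \<bar>Im z\<bar>" .
    moreover have "0 < 1 + norm z" by (simp add: add_pos_nonneg)
    ultimately show ?thesis by (simp add: field_simps)
  next
    case False
    then have z: "z \<noteq> 0" "1 < norm z" by auto
    have "norm (csinc z) = norm (sin z) / norm z" using z by (simp add: csinc_def norm_divide)
    also have "\<dots> \<le> exp \<bar>Im z\<bar> / norm z" using cmod_sin_le_exp[of 1 z] by (intro divide_right_mono) auto
    also have "\<dots> \<le> C * exp \<bar>Im z\<bar> / (1 + norm z)"
    proof -
      have "exp \<bar>Im z\<bar> * (1 + norm z) \<le> exp \<bar>Im z\<bar> * (C * norm z)"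
      proof (rule mult_left_mono)
        have "1 + norm z \<le> 2 * norm z" using z by simp
        also have "\<dots> \<le> C * norm z" by (intro mult_right_mono) (auto simp: C_def)
        finally show "1 + norm z \<le> C * norm z" .
      qed simp
      moreover have "0 < 1 + norm z" by (simp add: add_pos_nonneg)
      ultimately show ?thesis using z by (simp add: field_simps)
    qed
    finally show ?thesis .
  qed
  moreover have "0 < C" by (simp add: C_def)
  ultimately show ?thesis using that by blast
qed

section \<open>Entire functions of several variables\<close>

definition cvec :: "real^'m \<Rightarrow> complex^'m" where
  "cvec t = (\<chi> j. complex_of_real (t $ j))"

definition imv :: "complex^'m \<Rightarrow> real^'m" where
  "imv z = (\<chi> j. Im (z $ j))"

text \<open>Holomorphy on all complex lines. For functions defined by integrals and infinite sums this is much easier to verify than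
differentiability in several variables, and the estimates below use nothing else.\<close>

definition line_holomorphic :: "(complex^'m \<Rightarrow> complex) \<Rightarrow> bool" where
  "line_holomorphic f \<longleftrightarrow> (\<forall>x v. (\<lambda>\<zeta>. f (x + \<zeta> *s v)) holomorphic_on UNIV)"

lemma cvec_nth [simp]: "cvec t $ j = complex_of_real (t $ j)" by (simp add: cvec_def)
lemma imv_nth [simp]: "imv z $ j = Im (z $ j)" by (simp add: imv_def)
lemma imv_cvec [simp]: "imv (cvec t) = 0" by (simp add: vec_eq_iff)

lemma norm_scalar_mult_vec: "norm (\<zeta> *s v) = norm \<zeta> * norm (v :: complex^'m)"
  by (simp add: norm_vec_def norm_mult L2_set_right_distrib)

lemma has_derivative_line:
  fixes v x :: "complex^'m"
  shows "((\<lambda>\<zeta>. x + \<zeta> *s v) has_derivative (\<lambda>h. h *s v)) (at \<zeta>)"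
proof -
  have "linear (\<lambda>h. h *s v)"
    by (rule linearI) (simp_all add: vec_eq_iff algebra_simps)
  then have "bounded_linear (\<lambda>h. h *s v)" by (rule linear_conv_bounded_linear[THEN iffD1])
  then have "((\<lambda>h. h *s v) has_derivative (\<lambda>h. h *s v)) (at \<zeta>)" by (rule bounded_linear_imp_has_derivative)
  from has_derivative_add[OF has_derivative_const this] show ?thesis by simp
qed

lemma entire_line_derivative:
  fixes f :: "complex^'m \<Rightarrow> complex"
  assumes "(f has_derivative D) (at (x + \<zeta> *s v))" "\<And>c v. D (c *s v) = c * D v"
  shows "((\<lambda>\<zeta>. f (x + \<zeta> *s v)) has_field_derivative D v) (at \<zeta>)"
proof -
  have "((\<lambda>\<zeta>. f (x + \<zeta> *s v)) has_derivative (\<lambda>h. D (h *s v))) (at \<zeta>)"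
    by (rule has_derivative_compose[OF has_derivative_line assms(1)])
  then show ?thesis by (simp add: has_field_derivative_def assms(2) mult.commute[of "D v"] fun_eq_iff)
     (metis (no_types, lifting) ext mult.commute)
qed

lemma entire_imp_line_holomorphic:
  fixes f :: "complex^'m \<Rightarrow> complex"
  assumes "entire f" shows "line_holomorphic f"
  unfolding line_holomorphic_def
proof (intro allI)
  fix x v
  have "\<exists>f'. ((\<lambda>\<zeta>. f (x + \<zeta> *s v)) has_field_derivative f') (at \<zeta>)" for \<zeta>
    using assms entire_line_derivative[of f _ x \<zeta> v] unfolding entire_def by blast
  then show "(\<lambda>\<zeta>. f (x + \<zeta> *s v)) holomorphic_on UNIV"
    by (auto simp: holomorphic_on_def field_differentiable_def)
qed

lemma entire_imp_continuous: "entire f \<Longrightarrow> continuous_on UNIV f"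
  unfolding entire_def
  by (metis continuous_at_imp_continuous_on has_derivative_continuous)

lemma entire_const: "entire (\<lambda>z. c)"
  unfolding entire_def by (auto intro!: exI[of _ "\<lambda>_. 0"])

lemma entire_add:
  assumes "entire f" "entire g" shows "entire (\<lambda>z. f z + g z)"
  unfolding entire_def
proof
  fix z
  obtain D E where D: "(f has_derivative D) (at z)" "\<And>c v. D (c *s v) = c * D v"
    and E: "(g has_derivative E) (at z)" "\<And>c v. E (c *s v) = c * E v"
    using assms unfolding entire_def by meson
  show "\<exists>D. ((\<lambda>z. f z + g z) has_derivative D) (at z) \<and> (\<forall>c v. D (c *s v) = c * D v)"
    using has_derivative_add[OF D(1) E(1)] by (intro exI conjI) (auto simp: D(2) E(2) algebra_simps)
qed

lemma entire_mult:
  assumes "entire f" "entire g" shows "entire (\<lambda>z. f z * g z)"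
  unfolding entire_def
proof
  fix z
  obtain D E where D: "(f has_derivative D) (at z)" "\<And>c v. D (c *s v) = c * D v"
    and E: "(g has_derivative E) (at z)" "\<And>c v. E (c *s v) = c * E v"
    using assms unfolding entire_def by meson
  show "\<exists>D. ((\<lambda>z. f z * g z) has_derivative D) (at z) \<and> (\<forall>c v. D (c *s v) = c * D v)"
    using has_derivative_mult[OF D(1) E(1)] by (intro exI conjI) (auto simp: D(2) E(2) algebra_simps)
qed

lemma entire_sum: "(\<And>i. i \<in> I \<Longrightarrow> entire (f i)) \<Longrightarrow> entire (\<lambda>z. \<Sum>i\<in>I. f i z)"
  by (induction I rule: infinite_finite_induct) (auto intro!: entire_const entire_add)

lemma entire_prod: "(\<And>i. i \<in> I \<Longrightarrow> entire (f i)) \<Longrightarrow> entire (\<lambda>z. \<Prod>i\<in>I. f i z)"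
  by (induction I rule: infinite_finite_induct) (auto intro!: entire_const entire_mult)

lemma entire_coordinate:
  assumes "\<phi> holomorphic_on UNIV" shows "entire (\<lambda>z::complex^'m. \<phi> (z $ j))"
  unfolding entire_def
proof
  fix z :: "complex^'m"
  have "(\<phi> has_derivative (*) (deriv \<phi> (z $ j))) (at (z $ j))"
    using holomorphic_derivI[OF assms open_UNIV, of "z $ j"] by (simp add: has_field_derivative_def)
  then have "((\<lambda>z. \<phi> (z $ j)) has_derivative (\<lambda>v. deriv \<phi> (z $ j) * v $ j)) (at z)"
    by (rule has_derivative_compose[rotated]) (intro bounded_linear_imp_has_derivative bounded_linear_vec_nth)
  then show "\<exists>D. ((\<lambda>z. \<phi> (z $ j)) has_derivative D) (at z) \<and> (\<forall>c v. D (c *s v) = c * D v)"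
    by (intro exI[of _ "\<lambda>v. deriv \<phi> (z $ j) * v $ j"]) auto
qed

text \<open>The one-variable remainder estimate on the complex line through \<open>z\<close> and \<open>z + v\<close>, with radius \<open>1 / norm v\<close>.\<close>

lemma entire_taylor:
  fixes F :: "complex^'m \<Rightarrow> complex"
  assumes F: "entire F" and D: "(F has_derivative D) (at z)" "\<And>c v. D (c *s v) = c * D v"
    and M: "\<And>w. norm (w - z) \<le> 1 \<Longrightarrow> norm (F w) \<le> M"
  shows "norm v \<le> 1 / 2 \<Longrightarrow> norm (F (z + v) - F z - D v) \<le> 2 * M * (norm v)\<^sup>2"
    and "norm (D v) \<le> M * norm v"
proof -
  have lin: "D 0 = 0" using D(2)[of 0 0] by simp
  have main: "norm (F (z + v) - F z - D v) \<le> 2 * M * (norm v)\<^sup>2 \<and> norm (D v) \<le> M * norm v"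
    if v: "norm v \<le> 1 / 2" for v
  proof (cases "v = 0")
    case True then show ?thesis by (simp add: lin)
  next
    case False
    define \<phi> where "\<phi> \<zeta> = F (z + \<zeta> *s v)" for \<zeta>
    have hol: "\<phi> holomorphic_on UNIV"
      using entire_imp_line_holomorphic[OF F] unfolding line_holomorphic_def \<phi>_def by blast
    have "(\<phi> has_field_derivative D v) (at 0)"
      unfolding \<phi>_def by (rule entire_line_derivative) (use D in auto)
    then have d: "deriv \<phi> 0 = D v" by (rule DERIV_imp_deriv)
    have bd: "norm (\<phi> \<zeta>) \<le> M" if "norm \<zeta> \<le> 1 / norm v" for \<zeta>
      unfolding \<phi>_def by (rule M) (use that False in \<open>simp add: norm_scalar_mult_vec field_simps\<close>)
    have "2 \<le> 1 / norm v" using v False by (simp add: field_simps)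
    from taylor_remainder_two[OF hol bd this] show ?thesis
      unfolding d by (simp add: \<phi>_def power_divide)
  qed
  show "norm v \<le> 1 / 2 \<Longrightarrow> norm (F (z + v) - F z - D v) \<le> 2 * M * (norm v)\<^sup>2" using main by blast
  show "norm (D v) \<le> M * norm v"
  proof (cases "v = 0")
    case False
    define c where "c = complex_of_real (1 / (2 * norm v))"
    have nc: "norm c = 1 / (2 * norm v)" unfolding c_def norm_of_real by simp
    have "norm (c *s v) \<le> 1 / 2" using False by (simp only: norm_scalar_mult_vec nc) simp
    then have "norm (D (c *s v)) \<le> M * norm (c *s v)" using main by blast
    then have "norm c * norm (D v) \<le> norm c * (M * norm v)" by (simp add: D(2) norm_mult norm_scalar_mult_vec mult_ac)
    moreover have "0 < norm c" using False nc by simp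
    ultimately show ?thesis by (simp only: mult_le_cancel_left_pos)
  qed (simp add: lin)
qed

lemma norm_axis_one: "norm (axis j 1 :: complex^'m) = 1"
  by (simp add: norm_vec_def L2_set_def axis_def if_distrib[of norm] if_distrib[of "\<lambda>x. x\<^sup>2"] cong: if_cong)

lemma vec_eq_sum_axis: "(v :: complex^'m) = (\<Sum>j\<in>UNIV. v $ j *s axis j 1)"
  by (simp add: vec_eq_iff axis_def if_distrib[of "\<lambda>x. _ * x"] sum.delta cong: if_cong)

text \<open>Montel's theorem in several variables. The uniform Taylor bounds make the family equi-Lipschitz near each point; a diagonal
sequence converges on a countable dense set, hence everywhere. The derivatives at a point are bounded, so a further subsequence of them
converges, and the uniform quadratic remainder identifies that limit as the derivative of the limit function.\<close>

lemma entire_locally_bounded_limit: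
  fixes f :: "nat \<Rightarrow> complex^'m \<Rightarrow> complex"
  assumes ent: "\<And>n. entire (f n)"
    and bdd: "\<And>R. \<exists>M. \<forall>n z. norm z \<le> R \<longrightarrow> norm (f n z) \<le> M"
  obtains r g where "strict_mono (r :: nat \<Rightarrow> nat)" "entire g" "\<And>z. (\<lambda>n. f (r n) z) \<longlonglongrightarrow> g z"
proof -
  obtain M where M: "\<And>n R z. norm z \<le> R \<Longrightarrow> norm (f n z) \<le> M R" using bdd by metis
  have M0: "0 \<le> M R" if "0 \<le> R" for R using M[of 0 R 0] that norm_ge_zero order_trans by (metis norm_zero)
  have Mz: "norm (f n w) \<le> M (norm z + 1)" if "norm (w - z) \<le> 1" for n w z
    by (rule M) (use that norm_triangle_ineq2[of w z] in simp)
  have "\<forall>n z. \<exists>D. (f n has_derivative D) (at z) \<and> (\<forall>c v. D (c *s v) = c * D v)"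
    using ent unfolding entire_def by blast
  then obtain D where D: "\<And>n z. (f n has_derivative D n z) (at z)" "\<And>n z c v. D n z (c *s v) = c * D n z v"
    by metis
  have T1: "norm (f n (z + v) - f n z - D n z v) \<le> 2 * M (norm z + 1) * (norm v)\<^sup>2" if "norm v \<le> 1 / 2" for n z v
    using ent D(1) D(2) Mz that by (rule entire_taylor(1))
  have T2: "norm (D n z v) \<le> M (norm z + 1) * norm v" for n z v
    using ent D(1) D(2) Mz by (rule entire_taylor(2))
  have lip: "norm (f n (z + v) - f n z) \<le> 2 * M (norm z + 1) * norm v" if v: "norm v \<le> 1 / 2" for n z v
  proof -
    have "norm (f n (z + v) - f n z) \<le> norm (f n (z + v) - f n z - D n z v) + norm (D n z v)"
      by (metis diff_add_cancel norm_triangle_ineq)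
    also have "\<dots> \<le> 2 * M (norm z + 1) * (norm v)\<^sup>2 + M (norm z + 1) * norm v"
      using T1[OF v] T2 by (intro add_mono) auto
    also have "2 * M (norm z + 1) * (norm v)\<^sup>2 = M (norm z + 1) * norm v * (2 * norm v)" by (simp add: power2_eq_square)
    also have "\<dots> \<le> M (norm z + 1) * norm v * 1" using v M0[of "norm z + 1"] by (intro mult_left_mono) auto
    finally show ?thesis by (simp add: mult_ac)
  qed
  obtain S :: "(complex^'m) set" where S: "countable S" "\<And>X. open X \<Longrightarrow> X \<noteq> {} \<Longrightarrow> \<exists>d\<in>S. d \<in> X"
    by (rule countable_dense_setE) blast
  (* dividing by the local bounds makes the functions uniformly bounded, as the diagonal argument requires *)
  obtain r where r: "strict_mono (r :: nat \<Rightarrow> nat)"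
    and conv: "\<And>x. x \<in> S \<Longrightarrow> \<exists>l. (\<lambda>n. f (r n) x / of_real (1 + M (norm x))) \<longlonglongrightarrow> l"
  proof (rule function_convergent_subsequence[OF S(1), of "\<lambda>n x. f n x / of_real (1 + M (norm x))" 1])
    fix n x
    have "norm (f n x) \<le> 1 + M (norm x)" using M[of x "norm x" n] by simp
    then show "norm (f n x / of_real (1 + M (norm x))) \<le> 1" using M0[of "norm x"]
      by (simp add: norm_divide divide_le_eq del: of_real_add)
  qed blast
  have conv': "convergent (\<lambda>n. f (r n) x)" if x: "x \<in> S" for x
  proof -
    obtain l where "(\<lambda>n. f (r n) x / of_real (1 + M (norm x))) \<longlonglongrightarrow> l" using conv[OF x] by blast
    then have "(\<lambda>n. f (r n) x / of_real (1 + M (norm x)) * of_real (1 + M (norm x))) \<longlonglongrightarrow> l * of_real (1 + M (norm x))"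
      by (intro tendsto_intros)
    moreover have "complex_of_real (1 + M (norm x)) \<noteq> 0" using M0[of "norm x"] by (simp del: of_real_add)
    ultimately show ?thesis by (auto simp: convergent_def)
  qed
  have "convergent (\<lambda>n. f (r n) z)" for z
  proof -
    have "Cauchy (\<lambda>n. f (r n) z)"
    proof (rule CauchyI)
      fix e :: real assume e: "0 < e"
      define L where "L = 2 * M (norm z + 1) + 1"
      have L: "0 < L" using M0[of "norm z + 1"] by (simp add: L_def)
      define d where "d = min (1 / 2) (e / (3 * L))"
      have d: "0 < d" "d \<le> 1 / 2" "L * d \<le> e / 3" using e L by (auto simp: d_def min_def field_simps)
      obtain x where x: "x \<in> S" "x \<in> ball z d" using S(2)[of "ball z d"] d by auto
      have xz: "norm (x - z) < d" using x by (simp add: dist_norm norm_minus_commute)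
      have near: "norm (f n x - f n z) < e / 3" for n
      proof -
        have "norm (f n (z + (x - z)) - f n z) \<le> 2 * M (norm z + 1) * norm (x - z)" using xz d by (intro lip) auto
        also have "\<dots> \<le> L * norm (x - z)" by (intro mult_right_mono) (auto simp: L_def)
        also have "\<dots> < L * d" using xz L by simp
        finally show ?thesis using d by simp
      qed
      obtain N where N: "\<And>m n. m \<ge> N \<Longrightarrow> n \<ge> N \<Longrightarrow> norm (f (r m) x - f (r n) x) < e / 3"
        using convergent_Cauchy[OF conv'[OF x(1)]] e unfolding Cauchy_iff by (metis divide_pos_pos zero_less_numeral)
      show "\<exists>N. \<forall>m\<ge>N. \<forall>n\<ge>N. norm (f (r m) z - f (r n) z) < e"
      proof (intro exI allI impI)
        fix m n assume "N \<le> m" "N \<le> n"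
        have "f (r m) z - f (r n) z = (f (r m) x - f (r n) x) - (f (r m) x - f (r m) z) + (f (r n) x - f (r n) z)" by simp
        also have "norm \<dots> \<le> norm (f (r m) x - f (r n) x) + norm (f (r m) x - f (r m) z) + norm (f (r n) x - f (r n) z)"
          by (meson add_mono norm_triangle_ineq norm_triangle_ineq4 order_refl order_trans)
        also have "\<dots> < e" using N[OF \<open>N \<le> m\<close> \<open>N \<le> n\<close>] near[of "r m"] near[of "r n"] by simp
        finally show "norm (f (r m) z - f (r n) z) < e" .
      qed
    qed
    then show ?thesis by (simp add: Cauchy_convergent_iff)
  qed
  then obtain g where g: "\<And>z. (\<lambda>n. f (r n) z) \<longlonglongrightarrow> g z" unfolding convergent_def by metis
  have "entire g"
    unfolding entire_def
  proof
    fix z :: "complex^'m"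
    define d :: "nat \<Rightarrow> complex^'m" where "d n = (\<chi> j. D (r n) z (axis j 1))" for n
    have Dd: "D (r n) z v = (\<Sum>j\<in>UNIV. v $ j * d n $ j)" for n v
    proof -
      have "linear (D (r n) z)" using D(1) has_derivative_linear by blast
      then have "D (r n) z (\<Sum>j\<in>UNIV. v $ j *s axis j 1) = (\<Sum>j\<in>UNIV. D (r n) z (v $ j *s axis j 1))"
        by (simp add: linear_sum)
      then show ?thesis unfolding vec_eq_sum_axis[symmetric] by (simp add: D(2) d_def)
    qed
    define M1 where "M1 = M (norm z + 1)"
    have "norm (d n) \<le> (\<Sum>j\<in>(UNIV::'m set). M1)" for n
    proof -
      have "norm (d n) \<le> (\<Sum>j\<in>UNIV. norm (d n $ j))" unfolding norm_vec_def by (rule L2_set_le_sum) simp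
      also have "\<dots> \<le> (\<Sum>j\<in>(UNIV::'m set). M1)"
        by (intro sum_mono) (use T2[of "r n" z "axis _ 1"] in \<open>simp add: d_def M1_def norm_axis_one\<close>)
      finally show ?thesis .
    qed
    then have "bounded (range d)" by (auto simp: bounded_iff)
    then obtain l q where q: "strict_mono (q :: nat \<Rightarrow> nat)" "(d \<circ> q) \<longlonglongrightarrow> l"
      using bounded_imp_convergent_subsequence[of d] by blast
    define E where "E v = (\<Sum>j\<in>UNIV. v $ j * l $ j)" for v
    have Elim: "(\<lambda>n. D (r (q n)) z v) \<longlonglongrightarrow> E v" for v
      unfolding Dd E_def by (intro tendsto_intros) (use q(2) in \<open>auto simp: o_def\<close>)
    have E: "bounded_linear E"
    proof -
      have "linear E" by (rule linearI) (auto simp: E_def algebra_simps sum.distrib scaleR_sum_right)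
      then show ?thesis by (rule linear_conv_bounded_linear[THEN iffD1])
    qed
    have Ec: "E (c *s v) = c * E v" for c v by (simp add: E_def sum_distrib_left mult.assoc)
    have gT: "norm (g (z + v) - g z - E v) \<le> 2 * M1 * (norm v)\<^sup>2" if v: "norm v \<le> 1 / 2" for v
    proof (rule tendsto_upperbound)
      have "(\<lambda>n. f (r (q n)) w) \<longlonglongrightarrow> g w" for w
        using LIMSEQ_subseq_LIMSEQ[OF g q(1)] by (simp add: o_def)
      then show "(\<lambda>n. norm (f (r (q n)) (z + v) - f (r (q n)) z - D (r (q n)) z v)) \<longlonglongrightarrow> norm (g (z + v) - g z - E v)"
        by (intro tendsto_intros Elim)
      show "eventually (\<lambda>n. norm (f (r (q n)) (z + v) - f (r (q n)) z - D (r (q n)) z v) \<le> 2 * M1 * (norm v)\<^sup>2) sequentially"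
        using T1[OF v] unfolding M1_def by (intro always_eventually) blast
    qed simp
    have "(g has_derivative E) (at z)"
      unfolding has_derivative_at'
    proof (intro conjI allI impI E)
      fix e :: real assume e: "0 < e"
      have M1: "0 \<le> M1" using M0 by (simp add: M1_def)
      define dd where "dd = min (1 / 2) (e / (2 * M1 + 1))"
      show "\<exists>d>0. \<forall>x'. 0 < norm (x' - z) \<and> norm (x' - z) < d \<longrightarrow> norm (g x' - g z - E (x' - z)) / norm (x' - z) < e"
      proof (intro exI[of _ dd] conjI allI impI)
        show "0 < dd" using e M1 by (simp add: dd_def)
        fix x' assume x': "0 < norm (x' - z) \<and> norm (x' - z) < dd"
        then have "norm (g x' - g z - E (x' - z)) \<le> 2 * M1 * (norm (x' - z))\<^sup>2"
          using gT[of "x' - z"] by (simp add: dd_def)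
        then have "norm (g x' - g z - E (x' - z)) / norm (x' - z) \<le> 2 * M1 * norm (x' - z)"
          using x' by (simp add: divide_le_eq power2_eq_square mult.assoc)
        also have "\<dots> \<le> (2 * M1 + 1) * norm (x' - z)" by (intro mult_right_mono) auto
        also have "\<dots> < (2 * M1 + 1) * (e / (2 * M1 + 1))" using x' M1 by (intro mult_strict_left_mono) (auto simp: dd_def)
        also have "\<dots> = e" using M1 by simp
        finally show "norm (g x' - g z - E (x' - z)) / norm (x' - z) < e" .
      qed
    qed
    then show "\<exists>D. (g has_derivative D) (at z) \<and> (\<forall>c v. D (c *s v) = c * D v)" using Ec by blast
  qed
  with r g show ?thesis using that by blast
qed

section \<open>Solid convex bodies and their dual norms\<close>

text \<open>The hypotheses on \<open>V\<close>. The name refers to the \<open>\<Pi>\<close>-condition.\<close>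

locale pi_body =
  fixes V :: "(real^'m) set"
  assumes body: "convex_body V" and sym: "centrally_symmetric V" and Pi: "Pi_condition V"
begin

lemma V_solid:
  assumes "t \<in> V" "\<And>j. \<bar>s $ j\<bar> \<le> \<bar>t $ j\<bar>" shows "s \<in> V"
proof (cases "t = 0")
  case True
  then have "s = 0" using assms(2) by (simp add: vec_eq_iff)
  then show ?thesis using assms(1) True by simp
next
  case False
  then show ?thesis using Pi assms unfolding Pi_condition_def by blast
qed

lemma V_nonempty: "V \<noteq> {}"
  using body interior_subset unfolding convex_body_def by blast

lemma pairing_bounded: "\<exists>B. \<forall>t\<in>V. norm (\<Sum>j\<in>UNIV. complex_of_real (t $ j) * z $ j) \<le> B"
proof -
  have "bounded V" using body compact_imp_bounded unfolding convex_body_def by blast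
  then obtain B where B: "\<And>t. t \<in> V \<Longrightarrow> norm t \<le> B" unfolding bounded_iff by blast
  have "norm (\<Sum>j\<in>UNIV. complex_of_real (t $ j) * z $ j) \<le> (\<Sum>j\<in>UNIV. B * norm (z $ j))" if "t \<in> V" for t
  proof (rule sum_norm_le)
    fix j
    have "\<bar>t $ j\<bar> \<le> B" using component_le_norm_cart[of t j] B[OF that] by linarith
    then show "norm (complex_of_real (t $ j) * z $ j) \<le> B * norm (z $ j)"
      by (simp add: norm_mult mult_right_mono)
  qed
  then show ?thesis by blast
qed

lemma dual_norm_upper: "t \<in> V \<Longrightarrow> norm (\<Sum>j\<in>UNIV. complex_of_real (t $ j) * z $ j) \<le> dual_norm V z"
  unfolding dual_norm_def using pairing_bounded[of z] by (intro cSUP_upper) (auto simp: bdd_above_def)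

lemma dual_norm_least:
  "(\<And>t. t \<in> V \<Longrightarrow> norm (\<Sum>j\<in>UNIV. complex_of_real (t $ j) * z $ j) \<le> c) \<Longrightarrow> dual_norm V z \<le> c"
  unfolding dual_norm_def by (rule cSUP_least[OF V_nonempty])

lemma dual_norm_nonneg: "0 \<le> dual_norm V z"
  using dual_norm_upper V_nonempty norm_ge_zero order_trans by blast

lemma dual_norm_triangle: "dual_norm V (z + w) \<le> dual_norm V z + dual_norm V w"
proof (rule dual_norm_least)
  fix t assume t: "t \<in> V"
  have "(\<Sum>j\<in>UNIV. complex_of_real (t $ j) * (z + w) $ j) = (\<Sum>j\<in>UNIV. complex_of_real (t $ j) * z $ j) + (\<Sum>j\<in>UNIV. complex_of_real (t $ j) * w $ j)"
    by (simp add: algebra_simps sum.distrib)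
  then show "norm (\<Sum>j\<in>UNIV. complex_of_real (t $ j) * (z + w) $ j) \<le> dual_norm V z + dual_norm V w"
    using norm_triangle_ineq dual_norm_upper[OF t, of z] dual_norm_upper[OF t, of w] by (smt (verit))
qed

lemma dual_norm_scale: "dual_norm V (c *s z) \<le> norm c * dual_norm V z"
proof (rule dual_norm_least)
  fix t assume t: "t \<in> V"
  have "(\<Sum>j\<in>UNIV. complex_of_real (t $ j) * (c *s z) $ j) = c * (\<Sum>j\<in>UNIV. complex_of_real (t $ j) * z $ j)"
    by (simp add: sum_distrib_left mult_ac)
  then show "norm (\<Sum>j\<in>UNIV. complex_of_real (t $ j) * (c *s z) $ j) \<le> norm c * dual_norm V z"
    using dual_norm_upper[OF t, of z] by (simp add: norm_mult mult_left_mono)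
qed

lemma dual_norm_Im_le: "dual_norm V (cvec (imv z)) \<le> dual_norm V z"
proof (rule dual_norm_least)
  fix t assume t: "t \<in> V"
  have "(\<Sum>j\<in>UNIV. complex_of_real (t $ j) * cvec (imv z) $ j) = of_real (Im (\<Sum>j\<in>UNIV. complex_of_real (t $ j) * z $ j))"
    by simp
  then have "norm (\<Sum>j\<in>UNIV. complex_of_real (t $ j) * cvec (imv z) $ j) = \<bar>Im (\<Sum>j\<in>UNIV. complex_of_real (t $ j) * z $ j)\<bar>"
    by (simp only: norm_of_real)
  then show "norm (\<Sum>j\<in>UNIV. complex_of_real (t $ j) * cvec (imv z) $ j) \<le> dual_norm V z"
    using abs_Im_le_cmod dual_norm_upper[OF t, of z] order_trans by metis
qed

text \<open>Solidity of \<open>V\<close> allows the signs of the coordinates of \<open>t\<close> to be chosen so that no cancellation occurs in the pairing with \<open>y\<close>.\<close>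

lemma abs_pairing_le_dual_norm:
  assumes t: "t \<in> V" shows "(\<Sum>j\<in>UNIV. \<bar>t $ j\<bar> * \<bar>y $ j\<bar>) \<le> dual_norm V (cvec y)"
proof -
  define s :: "real^'m" where "s = (\<chi> j. \<bar>t $ j\<bar> * sgn (y $ j))"
  have "s \<in> V" by (rule V_solid[OF t]) (simp add: s_def abs_mult abs_sgn_eq)
  have "(\<Sum>j\<in>UNIV. complex_of_real (s $ j) * cvec y $ j) = of_real (\<Sum>j\<in>UNIV. \<bar>t $ j\<bar> * \<bar>y $ j\<bar>)"
    by (simp add: s_def mult_ac abs_sgn)
  also have "norm \<dots> = (\<Sum>j\<in>UNIV. \<bar>t $ j\<bar> * \<bar>y $ j\<bar>)"
    by (simp only: norm_of_real) (simp add: sum_nonneg)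
  finally show ?thesis using dual_norm_upper[OF \<open>s \<in> V\<close>, of "cvec y"] by simp
qed

text \<open>Dually to solidity of \<open>V\<close>: the coordinatewise product with \<open>r\<close> can be moved to the other side of the pairing, where it
maps \<open>V\<close> into \<open>\<rho> V\<close>.\<close>

lemma dual_norm_hadamard:
  assumes r: "\<And>j. \<bar>r $ j\<bar> \<le> \<rho>" shows "dual_norm V (cvec r * z) \<le> \<rho> * dual_norm V z"
proof (cases "\<rho> = 0")
  case True
  then have "r = 0" using r by (simp add: vec_eq_iff)
  then have "dual_norm V (cvec r * z) \<le> 0" by (intro dual_norm_least) simp
  then show ?thesis using True by simp
next
  case False
  then have \<rho>: "0 < \<rho>" using r[of undefined] by linarith
  show ?thesis
  proof (rule dual_norm_least)
    fix t assume t: "t \<in> V"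
    define s :: "real^'m" where "s = (\<chi> j. t $ j * (r $ j / \<rho>))"
    have "s \<in> V"
    proof (rule V_solid[OF t])
      fix j
      have "\<bar>r $ j / \<rho>\<bar> \<le> 1" using r[of j] \<rho> by simp
      then have "\<bar>t $ j\<bar> * \<bar>r $ j / \<rho>\<bar> \<le> \<bar>t $ j\<bar> * 1" by (rule mult_left_mono) simp
      then show "\<bar>s $ j\<bar> \<le> \<bar>t $ j\<bar>" unfolding s_def by (simp add: abs_mult)
    qed
    have "(\<Sum>j\<in>UNIV. complex_of_real (t $ j) * (cvec r * z) $ j) = of_real \<rho> * (\<Sum>j\<in>UNIV. complex_of_real (s $ j) * z $ j)"
      using \<rho> by (simp add: s_def sum_distrib_left mult_ac)
    then have "norm (\<Sum>j\<in>UNIV. complex_of_real (t $ j) * (cvec r * z) $ j) = \<rho> * norm (\<Sum>j\<in>UNIV. complex_of_real (s $ j) * z $ j)"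
      using \<rho> by (simp add: norm_mult)
    then show "norm (\<Sum>j\<in>UNIV. complex_of_real (t $ j) * (cvec r * z) $ j) \<le> \<rho> * dual_norm V z"
      using dual_norm_upper[OF \<open>s \<in> V\<close>, of z] \<rho> by simp
  qed
qed

text \<open>An interior point of \<open>V\<close> can be moved off the coordinate hyperplanes; the box that it spans lies in \<open>V\<close> by solidity.\<close>

lemma V_contains_cube: obtains \<eta> where "0 < \<eta>" "\<And>s. (\<And>j. \<bar>s $ j\<bar> \<le> \<eta>) \<Longrightarrow> s \<in> V"
proof -
  obtain x where "x \<in> interior V" using body unfolding convex_body_def by blast
  then obtain e where e: "0 < e" "ball x e \<subseteq> V" unfolding mem_interior by blast
  define \<eta> where "\<eta> = e / (2 * real CARD('m))"
  have \<eta>: "0 < \<eta>" using e by (simp add: \<eta>_def)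
  define u :: "real^'m" where "u = (\<chi> j. if 0 \<le> x $ j then \<eta> else - \<eta>)"
  have "norm u \<le> (\<Sum>j\<in>(UNIV::'m set). \<bar>u $ j\<bar>)" by (rule norm_le_l1_cart)
  also have "\<dots> = (\<Sum>j\<in>(UNIV::'m set). \<eta>)" using \<eta> by (intro sum.cong) (auto simp: u_def)
  also have "\<dots> < e" using e by (simp add: \<eta>_def)
  finally have "x + u \<in> V" using e by (intro subsetD[OF e(2)]) (simp add: dist_norm)
  then have "s \<in> V" if "\<And>j. \<bar>s $ j\<bar> \<le> \<eta>" for s
  proof (rule V_solid)
    fix j show "\<bar>s $ j\<bar> \<le> \<bar>(x + u) $ j\<bar>" using that[of j] \<eta> by (auto simp: u_def)
  qed
  with \<eta> show ?thesis using that by blast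
qed

lemma dual_norm_lower: obtains c where "0 < c" "\<And>z j. c * norm (z $ j) \<le> dual_norm V z"
proof -
  obtain \<eta> where \<eta>: "0 < \<eta>" "\<And>s. (\<And>j. \<bar>s $ j\<bar> \<le> \<eta>) \<Longrightarrow> s \<in> V" by (rule V_contains_cube) blast
  have "\<eta> * norm (z $ j) \<le> dual_norm V z" for z j
  proof -
    define s :: "real^'m" where "s = axis j \<eta>"
    have "s \<in> V" using \<eta> by (intro \<eta>(2)) (simp add: s_def axis_def)
    from dual_norm_upper[OF this, of z]
    show ?thesis using \<eta> by (simp add: s_def axis_def if_distrib[of complex_of_real] if_distrib[of "\<lambda>x. x * _"] norm_mult cong: if_cong)
  qed
  with \<eta> show ?thesis using that by blast
qed

text \<open>Hahn-Banach separation of \<open>k\<close> from the compact convex set \<open>a V\<close>, phrased with the support function \<open>dual_norm V\<close>; central symmetry turns the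
one-sided bound on \<open>V\<close> into a bound of the absolute value.\<close>

lemma separate_from_dilate:
  fixes k :: "real^'m"
  assumes a: "0 < a" and k: "k \<notin> (\<lambda>t. a *\<^sub>R t) ` V"
  obtains u where "a * dual_norm V (cvec u) < (\<Sum>j\<in>UNIV. k $ j * u $ j)"
proof -
  have "convex ((\<lambda>t. a *\<^sub>R t) ` V)" "closed ((\<lambda>t. a *\<^sub>R t) ` V)"
    using body unfolding convex_body_def by (auto intro: convex_scaling closed_scaling compact_imp_closed)
  then obtain w b where w: "inner w k < b" "\<And>x. x \<in> (\<lambda>t. a *\<^sub>R t) ` V \<Longrightarrow> b < inner w x"
    using separating_hyperplane_closed_point[OF _ _ k] by blast
  have "dual_norm V (cvec (- w)) \<le> - b / a"
  proof (rule dual_norm_least)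
    fix t assume t: "t \<in> V"
    have mt: "- t \<in> V" using sym t unfolding centrally_symmetric_def by blast
    have "b < a * inner w t" "b < - (a * inner w t)"
      using w(2)[OF imageI[OF t]] w(2)[OF imageI[OF mt]] by auto
    then have "a * \<bar>inner w t\<bar> \<le> - b" by (auto simp: abs_if)
    then have 1: "\<bar>inner w t\<bar> \<le> - b / a" using a by (simp add: field_simps)
    have "(\<Sum>j\<in>UNIV. complex_of_real (t $ j) * cvec (- w) $ j) = of_real (- inner w t)"
      by (simp add: inner_vec_def sum_negf mult.commute)
    then have "norm (\<Sum>j\<in>UNIV. complex_of_real (t $ j) * cvec (- w) $ j) = \<bar>- inner w t\<bar>"
      by (simp only: norm_of_real)
    with 1 show "norm (\<Sum>j\<in>UNIV. complex_of_real (t $ j) * cvec (- w) $ j) \<le> - b / a" by simp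
  qed
  then have "a * dual_norm V (cvec (- w)) \<le> - b" using a by (simp add: field_simps)
  also have "\<dots> < inner (- w) k" using w(1) by simp
  also have "\<dots> = (\<Sum>j\<in>UNIV. k $ j * (- w) $ j)" by (simp add: inner_vec_def mult.commute sum_negf)
  finally show ?thesis using that by blast
qed

lemma norm_cvec [simp]: "norm (cvec (t::real^'n)) = norm t"
  by (simp add: norm_vec_def)

lemma phragmen_lindelof:
  fixes G :: "complex^'m \<Rightarrow> complex"
  assumes hol: "line_holomorphic G" and growth: "\<And>z. norm (G z) \<le> B * exp (\<kappa> * dual_norm V z)"
    and re: "\<And>t. norm (G (cvec t)) \<le> C * (1 + norm t) ^ K" and C: "0 < C" and \<kappa>: "0 \<le> \<kappa>"
  shows "norm (G z) \<le> C * (4 * (1 + norm z)) ^ K * exp (\<kappa> * dual_norm V (cvec (imv z)))"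
proof -
  define x y where "x = (\<chi> j. Re (z $ j))" and "y = imv z"
  have z: "z = cvec x + \<i> *s cvec y" by (simp add: vec_eq_iff x_def y_def complex_eq_iff)
  have nx: "norm x \<le> norm z" "norm y \<le> norm z"
    unfolding norm_vec_def by (auto intro!: L2_set_mono simp: x_def y_def abs_Re_le_cmod abs_Im_le_cmod)
  have B: "0 \<le> B" using order_trans[OF norm_ge_zero growth[of 0]] by (simp add: zero_le_mult_iff)
  have "norm (G z) \<le> C * (2 * (1 + norm x + norm y)) ^ K * exp (\<kappa> * dual_norm V (cvec y))"
  proof (cases "y = 0")
    case True
    then have "z = cvec x" using z by (simp add: vec_eq_iff)
    then have "norm (G z) \<le> C * (1 + norm x) ^ K" using re[of x] by simp
    also have "\<dots> \<le> C * (2 * (1 + norm x + norm y)) ^ K" using C by (intro mult_left_mono power_mono) auto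
    also have "\<dots> \<le> C * (2 * (1 + norm x + norm y)) ^ K * exp (\<kappa> * dual_norm V (cvec y))"
    proof -
      have "1 \<le> exp (\<kappa> * dual_norm V (cvec y))" using \<kappa> dual_norm_nonneg[of "cvec y"] by simp
      then show ?thesis using C mult_left_mono[of 1 "exp (\<kappa> * dual_norm V (cvec y))" "C * (2 * (1 + norm x + norm y)) ^ K"] by simp
    qed
    finally show ?thesis .
  next
    case False
    define g where "g \<zeta> = G (cvec x + \<zeta> *s cvec y)" for \<zeta>
    (* chosen so that 1 + norm (x + s y) is at most norm y * (A + |s|) *)
    define A where "A = (1 + norm x) / norm y"
    have y0: "0 < norm y" using False by simp
    have A: "0 < A" using y0 by (simp add: A_def add_pos_nonneg)
    have "norm (g \<i>) \<le> (C * norm y ^ K) * (2 * norm (\<i> + \<i> * of_real A)) ^ K * exp ((\<kappa> * dual_norm V (cvec y)) * Im \<i>)"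
    proof (rule phragmen_lindelof_line[where B="B * exp (\<kappa> * dual_norm V (cvec x))"])
      show "g holomorphic_on UNIV" using hol unfolding g_def line_holomorphic_def by blast
      show "norm (g \<zeta>) \<le> B * exp (\<kappa> * dual_norm V (cvec x)) * exp ((\<kappa> * dual_norm V (cvec y)) * norm \<zeta>)" for \<zeta>
      proof -
        have "dual_norm V (cvec x + \<zeta> *s cvec y) \<le> dual_norm V (cvec x) + norm \<zeta> * dual_norm V (cvec y)"
          using dual_norm_triangle[of "cvec x" "\<zeta> *s cvec y"] dual_norm_scale[of \<zeta> "cvec y"] by linarith
        then have "\<kappa> * dual_norm V (cvec x + \<zeta> *s cvec y) \<le> \<kappa> * (dual_norm V (cvec x) + norm \<zeta> * dual_norm V (cvec y))"
          using \<kappa> by (rule mult_left_mono)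
        also have "\<dots> = \<kappa> * dual_norm V (cvec x) + (\<kappa> * dual_norm V (cvec y)) * norm \<zeta>" by (simp add: algebra_simps)
        finally have "B * exp (\<kappa> * dual_norm V (cvec x + \<zeta> *s cvec y)) \<le> B * (exp (\<kappa> * dual_norm V (cvec x)) * exp ((\<kappa> * dual_norm V (cvec y)) * norm \<zeta>))"
          using B unfolding exp_add[symmetric] by (intro mult_left_mono) auto
        then show ?thesis using growth[of "cvec x + \<zeta> *s cvec y"] unfolding g_def by (simp add: mult.assoc)
      qed
      show "norm (g (of_real s)) \<le> C * norm y ^ K * (A + \<bar>s\<bar>) ^ K" for s
      proof -
        have "cvec x + of_real s *s cvec y = cvec (x + s *\<^sub>R y)" by (simp add: vec_eq_iff)
        then have "norm (g (of_real s)) \<le> C * (1 + norm (x + s *\<^sub>R y)) ^ K" using re unfolding g_def by simp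
        also have "\<dots> \<le> C * (norm y * (A + \<bar>s\<bar>)) ^ K"
        proof -
          have "norm (x + s *\<^sub>R y) \<le> norm x + \<bar>s\<bar> * norm y" using norm_triangle_ineq[of x "s *\<^sub>R y"] by simp
          moreover have "norm y * A = 1 + norm x" using y0 by (simp add: A_def)
          ultimately have "1 + norm (x + s *\<^sub>R y) \<le> norm y * (A + \<bar>s\<bar>)" by (simp add: algebra_simps)
          then show ?thesis using C by (intro mult_left_mono power_mono) auto
        qed
        finally show ?thesis by (simp add: power_mult_distrib mult_ac)
      qed
      show "0 < A" by (rule A)
      show "0 < C * norm y ^ K" using C y0 by simp
      show "0 \<le> \<kappa> * dual_norm V (cvec y)" using \<kappa> dual_norm_nonneg by simp
    qed auto
    also have "norm (\<i> + \<i> * of_real A) = 1 + A"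
    proof -
      have "\<i> + \<i> * of_real A = \<i> * of_real (1 + A)" by (simp add: algebra_simps)
      then show ?thesis using A by (simp only: norm_mult norm_of_real) simp
    qed
    also have "C * norm y ^ K * (2 * (1 + A)) ^ K = C * (2 * (1 + norm x + norm y)) ^ K"
    proof -
      have "norm y * (2 * (1 + A)) = 2 * (1 + norm x + norm y)" using y0 by (simp add: A_def field_simps)
      then show ?thesis by (metis mult.assoc power_mult_distrib)
    qed
    finally show ?thesis using z by (simp add: g_def)
  qed
  also have "\<dots> \<le> C * (4 * (1 + norm z)) ^ K * exp (\<kappa> * dual_norm V (cvec y))"
    using nx C by (intro mult_left_mono mult_right_mono power_mono) auto
  finally show ?thesis by (simp add: y_def)
qed

end

section \<open>Removing a monomial factor from a bound\<close>

definition upd_coord :: "'a^'m \<Rightarrow> 'm \<Rightarrow> 'a \<Rightarrow> 'a^'m" where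
  "upd_coord z j w = (\<chi> i. if i = j then w else z $ i)"

lemma line_holomorphic_coord:
  assumes "line_holomorphic h" shows "(\<lambda>w. h (upd_coord z j w)) holomorphic_on UNIV"
proof -
  have "upd_coord z j w = upd_coord z j 0 + w *s axis j 1" for w
    by (simp add: vec_eq_iff upd_coord_def axis_def)
  then have "(\<lambda>w. h (upd_coord z j w)) = (\<lambda>w. h (upd_coord z j 0 + w *s axis j 1))" by metis
  then show ?thesis using assms unfolding line_holomorphic_def by simp
qed

text \<open>Where all coordinates have modulus at least one, dividing by the monomial does no harm. A coordinate \<open>z\<^sub>k\<close> of modulus less than one is
surrounded by the circle of radius two about it, on which the modulus is at least one, and the maximum principle applies in that coordinate. The induction treats the
coordinates one at a time.\<close>

lemma bound_from_monomial_multiple: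
  fixes h :: "complex^'m \<Rightarrow> complex"
  assumes hol: "line_holomorphic h"
    and bd: "\<And>w. (\<And>j. norm (w $ j - z $ j) \<le> 2) \<Longrightarrow> norm ((\<Prod>j\<in>UNIV. w $ j ^ N) * h w) \<le> M"
  shows "norm (h z) \<le> M"
proof -
  (* the points whose coordinates in J have been pushed out to modulus at least one *)
  define S where "S J = {w::complex^'m. (\<forall>j\<in>J. 1 \<le> norm (w $ j) \<and> norm (w $ j - z $ j) \<le> 2) \<and> (\<forall>j\<in>-J. w $ j = z $ j)}" for J
  have claim: "finite J \<Longrightarrow> \<forall>w\<in>S (- J). norm (h w) \<le> M" for J
  proof (induction J rule: finite_induct)
    case empty
    show ?case
    proof
      fix w assume w: "w \<in> S (- {})"
      have "1 \<le> (\<Prod>j\<in>UNIV. norm (w $ j) ^ N)" using w by (intro prod_ge_1) (auto simp: S_def one_le_power)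
      then have "norm (h w) \<le> (\<Prod>j\<in>UNIV. norm (w $ j) ^ N) * norm (h w)"
        by (simp add: mult_le_cancel_right1)
      also have "\<dots> = norm ((\<Prod>j\<in>UNIV. w $ j ^ N) * h w)" by (simp add: norm_mult prod_norm[symmetric] norm_power)
      also have "\<dots> \<le> M" using w by (intro bd) (auto simp: S_def)
      finally show "norm (h w) \<le> M" .
    qed
  next
    case (insert k J)
    show ?case
    proof
      fix w assume w: "w \<in> S (- insert k J)"
      have wk: "w $ k = z $ k" using w by (auto simp: S_def)
      show "norm (h w) \<le> M"
      proof (cases "1 \<le> norm (z $ k)")
        case True
        then have "w \<in> S (- J)" using w wk insert.hyps by (auto simp: S_def)
        then show ?thesis using insert.IH by blast
      next
        case False
        define \<phi> where "\<phi> u = h (upd_coord w k u)" for u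
        have hp: "\<phi> holomorphic_on UNIV" unfolding \<phi>_def by (rule line_holomorphic_coord[OF hol])
        have "norm (\<phi> (z $ k)) \<le> M"
        proof (rule maximum_modulus_frontier[where S="cball (z $ k) 2" and f=\<phi> and \<xi>="z $ k"])
          show "\<phi> holomorphic_on interior (cball (z $ k) 2)" using hp by (rule holomorphic_on_subset) auto
          show "continuous_on (closure (cball (z $ k) 2)) \<phi>"
            by (rule continuous_on_subset[OF holomorphic_on_imp_continuous_on[OF hp]]) auto
          fix u assume "u \<in> frontier (cball (z $ k) 2)"
          then have u: "norm (u - z $ k) = 2" by (simp add: dist_norm norm_minus_commute)
          have "norm (u - z $ k) \<le> norm u + norm (z $ k)" by (rule norm_triangle_ineq4)
          then have "1 \<le> norm u" using u False by linarith
          then have "upd_coord w k u \<in> S (- J)" using w u insert.hyps by (auto simp: S_def upd_coord_def)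
          then show "norm (\<phi> u) \<le> M" using insert.IH unfolding \<phi>_def by blast
        qed auto
        moreover have "upd_coord w k (z $ k) = w" using wk by (simp add: vec_eq_iff upd_coord_def)
        ultimately show ?thesis by (simp add: \<phi>_def)
      qed
    qed
  qed
  from claim[of UNIV] show ?thesis by (auto simp: S_def)
qed

section \<open>Polynomials with exponents in a dilated body\<close>

lemma Chebyshev_poly_exists:
  "\<exists>q :: complex poly. degree q \<le> n \<and> (\<forall>\<theta>. cos (of_nat n * \<theta>) = poly q (cos \<theta>))"
proof (induction n rule: nat_less_induct)
  case (1 n)
  consider "n = 0" | "n = 1" | m where "n = Suc (Suc m)" by (metis One_nat_def not0_implies_Suc)
  then show ?case
  proof cases
    case 1 then show ?thesis by (intro exI[of _ "1"]) auto
  next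
    case 2 then show ?thesis by (intro exI[of _ "[:0, 1:]"]) auto
  next
    case (3 m)
    obtain q0 q1 :: "complex poly" where q0: "degree q0 \<le> m" "\<And>\<theta>. cos (of_nat m * \<theta>) = poly q0 (cos \<theta>)"
      and q1: "degree q1 \<le> Suc m" "\<And>\<theta>. cos (of_nat (Suc m) * \<theta>) = poly q1 (cos \<theta>)"
      using "1.IH" 3 by (metis lessI less_SucI)
    define q where "q = [:0, 2:] * q1 - q0"
    have "degree ([:0, 2:] * q1) \<le> 1 + Suc m"
      by (rule order_trans[OF degree_mult_le]) (use q1 in auto)
    then have "degree q \<le> n" unfolding q_def 3 using q0 by (intro degree_diff_le) auto
    moreover have "cos (of_nat n * \<theta>) = poly q (cos \<theta>)" for \<theta>
    proof -
      have e: "of_nat n * \<theta> = of_nat (Suc m) * \<theta> + \<theta>" "of_nat m * \<theta> = of_nat (Suc m) * \<theta> - \<theta>"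
        by (simp_all add: 3 algebra_simps)
      have "cos (of_nat n * \<theta>) + cos (of_nat m * \<theta>) = 2 * cos \<theta> * cos (of_nat (Suc m) * \<theta>)"
        unfolding e cos_add cos_diff by (simp add: mult_ac)
      then show ?thesis unfolding q_def q0(2) q1(2) by (simp add: algebra_simps)
    qed
    ultimately show ?thesis by blast
  qed
qed

definition index_set :: "real \<Rightarrow> (real^'m) set \<Rightarrow> ('m \<Rightarrow> nat) set" where
  "index_set a V = {k. (\<chi> j. real (k j)) \<in> (\<lambda>t. a *\<^sub>R t) ` V}"

lemma poly_space_add:
  assumes "P \<in> poly_space a V" "Q \<in> poly_space a V" shows "(\<lambda>x. P x + Q x) \<in> poly_space a V"
proof -
  obtain c d where "P = (\<lambda>x. \<Sum>k | (\<chi> j. real (k j)) \<in> (\<lambda>t. a *\<^sub>R t) ` V. c k * (\<Prod>j\<in>UNIV. complex_of_real (x $ j) ^ k j))"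
    "Q = (\<lambda>x. \<Sum>k | (\<chi> j. real (k j)) \<in> (\<lambda>t. a *\<^sub>R t) ` V. d k * (\<Prod>j\<in>UNIV. complex_of_real (x $ j) ^ k j))"
    using assms unfolding poly_space_def by blast
  then show ?thesis unfolding poly_space_def
    by (intro CollectI exI[of _ "\<lambda>k. c k + d k"]) (simp add: sum.distrib algebra_simps)
qed

lemma poly_space_cmult:
  assumes "P \<in> poly_space a V" shows "(\<lambda>x. b * P x) \<in> poly_space a V"
proof -
  obtain c where "P = (\<lambda>x. \<Sum>k | (\<chi> j. real (k j)) \<in> (\<lambda>t. a *\<^sub>R t) ` V. c k * (\<Prod>j\<in>UNIV. complex_of_real (x $ j) ^ k j))"
    using assms unfolding poly_space_def by blast
  then show ?thesis unfolding poly_space_def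
    by (intro CollectI exI[of _ "\<lambda>k. b * c k"]) (simp add: sum_distrib_left algebra_simps)
qed

lemma poly_space_0: "(\<lambda>x. 0) \<in> poly_space a V"
  unfolding poly_space_def by (intro CollectI exI[of _ "\<lambda>_. 0"]) simp

lemma poly_space_sum:
  "(\<And>i. i \<in> I \<Longrightarrow> P i \<in> poly_space a V) \<Longrightarrow> (\<lambda>x. \<Sum>i\<in>I. P i x) \<in> poly_space a V"
  by (induction I rule: infinite_finite_induct) (auto intro: poly_space_0 poly_space_add)

lemma poly_space_continuous: "P \<in> poly_space a V \<Longrightarrow> continuous_on UNIV P"
  unfolding poly_space_def by (auto intro!: continuous_intros)

context pi_body
begin

lemma finite_index_set:
  shows "finite (index_set a V)"
proof -
  have "bounded V" using body compact_imp_bounded unfolding convex_body_def by blast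
  then have "bounded ((\<lambda>t. a *\<^sub>R t) ` V)" by (rule bounded_scaling)
  then obtain B where B: "\<And>t. t \<in> (\<lambda>t. a *\<^sub>R t) ` V \<Longrightarrow> norm t \<le> B" unfolding bounded_iff by blast
  have "index_set a V \<subseteq> PiE UNIV (\<lambda>_. {..nat \<lfloor>B\<rfloor>})"
  proof
    fix k assume "k \<in> index_set a V"
    then have "norm (\<chi> j. real (k j)) \<le> B" using B by (auto simp: index_set_def)
    then have "real (k j) \<le> B" for j using component_le_norm_cart[of "\<chi> j. real (k j)" j] by simp
    then show "k \<in> PiE UNIV (\<lambda>_. {..nat \<lfloor>B\<rfloor>})" by (auto simp: le_nat_floor)
  qed
  then show ?thesis by (rule finite_subset) (intro finite_PiE, auto)
qed

text \<open>Solidity of \<open>V\<close>: the set of admissible exponents is closed under lowering of coordinates.\<close>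

lemma index_set_down:
  assumes k: "k \<in> index_set a V" and le: "\<And>j. k' j \<le> k j" and a: "0 < a"
  shows "k' \<in> index_set a V"
proof -
  obtain t where t: "t \<in> V" "(\<chi> j. real (k j)) = a *\<^sub>R t" using k by (auto simp: index_set_def)
  have tk: "t $ j = real (k j) / a" for j
    using t(2) a by (simp add: vec_eq_iff field_simps)
  have "(1 / a) *\<^sub>R (\<chi> j. real (k' j)) \<in> V"
    by (rule V_solid[OF t(1)]) (use le a in \<open>simp add: tk field_simps\<close>)
  then have "a *\<^sub>R ((1 / a) *\<^sub>R (\<chi> j. real (k' j))) \<in> (\<lambda>t. a *\<^sub>R t) ` V" by (rule imageI)
  then show ?thesis using a by (simp add: index_set_def)
qed

lemma poly_space_monomial:
  assumes "k \<in> index_set a V"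
  shows "(\<lambda>x. \<Prod>j\<in>UNIV. complex_of_real (x $ j) ^ k j) \<in> poly_space a V"
  unfolding poly_space_def
proof (intro CollectI exI[of _ "\<lambda>k'. if k' = k then 1 else 0"] ext)
  fix x :: "real^'m"
  have fin: "finite {k. (\<chi> j. real (k j)) \<in> (\<lambda>t. a *\<^sub>R t) ` V}"
    using finite_index_set[of a] by (simp add: index_set_def)
  show "(\<Prod>j\<in>UNIV. complex_of_real (x $ j) ^ k j) =
    (\<Sum>k' | (\<chi> j. real (k' j)) \<in> (\<lambda>t. a *\<^sub>R t) ` V. (if k' = k then 1 else 0) * (\<Prod>j\<in>UNIV. complex_of_real (x $ j) ^ k' j))"
    using assms fin by (simp add: if_distrib[of "\<lambda>x. x * _"] index_set_def sum.delta' cong: if_cong)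
qed

text \<open>All monomials in the expansion have exponents below \<open>k\<close>, hence admissible ones. This is how the \<open>\<Pi>\<close>-condition enters on the side of the
polynomials.\<close>

lemma poly_space_prod:
  assumes k: "k \<in> index_set a V" and a: "0 < a" and q: "\<And>j. degree (q j) \<le> k j"
  shows "(\<lambda>x. \<Prod>j\<in>UNIV. poly (q j) (complex_of_real (x $ j))) \<in> poly_space a V"
proof -
  have p: "poly (q j) y = (\<Sum>i\<le>k j. coeff (q j) i * y ^ i)" for j y
    unfolding poly_altdef using q[of j] by (intro sum.mono_neutral_left) (auto simp: coeff_eq_0)
  have "(\<lambda>x. \<Prod>j\<in>UNIV. poly (q j) (complex_of_real (x $ j)))
     = (\<lambda>x. \<Sum>f\<in>PiE UNIV (\<lambda>j. {..k j}). (\<Prod>j\<in>UNIV. coeff (q j) (f j)) * (\<Prod>j\<in>UNIV. complex_of_real (x $ j) ^ f j))"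
    unfolding p by (subst prod_sum_PiE) (auto simp: prod.distrib)
  moreover have "(\<lambda>x. \<Sum>f\<in>PiE UNIV (\<lambda>j. {..k j}). (\<Prod>j\<in>UNIV. coeff (q j) (f j)) * (\<Prod>j\<in>UNIV. complex_of_real (x $ j) ^ f j)) \<in> poly_space a V"
    by (intro poly_space_sum poly_space_cmult poly_space_monomial index_set_down[OF k _ a]) (auto simp: PiE_def)
  ultimately show ?thesis by simp
qed

end

section \<open>Generalized translation\<close>

text \<open>The radial density \<open>(1 - q) powr (\<mu> - 1)\<close> of the unit disc as a function of the squared radius \<open>q\<close>.\<close>

definition radial :: "real \<Rightarrow> real \<Rightarrow> ennreal" where
  "radial \<mu> q = (if q < 1 then ennreal ((1 - q) powr (\<mu> - 1)) else 0)"

lemma radial_measurable [measurable]: "radial \<mu> \<in> borel_measurable borel"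
  unfolding radial_def by measurable

lemma radial_mass:
  assumes \<mu>: "0 < \<mu>"
  shows "(\<integral>\<^sup>+s. radial \<mu> (s\<^sup>2) \<partial>lborel) < \<infinity>" and "0 < (\<integral>\<^sup>+s. radial \<mu> (s\<^sup>2) \<partial>lborel)"
proof -
  have sq: "s\<^sup>2 < 1 \<longleftrightarrow> -1 < s \<and> s < 1" for s :: real using abs_square_less_1[of s] by auto
  let ?f = "\<lambda>t. t powr (\<mu> - 1) * (1 - t) powr (\<mu> - 1) :: real"
  have b: "(\<integral>\<^sup>+t. ennreal (?f t) * indicator {0..1} t \<partial>lborel) = ennreal (Beta \<mu> \<mu>)"
    by (rule nn_integral_has_integral_lebesgue'[OF _ has_integral_Beta_real]) (use \<mu> in auto)
  have "(\<integral>\<^sup>+s. radial \<mu> (s\<^sup>2) \<partial>lborel) = ennreal \<bar>2\<bar> * (\<integral>\<^sup>+t. radial \<mu> ((-1 + 2 * t)\<^sup>2) \<partial>lborel)"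
    by (rule nn_integral_real_affine) auto
  also have "(\<integral>\<^sup>+t. radial \<mu> ((-1 + 2 * t)\<^sup>2) \<partial>lborel) \<le> (\<integral>\<^sup>+t. ennreal (4 powr (\<mu> - 1)) * (ennreal (?f t) * indicator {0..1} t) \<partial>lborel)"
  proof (rule nn_integral_mono)
    fix t :: real
    show "radial \<mu> ((-1 + 2 * t)\<^sup>2) \<le> ennreal (4 powr (\<mu> - 1)) * (ennreal (?f t) * indicator {0..1} t)"
    proof (cases "0 < t \<and> t < 1")
      case True
      have "1 - (-1 + 2 * t)\<^sup>2 = 4 * (t * (1 - t))" by (simp add: power2_eq_square algebra_simps)
      then have "(1 - (-1 + 2 * t)\<^sup>2) powr (\<mu> - 1) = 4 powr (\<mu> - 1) * ?f t" using True by (simp add: powr_mult)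
      then show ?thesis using True by (simp add: radial_def ennreal_mult'[symmetric])
    next
      case False
      then have "\<not> (-1 + 2 * t)\<^sup>2 < 1" unfolding sq by auto
      then show ?thesis by (simp add: radial_def)
    qed
  qed
  also have "\<dots> = ennreal (4 powr (\<mu> - 1)) * ennreal (Beta \<mu> \<mu>)"
    using b by (subst nn_integral_cmult) auto
  finally have "(\<integral>\<^sup>+s. radial \<mu> (s\<^sup>2) \<partial>lborel) \<le> ennreal \<bar>2\<bar> * (ennreal (4 powr (\<mu> - 1)) * ennreal (Beta \<mu> \<mu>))"
    by (simp add: mult_left_mono)
  also have "\<dots> < \<infinity>" by (simp add: ennreal_mult_less_top)
  finally show "(\<integral>\<^sup>+s. radial \<mu> (s\<^sup>2) \<partial>lborel) < \<infinity>" .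
  show "0 < (\<integral>\<^sup>+s. radial \<mu> (s\<^sup>2) \<partial>lborel)"
  proof (rule ccontr)
    assume "\<not> 0 < (\<integral>\<^sup>+s. radial \<mu> (s\<^sup>2) \<partial>lborel)"
    then have "(\<integral>\<^sup>+s. radial \<mu> (s\<^sup>2) \<partial>lborel) = 0" by simp
    then have "emeasure lborel {s\<in>space lborel. radial \<mu> (s\<^sup>2) \<noteq> 0} = 0"
      by (subst (asm) nn_integral_0_iff) auto
    moreover have "{s\<in>space lborel. radial \<mu> (s\<^sup>2) \<noteq> 0} = {-1<..<1}"
    proof -
      have "{-1<..<1} = {s::real. s\<^sup>2 < 1}" by (auto simp: sq)
      then show ?thesis by (auto simp: radial_def)
    qed
    ultimately show False by simp
  qed
qed

text \<open>The product density on the product of \<open>m\<close> unit discs; \<open>x\<close> and \<open>u\<close> collect the first and the second coordinates.\<close>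

definition disc_density :: "('m::finite \<Rightarrow> real) \<Rightarrow> real^'m \<Rightarrow> real^'m \<Rightarrow> ennreal" where
  "disc_density \<mu> x u = (\<Prod>j\<in>UNIV. radial (\<mu> j) ((x $ j)\<^sup>2 + (u $ j)\<^sup>2))"

definition fibre_density :: "('m::finite \<Rightarrow> real) \<Rightarrow> real^'m \<Rightarrow> ennreal" where
  "fibre_density \<mu> \<xi> = (\<Prod>j\<in>UNIV. radial (\<mu> j) ((\<xi> $ j)\<^sup>2))"

definition fibre_mass :: "('m::finite \<Rightarrow> real) \<Rightarrow> ennreal" where
  "fibre_mass \<mu> = (\<integral>\<^sup>+\<xi>. fibre_density \<mu> \<xi> \<partial>lborel)"

definition open_cube :: "(real^'m) set" where "open_cube = {x. \<forall>j. \<bar>x $ j\<bar> < 1}"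

definition fibre_scale :: "real^'m \<Rightarrow> real^'m" where
  "fibre_scale x = (\<chi> j. sqrt (1 - (x $ j)\<^sup>2))"

lemma disc_density_measurable [measurable]:
  "(\<lambda>(x, u). disc_density \<mu> x u) \<in> borel_measurable (lborel \<Otimes>\<^sub>M lborel)"
  "disc_density \<mu> x \<in> borel_measurable borel"
  unfolding disc_density_def by measurable

lemma fibre_density_measurable [measurable]: "fibre_density \<mu> \<in> borel_measurable borel"
  unfolding fibre_density_def by measurable

lemma jacobi_weight_measurable [measurable]: "jacobi_weight \<mu> \<in> borel_measurable borel"
  unfolding jacobi_weight_def by measurable

lemma open_cube_measurable [measurable]: "open_cube \<in> sets (borel :: (real^'m) measure)"
proof -
  have "open_cube = (\<Inter>j. {x::real^'m. \<bar>x $ j\<bar> < 1})" by (auto simp: open_cube_def)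
  moreover have "open \<dots>" by (intro open_INT ballI open_Collect_less continuous_intros) auto
  ultimately show ?thesis by simp
qed

lemma fibre_mass_bounds:
  assumes "\<And>j. 0 < \<mu> j" shows "fibre_mass \<mu> < \<infinity>" "0 < fibre_mass \<mu>"
proof -
  have "fibre_mass \<mu> = (\<Prod>j\<in>UNIV. \<integral>\<^sup>+s. radial (\<mu> j) (s\<^sup>2) \<partial>lborel)"
    unfolding fibre_mass_def fibre_density_def
    by (rule nn_integral_prod_coords[where \<phi>="\<lambda>j s. radial (\<mu> j) (s\<^sup>2)"]) measurable
  moreover have "(\<integral>\<^sup>+s. radial (\<mu> j) (s\<^sup>2) \<partial>lborel) \<noteq> \<infinity>" "(\<integral>\<^sup>+s. radial (\<mu> j) (s\<^sup>2) \<partial>lborel) \<noteq> 0" for j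
    using radial_mass[OF assms[of j]] by auto
  ultimately show "fibre_mass \<mu> < \<infinity>" "0 < fibre_mass \<mu>"
    by (auto simp: less_top[symmetric] ennreal_prod_eq_top zero_less_iff_neq_zero)
qed

lemma open_cube_sq: "x \<in> open_cube \<Longrightarrow> (x $ j)\<^sup>2 < 1"
  by (simp add: open_cube_def abs_square_less_1)

lemma disc_density_outside: "x \<notin> open_cube \<Longrightarrow> disc_density \<mu> x u = 0"
proof -
  assume "x \<notin> open_cube"
  then obtain j where "1 \<le> \<bar>x $ j\<bar>" by (auto simp: open_cube_def not_less)
  then have "1 \<le> (x $ j)\<^sup>2" using abs_square_less_1[of "x $ j"] by (simp add: not_less[symmetric])
  then have "\<not> (x $ j)\<^sup>2 + (u $ j)\<^sup>2 < 1" using zero_le_power2[of "u $ j"] by linarith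
  then have "radial (\<mu> j) ((x $ j)\<^sup>2 + (u $ j)\<^sup>2) = 0" by (simp add: radial_def)
  then show ?thesis unfolding disc_density_def by (intro prod_zero) auto
qed

lemma jacobi_weight_boundary:
  assumes "x \<in> cube" "x \<notin> open_cube" shows "jacobi_weight \<mu> x = 0"
proof -
  obtain j where j: "\<bar>x $ j\<bar> = 1" using assms by (force simp: open_cube_def cube_def not_less antisym_conv1)
  then have "(x $ j)\<^sup>2 = 1" by (metis power2_abs one_power2)
  then show ?thesis unfolding jacobi_weight_def by (intro prod_zero) (auto intro!: bexI[of _ j])
qed

text \<open>For fixed \<open>x\<close> the second coordinates run through intervals of half-length \<open>sqrt (1 - x\<^sub>j^2)\<close>. Rescaling them to the interval \<open>(-1, 1)\<close> factors the
density; the powers of \<open>1 - x\<^sub>j^2\<close> that come out form exactly the Jacobi weight.\<close>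

lemma fibre_integral:
  fixes x :: "real^'m"
  assumes x: "x \<in> open_cube" and [measurable]: "\<Psi> \<in> borel_measurable borel"
  shows "(\<integral>\<^sup>+u. \<Psi> u * disc_density \<mu> x u \<partial>lborel)
    = jacobi_weight \<mu> x * (\<integral>\<^sup>+\<xi>. \<Psi> (fibre_scale x * \<xi>) * fibre_density \<mu> \<xi> \<partial>lborel)"
proof -
  let ?c = "fibre_scale x"
  have c: "0 < 1 - (x $ j)\<^sup>2" for j using open_cube_sq[OF x] by simp
  have cj: "0 < ?c $ j" "(?c $ j)\<^sup>2 = 1 - (x $ j)\<^sup>2" for j using c[of j] by (auto simp: fibre_scale_def)
  have m[measurable]: "(\<lambda>\<xi>. \<Psi> (?c * \<xi>)) \<in> borel_measurable borel"
    unfolding times_vec_def by measurable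
  have "(\<integral>\<^sup>+u. \<Psi> u * disc_density \<mu> x u \<partial>lborel)
     = ennreal (\<Prod>j\<in>UNIV. \<bar>?c $ j\<bar>) * (\<integral>\<^sup>+\<xi>. \<Psi> (0 + ?c * \<xi>) * disc_density \<mu> x (0 + ?c * \<xi>) \<partial>lborel)"
    by (rule nn_integral_dilate) (use cj in \<open>auto simp: less_imp_neq[THEN not_sym]\<close>)
  also have "\<dots> = (\<integral>\<^sup>+\<xi>. jacobi_weight \<mu> x * (\<Psi> (?c * \<xi>) * fibre_density \<mu> \<xi>) \<partial>lborel)"
  proof (subst nn_integral_cmult[symmetric])
    show "(\<lambda>\<xi>. \<Psi> (0 + ?c * \<xi>) * disc_density \<mu> x (0 + ?c * \<xi>)) \<in> borel_measurable lborel"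
      unfolding times_vec_def by measurable
    show "(\<integral>\<^sup>+\<xi>. ennreal (\<Prod>j\<in>UNIV. \<bar>?c $ j\<bar>) * (\<Psi> (0 + ?c * \<xi>) * disc_density \<mu> x (0 + ?c * \<xi>)) \<partial>lborel)
      = (\<integral>\<^sup>+\<xi>. jacobi_weight \<mu> x * (\<Psi> (?c * \<xi>) * fibre_density \<mu> \<xi>) \<partial>lborel)"
    proof (rule nn_integral_cong)
      fix \<xi> :: "real^'m"
      have one: "ennreal \<bar>?c $ j\<bar> * radial (\<mu> j) ((x $ j)\<^sup>2 + ((?c * \<xi>) $ j)\<^sup>2)
          = ennreal ((1 - (x $ j)\<^sup>2) powr (\<mu> j - 1 / 2)) * radial (\<mu> j) ((\<xi> $ j)\<^sup>2)" for j
      proof -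
        have e: "1 - ((x $ j)\<^sup>2 + ((?c * \<xi>) $ j)\<^sup>2) = (1 - (x $ j)\<^sup>2) * (1 - (\<xi> $ j)\<^sup>2)"
          by (simp add: power_mult_distrib cj(2)) (simp add: algebra_simps)
        have iff: "(x $ j)\<^sup>2 + ((?c * \<xi>) $ j)\<^sup>2 < 1 \<longleftrightarrow> (\<xi> $ j)\<^sup>2 < 1"
          using e c[of j] zero_less_mult_iff[of "1 - (x $ j)\<^sup>2" "1 - (\<xi> $ j)\<^sup>2"] by linarith
        show ?thesis
        proof (cases "(\<xi> $ j)\<^sup>2 < 1")
          case True
          have "\<bar>?c $ j\<bar> = (1 - (x $ j)\<^sup>2) powr (1 / 2)" using c[of j] by (simp add: fibre_scale_def powr_half_sqrt)
          moreover have "((1 - (x $ j)\<^sup>2) * (1 - (\<xi> $ j)\<^sup>2)) powr (\<mu> j - 1) = (1 - (x $ j)\<^sup>2) powr (\<mu> j - 1) * (1 - (\<xi> $ j)\<^sup>2) powr (\<mu> j - 1)"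
            using c[of j] True by (simp add: powr_mult)
          moreover have "(1 - (x $ j)\<^sup>2) powr (1 / 2) * (1 - (x $ j)\<^sup>2) powr (\<mu> j - 1) = (1 - (x $ j)\<^sup>2) powr (\<mu> j - 1 / 2)"
            by (simp add: powr_add[symmetric])
          ultimately have "\<bar>?c $ j\<bar> * ((1 - (x $ j)\<^sup>2) * (1 - (\<xi> $ j)\<^sup>2)) powr (\<mu> j - 1) = (1 - (x $ j)\<^sup>2) powr (\<mu> j - 1 / 2) * (1 - (\<xi> $ j)\<^sup>2) powr (\<mu> j - 1)"
            by (metis mult.assoc)
          then show ?thesis using True iff unfolding radial_def e by (simp add: ennreal_mult'[symmetric])
        next
          case False then show ?thesis using iff by (simp add: radial_def)
        qed
      qed
      have "ennreal (\<Prod>j\<in>UNIV. \<bar>?c $ j\<bar>) * disc_density \<mu> x (?c * \<xi>) = jacobi_weight \<mu> x * fibre_density \<mu> \<xi>"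
        unfolding disc_density_def jacobi_weight_def fibre_density_def prod.distrib[symmetric]
        by (simp add: prod_ennreal[symmetric] prod.distrib[symmetric] one del: vector_mult_component)
      then show "ennreal (\<Prod>j\<in>UNIV. \<bar>?c $ j\<bar>) * (\<Psi> (0 + ?c * \<xi>) * disc_density \<mu> x (0 + ?c * \<xi>))
        = jacobi_weight \<mu> x * (\<Psi> (?c * \<xi>) * fibre_density \<mu> \<xi>)"
        by (simp add: mult_ac)
    qed
  qed
  also have "\<dots> = jacobi_weight \<mu> x * (\<integral>\<^sup>+\<xi>. \<Psi> (?c * \<xi>) * fibre_density \<mu> \<xi> \<partial>lborel)"
    by (rule nn_integral_cmult) measurable
  finally show ?thesis .
qed

lemma fibre_scale_pos: "y \<in> open_cube \<Longrightarrow> 0 < fibre_scale y $ j"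
  using open_cube_sq[of y j] by (simp add: fibre_scale_def)

lemma fibre_scale_sq: "y \<in> cube \<Longrightarrow> (fibre_scale y $ j)\<^sup>2 = 1 - (y $ j)\<^sup>2"
  using abs_square_le_1[of "y $ j"] by (simp add: fibre_scale_def cube_def)

lemma open_cube_subset: "x \<in> open_cube \<Longrightarrow> x \<in> cube"
  by (auto simp: open_cube_def cube_def intro: less_imp_le)

text \<open>The map \<open>(x, u) \<mapsto> y x + sqrt (1 - y^2) u\<close> is the first coordinate of a rotation of each disc, which leaves the radial density
invariant. The rotation is carried out by two affine substitutions: first in \<open>u\<close> for fixed \<open>x\<close>, then, after exchanging the order of
integration, in \<open>x\<close>.\<close>

lemma disc_rotation:
  fixes y :: "real^'m"
  assumes y: "y \<in> open_cube" and [measurable]: "\<Phi> \<in> borel_measurable borel"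
  shows "(\<integral>\<^sup>+x. (\<integral>\<^sup>+u. \<Phi> (y * x + fibre_scale y * u) * disc_density \<mu> x u \<partial>lborel) \<partial>lborel)
    = (\<integral>\<^sup>+z. \<Phi> z * (\<integral>\<^sup>+v. disc_density \<mu> z v \<partial>lborel) \<partial>lborel)"
proof -
  define s where "s = fibre_scale y"
  have s: "0 < s $ j" "(s $ j)\<^sup>2 = 1 - (y $ j)\<^sup>2" for j
    using fibre_scale_pos[OF y] fibre_scale_sq[OF open_cube_subset[OF y]] by (simp_all add: s_def)
  define si :: "real^'m" where "si = (\<chi> j. 1 / s $ j)"
  define Q where "Q x z = (\<Prod>j\<in>UNIV. radial (\<mu> j) ((x $ j)\<^sup>2 + ((z $ j - y $ j * x $ j) / s $ j)\<^sup>2))" for x z :: "real^'m"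
  define c1 where "c1 = ennreal (\<Prod>j\<in>UNIV. \<bar>si $ j\<bar>)"
  define c2 where "c2 = ennreal (\<Prod>j\<in>UNIV. \<bar>s $ j\<bar>)"
  have c12: "c1 * c2 = 1"
  proof -
    have "(\<Prod>j\<in>UNIV. \<bar>si $ j\<bar>) * (\<Prod>j\<in>UNIV. \<bar>s $ j\<bar>) = 1"
      unfolding prod.distrib[symmetric] by (rule prod.neutral) (use s(1) in \<open>auto simp: si_def less_imp_neq[THEN not_sym]\<close>)
    then show ?thesis unfolding c1_def c2_def by (simp add: ennreal_mult'[symmetric] prod_nonneg)
  qed
  have mQ[measurable]: "(\<lambda>(x, z). Q x z) \<in> borel_measurable (lborel \<Otimes>\<^sub>M lborel)" "\<And>x. Q x \<in> borel_measurable borel" "\<And>z. (\<lambda>x. Q x z) \<in> borel_measurable borel"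
    unfolding Q_def by measurable
  have inner: "(\<integral>\<^sup>+u. \<Phi> (y * x + s * u) * disc_density \<mu> x u \<partial>lborel) = c1 * (\<integral>\<^sup>+z. \<Phi> z * Q x z \<partial>lborel)" for x
  proof -
    define d :: "real^'m" where "d = (\<chi> j. - (y $ j * x $ j) / s $ j)"
    have m: "(\<lambda>u. \<Phi> (y * x + s * u) * disc_density \<mu> x u) \<in> borel_measurable borel"
      unfolding times_vec_def by measurable
    have nz: "si $ j \<noteq> 0" for j using s(1)[of j] by (simp add: si_def)
    have a: "y * x + s * (d + si * z) = z" for z
      using s(1) by (simp add: vec_eq_iff d_def si_def field_simps less_imp_neq[THEN not_sym])
    have b: "disc_density \<mu> x (d + si * z) = Q x z" for z
      unfolding disc_density_def Q_def by (simp add: d_def si_def diff_divide_distrib)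
    show ?thesis unfolding nn_integral_dilate[OF m nz, of d] a b c1_def ..
  qed
  have outer: "(\<integral>\<^sup>+x. Q x z \<partial>lborel) = c2 * (\<integral>\<^sup>+v. disc_density \<mu> z v \<partial>lborel)" for z
  proof -
    have nz: "s $ j \<noteq> 0" for j using s(1)[of j] by simp
    (* the identity (Y Z + S W)^2 + (S Z - Y W)^2 = Z^2 + W^2, which expresses the rotation *)
    have b: "Q (y * z + s * v) z = disc_density \<mu> z v" for v
      unfolding disc_density_def Q_def
    proof (rule prod.cong[OF refl])
      fix j
      define Y Z W S where "Y = y $ j" and "Z = z $ j" and "W = v $ j" and "S = s $ j"
      have S2: "S\<^sup>2 = 1 - Y\<^sup>2" "S \<noteq> 0" using s[of j] by (auto simp: S_def Y_def)
      have "Z - Y * (Y * Z + S * W) = (1 - Y\<^sup>2) * Z - Y * S * W" by (simp add: algebra_simps power2_eq_square)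
      also have "\<dots> = S * (S * Z - Y * W)" unfolding S2(1)[symmetric] by (simp add: algebra_simps power2_eq_square)
      finally have e: "(Z - Y * (Y * Z + S * W)) / S = S * Z - Y * W" using S2 by simp
      have "(Y * Z + S * W)\<^sup>2 + ((Z - Y * (Y * Z + S * W)) / S)\<^sup>2 = (Y\<^sup>2 + S\<^sup>2) * (Z\<^sup>2 + W\<^sup>2)"
        unfolding e by (simp add: algebra_simps power2_eq_square)
      then show "radial (\<mu> j) (((y * z + s * v) $ j)\<^sup>2 + ((z $ j - y $ j * (y * z + s * v) $ j) / s $ j)\<^sup>2) = radial (\<mu> j) ((z $ j)\<^sup>2 + (v $ j)\<^sup>2)"
        using S2 by (simp add: Y_def Z_def W_def S_def)
    qed
    show ?thesis unfolding nn_integral_dilate[OF mQ(3) nz, of z "y * z"] b c2_def ..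
  qed
  have "(\<integral>\<^sup>+x. (\<integral>\<^sup>+u. \<Phi> (y * x + s * u) * disc_density \<mu> x u \<partial>lborel) \<partial>lborel) = (\<integral>\<^sup>+x. c1 * (\<integral>\<^sup>+z. \<Phi> z * Q x z \<partial>lborel) \<partial>lborel)"
    by (simp only: inner)
  also have "\<dots> = c1 * (\<integral>\<^sup>+x. (\<integral>\<^sup>+z. \<Phi> z * Q x z \<partial>lborel) \<partial>lborel)"
    by (rule nn_integral_cmult) measurable
  also have "(\<integral>\<^sup>+x. (\<integral>\<^sup>+z. \<Phi> z * Q x z \<partial>lborel) \<partial>lborel) = (\<integral>\<^sup>+z. (\<integral>\<^sup>+x. \<Phi> z * Q x z \<partial>lborel) \<partial>lborel)"
    by (rule lborel_pair.Fubini'[symmetric]) measurable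
  also have "\<dots> = (\<integral>\<^sup>+z. \<Phi> z * (c2 * (\<integral>\<^sup>+v. disc_density \<mu> z v \<partial>lborel)) \<partial>lborel)"
    unfolding outer[symmetric] by (intro nn_integral_cong nn_integral_cmult) measurable
  also have "\<dots> = c2 * (\<integral>\<^sup>+z. \<Phi> z * (\<integral>\<^sup>+v. disc_density \<mu> z v \<partial>lborel) \<partial>lborel)"
    by (subst nn_integral_cmult[symmetric], measurable) (simp add: mult_ac)
  finally show ?thesis unfolding s_def[symmetric] using c12 by (simp add: mult.assoc[symmetric])
qed

text \<open>Invariance of the disc under rotation, read on the first coordinates only: generalized translation preserves integrals
against the Jacobi weight.\<close>

lemma translation_integral:
  fixes y :: "real^'m"
  assumes y: "y \<in> open_cube" and [measurable]: "\<Phi> \<in> borel_measurable borel"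
  shows "(\<integral>\<^sup>+x. jacobi_weight \<mu> x * (\<integral>\<^sup>+\<xi>. \<Phi> (y * x + fibre_scale y * (fibre_scale x * \<xi>)) * fibre_density \<mu> \<xi> \<partial>lborel) * indicator open_cube x \<partial>lborel)
    = fibre_mass \<mu> * (\<integral>\<^sup>+z. \<Phi> z * jacobi_weight \<mu> z * indicator open_cube z \<partial>lborel)"
proof -
  have "(\<integral>\<^sup>+x. jacobi_weight \<mu> x * (\<integral>\<^sup>+\<xi>. \<Phi> (y * x + fibre_scale y * (fibre_scale x * \<xi>)) * fibre_density \<mu> \<xi> \<partial>lborel) * indicator open_cube x \<partial>lborel)
    = (\<integral>\<^sup>+x. (\<integral>\<^sup>+u. \<Phi> (y * x + fibre_scale y * u) * disc_density \<mu> x u \<partial>lborel) \<partial>lborel)"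
  proof (rule nn_integral_cong)
    fix x :: "real^'m"
    have m: "(\<lambda>u. \<Phi> (y * x + fibre_scale y * u)) \<in> borel_measurable borel"
      unfolding times_vec_def by measurable
    show "jacobi_weight \<mu> x * (\<integral>\<^sup>+\<xi>. \<Phi> (y * x + fibre_scale y * (fibre_scale x * \<xi>)) * fibre_density \<mu> \<xi> \<partial>lborel) * indicator open_cube x
      = (\<integral>\<^sup>+u. \<Phi> (y * x + fibre_scale y * u) * disc_density \<mu> x u \<partial>lborel)"
      by (cases "x \<in> open_cube") (simp_all add: fibre_integral[OF _ m] disc_density_outside)
  qed
  also have "\<dots> = (\<integral>\<^sup>+z. \<Phi> z * (\<integral>\<^sup>+v. disc_density \<mu> z v \<partial>lborel) \<partial>lborel)"
    by (rule disc_rotation[OF y]) measurable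
  also have "\<dots> = (\<integral>\<^sup>+z. fibre_mass \<mu> * (\<Phi> z * jacobi_weight \<mu> z * indicator open_cube z) \<partial>lborel)"
  proof (rule nn_integral_cong)
    fix z :: "real^'m"
    have "z \<in> open_cube \<Longrightarrow> (\<integral>\<^sup>+v. disc_density \<mu> z v \<partial>lborel) = jacobi_weight \<mu> z * fibre_mass \<mu>"
      using fibre_integral[of z "\<lambda>_. 1" \<mu>] by (simp add: fibre_mass_def)
    then show "\<Phi> z * (\<integral>\<^sup>+v. disc_density \<mu> z v \<partial>lborel) = fibre_mass \<mu> * (\<Phi> z * jacobi_weight \<mu> z * indicator open_cube z)"
      by (cases "z \<in> open_cube") (simp_all add: disc_density_outside mult_ac)
  qed
  also have "\<dots> = fibre_mass \<mu> * (\<integral>\<^sup>+z. \<Phi> z * jacobi_weight \<mu> z * indicator open_cube z \<partial>lborel)"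
    by (rule nn_integral_cmult) measurable
  finally show ?thesis .
qed

definition fibre_prob :: "('m::finite \<Rightarrow> real) \<Rightarrow> (real^'m) measure" where
  "fibre_prob \<mu> = density lborel (\<lambda>\<xi>. fibre_density \<mu> \<xi> / fibre_mass \<mu>)"

text \<open>The generalized translation of Gegenbauer expansions, in each variable. The product and square roots act coordinatewise; \<open>y = 1\<close>
gives the identity.\<close>

definition gtrans :: "('m::finite \<Rightarrow> real) \<Rightarrow> real^'m \<Rightarrow> (real^'m \<Rightarrow> complex) \<Rightarrow> real^'m \<Rightarrow> complex" where
  "gtrans \<mu> y P x = (\<integral>\<xi>. P (y * x + fibre_scale y * (fibre_scale x * \<xi>)) \<partial>fibre_prob \<mu>)"

lemma sets_fibre_prob [measurable_cong, simp]: "sets (fibre_prob \<mu>) = sets borel"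
  by (simp add: fibre_prob_def)

lemma space_fibre_prob [simp]: "space (fibre_prob \<mu>) = UNIV"
  by (simp add: fibre_prob_def)

lemma nn_integral_fibre_prob:
  fixes F :: "real^'m \<Rightarrow> ennreal"
  assumes [measurable]: "F \<in> borel_measurable borel"
  shows "(\<integral>\<^sup>+\<xi>. F \<xi> \<partial>fibre_prob \<mu>) = (\<integral>\<^sup>+\<xi>. F \<xi> * fibre_density \<mu> \<xi> \<partial>lborel) / fibre_mass \<mu>"
proof -
  have "(\<integral>\<^sup>+\<xi>. F \<xi> \<partial>fibre_prob \<mu>) = (\<integral>\<^sup>+\<xi>. fibre_density \<mu> \<xi> / fibre_mass \<mu> * F \<xi> \<partial>lborel)"
    unfolding fibre_prob_def by (rule nn_integral_density) measurable
  also have "\<dots> = (\<integral>\<^sup>+\<xi>. F \<xi> * fibre_density \<mu> \<xi> / fibre_mass \<mu> \<partial>lborel)"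
    by (simp add: divide_ennreal_def mult_ac)
  also have "\<dots> = (\<integral>\<^sup>+\<xi>. F \<xi> * fibre_density \<mu> \<xi> \<partial>lborel) / fibre_mass \<mu>"
    by (rule nn_integral_divide) measurable
  finally show ?thesis .
qed

lemma prob_space_fibre_prob:
  assumes "\<And>j. 0 < \<mu> j" shows "prob_space (fibre_prob \<mu>)"
proof
  have "emeasure (fibre_prob \<mu>) (space (fibre_prob \<mu>)) = (\<integral>\<^sup>+\<xi>. 1 \<partial>fibre_prob \<mu>)" by simp
  also have "\<dots> = fibre_mass \<mu> / fibre_mass \<mu>"
    by (subst nn_integral_fibre_prob) (auto simp: fibre_mass_def)
  also have "\<dots> = 1" using fibre_mass_bounds[of \<mu>, OF assms] by (intro ennreal_divide_self) auto
  finally show "emeasure (fibre_prob \<mu>) (space (fibre_prob \<mu>)) = 1" .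
qed

lemma AE_fibre_prob: "AE \<xi> in fibre_prob \<mu>. \<xi> \<in> open_cube"
proof -
  have "fibre_density \<mu> \<xi> = disc_density \<mu> \<xi> 0" for \<xi> by (simp add: fibre_density_def disc_density_def)
  then have "\<xi> \<notin> open_cube \<Longrightarrow> fibre_density \<mu> \<xi> = 0" for \<xi> using disc_density_outside by simp
  then have "0 < fibre_density \<mu> \<xi> / fibre_mass \<mu> \<longrightarrow> \<xi> \<in> open_cube" for \<xi>
    by (cases "\<xi> \<in> open_cube") auto
  then show ?thesis unfolding fibre_prob_def
    by (subst AE_density) auto
qed

text \<open>Cauchy-Schwarz in each coordinate, for the unit vectors \<open>(y, sqrt (1 - y^2))\<close> and \<open>(x, sqrt (1 - x^2))\<close>.\<close>

lemma translated_point_in_cube: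
  assumes "x \<in> cube" "y \<in> cube" "\<xi> \<in> open_cube"
  shows "y * x + fibre_scale y * (fibre_scale x * \<xi>) \<in> cube"
  unfolding cube_def
proof (intro CollectI allI)
  fix j
  define X Y S C t where "X = x $ j" and "Y = y $ j" and "S = fibre_scale y $ j" and "C = fibre_scale x $ j" and "t = \<xi> $ j"
  have SC: "S\<^sup>2 = 1 - Y\<^sup>2" "C\<^sup>2 = 1 - X\<^sup>2" using fibre_scale_sq assms by (auto simp: S_def C_def X_def Y_def)
  have t: "\<bar>t\<bar> \<le> 1" using assms(3) by (auto simp: open_cube_def t_def intro: less_imp_le)
  have "t\<^sup>2 \<le> 1" using t by (simp add: abs_square_le_1)
  have "(Y * X + S * (C * t))\<^sup>2 \<le> (Y\<^sup>2 + S\<^sup>2) * (X\<^sup>2 + (C * t)\<^sup>2)"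
  proof -
    have "(Y\<^sup>2 + S\<^sup>2) * (X\<^sup>2 + (C * t)\<^sup>2) - (Y * X + S * (C * t))\<^sup>2 = (Y * (C * t) - S * X)\<^sup>2"
      by (simp add: power2_eq_square algebra_simps)
    then show ?thesis using zero_le_power2[of "Y * (C * t) - S * X"] by linarith
  qed
  also have "\<dots> = X\<^sup>2 + C\<^sup>2 * t\<^sup>2" by (simp add: SC(1) power_mult_distrib)
  also have "\<dots> \<le> X\<^sup>2 + C\<^sup>2 * 1" using \<open>t\<^sup>2 \<le> 1\<close> by (intro add_left_mono mult_left_mono) auto
  also have "\<dots> = 1" by (simp add: SC)
  finally have "\<bar>Y * X + S * (C * t)\<bar> \<le> 1" by (simp add: abs_square_le_1)
  then show "\<bar>(y * x + fibre_scale y * (fibre_scale x * \<xi>)) $ j\<bar> \<le> 1"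
    by (simp add: X_def Y_def S_def C_def t_def)
qed

lemma gtrans_integrable:
  fixes P :: "real^'m \<Rightarrow> complex"
  assumes \<mu>: "\<And>j. 0 < \<mu> j" and P: "continuous_on UNIV P" and B: "\<And>z. z \<in> cube \<Longrightarrow> norm (P z) \<le> B"
    and xy: "x \<in> cube" "y \<in> cube"
  shows "integrable (fibre_prob \<mu>) (\<lambda>\<xi>. P (y * x + fibre_scale y * (fibre_scale x * \<xi>)))"
    and "norm (gtrans \<mu> y P x) \<le> B"
proof -
  interpret prob_space "fibre_prob \<mu>" by (rule prob_space_fibre_prob[OF \<mu>])
  have [measurable]: "P \<in> borel_measurable borel" using P by (rule borel_measurable_continuous_onI)
  have bd: "AE \<xi> in fibre_prob \<mu>. norm (P (y * x + fibre_scale y * (fibre_scale x * \<xi>))) \<le> B"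
    using AE_fibre_prob by eventually_elim (intro B translated_point_in_cube xy)
  show i: "integrable (fibre_prob \<mu>) (\<lambda>\<xi>. P (y * x + fibre_scale y * (fibre_scale x * \<xi>)))"
    by (rule integrable_const_bound[OF bd]) (unfold times_vec_def, measurable)
  have "norm (gtrans \<mu> y P x) \<le> (\<integral>\<xi>. norm (P (y * x + fibre_scale y * (fibre_scale x * \<xi>))) \<partial>fibre_prob \<mu>)"
    unfolding gtrans_def by (rule integral_norm_bound)
  also have "\<dots> \<le> (\<integral>\<xi>. B \<partial>fibre_prob \<mu>)"
    by (rule integral_mono_AE) (use i bd in auto)
  finally show "norm (gtrans \<mu> y P x) \<le> B" using prob_space by simp
qed

text \<open>Jensen's inequality for the fibre probability measure, followed by the invariance of the integral.\<close>

lemma gtrans_contraction: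
  fixes P :: "real^'m \<Rightarrow> complex"
  assumes \<mu>: "\<And>j. 0 < \<mu> j" and P: "continuous_on UNIV P" and B: "\<And>z. z \<in> cube \<Longrightarrow> norm (P z) \<le> B"
    and y: "y \<in> open_cube" and p: "1 \<le> p"
  shows "(\<integral>\<^sup>+x. ennreal (norm (gtrans \<mu> y P x) powr p) * jacobi_weight \<mu> x * indicator open_cube x \<partial>lborel)
    \<le> (\<integral>\<^sup>+x. ennreal (norm (P x) powr p) * jacobi_weight \<mu> x * indicator open_cube x \<partial>lborel)"
proof -
  have [measurable]: "P \<in> borel_measurable borel" using P by (rule borel_measurable_continuous_onI)
  let ?\<Phi> = "\<lambda>z. ennreal (norm (P z) powr p)"
  let ?R = "\<lambda>x. \<integral>\<^sup>+\<xi>. ?\<Phi> (y * x + fibre_scale y * (fibre_scale x * \<xi>)) * fibre_density \<mu> \<xi> \<partial>lborel"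
  have K: "fibre_mass \<mu> < \<infinity>" "0 < fibre_mass \<mu>" using fibre_mass_bounds[of \<mu>, OF \<mu>] by auto
  have [measurable]: "(\<lambda>x::real^'m. fibre_scale x) \<in> borel_measurable borel" unfolding fibre_scale_def by measurable
  have mR[measurable]: "?R \<in> borel_measurable borel" unfolding times_vec_def by measurable
  have "(\<integral>\<^sup>+x. ennreal (norm (gtrans \<mu> y P x) powr p) * jacobi_weight \<mu> x * indicator open_cube x \<partial>lborel)
    \<le> (\<integral>\<^sup>+x. (jacobi_weight \<mu> x * ?R x * indicator open_cube x) / fibre_mass \<mu> \<partial>lborel)"
  proof (rule nn_integral_mono)
    fix x :: "real^'m"
    show "ennreal (norm (gtrans \<mu> y P x) powr p) * jacobi_weight \<mu> x * indicator open_cube x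
      \<le> (jacobi_weight \<mu> x * ?R x * indicator open_cube x) / fibre_mass \<mu>"
    proof (cases "x \<in> open_cube")
      case True
      have "ennreal (norm (gtrans \<mu> y P x) powr p) \<le> (\<integral>\<^sup>+\<xi>. ?\<Phi> (y * x + fibre_scale y * (fibre_scale x * \<xi>)) \<partial>fibre_prob \<mu>)"
        unfolding gtrans_def
        by (rule jensen_powr[OF prob_space_fibre_prob[OF \<mu>] gtrans_integrable(1)[OF \<mu> P B] p])
           (use True y open_cube_subset in auto)
      also have "\<dots> = ?R x / fibre_mass \<mu>"
        by (rule nn_integral_fibre_prob) (unfold times_vec_def, measurable)
      finally have "ennreal (norm (gtrans \<mu> y P x) powr p) * jacobi_weight \<mu> x \<le> ?R x / fibre_mass \<mu> * jacobi_weight \<mu> x"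
        by (rule mult_right_mono) simp
      then show ?thesis using True by (simp add: divide_ennreal_def mult_ac)
    qed simp
  qed
  also have "\<dots> = (\<integral>\<^sup>+x. jacobi_weight \<mu> x * ?R x * indicator open_cube x \<partial>lborel) / fibre_mass \<mu>"
    by (rule nn_integral_divide) measurable
  also have "\<dots> = (fibre_mass \<mu> * (\<integral>\<^sup>+z. ?\<Phi> z * jacobi_weight \<mu> z * indicator open_cube z \<partial>lborel)) / fibre_mass \<mu>"
    by (subst translation_integral[OF y]) auto
  also have "\<dots> = (\<integral>\<^sup>+z. ?\<Phi> z * jacobi_weight \<mu> z * indicator open_cube z \<partial>lborel)"
    using K by (simp add: divide_ennreal_def mult_ac) (simp add: mult.assoc[symmetric] ennreal_inverse_mult divide_ennreal_def[symmetric] ennreal_divide_self)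
  finally show ?thesis .
qed

text \<open>At the vertex the fibre degenerates to a point, so the translated function has there the value of the original one at \<open>y\<close>.\<close>

lemma gtrans_one:
  fixes P :: "real^'m \<Rightarrow> complex"
  assumes \<mu>: "\<And>j. 0 < \<mu> j" shows "gtrans \<mu> y P 1 = P y"
proof -
  interpret prob_space "fibre_prob \<mu>" by (rule prob_space_fibre_prob[OF \<mu>])
  have "fibre_scale (1 :: real^'m) = 0" by (simp add: vec_eq_iff fibre_scale_def)
  then have "y * 1 + fibre_scale y * (fibre_scale 1 * \<xi>) = y" for \<xi> by (simp add: vec_eq_iff)
  then show ?thesis unfolding gtrans_def using prob_space by simp
qed

text \<open>The fibre measure is invariant under reflection of a coordinate.\<close>

lemma fibre_moment_odd:
  fixes f :: "'m::finite \<Rightarrow> nat"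
  assumes j: "odd (f j)"
  shows "(\<integral>\<xi>. complex_of_real (\<Prod>i\<in>UNIV. (\<xi> $ i) ^ f i) \<partial>fibre_prob \<mu>) = 0"
proof -
  define c :: "real^'m" where "c = (\<chi> i. if i = j then -1 else 1)"
  define F where "F \<xi> = c * \<xi>" for \<xi> :: "real^'m"
  have [measurable]: "F \<in> borel_measurable borel" unfolding F_def times_vec_def by measurable
  have sq: "(F \<xi> $ i)\<^sup>2 = (\<xi> $ i)\<^sup>2" for \<xi> i by (simp add: F_def c_def)
  have dens: "fibre_density \<mu> (F \<xi>) = fibre_density \<mu> \<xi>" for \<xi> by (simp add: fibre_density_def sq)
  have FF: "F (F \<xi>) = \<xi>" for \<xi> by (simp add: F_def c_def vec_eq_iff)
  have "distr (fibre_prob \<mu>) borel F = fibre_prob \<mu>"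
  proof (rule measure_eqI)
    fix A assume "A \<in> sets (distr (fibre_prob \<mu>) borel F)"
    then have [measurable]: "A \<in> sets borel" by simp
    have "emeasure (distr (fibre_prob \<mu>) borel F) A = (\<integral>\<^sup>+\<xi>. indicator A \<xi> \<partial>distr (fibre_prob \<mu>) borel F)" by simp
    also have "\<dots> = (\<integral>\<^sup>+\<xi>. indicator A (F \<xi>) \<partial>fibre_prob \<mu>)" by (rule nn_integral_distr) measurable
    also have "\<dots> = (\<integral>\<^sup>+\<xi>. indicator A (F \<xi>) * fibre_density \<mu> \<xi> \<partial>lborel) / fibre_mass \<mu>"
      by (rule nn_integral_fibre_prob) measurable
    also have "(\<integral>\<^sup>+\<xi>. indicator A (F \<xi>) * fibre_density \<mu> \<xi> \<partial>lborel)
      = ennreal (\<Prod>j\<in>UNIV. \<bar>c $ j\<bar>) * (\<integral>\<^sup>+\<xi>. indicator A (F (0 + c * \<xi>)) * fibre_density \<mu> (0 + c * \<xi>) \<partial>lborel)"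
      by (rule nn_integral_dilate) (auto simp: c_def)
    also have "(\<Prod>j\<in>UNIV. \<bar>c $ j\<bar>) = 1" by (rule prod.neutral) (auto simp: c_def)
    also have "(\<lambda>\<xi>. indicator A (F (0 + c * \<xi>)) * fibre_density \<mu> (0 + c * \<xi>)) = (\<lambda>\<xi>. indicator A \<xi> * fibre_density \<mu> \<xi> :: ennreal)"
      using FF dens by (simp add: F_def fun_eq_iff)
    also have "ennreal 1 * (\<integral>\<^sup>+\<xi>. indicator A \<xi> * fibre_density \<mu> \<xi> \<partial>lborel) / fibre_mass \<mu> = (\<integral>\<^sup>+\<xi>. indicator A \<xi> \<partial>fibre_prob \<mu>)"
      by (subst nn_integral_fibre_prob) auto
    finally show "emeasure (distr (fibre_prob \<mu>) borel F) A = emeasure (fibre_prob \<mu>) A" by simp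
  qed simp
  then have "(\<integral>\<xi>. complex_of_real (\<Prod>i\<in>UNIV. (\<xi> $ i) ^ f i) \<partial>fibre_prob \<mu>)
    = (\<integral>\<xi>. complex_of_real (\<Prod>i\<in>UNIV. (\<xi> $ i) ^ f i) \<partial>distr (fibre_prob \<mu>) borel F)" by simp
  also have "\<dots> = (\<integral>\<xi>. complex_of_real (\<Prod>i\<in>UNIV. (F \<xi> $ i) ^ f i) \<partial>fibre_prob \<mu>)"
    by (rule integral_distr) measurable
  also have "(\<lambda>\<xi>. complex_of_real (\<Prod>i\<in>UNIV. (F \<xi> $ i) ^ f i)) = (\<lambda>\<xi>. - complex_of_real (\<Prod>i\<in>UNIV. (\<xi> $ i) ^ f i))"
  proof
    fix \<xi> :: "real^'m"
    have "(\<Prod>i\<in>UNIV. (F \<xi> $ i) ^ f i) = (\<Prod>i\<in>UNIV. (c $ i) ^ f i) * (\<Prod>i\<in>UNIV. (\<xi> $ i) ^ f i)"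
      by (simp add: F_def power_mult_distrib prod.distrib)
    also have "(\<Prod>i\<in>UNIV. (c $ i) ^ f i) = (\<Prod>i\<in>UNIV. if i = j then -1 else 1)"
      using j by (intro prod.cong) (auto simp: c_def)
    also have "\<dots> = -1" by simp
    finally show "complex_of_real (\<Prod>i\<in>UNIV. (F \<xi> $ i) ^ f i) = - complex_of_real (\<Prod>i\<in>UNIV. (\<xi> $ i) ^ f i)" by simp
  qed
  finally have e: "(\<integral>\<xi>. complex_of_real (\<Prod>i\<in>UNIV. (\<xi> $ i) ^ f i) \<partial>fibre_prob \<mu>) = - (\<integral>\<xi>. complex_of_real (\<Prod>i\<in>UNIV. (\<xi> $ i) ^ f i) \<partial>fibre_prob \<mu>)"
    by simp
  have "I = 0" if "I = - I" for I :: complex using that by (simp add: complex_eq_iff)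
  then show ?thesis using e by blast
qed

text \<open>Expanding the power by the binomial theorem yields powers of \<open>\<xi>\<^sub>j\<close> times the same powers of \<open>sqrt (1 - x\<^sub>j^2)\<close>. Odd moments of the
fibre measure vanish, so only even powers of the square root survive and the result is a polynomial whose degree in each
variable does not exceed that of the monomial.\<close>

lemma gtrans_monomial:
  fixes k :: "'m::finite \<Rightarrow> nat" and V :: "(real^'m) set"
  assumes V: "pi_body V" and k: "k \<in> index_set a V" and a: "0 < a" and \<mu>: "\<And>j. 0 < \<mu> j" and y: "y \<in> open_cube"
  obtains P' where "P' \<in> poly_space a V"
    "\<And>x. x \<in> cube \<Longrightarrow> P' x = gtrans \<mu> y (\<lambda>x. \<Prod>j\<in>UNIV. complex_of_real (x $ j) ^ k j) x"
proof -
  interpret pi_body V by (rule V)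
  interpret prob_space "fibre_prob \<mu>" by (rule prob_space_fibre_prob[OF \<mu>])
  define m where "m f = (\<integral>\<xi>. complex_of_real (\<Prod>i\<in>UNIV. (\<xi> $ i) ^ f i) \<partial>fibre_prob \<mu>)" for f :: "'m \<Rightarrow> nat"
  define b where "b j i = of_nat (k j choose i) * complex_of_real (y $ j) ^ (k j - i) * complex_of_real (fibre_scale y $ j) ^ i" for j i
  (* the even power i of sqrt (1 - x^2) is the polynomial (1 - x^2)^(i div 2) *)
  define q where "q j i = smult (b j i) (monom 1 (k j - i) * [:1, 0, -1:] ^ (i div 2))" for j i
  define E where "E = PiE UNIV (\<lambda>j. {..k j})"
  define P' where "P' x = (\<Sum>f\<in>E. m f * (\<Prod>j\<in>UNIV. poly (q j (f j)) (complex_of_real (x $ j))))" for x :: "real^'m"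
  have deg: "degree (q j i) \<le> k j" if "i \<le> k j" for i j
  proof -
    have "degree ([:1, 0, -1:] ^ (i div 2) :: complex poly) \<le> degree ([:1, 0, -1:] :: complex poly) * (i div 2)" by (rule degree_power_le)
    also have "\<dots> \<le> i" by simp
    finally have "degree (monom 1 (k j - i) * [:1, 0, -1:] ^ (i div 2) :: complex poly) \<le> (k j - i) + i"
      by (intro order_trans[OF degree_mult_le] add_mono degree_monom_le)
    then show ?thesis unfolding q_def using that by (intro order_trans[OF degree_smult_le]) simp
  qed
  have "P' \<in> poly_space a V" unfolding P'_def
    by (intro poly_space_sum poly_space_cmult poly_space_prod[OF k a] deg) (auto simp: E_def)
  moreover have "P' x = gtrans \<mu> y (\<lambda>x. \<Prod>j\<in>UNIV. complex_of_real (x $ j) ^ k j) x" if x: "x \<in> cube" for x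
  proof -
    define cx where "cx f = (\<Prod>j\<in>UNIV. b j (f j) * complex_of_real (x $ j) ^ (k j - f j) * complex_of_real (fibre_scale x $ j) ^ f j)" for f
    have "(\<Prod>j\<in>UNIV. complex_of_real ((y * x + fibre_scale y * (fibre_scale x * \<xi>)) $ j) ^ k j)
      = (\<Sum>f\<in>E. cx f * complex_of_real (\<Prod>i\<in>UNIV. (\<xi> $ i) ^ f i))" for \<xi>
    proof -
      have "complex_of_real ((y * x + fibre_scale y * (fibre_scale x * \<xi>)) $ j) ^ k j
        = (\<Sum>i\<le>k j. b j i * complex_of_real (x $ j) ^ (k j - i) * complex_of_real (fibre_scale x $ j) ^ i * complex_of_real (\<xi> $ j) ^ i)" for j
      proof -
        have "complex_of_real ((y * x + fibre_scale y * (fibre_scale x * \<xi>)) $ j)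
          = complex_of_real (fibre_scale y $ j) * complex_of_real (fibre_scale x $ j) * complex_of_real (\<xi> $ j) + complex_of_real (y $ j) * complex_of_real (x $ j)"
          by (simp add: algebra_simps)
        note e = this
        show ?thesis unfolding e binomial_ring by (rule sum.cong[OF refl]) (simp add: b_def power_mult_distrib mult_ac)
      qed
      then have "(\<Prod>j\<in>UNIV. complex_of_real ((y * x + fibre_scale y * (fibre_scale x * \<xi>)) $ j) ^ k j)
        = (\<Sum>f\<in>E. \<Prod>j\<in>UNIV. b j (f j) * complex_of_real (x $ j) ^ (k j - f j) * complex_of_real (fibre_scale x $ j) ^ f j * complex_of_real (\<xi> $ j) ^ f j)"
        unfolding E_def by (subst prod_sum_PiE[symmetric]) auto
      also have "\<dots> = (\<Sum>f\<in>E. cx f * complex_of_real (\<Prod>i\<in>UNIV. (\<xi> $ i) ^ f i))"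
        by (simp add: cx_def prod.distrib)
      finally show ?thesis .
    qed
    then have "gtrans \<mu> y (\<lambda>x. \<Prod>j\<in>UNIV. complex_of_real (x $ j) ^ k j) x
      = (\<integral>\<xi>. (\<Sum>f\<in>E. cx f * complex_of_real (\<Prod>i\<in>UNIV. (\<xi> $ i) ^ f i)) \<partial>fibre_prob \<mu>)"
      unfolding gtrans_def by simp
    also have "\<dots> = (\<Sum>f\<in>E. (\<integral>\<xi>. cx f * complex_of_real (\<Prod>i\<in>UNIV. (\<xi> $ i) ^ f i) \<partial>fibre_prob \<mu>))"
    proof (rule Bochner_Integration.integral_sum)
      fix f
      have "AE \<xi> in fibre_prob \<mu>. norm (complex_of_real (\<Prod>i\<in>UNIV. (\<xi> $ i) ^ f i)) \<le> 1"
        using AE_fibre_prob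
      proof eventually_elim
        fix \<xi> :: "real^'m" assume "\<xi> \<in> open_cube"
        then have "\<bar>\<Prod>i\<in>UNIV. (\<xi> $ i) ^ f i\<bar> \<le> 1"
          unfolding abs_prod power_abs by (intro prod_le_1) (auto simp: open_cube_def less_imp_le intro!: power_le_one)
        then show "norm (complex_of_real (\<Prod>i\<in>UNIV. (\<xi> $ i) ^ f i)) \<le> 1" by (simp only: norm_of_real)
      qed
      then show "integrable (fibre_prob \<mu>) (\<lambda>\<xi>. cx f * complex_of_real (\<Prod>i\<in>UNIV. (\<xi> $ i) ^ f i))"
        by (intro integrable_mult_right integrable_const_bound[where B=1]) measurable
    qed
    also have "\<dots> = (\<Sum>f\<in>E. m f * cx f)" unfolding m_def by (simp add: mult.commute)
    also have "\<dots> = P' x" unfolding P'_def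
    proof (rule sum.cong[OF refl])
      fix f
      show "m f * cx f = m f * (\<Prod>j\<in>UNIV. poly (q j (f j)) (complex_of_real (x $ j)))"
      proof (cases "\<exists>j. odd (f j)")
        case True then show ?thesis unfolding m_def using fibre_moment_odd by auto
      next
        case False
        have "cx f = (\<Prod>j\<in>UNIV. poly (q j (f j)) (complex_of_real (x $ j)))" unfolding cx_def
        proof (rule prod.cong[OF refl])
          fix j
          obtain n where n: "f j = 2 * n" using False by (auto elim: evenE)
          have "complex_of_real (fibre_scale x $ j) ^ f j = complex_of_real ((fibre_scale x $ j)\<^sup>2) ^ n"
            by (simp add: n power_mult)
          also have "\<dots> = complex_of_real (1 - (x $ j)\<^sup>2) ^ n" using fibre_scale_sq[OF x] by simp
          also have "\<dots> = poly ([:1, 0, -1:] ^ (f j div 2)) (complex_of_real (x $ j))"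
            by (simp add: n poly_power power2_eq_square)
          finally show "b j (f j) * complex_of_real (x $ j) ^ (k j - f j) * complex_of_real (fibre_scale x $ j) ^ f j = poly (q j (f j)) (complex_of_real (x $ j))"
            by (simp add: q_def poly_monom)
        qed
        then show ?thesis by simp
      qed
    qed
    finally show ?thesis by simp
  qed
  ultimately show ?thesis using that by blast
qed

lemma gtrans_poly:
  fixes V :: "(real^'m) set"
  assumes V: "pi_body V" and P: "P \<in> poly_space a V" and a: "0 < a" and \<mu>: "\<And>j. 0 < \<mu> j" and y: "y \<in> open_cube"
  obtains P' where "P' \<in> poly_space a V" "\<And>x. x \<in> cube \<Longrightarrow> P' x = gtrans \<mu> y P x"
proof -
  obtain c where c: "P = (\<lambda>x. \<Sum>k\<in>index_set a V. c k * (\<Prod>j\<in>UNIV. complex_of_real (x $ j) ^ k j))"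
    using P unfolding poly_space_def index_set_def by blast
  have "\<forall>k\<in>index_set a V. \<exists>Q. Q \<in> poly_space a V \<and> (\<forall>x\<in>cube. Q x = gtrans \<mu> y (\<lambda>x. \<Prod>j\<in>UNIV. complex_of_real (x $ j) ^ k j) x)"
  proof
    fix k assume k: "k \<in> index_set a V"
    show "\<exists>Q. Q \<in> poly_space a V \<and> (\<forall>x\<in>cube. Q x = gtrans \<mu> y (\<lambda>x. \<Prod>j\<in>UNIV. complex_of_real (x $ j) ^ k j) x)"
      by (rule gtrans_monomial[where \<mu>=\<mu>, OF V k a \<mu> y]) blast
  qed
  from bchoice[OF this] obtain Q where Q: "\<forall>k\<in>index_set a V. Q k \<in> poly_space a V \<and>
    (\<forall>x\<in>cube. Q k x = gtrans \<mu> y (\<lambda>x. \<Prod>j\<in>UNIV. complex_of_real (x $ j) ^ k j) x)" ..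
  have "(\<lambda>x. \<Sum>k\<in>index_set a V. c k * Q k x) \<in> poly_space a V"
    by (intro poly_space_sum poly_space_cmult) (use Q in blast)
  moreover have "(\<Sum>k\<in>index_set a V. c k * Q k x) = gtrans \<mu> y P x" if x: "x \<in> cube" for x
  proof -
    have i: "integrable (fibre_prob \<mu>) (\<lambda>\<xi>. \<Prod>j\<in>UNIV. complex_of_real ((y * x + fibre_scale y * (fibre_scale x * \<xi>)) $ j) ^ k j)" for k
    proof (rule gtrans_integrable(1)[where \<mu>=\<mu>, OF \<mu> _ _ x open_cube_subset[OF y], of "\<lambda>x. \<Prod>j\<in>UNIV. complex_of_real (x $ j) ^ k j" 1])
      show "continuous_on UNIV (\<lambda>x::real^'m. \<Prod>j\<in>UNIV. complex_of_real (x $ j) ^ k j)" by (intro continuous_intros)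
      fix z :: "real^'m" assume "z \<in> cube"
      then show "norm (\<Prod>j\<in>UNIV. complex_of_real (z $ j) ^ k j) \<le> 1"
        unfolding prod_norm[symmetric] by (intro prod_le_1) (auto simp: norm_power cube_def intro!: power_le_one)
    qed
    have "gtrans \<mu> y P x = (\<Sum>k\<in>index_set a V. c k * gtrans \<mu> y (\<lambda>x. \<Prod>j\<in>UNIV. complex_of_real (x $ j) ^ k j) x)"
      unfolding gtrans_def c
      by (subst Bochner_Integration.integral_sum) (simp_all only: integrable_mult_right[OF i] integral_mult_right_zero)
    also have "\<dots> = (\<Sum>k\<in>index_set a V. c k * Q k x)"
      by (rule sum.cong[OF refl]) (use Q x in simp)
    finally show ?thesis by simp
  qed
  ultimately show ?thesis using that by blast
qed

section \<open>The cosine substitution\<close>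

text \<open>The weight into which \<open>(1 - x^2) powr (\<beta> - 1/2)\<close> turns under \<open>x = cos (s / a)\<close>, scaled by the factor that makes it converge
to \<open>s powr (2 \<beta>)\<close>. The Jacobian contributes one factor \<open>sin\<close>.\<close>

definition sine_weight :: "real \<Rightarrow> real \<Rightarrow> real \<Rightarrow> ennreal" where
  "sine_weight a \<beta> s = ennreal ((a * sin (s / a)) powr (2 * \<beta>)) * indicator {0<..<pi * a} s"

lemma sine_weight_measurable [measurable]: "sine_weight a \<beta> \<in> borel_measurable borel"
  unfolding sine_weight_def by measurable

lemma cos_substitution:
  fixes \<beta> b c :: real
  shows "(\<integral>\<^sup>+s. sine_weight 1 \<beta> s * indicator {b<..<c} (cos s) \<partial>lborel)
    = (\<integral>\<^sup>+x. (ennreal ((1 - x\<^sup>2) powr (\<beta> - 1 / 2)) * indicator {-1..1} x) * indicator {b<..<c} x \<partial>lborel)"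
proof -
  (* - cos is increasing on [0, pi], so the variable is reflected first *)
  define f :: "real \<Rightarrow> real" where "f x = (1 - x\<^sup>2) powr (\<beta> - 1 / 2) * indicator {b<..<c} (- x)" for x
  have [measurable]: "f \<in> borel_measurable borel" unfolding f_def by measurable
  have "(\<integral>\<^sup>+x. (ennreal ((1 - x\<^sup>2) powr (\<beta> - 1 / 2)) * indicator {-1..1} x) * indicator {b<..<c} x \<partial>lborel)
    = ennreal \<bar>-1\<bar> * (\<integral>\<^sup>+x. (ennreal ((1 - (0 + -1 * x)\<^sup>2) powr (\<beta> - 1 / 2)) * indicator {-1..1} (0 + -1 * x)) * indicator {b<..<c} (0 + -1 * x) \<partial>lborel)"
    by (rule nn_integral_real_affine) auto
  also have "\<dots> = (\<integral>\<^sup>+x. ennreal (f x * indicator {- cos 0..- cos pi} x) \<partial>lborel)"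
    by (auto intro!: nn_integral_cong simp: f_def indicator_def)
  also have "\<dots> = (\<integral>\<^sup>+s. ennreal (f (- cos s) * sin s * indicator {0..pi} s) \<partial>lborel)"
  proof (rule nn_integral_substitution)
    show "set_borel_measurable borel {- cos 0..- cos pi} f" unfolding set_borel_measurable_def by measurable
    show "((\<lambda>x. - cos x) has_real_derivative sin x) (at x)" for x
      by (auto intro!: derivative_eq_intros)
  qed (auto intro!: continuous_intros sin_ge_zero)
  also have "\<dots> = (\<integral>\<^sup>+s. sine_weight 1 \<beta> s * indicator {b<..<c} (cos s) \<partial>lborel)"
  proof (rule nn_integral_cong)
    fix s :: real
    show "ennreal (f (- cos s) * sin s * indicator {0..pi} s) = sine_weight 1 \<beta> s * indicator {b<..<c} (cos s)"
    proof (cases "0 < s \<and> s < pi")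
      case True
      then have s: "0 < sin s" by (simp add: sin_gt_zero)
      have e: "1 - (cos s)\<^sup>2 = sin s powr 2" using s by (simp add: sin_squared_eq[symmetric] powr_numeral)
      have "(1 - (cos s)\<^sup>2) powr (\<beta> - 1 / 2) = sin s powr (2 * (\<beta> - 1 / 2))"
        by (simp only: e powr_powr)
      then have "(1 - (cos s)\<^sup>2) powr (\<beta> - 1 / 2) * sin s = sin s powr (2 * (\<beta> - 1 / 2)) * sin s powr 1"
        using s by (simp only: powr_one)
      also have "\<dots> = sin s powr (2 * \<beta>)" by (simp only: powr_add[symmetric]) (simp add: algebra_simps)
      finally show ?thesis using True by (auto simp: f_def sine_weight_def indicator_def)
    next
      case False
      then show ?thesis by (cases "s = 0 \<or> s = pi") (auto simp: sine_weight_def indicator_def)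
    qed
  qed
  finally show ?thesis by simp
qed

text \<open>The weight on the cube has finite mass for \<open>\<beta> \<ge> 0\<close>, its exponents being at least \<open>-1/2\<close>, so the coordinatewise substitution applies.\<close>

lemma cube_integral_cos:
  fixes \<beta> :: "'m::finite \<Rightarrow> real"
  assumes \<beta>: "\<And>j. 0 \<le> \<beta> j" and [measurable]: "\<Phi> \<in> borel_measurable borel"
  shows "(\<integral>\<^sup>+x. \<Phi> x * jacobi_weight \<beta> x * indicator cube x \<partial>lborel)
    = (\<integral>\<^sup>+\<tau>. \<Phi> (\<chi> j. cos (\<tau> $ j)) * (\<Prod>j\<in>UNIV. sine_weight 1 (\<beta> j) (\<tau> $ j)) \<partial>lborel)"
proof -
  define n2 where "n2 j x = ennreal ((1 - x\<^sup>2) powr (\<beta> j - 1 / 2)) * indicator {-1..1} x" for j x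
  have [measurable]: "\<And>j. n2 j \<in> borel_measurable borel" unfolding n2_def by measurable
  have fin: "(\<integral>\<^sup>+x. n2 j x \<partial>lborel) < \<infinity>" for j
  proof -
    have "(\<integral>\<^sup>+x. n2 j x \<partial>lborel) = (\<integral>\<^sup>+x. n2 j x * indicator {-2<..<2} x \<partial>lborel)"
      by (intro nn_integral_cong) (auto simp: n2_def indicator_def)
    also have "\<dots> = (\<integral>\<^sup>+s. sine_weight 1 (\<beta> j) s * indicator {-2<..<2} (cos s) \<partial>lborel)"
      unfolding n2_def cos_substitution ..
    also have "\<dots> \<le> (\<integral>\<^sup>+s. indicator {0<..<pi} s \<partial>lborel)"
    proof (rule nn_integral_mono)
      fix s :: real
      show "sine_weight 1 (\<beta> j) s * indicator {-2<..<2} (cos s) \<le> indicator {0<..<pi} s"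
      proof (cases "0 < s \<and> s < pi")
        case True
        have "sin s powr (2 * \<beta> j) \<le> 1 powr (2 * \<beta> j)"
          using True \<beta> by (intro powr_mono2) (auto intro!: sin_ge_zero)
        then show ?thesis using True by (auto simp: sine_weight_def indicator_def)
      qed (auto simp: sine_weight_def indicator_def)
    qed
    also have "\<dots> < \<infinity>" by simp
    finally show ?thesis .
  qed
  have w: "jacobi_weight \<beta> x * indicator cube x = (\<Prod>j\<in>UNIV. n2 j (x $ j))" for x
  proof (cases "x \<in> cube")
    case True
    then have "n2 j (x $ j) = ennreal ((1 - (x $ j)\<^sup>2) powr (\<beta> j - 1 / 2))" for j
      by (auto simp: n2_def cube_def abs_le_iff indicator_def)
    then show ?thesis using True by (simp add: jacobi_weight_def)
  next
    case False
    then obtain j where "1 < \<bar>x $ j\<bar>" by (auto simp: cube_def not_le)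
    then have "n2 j (x $ j) = 0" by (auto simp: n2_def indicator_def)
    then show ?thesis using False by (subst prod_zero) auto
  qed
  have "(\<integral>\<^sup>+\<tau>. \<Phi> (\<chi> j. cos (\<tau> $ j)) * (\<Prod>j\<in>UNIV. sine_weight 1 (\<beta> j) (\<tau> $ j)) \<partial>lborel)
    = (\<integral>\<^sup>+x. \<Phi> x * (\<Prod>j\<in>UNIV. n2 j (x $ j)) \<partial>lborel)"
    by (rule nn_integral_coordinatewise[where T="\<lambda>_. cos"]) (use fin in \<open>auto simp: n2_def cos_substitution\<close>)
  then show ?thesis by (simp add: w[symmetric] mult.assoc)
qed

text \<open>The exponent \<open>m + 2 * sum \<beta>\<close> collects one power of \<open>a\<close> from each dilation \<open>t \<mapsto> t / a\<close> and \<open>2 \<beta>\<^sub>j\<close> from the normalization of each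
sine weight. It is the exponent by which the norms are scaled in the limit relation.\<close>

lemma cube_integral_scaled:
  fixes \<beta> :: "'m::finite \<Rightarrow> real"
  assumes \<beta>: "\<And>j. 0 \<le> \<beta> j" and a: "0 < a" and [measurable]: "\<Phi> \<in> borel_measurable borel"
  shows "ennreal (a powr (real CARD('m) + 2 * (\<Sum>j\<in>UNIV. \<beta> j))) * (\<integral>\<^sup>+x. \<Phi> x * jacobi_weight \<beta> x * indicator cube x \<partial>lborel)
    = (\<integral>\<^sup>+t. \<Phi> (\<chi> j. cos (t $ j / a)) * (\<Prod>j\<in>UNIV. sine_weight a (\<beta> j) (t $ j)) \<partial>lborel)"
proof -
  define G where "G \<tau> = \<Phi> (\<chi> j. cos (\<tau> $ j)) * (\<Prod>j\<in>UNIV. sine_weight 1 (\<beta> j) (\<tau> $ j))" for \<tau> :: "real^'m"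
  have [measurable]: "G \<in> borel_measurable borel" unfolding G_def by measurable
  define c :: "real^'m" where "c = (\<chi> j. 1 / a)"
  define C where "C = a powr (2 * (\<Sum>j\<in>UNIV. \<beta> j))"
  have one: "ennreal (a powr (2 * \<beta> j)) * sine_weight 1 (\<beta> j) (s / a) = sine_weight a (\<beta> j) s" for j s
  proof (cases "0 < s \<and> s < pi * a")
    case True
    then have "0 < s / a" "s / a < pi" using a by (auto simp: field_simps)
    moreover from this have "a powr (2 * \<beta> j) * sin (s / a) powr (2 * \<beta> j) = (a * sin (s / a)) powr (2 * \<beta> j)"
      using a by (simp add: powr_mult sin_ge_zero)
    ultimately show ?thesis using True by (simp add: sine_weight_def ennreal_mult'[symmetric])
  next
    case False
    then have "\<not> (0 < s / a \<and> s / a < pi)" using a by (auto simp: field_simps)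
    then show ?thesis using False by (auto simp: sine_weight_def indicator_def)
  qed
  have Cp: "ennreal C = (\<Prod>j\<in>UNIV. ennreal (a powr (2 * \<beta> j)))"
    unfolding C_def using a by (simp add: prod_ennreal powr_sum sum_distrib_left)
  have CG: "ennreal C * G (0 + c * t) = \<Phi> (\<chi> j. cos (t $ j / a)) * (\<Prod>j\<in>UNIV. sine_weight a (\<beta> j) (t $ j))" for t
    unfolding G_def Cp one[symmetric] prod.distrib by (simp add: c_def mult_ac)
  have P: "(\<Prod>j\<in>UNIV. \<bar>c $ j\<bar>) = (1 / a) ^ CARD('m)" using a by (simp add: c_def)
  have "(\<integral>\<^sup>+\<tau>. G \<tau> \<partial>lborel) = ennreal ((1 / a) ^ CARD('m)) * (\<integral>\<^sup>+t. G (0 + c * t) \<partial>lborel)"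
    unfolding P[symmetric] by (rule nn_integral_dilate) (use a in \<open>auto simp: c_def\<close>)
  then have "(\<integral>\<^sup>+x. \<Phi> x * jacobi_weight \<beta> x * indicator cube x \<partial>lborel) = ennreal ((1 / a) ^ CARD('m)) * (\<integral>\<^sup>+t. G (0 + c * t) \<partial>lborel)"
    using cube_integral_cos[OF \<beta>, of \<Phi>] by (simp add: G_def)
  moreover have "ennreal (a powr (real CARD('m) + 2 * (\<Sum>j\<in>UNIV. \<beta> j))) * ennreal ((1 / a) ^ CARD('m)) = ennreal C"
    using a by (simp add: ennreal_mult'[symmetric] powr_add powr_realpow C_def power_divide)
  ultimately have "ennreal (a powr (real CARD('m) + 2 * (\<Sum>j\<in>UNIV. \<beta> j))) * (\<integral>\<^sup>+x. \<Phi> x * jacobi_weight \<beta> x * indicator cube x \<partial>lborel)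
    = ennreal C * (\<integral>\<^sup>+t. G (0 + c * t) \<partial>lborel)" by (simp add: mult.assoc[symmetric])
  also have "\<dots> = (\<integral>\<^sup>+t. ennreal C * G (0 + c * t) \<partial>lborel)"
    by (rule nn_integral_cmult[symmetric]) (unfold times_vec_def, measurable)
  finally show ?thesis by (simp only: CG)
qed

section \<open>Norms on the cube\<close>

text \<open>The p-th root on the extended nonnegative reals, so that weighted norms can be treated as roots of integrals.\<close>

definition eroot :: "real \<Rightarrow> ennreal \<Rightarrow> ennreal" where
  "eroot p I = (if I = \<infinity> then \<infinity> else ennreal (enn2real I powr (1 / p)))"

lemma eroot_ennreal: "0 \<le> r \<Longrightarrow> eroot p (ennreal r) = ennreal (r powr (1 / p))"
  by (simp add: eroot_def)

lemma eroot_top [simp]: "eroot p \<infinity> = \<infinity>" "eroot p top = top" by (simp_all add: eroot_def)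

lemma eroot_mono: assumes "0 < p" "I \<le> J" shows "eroot p I \<le> eroot p J"
proof (cases J)
  case (real r)
  then obtain s where s: "I = ennreal s" "0 \<le> s" using assms(2) by (cases I) (auto simp: top_unique)
  then show ?thesis using assms real by (auto simp: eroot_ennreal intro!: ennreal_leI powr_mono2)
qed simp

lemma eroot_cmult:
  assumes c: "0 < c" shows "eroot p (ennreal c * I) = ennreal (c powr (1 / p)) * eroot p I"
proof (cases I)
  case (real r)
  then show ?thesis using c by (simp add: ennreal_mult'[symmetric] eroot_ennreal powr_mult)
next
  case top
  then show ?thesis using c by (simp add: ennreal_mult_top)
qed

lemma wnorm_eroot:
  assumes [measurable]: "F \<in> borel_measurable borel" "W \<in> borel_measurable borel" "\<Omega> \<in> sets borel"
  shows "wnorm p W \<Omega> F = eroot p (\<integral>\<^sup>+x. ennreal (norm (F x) powr p) * W x * indicator \<Omega> x \<partial>lborel)"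
proof -
  have "(\<integral>\<^sup>+x. ennreal (norm (F x) powr p) * W x \<partial>lebesgue_on \<Omega>) = (\<integral>\<^sup>+x. ennreal (norm (F x) powr p) * W x * indicator \<Omega> x \<partial>lebesgue)"
    by (rule nn_integral_restrict_space) auto
  also have "\<dots> = (\<integral>\<^sup>+x. ennreal (norm (F x) powr p) * W x * indicator \<Omega> x \<partial>lborel)"
    by (rule nn_integral_completion)
  finally show ?thesis by (simp add: wnorm_def eroot_def Let_def)
qed

lemma power_weight_measurable [measurable]: "power_weight l \<in> borel_measurable borel"
  unfolding power_weight_def by measurable

lemma cube_closed: "closed (cube :: (real^'m) set)"
proof -
  have "cube = (\<Inter>j. {x::real^'m. \<bar>x $ j\<bar> \<le> 1})" by (auto simp: cube_def)
  moreover have "closed \<dots>" by (intro closed_INT ballI closed_Collect_le continuous_intros)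
  ultimately show ?thesis by simp
qed

lemma cube_measurable [measurable]: "cube \<in> sets (borel :: (real^'m) measure)"
  by (rule borel_closed[OF cube_closed])

lemma cube_compact: "compact (cube :: (real^'m) set)"
proof -
  have "bounded (cube :: (real^'m) set)"
  proof -
    have "norm x \<le> real CARD('m)" if "x \<in> cube" for x :: "real^'m"
    proof -
      have "norm x \<le> (\<Sum>j\<in>(UNIV::'m set). \<bar>x $ j\<bar>)" by (rule norm_le_l1_cart)
      also have "\<dots> \<le> (\<Sum>j\<in>(UNIV::'m set). 1)" using that by (intro sum_mono) (simp add: cube_def)
      finally show ?thesis by simp
    qed
    then show ?thesis by (auto simp: bounded_iff)
  qed
  then show ?thesis using cube_closed by (simp add: compact_eq_bounded_closed)
qed

lemma cube_point_near:
  fixes x :: "real^'m"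
  assumes x: "x \<in> cube" and U: "open U" "x \<in> U"
  obtains y where "y \<in> U" "y \<in> open_cube"
proof -
  have "((\<lambda>r::real. r *\<^sub>R x) \<longlongrightarrow> 1 *\<^sub>R x) (at_left 1)" by (intro tendsto_intros)
  then have "eventually (\<lambda>r. r *\<^sub>R x \<in> U) (at_left 1)" using U by (simp add: tendsto_def)
  moreover have "eventually (\<lambda>r::real. 0 < r \<and> r < 1) (at_left 1)"
    by (auto intro!: eventually_at_leftI[of 0 1])
  ultimately have "eventually (\<lambda>r. r *\<^sub>R x \<in> U \<and> 0 < r \<and> r < 1) (at_left 1)" by eventually_elim auto
  then obtain r where r: "r *\<^sub>R x \<in> U" "0 < r" "r < 1" using eventually_happens by force
  have "\<bar>r * x $ j\<bar> < 1" for j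
  proof -
    have "r * \<bar>x $ j\<bar> \<le> r * 1" using x r by (intro mult_left_mono) (auto simp: cube_def)
    moreover have "\<bar>r * x $ j\<bar> = r * \<bar>x $ j\<bar>" using r by (simp add: abs_mult)
    ultimately show ?thesis using r by linarith
  qed
  then show ?thesis using r that by (auto simp: open_cube_def)
qed

lemma open_cube_open: "open (open_cube :: (real^'m) set)"
proof -
  have "open_cube = (\<Inter>j. {x::real^'m. \<bar>x $ j\<bar> < 1})" by (auto simp: open_cube_def)
  moreover have "open \<dots>" by (intro open_INT ballI open_Collect_less continuous_intros) auto
  ultimately show ?thesis by simp
qed

text \<open>A continuous function that exceeds a value at a point of the cube exceeds it on a set of positive measure in the cube, also when the point lies on the boundary.\<close>

lemma Linf_norm_ge:
  fixes P :: "real^'m \<Rightarrow> complex"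
  assumes P: "continuous_on UNIV P" and x: "x \<in> cube"
  shows "ennreal (norm (P x)) \<le> Linf_norm cube P"
proof (rule ccontr)
  assume "\<not> ennreal (norm (P x)) \<le> Linf_norm cube P"
  then have lt: "Linf_norm cube P < ennreal (norm (P x))" by simp
  then obtain c where c: "Linf_norm cube P = ennreal c" "0 \<le> c" by (cases "Linf_norm cube P") auto
  define U where "U = {z. c < norm (P z)}"
  have "open U" unfolding U_def by (intro open_Collect_less continuous_intros P)
  moreover have "x \<in> U" using lt c by (simp add: U_def ennreal_less_iff)
  ultimately obtain y where y: "y \<in> U" "y \<in> open_cube" using cube_point_near[OF x] by blast
  have o: "open (U \<inter> open_cube)" using \<open>open U\<close> open_cube_open by blast
  have "AE z in lebesgue_on cube. ennreal (norm (P z)) \<le> ennreal c"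
    using esssup_AE[of "\<lambda>z. ennreal (norm (P z))" "lebesgue_on cube"] c by (simp add: Linf_norm_def)
  then have "AE z in lebesgue. z \<in> cube \<longrightarrow> ennreal (norm (P z)) \<le> ennreal c"
    by (subst (asm) AE_restrict_space_iff) auto
  then have "AE z in lborel. z \<in> cube \<longrightarrow> ennreal (norm (P z)) \<le> ennreal c" by (simp add: AE_completion_iff)
  then have "AE z in lborel. z \<notin> U \<inter> open_cube"
    by eventually_elim (use c open_cube_subset in \<open>auto simp: U_def\<close>)
  then have "U \<inter> open_cube \<in> null_sets lborel"
    using o by (subst AE_iff_null_sets) auto
  then have "negligible (U \<inter> open_cube)" unfolding negligible_iff_null_sets using o by (simp add: null_sets_completionI)
  then have "U \<inter> open_cube = {}" using o open_not_negligible by blast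
  then show False using y by blast
qed

lemma Linf_norm_le:
  fixes P :: "real^'m \<Rightarrow> complex"
  assumes P: "continuous_on UNIV P" and B: "\<And>x. x \<in> open_cube \<Longrightarrow> norm (P x) \<le> B"
  shows "Linf_norm cube P \<le> ennreal B"
proof -
  have "norm (P x) \<le> B" if xc: "x \<in> cube" for x
  proof (rule ccontr)
    assume n: "\<not> norm (P x) \<le> B"
    have o: "open {z. B < norm (P z)}" by (intro open_Collect_less continuous_intros P)
    obtain y where "y \<in> {z. B < norm (P z)}" "y \<in> open_cube"
      by (rule cube_point_near[OF xc o]) (use n in auto)
    then show False using B[of y] by auto
  qed
  then have "\<forall>x\<in>cube. ennreal (norm (P x)) \<le> ennreal B" by (auto intro: ennreal_leI)
  moreover have "(\<lambda>z. ennreal (norm (P z))) \<in> borel_measurable (lebesgue_on cube)"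
  proof -
    have "P \<in> borel_measurable borel" using P by (rule borel_measurable_continuous_onI)
    then have "(\<lambda>z. ennreal (norm (P z))) \<in> borel_measurable lborel" by simp
    then show ?thesis by (intro measurable_restrict_space1 measurable_completion)
  qed
  ultimately show ?thesis unfolding Linf_norm_def by (intro esssup_I AE_I2) auto
qed

section \<open>Averages over dilations\<close>

text \<open>Differentiation under the integral sign: the second-order Taylor bound holds with the same constant for almost all parameters,
so the difference quotients of the integral converge to the integral of the derivatives.\<close>

lemma holomorphic_param_integral:
  fixes \<phi> :: "'a \<Rightarrow> complex \<Rightarrow> complex"
  assumes M: "finite_measure M" and hol: "\<And>x. \<phi> x holomorphic_on UNIV"
    and meas[measurable]: "\<And>\<zeta>. (\<lambda>x. \<phi> x \<zeta>) \<in> borel_measurable M"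
    and bd: "\<And>R. \<exists>B. AE x in M. \<forall>\<zeta>. norm \<zeta> \<le> R \<longrightarrow> norm (\<phi> x \<zeta>) \<le> B"
  shows "(\<lambda>\<zeta>. \<integral>x. \<phi> x \<zeta> \<partial>M) holomorphic_on UNIV"
proof -
  interpret finite_measure M by (rule M)
  have int: "integrable M (\<lambda>x. \<phi> x \<zeta>)" for \<zeta>
  proof -
    obtain B where "AE x in M. \<forall>\<zeta>'. norm \<zeta>' \<le> norm \<zeta> \<longrightarrow> norm (\<phi> x \<zeta>') \<le> B" using bd by blast
    then have "AE x in M. norm (\<phi> x \<zeta>) \<le> B" by eventually_elim auto
    then show ?thesis by (rule integrable_const_bound) measurable
  qed
  have "\<exists>D. ((\<lambda>\<zeta>. \<integral>x. \<phi> x \<zeta> \<partial>M) has_field_derivative D) (at z)" for z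
  proof -
    define D where "D x = deriv (\<phi> x) z" for x
    have der: "(\<phi> x has_field_derivative D x) (at z)" for x
      unfolding D_def using holomorphic_derivI[OF hol open_UNIV] by simp
    obtain B where B: "AE x in M. \<forall>\<zeta>. norm \<zeta> \<le> norm z + 1 \<longrightarrow> norm (\<phi> x \<zeta>) \<le> B" using bd by blast
    have T: "norm (\<phi> x (z + h) - \<phi> x z - h * D x) \<le> 2 * B * (norm h)\<^sup>2 \<and> norm (h * D x) \<le> B * norm h"
      if b: "\<forall>\<zeta>. norm \<zeta> \<le> norm z + 1 \<longrightarrow> norm (\<phi> x \<zeta>) \<le> B" and h: "h \<noteq> 0" "norm h \<le> 1 / 2" for x h
    proof -
      define g where "g s = \<phi> x (z + s * h)" for s
      have "(\<phi> x \<circ> (\<lambda>s. z + s * h)) holomorphic_on UNIV"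
        by (rule holomorphic_on_compose_gen[OF _ hol]) (auto intro!: holomorphic_intros)
      then have g: "g holomorphic_on UNIV" unfolding g_def o_def .
      have gb: "norm (g s) \<le> B" if "norm s \<le> 1 / norm h" for s
      proof -
        have "norm (s * h) \<le> 1" using that h by (simp add: norm_mult field_simps)
        then have "norm (z + s * h) \<le> norm z + 1" using norm_triangle_ineq[of z "s * h"] by linarith
        then show ?thesis using b unfolding g_def by blast
      qed
      have "(g has_field_derivative D x * h) (at 0)"
      proof -
        have "((\<lambda>s. z + s * h) has_field_derivative h) (at 0)" by (auto intro!: derivative_eq_intros)
        then show ?thesis unfolding g_def using DERIV_chain2[of "\<phi> x" "D x" "\<lambda>s. z + s * h" 0 h UNIV] der[of x] by simp
      qed
      then have dg: "deriv g 0 = h * D x" by (simp add: DERIV_imp_deriv mult.commute)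
      have "2 \<le> 1 / norm h" using h by (simp add: field_simps)
      from taylor_remainder_two[OF g gb this] show ?thesis unfolding dg by (simp add: g_def power_divide)
    qed
    have Dm[measurable]: "D \<in> borel_measurable M"
    proof (rule borel_measurable_LIMSEQ_metric)
      let ?h = "\<lambda>n. complex_of_real (1 / real (Suc n))"
      show "(\<lambda>x. (\<phi> x (z + ?h n) - \<phi> x z) / ?h n) \<in> borel_measurable M" for n by measurable
      fix x
      have "((\<lambda>h. (\<phi> x (z + h) - \<phi> x z) / h) \<longlongrightarrow> D x) (at 0)" using der[of x] by (simp add: DERIV_def)
      moreover have "filterlim ?h (at 0) sequentially"
      proof (rule filterlim_atI)
        have "(\<lambda>n. 1 / real (Suc n)) \<longlonglongrightarrow> 0" by (rule LIMSEQ_Suc) (rule lim_1_over_n)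
        then have "(\<lambda>n. complex_of_real (1 / real (Suc n))) \<longlonglongrightarrow> of_real 0" by (rule tendsto_of_real)
        then show "?h \<longlonglongrightarrow> 0" by simp
      qed (simp del: of_nat_Suc)
      ultimately show "(\<lambda>n. (\<phi> x (z + ?h n) - \<phi> x z) / ?h n) \<longlonglongrightarrow> D x" by (rule filterlim_compose)
    qed
    have Di: "integrable M D"
    proof (rule integrable_const_bound)
      show "AE x in M. norm (D x) \<le> B"
        using B
      proof eventually_elim
        fix x assume "\<forall>\<zeta>. norm \<zeta> \<le> norm z + 1 \<longrightarrow> norm (\<phi> x \<zeta>) \<le> B"
        from T[OF this, of "1/2"] show "norm (D x) \<le> B" by (simp add: norm_mult)
      qed
    qed measurable
    let ?\<Phi> = "\<lambda>\<zeta>. \<integral>x. \<phi> x \<zeta> \<partial>M"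
    define c where "c = 2 * B * measure M (space M)"
    have "((\<lambda>h. (?\<Phi> (z + h) - ?\<Phi> z) / h - (\<integral>x. D x \<partial>M)) \<longlongrightarrow> 0) (at 0)"
    proof (rule Lim_null_comparison)
      show "((\<lambda>h. c * norm h) \<longlongrightarrow> 0) (at 0)" by (auto intro!: tendsto_eq_intros)
      show "eventually (\<lambda>h. norm ((?\<Phi> (z + h) - ?\<Phi> z) / h - (\<integral>x. D x \<partial>M)) \<le> c * norm h) (at 0)"
        unfolding eventually_at
      proof (intro exI[of _ "1/2"] conjI ballI impI)
        fix h :: complex assume "h \<noteq> 0 \<and> dist h 0 < 1 / 2"
        then have h: "h \<noteq> 0" "norm h \<le> 1 / 2" by auto
        have "?\<Phi> (z + h) - ?\<Phi> z - h * (\<integral>x. D x \<partial>M) = (\<integral>x. \<phi> x (z + h) - \<phi> x z - h * D x \<partial>M)"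
          using int Di by simp
        also have "norm \<dots> \<le> (\<integral>x. norm (\<phi> x (z + h) - \<phi> x z - h * D x) \<partial>M)" by (rule integral_norm_bound)
        also have "\<dots> \<le> (\<integral>x. 2 * B * (norm h)\<^sup>2 \<partial>M)"
        proof (rule integral_mono_AE)
          show "AE x in M. norm (\<phi> x (z + h) - \<phi> x z - h * D x) \<le> 2 * B * (norm h)\<^sup>2"
            using B by eventually_elim (use T h in blast)
        qed (use int Di in auto)
        also have "\<dots> = c * (norm h)\<^sup>2" by (simp add: c_def)
        finally have "norm (?\<Phi> (z + h) - ?\<Phi> z - h * (\<integral>x. D x \<partial>M)) / norm h \<le> c * norm h"
          using h by (simp add: divide_le_eq power2_eq_square mult.assoc)
        moreover have "(?\<Phi> (z + h) - ?\<Phi> z) / h - (\<integral>x. D x \<partial>M) = (?\<Phi> (z + h) - ?\<Phi> z - h * (\<integral>x. D x \<partial>M)) / h"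
          using h by (simp add: field_simps)
        ultimately show "norm ((?\<Phi> (z + h) - ?\<Phi> z) / h - (\<integral>x. D x \<partial>M)) \<le> c * norm h"
          by (simp add: norm_divide)
      qed simp
    qed
    then have "((\<lambda>h. (?\<Phi> (z + h) - ?\<Phi> z) / h) \<longlongrightarrow> (\<integral>x. D x \<partial>M)) (at 0)"
      by (rule Lim_null[THEN iffD2])
    then show ?thesis unfolding DERIV_def by blast
  qed
  then show ?thesis by (auto simp: holomorphic_on_def field_differentiable_def)
qed

definition flip :: "'m::finite \<Rightarrow> 'a::uminus^'m \<Rightarrow> 'a^'m" where
  "flip j z = (\<chi> i. if i = j then - z $ i else z $ i)"

text \<open>Dilation factors of either sign, of modulus slightly below one. The signs make averages even, the moduli below one lower the
exponential type, and the positive volume makes averages bounded in terms of integrals.\<close>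

definition annulus :: "real \<Rightarrow> (real^'m) set" where
  "annulus \<delta> = {r. \<forall>j. 1 - 2 * \<delta> \<le> \<bar>r $ j\<bar> \<and> \<bar>r $ j\<bar> \<le> 1 - \<delta>}"

definition annulus_prob :: "real \<Rightarrow> (real^'m) measure" where
  "annulus_prob \<delta> = uniform_measure lborel (annulus \<delta>)"

definition dilation_average :: "real \<Rightarrow> (complex^'m \<Rightarrow> complex) \<Rightarrow> complex^'m \<Rightarrow> complex" where
  "dilation_average \<delta> f z = (\<integral>r. f (cvec r * z) \<partial>annulus_prob \<delta>)"

lemma sets_annulus_prob [measurable_cong, simp]: "sets (annulus_prob \<delta>) = sets borel"
  by (simp add: annulus_prob_def)

lemma space_annulus_prob [simp]: "space (annulus_prob \<delta>) = UNIV"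
  by (simp add: annulus_prob_def)

lemma annulus_closed: "closed (annulus \<delta> :: (real^'m) set)"
proof -
  have "annulus \<delta> = (\<Inter>j. {r::real^'m. 1 - 2 * \<delta> \<le> \<bar>r $ j\<bar>} \<inter> {r. \<bar>r $ j\<bar> \<le> 1 - \<delta>})" by (auto simp: annulus_def)
  moreover have "closed \<dots>" by (intro closed_INT ballI closed_Int closed_Collect_le continuous_intros)
  ultimately show ?thesis by simp
qed

lemma annulus_measurable [measurable]: "annulus \<delta> \<in> sets (borel :: (real^'m) measure)"
  by (rule borel_closed[OF annulus_closed])

lemma annulus_mass:
  assumes \<delta>: "0 < \<delta>" "\<delta> < 1 / 2"
  shows "emeasure lborel (annulus \<delta> :: (real^'m) set) \<noteq> 0" "emeasure lborel (annulus \<delta> :: (real^'m) set) \<noteq> \<infinity>"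
proof -
  have "annulus \<delta> \<subseteq> (cube :: (real^'m) set)"
  proof
    fix x :: "real^'m" assume "x \<in> annulus \<delta>"
    then have "\<bar>x $ j\<bar> \<le> 1 - \<delta>" for j by (simp add: annulus_def)
    then have "\<bar>x $ j\<bar> \<le> 1" for j using \<delta> by (meson diff_le_eq le_add_same_cancel1 less_imp_le order_trans)
    then show "x \<in> cube" by (simp add: cube_def)
  qed
  then have "bounded (annulus \<delta> :: (real^'m) set)" using cube_compact compact_imp_bounded bounded_subset by blast
  then show "emeasure lborel (annulus \<delta> :: (real^'m) set) \<noteq> \<infinity>" using emeasure_bounded_finite by fastforce
  show "emeasure lborel (annulus \<delta> :: (real^'m) set) \<noteq> 0"
  proof
    assume "emeasure lborel (annulus \<delta> :: (real^'m) set) = 0"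
    then have "(annulus \<delta> :: (real^'m) set) \<in> null_sets lborel" by auto
    then have "negligible (annulus \<delta> :: (real^'m) set)" unfolding negligible_iff_null_sets by (rule null_sets_completionI)
    moreover have "box (\<chi> j. 1 - 2 * \<delta>) (\<chi> j. 1 - \<delta>) \<subseteq> (annulus \<delta> :: (real^'m) set)"
    proof
      fix x :: "real^'m" assume x: "x \<in> box (\<chi> j. 1 - 2 * \<delta>) (\<chi> j. 1 - \<delta>)"
      then have b: "1 - 2 * \<delta> < x $ j" "x $ j < 1 - \<delta>" for j by (auto simp: mem_box_cart)
      have "1 - 2 * \<delta> \<le> \<bar>x $ j\<bar> \<and> \<bar>x $ j\<bar> \<le> 1 - \<delta>" for j using b[of j] \<delta> by linarith
      then show "x \<in> annulus \<delta>" by (simp add: annulus_def)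
    qed
    ultimately have "negligible (box (\<chi> j. 1 - 2 * \<delta>) (\<chi> j. 1 - \<delta>) :: (real^'m) set)" by (rule negligible_subset)
    then have "box (\<chi> j. 1 - 2 * \<delta>) (\<chi> j. 1 - \<delta>) = ({} :: (real^'m) set)" using open_not_negligible open_box by blast
    moreover have "(\<chi> j. 1 - \<delta> * (3 / 2)) \<in> (box (\<chi> j. 1 - 2 * \<delta>) (\<chi> j. 1 - \<delta>) :: (real^'m) set)"
      using \<delta> by (simp add: mem_box_cart)
    ultimately show False by blast
  qed
qed

lemma prob_space_annulus: "0 < \<delta> \<Longrightarrow> \<delta> < 1 / 2 \<Longrightarrow> prob_space (annulus_prob \<delta> :: (real^'m) measure)"
  unfolding annulus_prob_def by (rule prob_space_uniform_measure[OF annulus_mass])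

lemma AE_annulus: "0 < \<delta> \<Longrightarrow> \<delta> < 1 / 2 \<Longrightarrow> AE r in annulus_prob \<delta>. (r :: real^'m) \<in> annulus \<delta>"
  unfolding annulus_prob_def using annulus_mass[of \<delta>] by (intro AE_uniform_measureI) auto

lemma cvec_mult: "cvec (r * t) = cvec r * cvec t"
  by (simp add: vec_eq_iff)

lemma continuous_vec_times: "continuous_on UNIV (\<lambda>r::real^'m. cvec r * z)"
  unfolding cvec_def times_vec_def by (intro continuous_intros)

lemma cvec_mult_measurable [measurable]: "(\<lambda>r::real^'m. cvec r * z) \<in> borel_measurable borel"
  by (rule borel_measurable_continuous_onI[OF continuous_vec_times])

lemma cvec_measurable [measurable]: "(cvec :: real^'m \<Rightarrow> _) \<in> borel_measurable borel"
  unfolding cvec_def by (intro borel_measurable_continuous_onI continuous_intros)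

lemma power_weight_dilate: "power_weight l (r * t) = power_weight l r * power_weight l t"
  by (simp add: power_weight_def abs_mult powr_mult ennreal_mult' prod.distrib)

context pi_body
begin

context
  fixes \<delta> :: real and f :: "complex^'m \<Rightarrow> complex" and p :: real and l :: "'m \<Rightarrow> real"
  assumes \<delta>: "0 < \<delta>" "\<delta> < 1 / 2" and f: "f \<in> exp_type V" and p: "1 \<le> p" and l: "\<And>j. 0 \<le> l j"
begin

lemma exp_type_entire: "entire f" using f by (simp add: exp_type_def)

lemma exp_type_measurable [measurable]: "f \<in> borel_measurable borel"
  by (rule borel_measurable_continuous_onI[OF entire_imp_continuous[OF exp_type_entire]])

text \<open>Growth at the rate \<open>1 + \<delta>\<close> combined with dilation by at most \<open>1 - \<delta>\<close> leaves the rate \<open>(1 + \<delta>) (1 - \<delta>) < 1\<close>.\<close>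

lemma dilated_growth:
  obtains C where "0 < C" "\<And>r z. r \<in> annulus \<delta> \<Longrightarrow> norm (f (cvec r * z)) \<le> C * exp ((1 - \<delta>\<^sup>2) * dual_norm V z)"
proof -
  obtain C where C: "0 < C" "\<And>z. norm (f z) \<le> C * exp ((1 + \<delta>) * dual_norm V z)"
    using f \<delta> unfolding exp_type_def by blast
  have "norm (f (cvec r * z)) \<le> C * exp ((1 - \<delta>\<^sup>2) * dual_norm V z)" if r: "r \<in> annulus \<delta>" for r z
  proof -
    have "dual_norm V (cvec r * z) \<le> (1 - \<delta>) * dual_norm V z"
      using r by (intro dual_norm_hadamard) (auto simp: annulus_def)
    then have "(1 + \<delta>) * dual_norm V (cvec r * z) \<le> (1 + \<delta>) * ((1 - \<delta>) * dual_norm V z)"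
      using \<delta> by (intro mult_left_mono) auto
    also have "\<dots> = (1 - \<delta>\<^sup>2) * dual_norm V z" by (simp add: power2_eq_square algebra_simps)
    finally have "C * exp ((1 + \<delta>) * dual_norm V (cvec r * z)) \<le> C * exp ((1 - \<delta>\<^sup>2) * dual_norm V z)" using C by simp
    then show ?thesis using C(2)[of "cvec r * z"] by linarith
  qed
  then show ?thesis using C that by blast
qed

lemma dilated_integrable: "integrable (annulus_prob \<delta>) (\<lambda>r. f (cvec r * z))"
proof -
  interpret prob_space "annulus_prob \<delta> :: (real^'m) measure" by (rule prob_space_annulus[OF \<delta>])
  obtain C where C: "0 < C" "\<And>r z. r \<in> annulus \<delta> \<Longrightarrow> norm (f (cvec r * z)) \<le> C * exp ((1 - \<delta>\<^sup>2) * dual_norm V z)"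
    by (rule dilated_growth) blast
  show ?thesis
  proof (rule integrable_const_bound)
    show "AE r in annulus_prob \<delta>. norm (f (cvec r * z)) \<le> C * exp ((1 - \<delta>\<^sup>2) * dual_norm V z)"
      using AE_annulus[OF \<delta>] by eventually_elim (rule C(2))
  qed measurable
qed

lemma average_growth:
  obtains C where "0 < C" "\<And>z. norm (dilation_average \<delta> f z) \<le> C * exp ((1 - \<delta>\<^sup>2) * dual_norm V z)"
proof -
  interpret prob_space "annulus_prob \<delta> :: (real^'m) measure" by (rule prob_space_annulus[OF \<delta>])
  obtain C where C: "0 < C" "\<And>r z. r \<in> annulus \<delta> \<Longrightarrow> norm (f (cvec r * z)) \<le> C * exp ((1 - \<delta>\<^sup>2) * dual_norm V z)"
    by (rule dilated_growth) blast
  have "norm (dilation_average \<delta> f z) \<le> C * exp ((1 - \<delta>\<^sup>2) * dual_norm V z)" for z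
  proof -
    have "norm (dilation_average \<delta> f z) \<le> (\<integral>r. norm (f (cvec r * z)) \<partial>annulus_prob \<delta>)"
      unfolding dilation_average_def by (rule integral_norm_bound)
    also have "\<dots> \<le> (\<integral>r. C * exp ((1 - \<delta>\<^sup>2) * dual_norm V z) \<partial>(annulus_prob \<delta> :: (real^'m) measure))"
    proof (rule integral_mono_AE)
      show "AE r in annulus_prob \<delta>. norm (f (cvec r * z)) \<le> C * exp ((1 - \<delta>\<^sup>2) * dual_norm V z)"
        using AE_annulus[OF \<delta>] by eventually_elim (rule C(2))
    qed (use dilated_integrable in auto)
    finally show ?thesis using prob_space by simp
  qed
  then show ?thesis using C that by blast
qed

lemma average_line_holomorphic: "line_holomorphic (dilation_average \<delta> f)"
  unfolding line_holomorphic_def dilation_average_def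
proof (intro allI)
  fix x v :: "complex^'m"
  interpret prob_space "annulus_prob \<delta> :: (real^'m) measure" by (rule prob_space_annulus[OF \<delta>])
  obtain C where C: "0 < C" "\<And>r z. r \<in> annulus \<delta> \<Longrightarrow> norm (f (cvec r * z)) \<le> C * exp ((1 - \<delta>\<^sup>2) * dual_norm V z)"
    by (rule dilated_growth) blast
  show "(\<lambda>\<zeta>. \<integral>r. f (cvec r * (x + \<zeta> *s v)) \<partial>annulus_prob \<delta>) holomorphic_on UNIV"
  proof (rule holomorphic_param_integral)
    show "finite_measure (annulus_prob \<delta> :: (real^'m) measure)" by unfold_locales
    fix r :: "real^'m"
    have "cvec r * (x + \<zeta> *s v) = cvec r * x + \<zeta> *s (cvec r * v)" for \<zeta> by (simp add: vec_eq_iff algebra_simps)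
    then show "(\<lambda>\<zeta>. f (cvec r * (x + \<zeta> *s v))) holomorphic_on UNIV"
      using entire_imp_line_holomorphic[OF exp_type_entire] by (simp add: line_holomorphic_def)
  next
    fix R :: real
    define B where "B = C * exp ((1 - \<delta>\<^sup>2) * (dual_norm V x + R * dual_norm V v))"
    have d1: "0 \<le> 1 - \<delta>\<^sup>2" using \<delta> by (simp add: power_le_one)
    have "norm (f (cvec r * (x + \<zeta> *s v))) \<le> B" if "r \<in> annulus \<delta>" "norm \<zeta> \<le> R" for r \<zeta>
    proof -
      have "dual_norm V (x + \<zeta> *s v) \<le> dual_norm V x + norm \<zeta> * dual_norm V v"
        using dual_norm_triangle[of x "\<zeta> *s v"] dual_norm_scale[of \<zeta> v] by linarith
      also have "\<dots> \<le> dual_norm V x + R * dual_norm V v"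
        using that dual_norm_nonneg by (intro add_left_mono mult_right_mono) auto
      finally have "C * exp ((1 - \<delta>\<^sup>2) * dual_norm V (x + \<zeta> *s v)) \<le> B"
        unfolding B_def using C d1 by (simp add: mult_left_mono)
      then show ?thesis using C(2)[OF that(1), of "x + \<zeta> *s v"] by linarith
    qed
    then have "AE r in annulus_prob \<delta>. \<forall>\<zeta>. norm \<zeta> \<le> R \<longrightarrow> norm (f (cvec r * (x + \<zeta> *s v))) \<le> B"
      using AE_annulus[OF \<delta>] by (auto elim!: eventually_mono)
    then show "\<exists>B. AE r in annulus_prob \<delta>. \<forall>\<zeta>. norm \<zeta> \<le> R \<longrightarrow> norm (f (cvec r * (x + \<zeta> *s v))) \<le> B" by blast
  qed measurable
qed

lemma average_zero: "dilation_average \<delta> f 0 = f 0"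
proof -
  interpret prob_space "annulus_prob \<delta> :: (real^'m) measure" by (rule prob_space_annulus[OF \<delta>])
  have "cvec r * 0 = 0" for r :: "real^'m" by (simp add: vec_eq_iff)
  then show ?thesis unfolding dilation_average_def using prob_space by simp
qed

text \<open>The annulus is symmetric under reflection of each coordinate.\<close>

lemma average_flip: "dilation_average \<delta> f (flip j z) = dilation_average \<delta> f z"
proof -
  let ?F = "flip j :: real^'m \<Rightarrow> real^'m"
  define c :: "real^'m" where "c = (\<chi> i. if i = j then -1 else 1)"
  have Fc: "?F r = 0 + c * r" for r by (simp add: vec_eq_iff flip_def c_def)
  have [measurable]: "?F \<in> borel_measurable borel" unfolding Fc times_vec_def by measurable
  have FF: "?F (?F r) = r" for r by (simp add: flip_def vec_eq_iff)
  have an: "?F r \<in> annulus \<delta> \<longleftrightarrow> r \<in> annulus \<delta>" for r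
  proof -
    have "\<bar>?F r $ i\<bar> = \<bar>r $ i\<bar>" for i by (simp add: flip_def)
    then show ?thesis by (simp add: annulus_def)
  qed
  have "distr (annulus_prob \<delta>) borel ?F = annulus_prob \<delta>"
  proof (rule measure_eqI)
    fix A assume "A \<in> sets (distr (annulus_prob \<delta>) borel ?F)"
    then have [measurable]: "A \<in> sets borel" by simp
    have "emeasure (distr (annulus_prob \<delta>) borel ?F) A = (\<integral>\<^sup>+r. indicator A r \<partial>distr (annulus_prob \<delta>) borel ?F)" by simp
    also have "\<dots> = (\<integral>\<^sup>+r. indicator A (?F r) \<partial>annulus_prob \<delta>)" by (rule nn_integral_distr) measurable
    also have "\<dots> = (\<integral>\<^sup>+r. indicator A (?F r) * indicator (annulus \<delta>) r \<partial>lborel) / emeasure lborel (annulus \<delta> :: (real^'m) set)"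
      unfolding annulus_prob_def by (rule nn_integral_uniform_measure) measurable
    also have "(\<integral>\<^sup>+r. indicator A (?F r) * indicator (annulus \<delta>) r \<partial>lborel)
      = ennreal (\<Prod>j\<in>UNIV. \<bar>c $ j\<bar>) * (\<integral>\<^sup>+r. indicator A (?F (0 + c * r)) * indicator (annulus \<delta>) (0 + c * r) \<partial>lborel)"
      by (rule nn_integral_dilate) (auto simp: c_def)
    also have "(\<Prod>j\<in>UNIV. \<bar>c $ j\<bar>) = 1" by (rule prod.neutral) (auto simp: c_def)
    also have "(\<lambda>r. indicator A (?F (0 + c * r)) * indicator (annulus \<delta>) (0 + c * r)) = (\<lambda>r. indicator A r * indicator (annulus \<delta>) r :: ennreal)"
      unfolding Fc[symmetric] FF using an by (simp add: fun_eq_iff indicator_def)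
    also have "ennreal 1 * (\<integral>\<^sup>+r. indicator A r * indicator (annulus \<delta>) r \<partial>lborel) / emeasure lborel (annulus \<delta> :: (real^'m) set) = (\<integral>\<^sup>+r. indicator A r \<partial>annulus_prob \<delta>)"
      unfolding annulus_prob_def by (subst nn_integral_uniform_measure) auto
    finally show "emeasure (distr (annulus_prob \<delta>) borel ?F) A = emeasure (annulus_prob \<delta>) A" by simp
  qed simp
  then have "dilation_average \<delta> f z = (\<integral>r. f (cvec r * z) \<partial>distr (annulus_prob \<delta>) borel ?F)"
    by (simp add: dilation_average_def)
  also have "\<dots> = (\<integral>r. f (cvec (?F r) * z) \<partial>annulus_prob \<delta>)" by (rule integral_distr) measurable
  also have "(\<lambda>r. f (cvec (?F r) * z)) = (\<lambda>r. f (cvec r * flip j z))"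
    by (rule ext, rule arg_cong[where f=f]) (simp add: vec_eq_iff flip_def)
  finally show ?thesis by (simp add: dilation_average_def)
qed

lemma average_measurable [measurable]: "(\<lambda>t. dilation_average \<delta> f (cvec t)) \<in> borel_measurable borel"
proof -
  interpret prob_space "annulus_prob \<delta> :: (real^'m) measure" by (rule prob_space_annulus[OF \<delta>])
  have [measurable]: "(\<lambda>x. fst x * snd x :: real^'m) \<in> borel_measurable (borel \<Otimes>\<^sub>M borel)"
    unfolding times_vec_def by measurable
  have "(\<lambda>(t, r). f (cvec (fst (r, t) * snd (r, t)))) \<in> borel_measurable (borel \<Otimes>\<^sub>M annulus_prob \<delta>)"
    unfolding times_vec_def by measurable
  then have "(\<lambda>t. \<integral>r. f (cvec (fst (r, t) * snd (r, t))) \<partial>annulus_prob \<delta>) \<in> borel_measurable borel"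
    by (rule borel_measurable_lebesgue_integral)
  then show ?thesis by (simp add: dilation_average_def cvec_mult)
qed

lemma average_jensen:
  "ennreal (norm (dilation_average \<delta> f (cvec t)) powr p) \<le> (\<integral>\<^sup>+r. ennreal (norm (f (cvec (r * t))) powr p) \<partial>annulus_prob \<delta>)"
  unfolding dilation_average_def cvec_mult
  by (rule jensen_powr[OF prob_space_annulus[OF \<delta>] dilated_integrable p])

text \<open>Jensen's inequality, Fubini and a dilation of the variable: each single dilation by \<open>r\<close> multiplies the integral by a factor at most
\<open>(1 - 2 \<delta>) powr (- (m + 2 * sum l))\<close>.\<close>

lemma average_norm:
  "ennreal ((1 - 2 * \<delta>) powr (real CARD('m) + 2 * (\<Sum>j\<in>UNIV. l j)))
     * (\<integral>\<^sup>+t. ennreal (norm (dilation_average \<delta> f (cvec t)) powr p) * power_weight l t \<partial>lborel)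
   \<le> (\<integral>\<^sup>+t. ennreal (norm (f (cvec t)) powr p) * power_weight l t \<partial>lborel)"
proof -
  interpret A: prob_space "annulus_prob \<delta> :: (real^'m) measure" by (rule prob_space_annulus[OF \<delta>])
  interpret P: pair_sigma_finite lborel "annulus_prob \<delta> :: (real^'m) measure" ..
  let ?I = "\<integral>\<^sup>+t. ennreal (norm (f (cvec t)) powr p) * power_weight l t \<partial>lborel"
  let ?c = "(1 - 2 * \<delta>) powr (real CARD('m) + 2 * (\<Sum>j\<in>UNIV. l j))"
  have [measurable]: "(\<lambda>x. fst x * snd x :: real^'m) \<in> borel_measurable (borel \<Otimes>\<^sub>M borel)"
    unfolding times_vec_def by measurable
  have jm[measurable]: "(\<lambda>(t, r). ennreal (norm (f (cvec (r * t))) powr p) * power_weight l t) \<in> borel_measurable (lborel \<Otimes>\<^sub>M annulus_prob \<delta>)"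
    unfolding times_vec_def by measurable
  have inner: "ennreal ?c * (\<integral>\<^sup>+t. ennreal (norm (f (cvec (r * t))) powr p) * power_weight l t \<partial>lborel) \<le> ?I"
    if r: "r \<in> annulus \<delta>" for r
  proof -
    have r1: "1 - 2 * \<delta> \<le> \<bar>r $ j\<bar>" "0 < 1 - 2 * \<delta>" for j using r \<delta> by (auto simp: annulus_def)
    have r0: "r $ j \<noteq> 0" for j using r1(1)[of j] r1(2) by auto
    have m: "(\<lambda>t. ennreal (norm (f (cvec (r * t))) powr p) * power_weight l t) \<in> borel_measurable lborel"
      unfolding times_vec_def by measurable
    have "?I = ennreal (\<Prod>j\<in>UNIV. \<bar>r $ j\<bar>) * (\<integral>\<^sup>+t. ennreal (norm (f (cvec (0 + r * t))) powr p) * power_weight l (0 + r * t) \<partial>lborel)"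
      by (rule nn_integral_dilate[OF _ r0]) measurable
    also have "(\<integral>\<^sup>+t. ennreal (norm (f (cvec (0 + r * t))) powr p) * power_weight l (0 + r * t) \<partial>lborel)
      = power_weight l r * (\<integral>\<^sup>+t. ennreal (norm (f (cvec (r * t))) powr p) * power_weight l t \<partial>lborel)"
      by (subst nn_integral_cmult[OF m, symmetric]) (simp add: power_weight_dilate mult_ac)
    finally have e: "?I = ennreal (\<Prod>j\<in>UNIV. \<bar>r $ j\<bar>) * power_weight l r * (\<integral>\<^sup>+t. ennreal (norm (f (cvec (r * t))) powr p) * power_weight l t \<partial>lborel)"
      by (simp add: mult.assoc)
    have "?c = (\<Prod>j\<in>UNIV. (1 - 2 * \<delta>) powr (1 + 2 * l j))"
      using r1(2) by (simp add: powr_sum[symmetric] sum.distrib sum_distrib_left)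
    also have "\<dots> \<le> (\<Prod>j\<in>UNIV. \<bar>r $ j\<bar> powr (1 + 2 * l j))"
      using r1 l by (intro prod_mono) (auto intro!: powr_mono2 add_nonneg_nonneg)
    also have "\<dots> = (\<Prod>j\<in>UNIV. \<bar>r $ j\<bar>) * (\<Prod>j\<in>UNIV. \<bar>r $ j\<bar> powr (2 * l j))"
      using r0 by (simp add: powr_add prod.distrib)
    finally have "ennreal ?c \<le> ennreal (\<Prod>j\<in>UNIV. \<bar>r $ j\<bar>) * power_weight l r"
      unfolding power_weight_def by (simp add: prod_ennreal ennreal_mult'[symmetric] prod_nonneg ennreal_leI)
    then show ?thesis unfolding e by (rule mult_right_mono) simp
  qed
  have "(\<integral>\<^sup>+t. ennreal (norm (dilation_average \<delta> f (cvec t)) powr p) * power_weight l t \<partial>lborel)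
    \<le> (\<integral>\<^sup>+t. (\<integral>\<^sup>+r. ennreal (norm (f (cvec (r * t))) powr p) * power_weight l t \<partial>annulus_prob \<delta>) \<partial>lborel)"
  proof (rule nn_integral_mono)
    fix t :: "real^'m"
    have m: "(\<lambda>r. ennreal (norm (f (cvec (r * t))) powr p)) \<in> borel_measurable (annulus_prob \<delta>)"
      unfolding times_vec_def by measurable
    have "ennreal (norm (dilation_average \<delta> f (cvec t)) powr p) * power_weight l t
      \<le> (\<integral>\<^sup>+r. ennreal (norm (f (cvec (r * t))) powr p) \<partial>annulus_prob \<delta>) * power_weight l t"
      using average_jensen by (rule mult_right_mono) simp
    also have "\<dots> = (\<integral>\<^sup>+r. ennreal (norm (f (cvec (r * t))) powr p) * power_weight l t \<partial>annulus_prob \<delta>)"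
      by (rule nn_integral_multc[OF m, symmetric])
    finally show "ennreal (norm (dilation_average \<delta> f (cvec t)) powr p) * power_weight l t \<le> \<dots>" .
  qed
  also have "\<dots> = (\<integral>\<^sup>+r. (\<integral>\<^sup>+t. ennreal (norm (f (cvec (r * t))) powr p) * power_weight l t \<partial>lborel) \<partial>annulus_prob \<delta>)"
    by (rule P.Fubini'[OF jm, symmetric])
  finally have "ennreal ?c * (\<integral>\<^sup>+t. ennreal (norm (dilation_average \<delta> f (cvec t)) powr p) * power_weight l t \<partial>lborel)
    \<le> ennreal ?c * (\<integral>\<^sup>+r. (\<integral>\<^sup>+t. ennreal (norm (f (cvec (r * t))) powr p) * power_weight l t \<partial>lborel) \<partial>annulus_prob \<delta>)"
    by (rule mult_left_mono) simp
  also have "\<dots> = (\<integral>\<^sup>+r. ennreal ?c * (\<integral>\<^sup>+t. ennreal (norm (f (cvec (r * t))) powr p) * power_weight l t \<partial>lborel) \<partial>annulus_prob \<delta>)"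
    by (rule nn_integral_cmult[symmetric]) (unfold times_vec_def, measurable)
  also have "\<dots> \<le> (\<integral>\<^sup>+r. ?I \<partial>(annulus_prob \<delta> :: (real^'m) measure))"
    by (rule nn_integral_mono_AE) (use AE_annulus[OF \<delta>] inner in \<open>auto elim!: eventually_mono\<close>)
  also have "\<dots> = ?I" by (simp add: A.emeasure_space_1[simplified])
  finally show ?thesis .
qed

end

end

section \<open>Approximation by even decaying functions\<close>

lemma power_le_exp:
  fixes y \<theta> :: real
  assumes "0 \<le> y" "0 < \<theta>" shows "y ^ n \<le> (real n / \<theta>) ^ n * exp (\<theta> * y)"
proof (cases "n = 0")
  case False
  have "\<theta> * y / real n \<le> exp (\<theta> * y / real n)" using exp_ge_add_one_self[of "\<theta> * y / real n"] by linarith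
  then have "(\<theta> * y / real n) ^ n \<le> exp (\<theta> * y / real n) ^ n" using assms by (intro power_mono) auto
  also have "\<dots> = exp (\<theta> * y)" using False by (simp add: exp_of_nat_mult[symmetric])
  finally have "(\<theta> * y / real n) ^ n * (real n / \<theta>) ^ n \<le> exp (\<theta> * y) * (real n / \<theta>) ^ n"
    using assms by (intro mult_right_mono) auto
  moreover have "(\<theta> * y / real n) ^ n * (real n / \<theta>) ^ n = y ^ n"
    using False assms by (simp add: power_mult_distrib[symmetric])
  ultimately show ?thesis by (simp add: mult.commute)
qed (use assms in auto)

text \<open>The functions whose periodization is under control: even, of type \<open>V\<close> with growth depending on the imaginary part only, and with
polynomial decay of order \<open>q\<close> in each variable.\<close>

definition even_decaying :: "(real^'m) set \<Rightarrow> nat \<Rightarrow> (complex^'m \<Rightarrow> complex) \<Rightarrow> bool" where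
  "even_decaying V q h \<longleftrightarrow> line_holomorphic h \<and> (\<forall>j z. h (flip j z) = h z) \<and>
     (\<lambda>t. h (cvec t)) \<in> borel_measurable borel \<and>
     (\<exists>C>0. \<forall>z. norm (h z) \<le> C * (\<Prod>j\<in>UNIV. 1 / (1 + norm (z $ j)) ^ q) * exp (dual_norm V (cvec (imv z))))"

lemma line_holomorphic_mult: "line_holomorphic f \<Longrightarrow> line_holomorphic g \<Longrightarrow> line_holomorphic (\<lambda>z. f z * g z)"
  unfolding line_holomorphic_def by (auto intro!: holomorphic_intros)

context pi_body
begin

text \<open>For \<open>t\<close> off the coordinate hyperplanes the points \<open>r t\<close>, \<open>r\<close> in the annulus, fill a set of volume comparable to \<open>|\<Prod>j. t\<^sub>j|\<close>, on which the weight is comparable to its value at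
\<open>t\<close>. Jensen's inequality thus bounds the average at \<open>t\<close> by the norm of \<open>f\<close> divided by a power of the coordinates. Multiplication by a
monomial absorbs the singularity at the hyperplanes, so no local regularity of the weight is required.\<close>

lemma average_real_bound:
  assumes \<delta>: "0 < \<delta>" "\<delta> < 1 / 2" and f: "f \<in> exp_type V" and p: "1 \<le> p" and l: "\<And>j. 0 \<le> l j"
    and fin: "(\<integral>\<^sup>+t. ennreal (norm (f (cvec t)) powr p) * power_weight l t \<partial>lborel) < \<infinity>"
  obtains C N where "0 < C" "0 < N"
    "\<And>t. norm ((\<Prod>j\<in>UNIV. cvec t $ j ^ N) * dilation_average \<delta> f (cvec t)) \<le> C * (1 + norm t) ^ (N * CARD('m))"
proof -
  define I where "I = enn2real (\<integral>\<^sup>+t. ennreal (norm (f (cvec t)) powr p) * power_weight l t \<partial>lborel)"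
  have I: "(\<integral>\<^sup>+t. ennreal (norm (f (cvec t)) powr p) * power_weight l t \<partial>lborel) = ennreal I" "0 \<le> I"
    using fin by (auto simp: I_def)
  define vol where "vol = enn2real (emeasure lborel (annulus \<delta> :: (real^'m) set))"
  have vol: "emeasure lborel (annulus \<delta> :: (real^'m) set) = ennreal vol" "0 < vol"
  proof -
    show "emeasure lborel (annulus \<delta> :: (real^'m) set) = ennreal vol"
      using annulus_mass[OF \<delta>, where 'm='m] by (simp add: vol_def less_top ennreal_enn2real)
    then show "0 < vol" using annulus_mass(1)[OF \<delta>, where 'm='m] by (metis ennreal_eq_0_iff not_le)
  qed
  have [measurable]: "f \<in> borel_measurable borel" by (rule exp_type_measurable[OF \<delta> f p l])
  define c where "c = (\<Prod>j\<in>(UNIV::'m set). (1 - 2 * \<delta>) powr (2 * l j))"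
  have c: "0 < c" unfolding c_def using \<delta> by (intro prod_pos) auto
  define A where "A t = norm (dilation_average \<delta> f (cvec t))" for t
  define C1 where "C1 = I / (vol * c)"
  have C1: "0 \<le> C1" using I vol c by (simp add: C1_def)
  (* the order of the singularity at the hyperplane where the j-th coordinate vanishes *)
  define e where "e j = (1 + 2 * l j) / p" for j
  have key: "A t powr p * (\<Prod>j\<in>UNIV. \<bar>t $ j\<bar> powr (1 + 2 * l j)) \<le> C1" if t: "\<And>j. t $ j \<noteq> 0" for t
  proof -
    let ?J = "\<integral>\<^sup>+r. ennreal (norm (f (cvec (r * t))) powr p) * indicator (annulus \<delta>) r \<partial>lborel"
    have m: "(\<lambda>r. ennreal (norm (f (cvec (r * t))) powr p)) \<in> borel_measurable borel"
      unfolding times_vec_def by measurable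
    have "ennreal (A t powr p) \<le> ?J / emeasure lborel (annulus \<delta> :: (real^'m) set)"
      using average_jensen[OF \<delta> f p l, of t] m unfolding A_def annulus_prob_def
      by (subst (asm) nn_integral_uniform_measure) auto
    then have "ennreal (A t powr p) * ennreal vol \<le> ?J / ennreal vol * ennreal vol"
      unfolding vol(1) by (rule mult_right_mono) simp
    also have "?J / ennreal vol * ennreal vol = ?J"
      using vol(2) by (simp add: ennreal_divide_times divide_mult_eq ennreal_mult_divide_eq)
    finally have 1: "ennreal (A t powr p * vol) \<le> ?J" by (simp add: ennreal_mult')
    define w where "w = c * (\<Prod>j\<in>UNIV. \<bar>t $ j\<bar> powr (2 * l j))"
    have w: "0 \<le> w" unfolding w_def using c by (simp add: prod_nonneg)
    have "ennreal (\<Prod>j\<in>UNIV. \<bar>t $ j\<bar>) * (ennreal w * ?J)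
      \<le> ennreal (\<Prod>j\<in>UNIV. \<bar>t $ j\<bar>) * (\<integral>\<^sup>+r. ennreal (norm (f (cvec (0 + t * r))) powr p) * power_weight l (0 + t * r) \<partial>lborel)"
    proof (rule mult_left_mono)
      have "ennreal w * ?J = (\<integral>\<^sup>+r. ennreal w * (ennreal (norm (f (cvec (r * t))) powr p) * indicator (annulus \<delta>) r) \<partial>lborel)"
        using m by (intro nn_integral_cmult[symmetric]) auto
      also have "\<dots> \<le> (\<integral>\<^sup>+r. ennreal (norm (f (cvec (0 + t * r))) powr p) * power_weight l (0 + t * r) \<partial>lborel)"
      proof (rule nn_integral_mono)
        fix r :: "real^'m"
        show "ennreal w * (ennreal (norm (f (cvec (r * t))) powr p) * indicator (annulus \<delta>) r)
          \<le> ennreal (norm (f (cvec (0 + t * r))) powr p) * power_weight l (0 + t * r)"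
        proof (cases "r \<in> annulus \<delta>")
          case True
          have "c \<le> (\<Prod>j\<in>UNIV. \<bar>r $ j\<bar> powr (2 * l j))" unfolding c_def
            using True \<delta> l by (intro prod_mono) (auto simp: annulus_def intro!: powr_mono2)
          then have "w \<le> (\<Prod>j\<in>UNIV. \<bar>r $ j\<bar> powr (2 * l j)) * (\<Prod>j\<in>UNIV. \<bar>t $ j\<bar> powr (2 * l j))"
            unfolding w_def by (intro mult_right_mono prod_nonneg) auto
          then have "ennreal w \<le> power_weight l (t * r)"
            unfolding power_weight_dilate by (simp add: power_weight_def prod_ennreal ennreal_mult'[symmetric] prod_nonneg ennreal_leI mult.commute)
          then have "ennreal w * ennreal (norm (f (cvec (r * t))) powr p) \<le> power_weight l (t * r) * ennreal (norm (f (cvec (r * t))) powr p)"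
            by (rule mult_right_mono) simp
          then show ?thesis using True by (simp add: mult.commute)
        qed simp
      qed
      finally show "ennreal w * ?J \<le> (\<integral>\<^sup>+r. ennreal (norm (f (cvec (0 + t * r))) powr p) * power_weight l (0 + t * r) \<partial>lborel)" .
    qed simp
    also have "\<dots> = ennreal I"
      unfolding I(1)[symmetric] by (rule nn_integral_dilate[symmetric]) (use t in auto)
    finally have 2: "ennreal (\<Prod>j\<in>UNIV. \<bar>t $ j\<bar>) * (ennreal w * ?J) \<le> ennreal I" .
    have "ennreal ((\<Prod>j\<in>UNIV. \<bar>t $ j\<bar>) * (w * (A t powr p * vol))) = ennreal (\<Prod>j\<in>UNIV. \<bar>t $ j\<bar>) * (ennreal w * ennreal (A t powr p * vol))"
      using w by (simp add: ennreal_mult' prod_nonneg)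
    also have "\<dots> \<le> ennreal (\<Prod>j\<in>UNIV. \<bar>t $ j\<bar>) * (ennreal w * ?J)"
      using 1 by (intro mult_left_mono) auto
    also note 2
    finally have "(\<Prod>j\<in>UNIV. \<bar>t $ j\<bar>) * (w * (A t powr p * vol)) \<le> I" using I(2) by (simp add: ennreal_le_iff)
    moreover have "(\<Prod>j\<in>UNIV. \<bar>t $ j\<bar> powr (1 + 2 * l j)) = (\<Prod>j\<in>UNIV. \<bar>t $ j\<bar>) * (\<Prod>j\<in>UNIV. \<bar>t $ j\<bar> powr (2 * l j))"
      using t by (simp add: powr_add prod.distrib)
    ultimately have "A t powr p * (\<Prod>j\<in>UNIV. \<bar>t $ j\<bar> powr (1 + 2 * l j)) * (vol * c) \<le> I"
      by (simp add: w_def mult_ac)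
    then show ?thesis using vol c by (simp add: C1_def field_simps)
  qed
  obtain N :: nat where N: "\<And>j. e j \<le> real N" "0 < N"
  proof -
    obtain N0 :: nat where N0: "(\<Sum>j\<in>UNIV. e j) \<le> real N0" using real_arch_simple by blast
    have "e j \<le> (\<Sum>j\<in>UNIV. e j)" for j by (rule member_le_sum) (use l p in \<open>auto simp: e_def\<close>)
    then have "e j \<le> real (Suc N0)" for j using N0 by (meson le_SucI of_nat_le_iff order_trans order_refl)
    then show ?thesis using that[of "Suc N0"] by simp
  qed
  define C where "C = C1 powr (1 / p) + 1"
  have C: "0 < C" unfolding C_def by (simp add: add_nonneg_pos)
  have bnd: "norm ((\<Prod>j\<in>UNIV. cvec t $ j ^ N) * dilation_average \<delta> f (cvec t)) \<le> C * (1 + norm t) ^ (N * CARD('m))" for t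
  proof (cases "\<exists>j. t $ j = 0")
    case True
    then have z: "(\<Prod>j\<in>UNIV. cvec t $ j ^ N) = 0" using N by (intro prod_zero) auto
    show ?thesis unfolding z using C by simp
  next
    case False
    then have t: "\<And>j. t $ j \<noteq> 0" by blast
    have "(A t powr p * (\<Prod>j\<in>UNIV. \<bar>t $ j\<bar> powr (1 + 2 * l j))) powr (1 / p) \<le> C1 powr (1 / p)"
      using key[OF t] p by (intro powr_mono2) (auto simp: prod_nonneg)
    moreover have "(A t powr p * (\<Prod>j\<in>UNIV. \<bar>t $ j\<bar> powr (1 + 2 * l j))) powr (1 / p) = A t * (\<Prod>j\<in>UNIV. \<bar>t $ j\<bar> powr e j)"
    proof -
      have "(\<Prod>j\<in>UNIV. \<bar>t $ j\<bar> powr (1 + 2 * l j)) powr (1 / p) = (\<Prod>j\<in>UNIV. (\<bar>t $ j\<bar> powr (1 + 2 * l j)) powr (1 / p))"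
        by (rule prod_powr_distrib)
      then show ?thesis using p by (simp add: powr_mult prod_nonneg powr_powr e_def A_def)
    qed
    ultimately have 1: "A t * (\<Prod>j\<in>UNIV. \<bar>t $ j\<bar> powr e j) \<le> C1 powr (1 / p)" by simp
    have 2: "\<bar>t $ j\<bar> ^ N \<le> \<bar>t $ j\<bar> powr e j * (1 + norm t) ^ N" for j
    proof -
      have e0: "0 \<le> e j" using l p by (simp add: e_def)
      have "\<bar>t $ j\<bar> ^ N = \<bar>t $ j\<bar> powr e j * \<bar>t $ j\<bar> powr (real N - e j)"
        using t by (simp add: powr_add[symmetric] powr_realpow)
      also have "\<bar>t $ j\<bar> powr (real N - e j) \<le> (1 + norm t) powr (real N - e j)"
        using N(1)[of j] component_le_norm_cart[of t j] by (intro powr_mono2) auto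
      also have "(1 + norm t) powr (real N - e j) \<le> (1 + norm t) powr real N"
        using e0 by (intro powr_mono) auto
      also have "(1 + norm t) powr real N = (1 + norm t) ^ N" by (rule powr_realpow) (simp add: add_pos_nonneg)
      finally show ?thesis by (simp add: mult_left_mono)
    qed
    have "norm ((\<Prod>j\<in>UNIV. cvec t $ j ^ N) * dilation_average \<delta> f (cvec t)) = (\<Prod>j\<in>UNIV. \<bar>t $ j\<bar> ^ N) * A t"
      by (simp add: A_def norm_mult prod_norm[symmetric] norm_power)
    also have "\<dots> \<le> (\<Prod>j\<in>UNIV. \<bar>t $ j\<bar> powr e j * (1 + norm t) ^ N) * A t"
      using 2 by (intro mult_right_mono prod_mono) (auto simp: A_def)
    also have "\<dots> = A t * (\<Prod>j\<in>UNIV. \<bar>t $ j\<bar> powr e j) * (1 + norm t) ^ (N * CARD('m))"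
      by (simp add: prod.distrib power_mult)
    also have "\<dots> \<le> C * (1 + norm t) ^ (N * CARD('m))"
      using 1 by (intro mult_right_mono) (auto simp: C_def)
    finally show ?thesis .
  qed
  show ?thesis by (rule that[OF C N(2) bnd])
qed

text \<open>The monomial multiple of the average satisfies the hypotheses of the Phragmen-Lindelof estimate once its polynomial factor is
absorbed by half of the gap \<open>\<delta>^2\<close> in the type; afterwards the monomial is removed again.\<close>

lemma average_complex_bound:
  assumes \<delta>: "0 < \<delta>" "\<delta> < 1 / 2" and f: "f \<in> exp_type V" and p: "1 \<le> p" and l: "\<And>j. 0 \<le> l j"
    and fin: "(\<integral>\<^sup>+t. ennreal (norm (f (cvec t)) powr p) * power_weight l t \<partial>lborel) < \<infinity>"
  obtains C K where "0 < C"
    "\<And>z. norm (dilation_average \<delta> f z) \<le> C * (1 + norm z) ^ K * exp ((1 - \<delta>\<^sup>2 / 2) * dual_norm V (cvec (imv z)))"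
proof -
  let ?h = "dilation_average \<delta> f"
  obtain C N where C: "0 < C" and N: "0 < N"
    and re: "\<And>t. norm ((\<Prod>j\<in>UNIV. cvec t $ j ^ N) * ?h (cvec t)) \<le> C * (1 + norm t) ^ (N * CARD('m))"
    by (rule average_real_bound[OF \<delta> f p l fin]) blast
  obtain B where B: "0 < B" "\<And>z. norm (?h z) \<le> B * exp ((1 - \<delta>\<^sup>2) * dual_norm V z)"
    by (rule average_growth[OF \<delta> f p l]) blast
  obtain c where c: "0 < c" "\<And>z j. c * norm (z $ j) \<le> dual_norm V z" by (rule dual_norm_lower) blast
  define K where "K = N * CARD('m)"
  define \<kappa> where "\<kappa> = 1 - \<delta>\<^sup>2 / 2"
  have d2: "\<delta>\<^sup>2 \<le> 1" using \<delta> by (simp add: power_le_one)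
  have \<kappa>: "0 \<le> \<kappa>" using d2 by (simp add: \<kappa>_def)
  define G where "G z = (\<Prod>j\<in>UNIV. z $ j ^ N) * ?h z" for z
  have hl: "line_holomorphic ?h" by (rule average_line_holomorphic[OF \<delta> f p l])
  have "entire (\<lambda>z::complex^'m. \<Prod>j\<in>UNIV. z $ j ^ N)"
    by (intro entire_prod entire_coordinate holomorphic_intros)
  then have Gl: "line_holomorphic G" unfolding G_def
    by (intro line_holomorphic_mult hl entire_imp_line_holomorphic)
  define D where "D = (real K / (\<delta>\<^sup>2 / 2)) ^ K / c ^ K"
  (* the monomial is absorbed by exp (delta^2 / 2 * dual_norm V z) *)
  have Gg: "norm (G z) \<le> (B * D) * exp (\<kappa> * dual_norm V z)" for z
  proof -
    let ?d = "dual_norm V z"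
    have "norm (z $ j) \<le> ?d / c" for j using c(2)[of z j] c(1) by (simp add: field_simps)
    then have "(\<Prod>j\<in>UNIV. norm (z $ j) ^ N) \<le> (\<Prod>j\<in>(UNIV::'m set). (?d / c) ^ N)"
      by (intro prod_mono conjI power_mono) auto
    also have "\<dots> = ?d ^ K / c ^ K" by (simp add: K_def power_mult power_divide)
    also have "\<dots> \<le> ((real K / (\<delta>\<^sup>2 / 2)) ^ K * exp (\<delta>\<^sup>2 / 2 * ?d)) / c ^ K"
      using c \<delta> dual_norm_nonneg by (intro divide_right_mono power_le_exp) auto
    also have "\<dots> = D * exp (\<delta>\<^sup>2 / 2 * ?d)" by (simp add: D_def)
    finally have 1: "(\<Prod>j\<in>UNIV. norm (z $ j) ^ N) \<le> D * exp (\<delta>\<^sup>2 / 2 * ?d)" .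
    have "norm (G z) = (\<Prod>j\<in>UNIV. norm (z $ j) ^ N) * norm (?h z)"
      by (simp add: G_def norm_mult prod_norm[symmetric] norm_power)
    also have "\<dots> \<le> (D * exp (\<delta>\<^sup>2 / 2 * ?d)) * (B * exp ((1 - \<delta>\<^sup>2) * ?d))"
      using 1 B(2)[of z] by (intro mult_mono order_trans[OF prod_nonneg 1]) auto
    also have "\<dots> = (B * D) * exp (\<kappa> * ?d)"
    proof -
      have "exp (\<delta>\<^sup>2 / 2 * ?d) * exp ((1 - \<delta>\<^sup>2) * ?d) = exp (\<kappa> * ?d)"
        unfolding exp_add[symmetric] by (rule arg_cong[where f=exp]) (simp add: \<kappa>_def algebra_simps)
      then show ?thesis by (metis mult.assoc mult.commute)
    qed
    finally show ?thesis .
  qed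
  have Gre: "norm (G (cvec t)) \<le> C * (1 + norm t) ^ K" for t unfolding G_def K_def by (rule re)
  have PL: "norm (G z) \<le> C * (4 * (1 + norm z)) ^ K * exp (\<kappa> * dual_norm V (cvec (imv z)))" for z
    by (rule phragmen_lindelof[OF Gl Gg Gre C \<kappa>])
  define m where "m = real CARD('m)"
  define L where "L = (4 * (1 + 2 * m)) ^ K * exp (\<kappa> * (2 * dual_norm V 1))"
  have L: "0 < L" unfolding L_def m_def by (intro mult_pos_pos zero_less_power) auto
  have "norm (?h z) \<le> (C * L) * (1 + norm z) ^ K * exp (\<kappa> * dual_norm V (cvec (imv z)))" for z
  (* moving each coordinate by at most 2 changes the bound by a constant factor *)
  proof (rule bound_from_monomial_multiple[OF hl, where N=N])
    fix w assume w: "\<And>j. norm (w $ j - z $ j) \<le> 2"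
    have "norm (w - z) \<le> (\<Sum>j\<in>UNIV. norm ((w - z) $ j))" unfolding norm_vec_def by (rule L2_set_le_sum) simp
    also have "\<dots> \<le> (\<Sum>j\<in>(UNIV::'m set). 2)" using w by (intro sum_mono) auto
    finally have "norm w \<le> norm z + 2 * m" using norm_triangle_sub[of w z] by (simp add: m_def mult.commute)
    moreover have "0 \<le> norm z * m" by (simp add: m_def)
    ultimately have "1 + norm w \<le> (1 + 2 * m) * (1 + norm z)" by (simp add: algebra_simps)
    then have 1: "(4 * (1 + norm w)) ^ K \<le> (4 * ((1 + 2 * m) * (1 + norm z))) ^ K" by (intro power_mono) auto
    have "cvec (imv w) = cvec (imv z) + cvec (imv (w - z)) * 1" by (simp add: vec_eq_iff)
    moreover have "dual_norm V (cvec (imv (w - z)) * 1) \<le> 2 * dual_norm V 1"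
    proof (rule dual_norm_hadamard)
      fix j show "\<bar>imv (w - z) $ j\<bar> \<le> 2" using w[of j] abs_Im_le_cmod[of "w $ j - z $ j"] by simp
    qed
    ultimately have "dual_norm V (cvec (imv w)) \<le> dual_norm V (cvec (imv z)) + 2 * dual_norm V 1"
      using dual_norm_triangle[of "cvec (imv z)" "cvec (imv (w - z)) * 1"] by simp
    then have "\<kappa> * dual_norm V (cvec (imv w)) \<le> \<kappa> * (2 * dual_norm V 1) + \<kappa> * dual_norm V (cvec (imv z))"
      using mult_left_mono[OF _ \<kappa>] by (fastforce simp: algebra_simps)
    then have 2: "exp (\<kappa> * dual_norm V (cvec (imv w))) \<le> exp (\<kappa> * (2 * dual_norm V 1)) * exp (\<kappa> * dual_norm V (cvec (imv z)))"
      unfolding exp_add[symmetric] by simp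
    have "norm (G w) \<le> C * (4 * (1 + norm w)) ^ K * exp (\<kappa> * dual_norm V (cvec (imv w)))" by (rule PL)
    also have "\<dots> \<le> C * (4 * ((1 + 2 * m) * (1 + norm z))) ^ K * (exp (\<kappa> * (2 * dual_norm V 1)) * exp (\<kappa> * dual_norm V (cvec (imv z))))"
      using 1 2 C by (intro mult_mono mult_left_mono) (auto simp: m_def)
    also have "\<dots> = (C * L) * (1 + norm z) ^ K * exp (\<kappa> * dual_norm V (cvec (imv z)))"
      by (simp add: L_def power_mult_distrib mult_ac)
    finally show "norm ((\<Prod>j\<in>UNIV. w $ j ^ N) * ?h w) \<le> (C * L) * (1 + norm z) ^ K * exp (\<kappa> * dual_norm V (cvec (imv z)))"
      by (simp add: G_def)
  qed
  moreover have "0 < C * L" using C L by simp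
  ultimately show ?thesis unfolding \<kappa>_def using that by blast
qed

end

lemma one_plus_sum_le_prod:
  fixes x :: "'a \<Rightarrow> real"
  assumes "finite S" "\<And>i. i \<in> S \<Longrightarrow> 0 \<le> x i"
  shows "1 + (\<Sum>i\<in>S. x i) \<le> (\<Prod>i\<in>S. 1 + x i)"
  using assms
proof (induction S rule: finite_induct)
  case (insert k S)
  have "1 + (\<Sum>i\<in>S. x i) \<le> (\<Prod>i\<in>S. 1 + x i)" "0 \<le> x k" "0 \<le> (\<Sum>i\<in>S. x i)"
    using insert by (auto intro: sum_nonneg)
  moreover have "(1 + x k) * (1 + (\<Sum>i\<in>S. x i)) \<le> (1 + x k) * (\<Prod>i\<in>S. 1 + x i)"
    using calculation by (intro mult_left_mono) auto
  moreover have "0 \<le> x k * (\<Sum>i\<in>S. x i)" using calculation by simp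
  ultimately have "1 + (x k + (\<Sum>i\<in>S. x i)) \<le> (1 + x k) * (\<Prod>i\<in>S. 1 + x i)"
    by (simp only: distrib_left distrib_right mult_1 mult_1_right)
  then show ?case using insert.hyps by simp
qed simp

lemma norm_plus_one_le_prod: "1 + norm (z :: complex^'m) \<le> (\<Prod>j\<in>UNIV. 1 + norm (z $ j))"
proof -
  have "norm z \<le> (\<Sum>j\<in>UNIV. norm (z $ j))" unfolding norm_vec_def by (rule L2_set_le_sum) simp
  then show ?thesis using one_plus_sum_le_prod[of UNIV "\<lambda>j. norm (z $ j)"] by simp
qed

context pi_body
begin

text \<open>Each factor \<open>csinc (\<eta> z\<^sub>j)\<close> decays like \<open>1 / |z\<^sub>j|\<close> and costs the type \<open>\<eta>\<close> in the j-th variable; \<open>\<eta>\<close> is chosen so small that all the factors together fit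
into the gap \<open>1 - \<kappa>\<close>.\<close>

lemma sinc_damping_even_decaying:
  fixes g :: "complex^'m \<Rightarrow> complex"
  assumes hol: "line_holomorphic g" and flip: "\<And>j z. g (flip j z) = g z"
    and meas: "(\<lambda>t. g (cvec t)) \<in> borel_measurable borel"
    and C: "0 < C" and \<kappa>: "\<kappa> < 1"
    and bd: "\<And>z. norm (g z) \<le> C * (1 + norm z) ^ K * exp (\<kappa> * dual_norm V (cvec (imv z)))"
  obtains \<eta> M where "even_decaying V q (\<lambda>z. g z * (\<Prod>j\<in>UNIV. csinc (complex_of_real \<eta> * z $ j) ^ M))"
proof -
  obtain c where c: "0 < c" "\<And>z j. c * norm (z $ j) \<le> dual_norm V z" by (rule dual_norm_lower) blast
  obtain Cs where Cs: "0 < Cs" "\<And>z. norm (csinc z) \<le> Cs * exp \<bar>Im z\<bar> / (1 + norm z)" by (rule csinc_bound) blast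
  (* K factors compensate the polynomial growth, q remain as decay *)
  define M where "M = K + q"
  define m where "m = real CARD('m)"
  have m: "0 < m" by (simp add: m_def)
  define \<eta> where "\<eta> = min 1 ((1 - \<kappa>) * c / ((real M + 1) * m))"
  have \<eta>: "0 < \<eta>" "\<eta> \<le> 1" using \<kappa> c m by (auto simp: \<eta>_def)
  have \<eta>M: "\<eta> * real M * m \<le> (1 - \<kappa>) * c"
  proof -
    have "\<eta> * ((real M + 1) * m) \<le> (1 - \<kappa>) * c / ((real M + 1) * m) * ((real M + 1) * m)"
      using m by (intro mult_right_mono) (auto simp: \<eta>_def)
    also have "\<dots> = (1 - \<kappa>) * c" using m by simp
    finally show ?thesis using \<eta> m by (simp add: algebra_simps) (smt (verit) mult_pos_pos)
  qed
  define h where "h z = g z * (\<Prod>j\<in>UNIV. csinc (complex_of_real \<eta> * z $ j) ^ M)" for z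
  have 1: "norm (csinc (complex_of_real \<eta> * w)) ^ M \<le> (Cs / \<eta>) ^ M * exp (\<eta> * real M * \<bar>Im w\<bar>) * (1 / (1 + norm w) ^ M)" for w
  proof -
    have p: "0 < 1 + norm w" by (simp add: add_pos_nonneg)
    have "norm (csinc (complex_of_real \<eta> * w)) \<le> Cs * exp (\<eta> * \<bar>Im w\<bar>) / (1 + \<eta> * norm w)"
      using Cs(2)[of "complex_of_real \<eta> * w"] \<eta> by (simp add: norm_mult abs_mult)
    also have "\<dots> \<le> Cs * exp (\<eta> * \<bar>Im w\<bar>) / (\<eta> * (1 + norm w))"
      using \<eta> Cs p by (intro divide_left_mono) (auto simp: algebra_simps intro!: mult_pos_pos add_pos_nonneg)
    finally have "norm (csinc (complex_of_real \<eta> * w)) ^ M \<le> (Cs * exp (\<eta> * \<bar>Im w\<bar>) / (\<eta> * (1 + norm w))) ^ M"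
      by (intro power_mono) auto
    also have "\<dots> = (Cs / \<eta>) ^ M * exp (\<eta> * \<bar>Im w\<bar>) ^ M * (1 / (1 + norm w) ^ M)"
      by (simp add: power_mult_distrib power_divide)
    also have "exp (\<eta> * \<bar>Im w\<bar>) ^ M = exp (\<eta> * real M * \<bar>Im w\<bar>)"
      by (simp add: exp_of_nat_mult[symmetric] mult_ac)
    finally show ?thesis .
  qed
  define CC where "CC = C * ((Cs / \<eta>) ^ M) ^ CARD('m)"
  have CC: "0 < CC" using C Cs \<eta> by (simp add: CC_def)
  have main: "norm (h z) \<le> CC * (\<Prod>j\<in>UNIV. 1 / (1 + norm (z $ j)) ^ q) * exp (dual_norm V (cvec (imv z)))" for z
  proof -
    let ?d = "dual_norm V (cvec (imv z))"
    have "norm (\<Prod>j\<in>UNIV. csinc (complex_of_real \<eta> * z $ j) ^ M) = (\<Prod>j\<in>UNIV. norm (csinc (complex_of_real \<eta> * z $ j)) ^ M)"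
      by (simp add: prod_norm[symmetric] norm_power)
    also have "\<dots> \<le> (\<Prod>j\<in>UNIV. (Cs / \<eta>) ^ M * exp (\<eta> * real M * \<bar>Im (z $ j)\<bar>) * (1 / (1 + norm (z $ j)) ^ M))"
      using 1 by (intro prod_mono) auto
    also have "\<dots> = ((Cs / \<eta>) ^ M) ^ CARD('m) * exp (\<Sum>j\<in>UNIV. \<eta> * real M * \<bar>Im (z $ j)\<bar>) * (\<Prod>j\<in>UNIV. 1 / (1 + norm (z $ j)) ^ M)"
      by (simp only: prod.distrib prod_constant exp_sum finite)
    also have "(\<Sum>j\<in>UNIV. \<eta> * real M * \<bar>Im (z $ j)\<bar>) \<le> (1 - \<kappa>) * ?d"
    proof -
      have "(\<Sum>j\<in>UNIV. \<eta> * real M * \<bar>Im (z $ j)\<bar>) \<le> (\<Sum>j\<in>(UNIV::'m set). \<eta> * real M * (?d / c))"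
      proof (intro sum_mono mult_left_mono)
        fix j show "\<bar>Im (z $ j)\<bar> \<le> ?d / c" using c(2)[of "cvec (imv z)" j] c(1) by (simp add: field_simps)
      qed (use \<eta> in auto)
      also have "\<dots> = (\<eta> * real M * m) * (?d / c)" by (simp add: m_def)
      also have "\<dots> \<le> ((1 - \<kappa>) * c) * (?d / c)" using \<eta>M c dual_norm_nonneg by (intro mult_right_mono) auto
      also have "\<dots> = (1 - \<kappa>) * ?d" using c by simp
      finally show ?thesis .
    qed
    finally have 2: "norm (\<Prod>j\<in>UNIV. csinc (complex_of_real \<eta> * z $ j) ^ M)
      \<le> ((Cs / \<eta>) ^ M) ^ CARD('m) * exp ((1 - \<kappa>) * ?d) * (\<Prod>j\<in>UNIV. 1 / (1 + norm (z $ j)) ^ M)"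
      using Cs \<eta> by (simp add: mult_left_mono mult_right_mono prod_nonneg)
    have "(1 + norm z) ^ K \<le> (\<Prod>j\<in>UNIV. 1 + norm (z $ j)) ^ K" by (intro power_mono norm_plus_one_le_prod) auto
    then have 3: "C * (1 + norm z) ^ K * exp (\<kappa> * ?d) \<le> C * (\<Prod>j\<in>UNIV. (1 + norm (z $ j)) ^ K) * exp (\<kappa> * ?d)"
      using C by (simp add: prod_power_distrib)
    have "norm (h z) \<le> (C * (\<Prod>j\<in>UNIV. (1 + norm (z $ j)) ^ K) * exp (\<kappa> * ?d)) *
       (((Cs / \<eta>) ^ M) ^ CARD('m) * exp ((1 - \<kappa>) * ?d) * (\<Prod>j\<in>UNIV. 1 / (1 + norm (z $ j)) ^ M))"
      unfolding h_def norm_mult using order_trans[OF bd 3] 2 C by (intro mult_mono) (auto intro!: prod_nonneg mult_nonneg_nonneg)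
    also have "\<dots> = CC * ((\<Prod>j\<in>UNIV. (1 + norm (z $ j)) ^ K) * (\<Prod>j\<in>UNIV. 1 / (1 + norm (z $ j)) ^ M)) * (exp (\<kappa> * ?d) * exp ((1 - \<kappa>) * ?d))"
      by (simp only: CC_def mult_ac)
    also have "exp (\<kappa> * ?d) * exp ((1 - \<kappa>) * ?d) = exp ?d"
      unfolding exp_add[symmetric] by (simp add: algebra_simps)
    also have "(\<Prod>j\<in>UNIV. (1 + norm (z $ j)) ^ K) * (\<Prod>j\<in>UNIV. 1 / (1 + norm (z $ j)) ^ M) = (\<Prod>j\<in>UNIV. 1 / (1 + norm (z $ j)) ^ q)"
      unfolding prod.distrib[symmetric]
    proof (rule prod.cong[OF refl])
      fix j
      have "0 < 1 + norm (z $ j)" by (simp add: add_pos_nonneg)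
      then show "(1 + norm (z $ j)) ^ K * (1 / (1 + norm (z $ j)) ^ M) = 1 / (1 + norm (z $ j)) ^ q"
        by (simp add: M_def power_add)
    qed
    finally show ?thesis .
  qed
  have "even_decaying V q h" unfolding even_decaying_def
  proof (intro conjI allI exI[of _ CC])
    have "csinc \<circ> (\<lambda>w. complex_of_real \<eta> * w) holomorphic_on UNIV"
      by (rule holomorphic_on_compose_gen[OF _ holomorphic_csinc]) (auto intro!: holomorphic_intros)
    then have "(\<lambda>w. csinc (complex_of_real \<eta> * w)) holomorphic_on UNIV" unfolding o_def .
    then show "line_holomorphic h" unfolding h_def
      by (intro line_holomorphic_mult hol entire_imp_line_holomorphic entire_prod entire_coordinate holomorphic_intros)
    show "h (flip j z) = h z" for j z
    proof -
      have "csinc (complex_of_real \<eta> * flip j z $ i) = csinc (complex_of_real \<eta> * z $ i)" for i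
        by (simp add: flip_def)
      then show ?thesis by (simp add: h_def flip)
    qed
    have "continuous_on UNIV csinc" by (rule holomorphic_on_imp_continuous_on[OF holomorphic_csinc])
    then have [measurable]: "csinc \<in> borel_measurable borel" by (rule borel_measurable_continuous_onI)
    note meas[measurable]
    show "(\<lambda>t. h (cvec t)) \<in> borel_measurable borel" unfolding h_def cvec_nth by measurable
  qed (use CC main in auto)
  then show ?thesis unfolding h_def by (rule that)
qed

lemma csinc_prod_real_le_1: "norm (\<Prod>j\<in>UNIV. csinc (complex_of_real \<eta> * cvec t $ j) ^ M) \<le> 1"
proof -
  have "norm (csinc (complex_of_real \<eta> * cvec t $ j)) \<le> 1" for j
    using csinc_real_le_1[of "\<eta> * t $ j"] by simp
  then show ?thesis unfolding prod_norm[symmetric]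
    by (intro prod_le_1) (auto simp: norm_power intro!: power_le_one)
qed

text \<open>The number \<open>\<delta>\<close> is determined by \<open>(1 - 2 \<delta>) powr (m + 2 * sum l) = \<theta>\<close>. Damping by sinc functions does not increase the modulus at real
points and does not change the value at zero.\<close>

lemma even_decaying_approximation:
  assumes f: "f \<in> exp_type V" and p: "1 \<le> p" and l: "\<And>j. 0 \<le> l j"
    and fin: "(\<integral>\<^sup>+t. ennreal (norm (f (cvec t)) powr p) * power_weight l t \<partial>lborel) < \<infinity>"
    and \<theta>: "0 < \<theta>" "\<theta> < 1"
  obtains h where "even_decaying V q h" "h 0 = f 0"
    "ennreal \<theta> * (\<integral>\<^sup>+t. ennreal (norm (h (cvec t)) powr p) * power_weight l t \<partial>lborel)
       \<le> (\<integral>\<^sup>+t. ennreal (norm (f (cvec t)) powr p) * power_weight l t \<partial>lborel)"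
proof -
  define \<gamma> where "\<gamma> = real CARD('m) + 2 * (\<Sum>j\<in>UNIV. l j)"
  have \<gamma>: "0 < \<gamma>" unfolding \<gamma>_def using l by (simp add: add_pos_nonneg sum_nonneg)
  define \<delta> where "\<delta> = (1 - \<theta> powr (1 / \<gamma>)) / 2"
  have "\<theta> powr (1 / \<gamma>) < 1 powr (1 / \<gamma>)" using \<theta> \<gamma> by (intro powr_less_mono2) auto
  moreover have "0 < \<theta> powr (1 / \<gamma>)" using \<theta> by simp
  ultimately have \<delta>: "0 < \<delta>" "\<delta> < 1 / 2" by (auto simp: \<delta>_def)
  have d\<theta>: "(1 - 2 * \<delta>) powr \<gamma> = \<theta>"
  proof -
    have "1 - 2 * \<delta> = \<theta> powr (1 / \<gamma>)" by (simp add: \<delta>_def field_simps)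
    then show ?thesis using \<theta> \<gamma> by (simp add: powr_powr)
  qed
  let ?g = "dilation_average \<delta> f"
  obtain C K where CK: "0 < C" "\<And>z. norm (?g z) \<le> C * (1 + norm z) ^ K * exp ((1 - \<delta>\<^sup>2 / 2) * dual_norm V (cvec (imv z)))"
    by (rule average_complex_bound[OF \<delta> f p l fin]) blast
  have k1: "1 - \<delta>\<^sup>2 / 2 < 1" using \<delta> by simp
  obtain \<eta> M where n: "even_decaying V q (\<lambda>z. ?g z * (\<Prod>j\<in>UNIV. csinc (complex_of_real \<eta> * z $ j) ^ M))"
    by (rule sinc_damping_even_decaying[OF average_line_holomorphic[OF \<delta> f p l] average_flip[OF \<delta> f p l] average_measurable[OF \<delta> f p l] CK(1) k1 CK(2)])
  show ?thesis
  proof (rule that[OF n])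
    show "?g 0 * (\<Prod>j\<in>UNIV. csinc (complex_of_real \<eta> * 0 $ j) ^ M) = f 0"
      by (simp add: average_zero[OF \<delta> f p l])
    have le: "norm (?g (cvec t) * (\<Prod>j\<in>UNIV. csinc (complex_of_real \<eta> * cvec t $ j) ^ M)) powr p \<le> norm (?g (cvec t)) powr p" for t
      using p csinc_prod_real_le_1[of \<eta> t M] by (intro powr_mono2) (auto simp: norm_mult mult_left_le)
    have "ennreal \<theta> * (\<integral>\<^sup>+t. ennreal (norm (?g (cvec t) * (\<Prod>j\<in>UNIV. csinc (complex_of_real \<eta> * cvec t $ j) ^ M)) powr p) * power_weight l t \<partial>lborel)
      \<le> ennreal \<theta> * (\<integral>\<^sup>+t. ennreal (norm (?g (cvec t)) powr p) * power_weight l t \<partial>lborel)"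
      by (intro mult_left_mono nn_integral_mono mult_right_mono ennreal_leI le) auto
    also have "\<dots> \<le> (\<integral>\<^sup>+t. ennreal (norm (f (cvec t)) powr p) * power_weight l t \<partial>lborel)"
      using average_norm[where l=l, OF \<delta> f p l] unfolding \<gamma>_def[symmetric] d\<theta> .
    finally show "ennreal \<theta> * (\<integral>\<^sup>+t. ennreal (norm (?g (cvec t) * (\<Prod>j\<in>UNIV. csinc (complex_of_real \<eta> * cvec t $ j) ^ M)) powr p) * power_weight l t \<partial>lborel)
      \<le> (\<integral>\<^sup>+t. ennreal (norm (f (cvec t)) powr p) * power_weight l t \<partial>lborel)" .
  qed
qed

text \<open>The damped constant function one; it shows that the limit constant is positive.\<close>

lemma even_decaying_exists: obtains h where "even_decaying V q h" "h 0 = 1"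
proof -
  have "line_holomorphic (\<lambda>z::complex^'m. 1)" by (simp add: line_holomorphic_def)
  then obtain \<eta> M where n: "even_decaying V q (\<lambda>z. 1 * (\<Prod>j\<in>UNIV. csinc (complex_of_real \<eta> * z $ j) ^ M))"
    by (rule sinc_damping_even_decaying[where g="\<lambda>_. 1" and C=1 and \<kappa>=0 and K=0]) auto
  show ?thesis by (rule that[OF n]) simp
qed

end

section \<open>Lattice sums\<close>

lemma inverse_square_int_summable: "(\<lambda>n::int. 1 / (1 + real_of_int \<bar>n\<bar>)\<^sup>2) summable_on UNIV"
proof -
  have "(\<lambda>n. 1 / (1 + real n)\<^sup>2) = (\<lambda>n. 1 / real ((n + 1)\<^sup>2))"
    by (rule ext) (simp only: of_nat_power of_nat_add of_nat_1 add.commute)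
  then have "summable (\<lambda>n. 1 / (1 + real n)\<^sup>2)"
    using sums_summable[OF inverse_squares_sums] by simp
  then have nat: "(\<lambda>n::nat. 1 / (1 + real n)\<^sup>2) summable_on UNIV"
    by (intro norm_summable_imp_summable_on) auto
  have U: "(UNIV :: int set) = range int \<union> range (\<lambda>n. - int n)"
  proof -
    have "m \<in> range int \<union> range (\<lambda>n. - int n)" for m
      by (cases "0 \<le> m") (auto intro: image_eqI[of _ _ "nat m"] image_eqI[of _ _ "nat (- m)"])
    then show ?thesis by blast
  qed
  have "(\<lambda>n::int. 1 / (1 + real_of_int \<bar>n\<bar>)\<^sup>2) summable_on range int"
    using nat by (subst summable_on_reindex) (auto simp: o_def inj_def)
  moreover have "(\<lambda>n::int. 1 / (1 + real_of_int \<bar>n\<bar>)\<^sup>2) summable_on range (\<lambda>n. - int n)"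
    using nat by (subst summable_on_reindex) (auto simp: o_def inj_def)
  ultimately show ?thesis unfolding U by (rule summable_on_union)
qed

text \<open>A summable majorant on the integer lattice, of product form because decay is available in each variable separately.\<close>

definition lattice_weight :: "('m::finite \<Rightarrow> int) \<Rightarrow> real" where
  "lattice_weight n = (\<Prod>j\<in>UNIV. 1 / (1 + real_of_int \<bar>n j\<bar>)\<^sup>2)"

lemma lattice_weight_nonneg: "0 \<le> lattice_weight n"
  by (simp add: lattice_weight_def prod_nonneg)

lemma lattice_weight_summable: "(lattice_weight :: ('m::finite \<Rightarrow> int) \<Rightarrow> real) summable_on UNIV"
proof (rule nonneg_bdd_above_summable_on)
  let ?b = "\<lambda>n::int. 1 / (1 + real_of_int \<bar>n\<bar>)\<^sup>2"
  define s where "s = infsum ?b UNIV"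
  have s: "sum ?b B \<le> s" if "finite B" for B
    unfolding s_def using inverse_square_int_summable that by (intro finite_sum_le_infsum) auto
  show "bdd_above (sum (lattice_weight :: ('m \<Rightarrow> int) \<Rightarrow> real) ` {F. F \<subseteq> UNIV \<and> finite F})"
  proof (rule bdd_aboveI2)
    fix F :: "('m \<Rightarrow> int) set" assume "F \<in> {F. F \<subseteq> UNIV \<and> finite F}"
    then have F: "finite F" by simp
    define B where "B = (\<Union>n\<in>F. range n)"
    have B: "finite B" using F by (simp add: B_def)
    have "sum lattice_weight F \<le> sum lattice_weight (PiE (UNIV :: 'm set) (\<lambda>_. B))"
    proof (rule sum_mono2)
      show "finite ((PiE UNIV (\<lambda>_. B)) :: ('m \<Rightarrow> int) set)" using B by (intro finite_PiE) auto
      show "F \<subseteq> PiE UNIV (\<lambda>_. B)" by (auto simp: B_def)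
    qed (rule lattice_weight_nonneg)
    also have "\<dots> = (\<Prod>j\<in>(UNIV::'m set). sum ?b B)"
      unfolding lattice_weight_def using B by (subst prod_sum_PiE) auto
    also have "\<dots> \<le> (\<Prod>j\<in>(UNIV::'m set). s)" using s[OF B] by (intro prod_mono) (auto intro: sum_nonneg)
    finally show "sum lattice_weight F \<le> (\<Prod>j\<in>(UNIV::'m set). s)" .
  qed
qed (rule lattice_weight_nonneg)

section \<open>Even periodic functions as polynomials in cosines\<close>

text \<open>One-variable interpolation, applied to one coordinate after the other.\<close>

lemma trig_interpolation_multi:
  fixes F :: "complex^'m \<Rightarrow> complex"
  assumes hol: "\<And>\<tau> j. (\<lambda>w. F (upd_coord \<tau> j w)) holomorphic_on UNIV"
    and per: "\<And>\<tau> j w. F (upd_coord \<tau> j (w + 2 * of_real pi)) = F (upd_coord \<tau> j w)"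
    and bd: "\<And>\<tau> j. \<exists>C. \<forall>w. norm (F (upd_coord \<tau> j w)) \<le> C * exp (real L * \<bar>Im w\<bar>)"
  shows "F \<tau> = (\<Sum>\<rho>\<in>PiE UNIV (\<lambda>_. {..<2 * Suc L + 1}). F (\<chi> j. of_real (interp_node L (\<rho> j)))
    * (\<Prod>j\<in>UNIV. interp_kernel L (\<tau> $ j - of_real (interp_node L (\<rho> j)))))"
proof -
  define N where "N = 2 * Suc L + 1"
  have "finite J \<Longrightarrow> \<forall>\<tau>. F \<tau> = (\<Sum>\<rho>\<in>PiE J (\<lambda>_. {..<N}). F (\<chi> j. if j \<in> J then of_real (interp_node L (\<rho> j)) else \<tau> $ j)
    * (\<Prod>j\<in>J. interp_kernel L (\<tau> $ j - of_real (interp_node L (\<rho> j)))))" for J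
  proof (induction J rule: finite_induct)
    case empty
    show ?case by simp
  next
    case (insert k J)
    show ?case
    proof
      fix \<tau> :: "complex^'m"
      let ?R = "\<lambda>\<sigma> \<rho>. F (\<chi> j. if j \<in> J then of_real (interp_node L (\<rho> j)) else \<sigma> $ j) * (\<Prod>j\<in>J. interp_kernel L (\<sigma> $ j - of_real (interp_node L (\<rho> j))))"
      let ?S = "\<lambda>\<rho>. F (\<chi> j. if j \<in> insert k J then of_real (interp_node L (\<rho> j)) else \<tau> $ j) * (\<Prod>j\<in>insert k J. interp_kernel L (\<tau> $ j - of_real (interp_node L (\<rho> j))))"
      have u: "upd_coord \<tau> k (\<tau> $ k) = \<tau>" by (simp add: vec_eq_iff upd_coord_def)
      obtain C where C: "\<And>w. norm (F (upd_coord \<tau> k w)) \<le> C * exp (real L * \<bar>Im w\<bar>)" using bd by blast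
      have "F \<tau> = (\<Sum>r<N. F (upd_coord \<tau> k (of_real (interp_node L r))) * interp_kernel L (\<tau> $ k - of_real (interp_node L r)))"
        using trig_interpolation[OF hol per C, of "\<tau> $ k"] unfolding u N_def .
      also have "\<dots> = (\<Sum>r<N. \<Sum>\<rho>\<in>PiE J (\<lambda>_. {..<N}). ?S (\<rho>(k := r)))"
      proof (rule sum.cong[OF refl])
        fix r
        define \<sigma> where "\<sigma> = upd_coord \<tau> k (of_real (interp_node L r))"
        have "F \<sigma> = (\<Sum>\<rho>\<in>PiE J (\<lambda>_. {..<N}). ?R \<sigma> \<rho>)" by (rule insert.IH[rule_format])
        then have "F \<sigma> * interp_kernel L (\<tau> $ k - of_real (interp_node L r)) = (\<Sum>\<rho>\<in>PiE J (\<lambda>_. {..<N}). ?R \<sigma> \<rho> * interp_kernel L (\<tau> $ k - of_real (interp_node L r)))"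
          by (simp add: sum_distrib_right)
        also have "\<dots> = (\<Sum>\<rho>\<in>PiE J (\<lambda>_. {..<N}). ?S (\<rho>(k := r)))"
        proof (rule sum.cong[OF refl])
          fix \<rho>
          have 1: "(\<chi> j. if j \<in> J then of_real (interp_node L (\<rho> j)) else \<sigma> $ j)
            = (\<chi> j. if j \<in> insert k J then of_real (interp_node L ((\<rho>(k := r)) j)) else \<tau> $ j)"
            using insert.hyps by (auto simp: vec_eq_iff \<sigma>_def upd_coord_def)
          have 2: "(\<Prod>j\<in>J. interp_kernel L (\<sigma> $ j - of_real (interp_node L (\<rho> j))))
            = (\<Prod>j\<in>J. interp_kernel L (\<tau> $ j - of_real (interp_node L ((\<rho>(k := r)) j))))"
            using insert.hyps by (intro prod.cong) (auto simp: \<sigma>_def upd_coord_def)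
          show "?R \<sigma> \<rho> * interp_kernel L (\<tau> $ k - of_real (interp_node L r)) = ?S (\<rho>(k := r))"
            unfolding 1 2 prod.insert[OF insert.hyps] by (simp add: mult_ac)
        qed
        finally show "F (upd_coord \<tau> k (of_real (interp_node L r))) * interp_kernel L (\<tau> $ k - of_real (interp_node L r)) = (\<Sum>\<rho>\<in>PiE J (\<lambda>_. {..<N}). ?S (\<rho>(k := r)))"
          by (simp only: \<sigma>_def)
      qed
      also have "\<dots> = (\<Sum>(r, \<rho>)\<in>{..<N} \<times> PiE J (\<lambda>_. {..<N}). ?S (\<rho>(k := r)))"
        by (rule sum.cartesian_product)
      also have "\<dots> = (\<Sum>\<rho>\<in>PiE (insert k J) (\<lambda>_. {..<N}). ?S \<rho>)"
        unfolding PiE_insert_eq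
        using inj_combinator[OF insert.hyps(2), of "\<lambda>_. {..<N}"]
        by (subst sum.reindex) (auto simp: o_def case_prod_unfold)
      finally show "F \<tau> = (\<Sum>\<rho>\<in>PiE (insert k J) (\<lambda>_. {..<N}). ?S \<rho>)" .
    qed
  qed
  from this[of UNIV, OF finite, THEN spec, of \<tau>] show ?thesis by (simp only: N_def UNIV_I if_True)
qed

text \<open>The exponential of frequency \<open>k - (L + 1)\<close>; shifting the index makes frequencies of both signs accessible to natural numbers.\<close>

definition harmonic :: "nat \<Rightarrow> nat \<Rightarrow> complex \<Rightarrow> complex" where
  "harmonic L k w = exp (\<i> * of_int (int k - int (Suc L)) * w)"

lemma harmonic_diff: "harmonic L k (u - v) = harmonic L k u * harmonic L k (- v)"
  unfolding harmonic_def exp_add[symmetric] by (rule arg_cong[where f=exp]) (simp add: algebra_simps)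

lemma norm_harmonic: "norm (harmonic L k (of_real x + \<i> * of_real y)) = exp (- (real k - real (Suc L)) * y)"
  by (simp add: harmonic_def algebra_simps)

text \<open>Interpolation yields a trigonometric polynomial with frequencies in a cube. By orthogonality on the nodes, its
coefficients can be computed from the values of \<open>F\<close> on a real grid translated by any imaginary vector \<open>\<i> y\<close>, which bounds them by
\<open>exp (a * dual_norm V y + k \<bullet> y)\<close>, \<open>k\<close> being the frequency. If \<open>k\<close> is not in \<open>a V\<close>, a separating direction makes the exponent tend to
minus infinity.\<close>

lemma periodic_trig_polynomial:
  fixes F :: "complex^'m \<Rightarrow> complex" and V :: "(real^'m) set"
  assumes V: "pi_body V" and a: "0 < a"
    and hol: "\<And>\<tau> j. (\<lambda>w. F (upd_coord \<tau> j w)) holomorphic_on UNIV"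
    and per: "\<And>\<tau> j w. F (upd_coord \<tau> j (w + 2 * of_real pi)) = F (upd_coord \<tau> j w)"
    and bd: "\<And>\<tau>. norm (F \<tau>) \<le> B * exp (a * dual_norm V (cvec (imv \<tau>)))"
  obtains L c where "\<And>\<tau>. F \<tau> = (\<Sum>\<kappa>\<in>PiE UNIV (\<lambda>_. {..2 * Suc L}). c \<kappa> * (\<Prod>j\<in>UNIV. harmonic L (\<kappa> j) (\<tau> $ j)))"
    "\<And>\<kappa>. \<kappa> \<in> PiE UNIV (\<lambda>_. {..2 * Suc L}) \<Longrightarrow> c \<kappa> \<noteq> 0 \<Longrightarrow> (\<chi> j. real (\<kappa> j) - real (Suc L)) \<in> (\<lambda>t. a *\<^sub>R t) ` V"
proof -
  interpret pi_body V by (rule V)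
  have B: "0 \<le> B" using order_trans[OF norm_ge_zero bd[of 0]] by (simp add: zero_le_mult_iff)
  obtain L :: nat where L: "a * dual_norm V 1 \<le> real L" using real_arch_simple by blast
  define N where "N = 2 * Suc L + 1"
  define E where "E = (PiE UNIV (\<lambda>_. {..2 * Suc L}) :: ('m \<Rightarrow> nat) set)"
  define R where "R = (PiE UNIV (\<lambda>_. {..<N}) :: ('m \<Rightarrow> nat) set)"
  define nd where "nd \<rho> = (\<chi> j. complex_of_real (interp_node L (\<rho> j)))" for \<rho> :: "'m \<Rightarrow> nat"
  have finE: "finite E" unfolding E_def by (intro finite_PiE) auto
  have finR: "finite R" unfolding R_def by (intro finite_PiE) auto
  have N0: "(of_nat N :: complex) \<noteq> 0" unfolding N_def by (simp del: of_nat_Suc)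
  have bd1: "\<exists>C. \<forall>w. norm (F (upd_coord \<tau> j w)) \<le> C * exp (real L * \<bar>Im w\<bar>)" for \<tau> j
  proof (intro exI allI)
    fix w
    let ?d0 = "dual_norm V (cvec (imv (upd_coord \<tau> j 0)))"
    have "cvec (imv (upd_coord \<tau> j w)) = cvec (imv (upd_coord \<tau> j 0)) + cvec (axis j (Im w)) * 1"
      by (simp add: vec_eq_iff upd_coord_def axis_def)
    moreover have "dual_norm V (cvec (axis j (Im w)) * 1) \<le> \<bar>Im w\<bar> * dual_norm V 1"
      by (rule dual_norm_hadamard) (simp add: axis_def)
    ultimately have "dual_norm V (cvec (imv (upd_coord \<tau> j w))) \<le> ?d0 + \<bar>Im w\<bar> * dual_norm V 1"
      using dual_norm_triangle[of "cvec (imv (upd_coord \<tau> j 0))" "cvec (axis j (Im w)) * 1"] by simp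
    then have "a * dual_norm V (cvec (imv (upd_coord \<tau> j w))) \<le> a * (?d0 + \<bar>Im w\<bar> * dual_norm V 1)"
      using a by (intro mult_left_mono) auto
    also have "\<dots> = a * ?d0 + (a * dual_norm V 1) * \<bar>Im w\<bar>" by (simp add: algebra_simps)
    also have "\<dots> \<le> a * ?d0 + real L * \<bar>Im w\<bar>" using L by (intro add_left_mono mult_right_mono) auto
    finally have "B * exp (a * dual_norm V (cvec (imv (upd_coord \<tau> j w)))) \<le> B * (exp (a * ?d0) * exp (real L * \<bar>Im w\<bar>))"
      using B unfolding exp_add[symmetric] by (intro mult_left_mono) auto
    then show "norm (F (upd_coord \<tau> j w)) \<le> (B * exp (a * ?d0)) * exp (real L * \<bar>Im w\<bar>)"
      using bd[of "upd_coord \<tau> j w"] by (simp add: mult.assoc)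
  qed
  define c where "c \<kappa> = (\<Sum>\<rho>\<in>R. F (nd \<rho>) * (\<Prod>j\<in>UNIV. harmonic L (\<kappa> j) (- nd \<rho> $ j))) / of_nat N ^ CARD('m)" for \<kappa>
  have exp: "F \<tau> = (\<Sum>\<kappa>\<in>E. c \<kappa> * (\<Prod>j\<in>UNIV. harmonic L (\<kappa> j) (\<tau> $ j)))" for \<tau>
  proof -
    have "F \<tau> = (\<Sum>\<rho>\<in>R. F (nd \<rho>) * (\<Prod>j\<in>UNIV. interp_kernel L (\<tau> $ j - nd \<rho> $ j)))"
      using trig_interpolation_multi[OF hol per bd1, of \<tau>] by (simp only: R_def N_def nd_def vec_lambda_beta)
    also have "\<dots> = (\<Sum>\<rho>\<in>R. \<Sum>\<kappa>\<in>E. F (nd \<rho>) * ((\<Prod>j\<in>UNIV. harmonic L (\<kappa> j) (\<tau> $ j)) * (\<Prod>j\<in>UNIV. harmonic L (\<kappa> j) (- nd \<rho> $ j))) / of_nat N ^ CARD('m))"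
    proof (rule sum.cong[OF refl])
      fix \<rho>
      have "(\<Prod>j\<in>UNIV. interp_kernel L (\<tau> $ j - nd \<rho> $ j)) = (\<Prod>j\<in>UNIV. (\<Sum>k\<le>2 * Suc L. harmonic L k (\<tau> $ j - nd \<rho> $ j))) / of_nat N ^ CARD('m)"
        unfolding interp_kernel_def harmonic_def[symmetric] N_def[symmetric] by (simp only: prod_dividef prod_constant)
      also have "(\<Prod>j\<in>UNIV. (\<Sum>k\<le>2 * Suc L. harmonic L k (\<tau> $ j - nd \<rho> $ j))) = (\<Sum>\<kappa>\<in>E. \<Prod>j\<in>UNIV. harmonic L (\<kappa> j) (\<tau> $ j - nd \<rho> $ j))"
        unfolding E_def by (rule prod_sum_PiE) auto
      finally show "F (nd \<rho>) * (\<Prod>j\<in>UNIV. interp_kernel L (\<tau> $ j - nd \<rho> $ j)) = (\<Sum>\<kappa>\<in>E. F (nd \<rho>) * ((\<Prod>j\<in>UNIV. harmonic L (\<kappa> j) (\<tau> $ j)) * (\<Prod>j\<in>UNIV. harmonic L (\<kappa> j) (- nd \<rho> $ j))) / of_nat N ^ CARD('m))"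
        by (simp only: harmonic_diff prod.distrib sum_distrib_left sum_divide_distrib times_divide_eq_right)
    qed
    also have "\<dots> = (\<Sum>\<kappa>\<in>E. \<Sum>\<rho>\<in>R. F (nd \<rho>) * ((\<Prod>j\<in>UNIV. harmonic L (\<kappa> j) (\<tau> $ j)) * (\<Prod>j\<in>UNIV. harmonic L (\<kappa> j) (- nd \<rho> $ j))) / of_nat N ^ CARD('m))"
      by (rule sum.swap)
    also have "\<dots> = (\<Sum>\<kappa>\<in>E. c \<kappa> * (\<Prod>j\<in>UNIV. harmonic L (\<kappa> j) (\<tau> $ j)))"
      unfolding c_def sum_divide_distrib sum_distrib_right by (intro sum.cong refl) (simp add: mult_ac)
    finally show ?thesis .
  qed
  (* the translated grid: the coefficients do not depend on y, the bound does *)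
  have coef: "norm (c \<kappa>) \<le> B * exp (a * dual_norm V (cvec y) + (\<Sum>j\<in>UNIV. (real (\<kappa> j) - real (Suc L)) * y $ j))"
    if \<kappa>: "\<kappa> \<in> E" for \<kappa> y
  proof -
    define sh where "sh \<rho> = (\<chi> j. complex_of_real (interp_node L (\<rho> j)) + \<i> * of_real (y $ j))" for \<rho> :: "'m \<Rightarrow> nat"
    have orth: "(\<Sum>\<rho>\<in>R. (\<Prod>j\<in>UNIV. harmonic L (k j) (sh \<rho> $ j)) * (\<Prod>j\<in>UNIV. harmonic L (\<kappa> j) (- sh \<rho> $ j)))
      = (if k = \<kappa> then of_nat N ^ CARD('m) else 0)" if k: "k \<in> E" for k
    proof -
      have one: "(\<Sum>r<N. harmonic L (k j) (of_real (interp_node L r) + \<i> * of_real (y $ j)) * harmonic L (\<kappa> j) (- (of_real (interp_node L r) + \<i> * of_real (y $ j))))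
        = (if k j = \<kappa> j then of_nat N else 0)" for j
      proof -
        have h: "harmonic L (k j) (of_real (interp_node L r) + \<i> * of_real (y $ j)) * harmonic L (\<kappa> j) (- (of_real (interp_node L r) + \<i> * of_real (y $ j)))
          = exp (of_int (int (\<kappa> j) - int (k j)) * of_real (y $ j)) * exp (\<i> * of_int (int (k j) - int (\<kappa> j)) * of_real (interp_node L r))" for r
          unfolding harmonic_def exp_add[symmetric] by (rule arg_cong[where f=exp]) (simp add: algebra_simps)
        have "k j \<le> 2 * Suc L" "\<kappa> j \<le> 2 * Suc L" using k \<kappa> by (auto simp: E_def PiE_def Pi_def)
        from node_orthogonality[OF this] show ?thesis
          unfolding h sum_distrib_left[symmetric] N_def by simp
      qed
      have "(\<Sum>\<rho>\<in>R. (\<Prod>j\<in>UNIV. harmonic L (k j) (sh \<rho> $ j)) * (\<Prod>j\<in>UNIV. harmonic L (\<kappa> j) (- sh \<rho> $ j)))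
        = (\<Prod>j\<in>UNIV. if k j = \<kappa> j then of_nat N else 0)"
        unfolding one[symmetric] prod.distrib[symmetric] R_def
        by (subst prod_sum_PiE) (auto simp: sh_def)
      also have "\<dots> = (if k = \<kappa> then of_nat N ^ CARD('m) else 0)"
      proof (cases "k = \<kappa>")
        case False
        then obtain j where "k j \<noteq> \<kappa> j" by blast
        then have "(\<Prod>j\<in>UNIV. if k j = \<kappa> j then of_nat N else 0) = (0 :: complex)" by (intro prod_zero) auto
        then show ?thesis using False by simp
      qed simp
      finally show ?thesis .
    qed
    have "(\<Sum>\<rho>\<in>R. F (sh \<rho>) * (\<Prod>j\<in>UNIV. harmonic L (\<kappa> j) (- sh \<rho> $ j)))
      = (\<Sum>\<rho>\<in>R. \<Sum>k\<in>E. c k * ((\<Prod>j\<in>UNIV. harmonic L (k j) (sh \<rho> $ j)) * (\<Prod>j\<in>UNIV. harmonic L (\<kappa> j) (- sh \<rho> $ j))))"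
      unfolding exp sum_distrib_right by (simp only: mult.assoc)
    also have "\<dots> = (\<Sum>k\<in>E. c k * (\<Sum>\<rho>\<in>R. (\<Prod>j\<in>UNIV. harmonic L (k j) (sh \<rho> $ j)) * (\<Prod>j\<in>UNIV. harmonic L (\<kappa> j) (- sh \<rho> $ j))))"
      unfolding sum_distrib_left by (rule sum.swap)
    also have "\<dots> = (\<Sum>k\<in>E. c k * (if k = \<kappa> then of_nat N ^ CARD('m) else 0))"
      by (intro sum.cong refl) (simp only: orth)
    also have "\<dots> = c \<kappa> * of_nat N ^ CARD('m)" using \<kappa> finE by (simp add: if_distrib[of "\<lambda>x. _ * x"] sum.delta' cong: if_cong)
    finally have e: "c \<kappa> * of_nat N ^ CARD('m) = (\<Sum>\<rho>\<in>R. F (sh \<rho>) * (\<Prod>j\<in>UNIV. harmonic L (\<kappa> j) (- sh \<rho> $ j)))" by simp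
    define X where "X = B * exp (a * dual_norm V (cvec y) + (\<Sum>j\<in>UNIV. (real (\<kappa> j) - real (Suc L)) * y $ j))"
    have "norm (c \<kappa>) * real N ^ CARD('m) = norm (c \<kappa> * of_nat N ^ CARD('m))"
      by (simp add: norm_mult norm_power)
    also have "\<dots> \<le> (\<Sum>\<rho>\<in>R. X)" unfolding e
    proof (rule sum_norm_le)
      fix \<rho> assume "\<rho> \<in> R"
      have "imv (sh \<rho>) = y" by (simp add: vec_eq_iff sh_def)
      then have 1: "norm (F (sh \<rho>)) \<le> B * exp (a * dual_norm V (cvec y))" using bd[of "sh \<rho>"] by simp
      have "norm (harmonic L (\<kappa> j) (- sh \<rho> $ j)) = exp ((real (\<kappa> j) - real (Suc L)) * y $ j)" for j
        using norm_harmonic[of L "\<kappa> j" "- interp_node L (\<rho> j)" "- y $ j"] by (simp add: sh_def algebra_simps)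
      then have 2: "norm (\<Prod>j\<in>UNIV. harmonic L (\<kappa> j) (- sh \<rho> $ j)) = exp (\<Sum>j\<in>UNIV. (real (\<kappa> j) - real (Suc L)) * y $ j)"
        by (simp only: prod_norm[symmetric] exp_sum finite)
      show "norm (F (sh \<rho>) * (\<Prod>j\<in>UNIV. harmonic L (\<kappa> j) (- sh \<rho> $ j))) \<le> X"
        unfolding norm_mult 2 X_def exp_add using 1 by (simp add: mult.assoc[symmetric] mult_right_mono)
    qed
    also have "\<dots> = X * real N ^ CARD('m)" unfolding R_def by (simp add: card_PiE)
    finally show ?thesis unfolding X_def[symmetric] using N_def by simp
  qed
  have "(\<chi> j. real (\<kappa> j) - real (Suc L)) \<in> (\<lambda>t. a *\<^sub>R t) ` V" if \<kappa>: "\<kappa> \<in> E" and nz: "c \<kappa> \<noteq> 0" for \<kappa>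
  proof (rule ccontr)
    assume "(\<chi> j. real (\<kappa> j) - real (Suc L)) \<notin> (\<lambda>t. a *\<^sub>R t) ` V"
    then obtain u where u: "a * dual_norm V (cvec u) < (\<Sum>j\<in>UNIV. (\<chi> j. real (\<kappa> j) - real (Suc L)) $ j * u $ j)"
      by (rule separate_from_dilate[OF a])
    define g where "g = (\<Sum>j\<in>UNIV. (real (\<kappa> j) - real (Suc L)) * u $ j) - a * dual_norm V (cvec u)"
    have g: "0 < g" using u by (simp add: g_def)
    (* go to infinity in the direction - u *)
    have le: "norm (c \<kappa>) \<le> B * exp (- g * s)" if s: "0 \<le> s" for s
    proof -
      have "cvec (- s *\<^sub>R u) = of_real (- s) *s cvec u" by (simp add: vec_eq_iff)
      then have "dual_norm V (cvec (- s *\<^sub>R u)) \<le> s * dual_norm V (cvec u)"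
        using dual_norm_scale[of "of_real (- s)" "cvec u"] s by simp
      then have "a * dual_norm V (cvec (- s *\<^sub>R u)) \<le> a * (s * dual_norm V (cvec u))" using a by (intro mult_left_mono) auto
      moreover have "(\<Sum>j\<in>UNIV. (real (\<kappa> j) - real (Suc L)) * (- s *\<^sub>R u) $ j) = - s * (\<Sum>j\<in>UNIV. (real (\<kappa> j) - real (Suc L)) * u $ j)"
        unfolding sum_distrib_left by (intro sum.cong) auto
      ultimately have "a * dual_norm V (cvec (- s *\<^sub>R u)) + (\<Sum>j\<in>UNIV. (real (\<kappa> j) - real (Suc L)) * (- s *\<^sub>R u) $ j) \<le> - g * s"
        by (simp add: g_def algebra_simps)
      then have "B * exp (a * dual_norm V (cvec (- s *\<^sub>R u)) + (\<Sum>j\<in>UNIV. (real (\<kappa> j) - real (Suc L)) * (- s *\<^sub>R u) $ j)) \<le> B * exp (- g * s)"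
        using B by (intro mult_left_mono) auto
      then show ?thesis using coef[OF \<kappa>, of "- s *\<^sub>R u"] by linarith
    qed
    have "((\<lambda>s. B * exp (- g * s)) \<longlongrightarrow> 0) at_top" using g by real_asymp
    moreover have "eventually (\<lambda>s. norm (c \<kappa>) \<le> B * exp (- g * s)) at_top"
      using eventually_ge_at_top[of 0] by eventually_elim (rule le)
    ultimately have "norm (c \<kappa>) \<le> 0" by (intro tendsto_lowerbound) auto
    then show False using nz by simp
  qed
  then show ?thesis using exp unfolding E_def by (intro that[where L=L and c=c])
qed

text \<open>Symmetrizing in one variable after the other replaces exponentials by cosines of multiples, which are Chebyshev polynomials in the
cosines. The exponents \<open>|k\<^sub>j|\<close> are admissible by solidity of \<open>V\<close>.\<close>

lemma even_periodic_is_polynomial_in_cos: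
  fixes F :: "complex^'m \<Rightarrow> complex" and V :: "(real^'m) set"
  assumes V: "pi_body V" and a: "0 < a"
    and hol: "\<And>\<tau> j. (\<lambda>w. F (upd_coord \<tau> j w)) holomorphic_on UNIV"
    and per: "\<And>\<tau> j w. F (upd_coord \<tau> j (w + 2 * of_real pi)) = F (upd_coord \<tau> j w)"
    and bd: "\<And>\<tau>. norm (F \<tau>) \<le> B * exp (a * dual_norm V (cvec (imv \<tau>)))"
    and even: "\<And>j \<tau>. F (flip j \<tau>) = F \<tau>"
  obtains P where "P \<in> poly_space a V" "\<And>t. P (\<chi> j. cos (t $ j)) = F (cvec t)"
proof -
  interpret pi_body V by (rule V)
  obtain L c where exp: "\<And>\<tau>. F \<tau> = (\<Sum>\<kappa>\<in>PiE UNIV (\<lambda>_. {..2 * Suc L}). c \<kappa> * (\<Prod>j\<in>UNIV. harmonic L (\<kappa> j) (\<tau> $ j)))"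
    and supp: "\<And>\<kappa>. \<kappa> \<in> PiE UNIV (\<lambda>_. {..2 * Suc L}) \<Longrightarrow> c \<kappa> \<noteq> 0 \<Longrightarrow> (\<chi> j. real (\<kappa> j) - real (Suc L)) \<in> (\<lambda>t. a *\<^sub>R t) ` V"
    by (rule periodic_trig_polynomial[OF V a hol per bd]) blast
  define E where "E = (PiE UNIV (\<lambda>_. {..2 * Suc L}) :: ('m \<Rightarrow> nat) set)"
  define d where "d \<kappa> j = int (\<kappa> j) - int (Suc L)" for \<kappa> :: "'m \<Rightarrow> nat" and j
  have half: "harmonic L (\<kappa> j) w + harmonic L (\<kappa> j) (- w) = 2 * cos (of_int (d \<kappa> j) * w)" for \<kappa> j w
    unfolding harmonic_def d_def cos_exp_eq by (simp add: mult_ac)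
  have claim: "finite J \<Longrightarrow> \<forall>\<tau>. F \<tau> = (\<Sum>\<kappa>\<in>E. c \<kappa> * ((\<Prod>j\<in>J. cos (of_int (d \<kappa> j) * \<tau> $ j)) * (\<Prod>j\<in>-J. harmonic L (\<kappa> j) (\<tau> $ j))))" for J
  proof (induction J rule: finite_induct)
    case empty
    show ?case unfolding E_def using exp by simp
  next
    case (insert k J)
    show ?case
    proof
      fix \<tau> :: "complex^'m"
      let ?T = "\<lambda>\<kappa> \<tau>. (\<Prod>j\<in>J. cos (of_int (d \<kappa> j) * \<tau> $ j)) * (\<Prod>j\<in>-J. harmonic L (\<kappa> j) (\<tau> $ j))"
      let ?U = "\<lambda>\<kappa>. (\<Prod>j\<in>insert k J. cos (of_int (d \<kappa> j) * \<tau> $ j)) * (\<Prod>j\<in>-insert k J. harmonic L (\<kappa> j) (\<tau> $ j))"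
      have mJ: "- J = insert k (- insert k J)" using insert.hyps by auto
      have key: "?T \<kappa> \<tau> + ?T \<kappa> (flip k \<tau>) = 2 * ?U \<kappa>" for \<kappa>
      proof -
        have 1: "(\<Prod>j\<in>J. cos (of_int (d \<kappa> j) * flip k \<tau> $ j)) = (\<Prod>j\<in>J. cos (of_int (d \<kappa> j) * \<tau> $ j))"
          using insert.hyps by (intro prod.cong) (auto simp: flip_def)
        have 2: "(\<Prod>j\<in>-J. harmonic L (\<kappa> j) (\<sigma> $ j)) = harmonic L (\<kappa> k) (\<sigma> $ k) * (\<Prod>j\<in>-insert k J. harmonic L (\<kappa> j) (\<sigma> $ j))" for \<sigma> :: "complex^'m"
          unfolding mJ by (subst prod.insert) auto
        have 3: "(\<Prod>j\<in>-insert k J. harmonic L (\<kappa> j) (flip k \<tau> $ j)) = (\<Prod>j\<in>-insert k J. harmonic L (\<kappa> j) (\<tau> $ j))"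
          by (intro prod.cong) (auto simp: flip_def)
        have 4: "flip k \<tau> $ k = - \<tau> $ k" by (simp add: flip_def)
        show ?thesis unfolding 1 2 3 4 prod.insert[OF insert.hyps]
          using half[of \<kappa> k "\<tau> $ k"] by (simp add: distrib_left[symmetric] distrib_right[symmetric] mult_ac)
      qed
      have F1: "F \<sigma> = (\<Sum>\<kappa>\<in>E. c \<kappa> * ?T \<kappa> \<sigma>)" for \<sigma> by (rule insert.IH[rule_format])
      have "2 * F \<tau> = F \<tau> + F (flip k \<tau>)" by (simp add: even)
      also have "\<dots> = (\<Sum>\<kappa>\<in>E. c \<kappa> * (?T \<kappa> \<tau> + ?T \<kappa> (flip k \<tau>)))"
        unfolding F1[of \<tau>] F1[of "flip k \<tau>"] by (simp only: sum.distrib[symmetric] distrib_left)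
      also have "\<dots> = (\<Sum>\<kappa>\<in>E. 2 * (c \<kappa> * ?U \<kappa>))"
        unfolding key by (intro sum.cong refl) (simp only: mult_ac)
      also have "\<dots> = 2 * (\<Sum>\<kappa>\<in>E. c \<kappa> * ?U \<kappa>)" by (simp only: sum_distrib_left)
      finally show "F \<tau> = (\<Sum>\<kappa>\<in>E. c \<kappa> * ?U \<kappa>)" by (simp only: mult_cancel_left) simp
    qed
  qed
  have cosF: "F \<tau> = (\<Sum>\<kappa>\<in>E. c \<kappa> * (\<Prod>j\<in>UNIV. cos (of_int (d \<kappa> j) * \<tau> $ j)))" for \<tau>
    using claim[of UNIV, OF finite, THEN spec, of \<tau>] by (simp only: Compl_UNIV_eq prod.empty mult_1_right)
  obtain q :: "nat \<Rightarrow> complex poly" where q: "\<And>n. degree (q n) \<le> n" "\<And>n \<theta>. cos (of_nat n * \<theta>) = poly (q n) (cos \<theta>)"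
    using Chebyshev_poly_exists by metis
  define P where "P x = (\<Sum>\<kappa>\<in>E. c \<kappa> * (\<Prod>j\<in>UNIV. poly (q (nat \<bar>d \<kappa> j\<bar>)) (complex_of_real (x $ j))))" for x :: "real^'m"
  have "P \<in> poly_space a V" unfolding P_def
  proof (rule poly_space_sum)
    fix \<kappa> assume \<kappa>: "\<kappa> \<in> E"
    show "(\<lambda>x. c \<kappa> * (\<Prod>j\<in>UNIV. poly (q (nat \<bar>d \<kappa> j\<bar>)) (complex_of_real (x $ j)))) \<in> poly_space a V"
    proof (cases "c \<kappa> = 0")
      case True then show ?thesis by (simp add: poly_space_0)
    next
      case False
      then obtain t where t: "t \<in> V" "(\<chi> j. real (\<kappa> j) - real (Suc L)) = a *\<^sub>R t"
        using supp \<kappa> unfolding E_def by blast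
      have tj: "real (\<kappa> j) - real (Suc L) = a * t $ j" for j
        using arg_cong[OF t(2), of "\<lambda>v. v $ j"] by simp
      have "(\<chi> j. \<bar>t $ j\<bar>) \<in> V" by (rule V_solid[OF t(1)]) simp
      moreover have "(\<chi> j. real (nat \<bar>d \<kappa> j\<bar>)) = a *\<^sub>R (\<chi> j. \<bar>t $ j\<bar>)"
      proof -
        have "real (nat \<bar>d \<kappa> j\<bar>) = a * \<bar>t $ j\<bar>" for j
        proof -
          have "real (nat \<bar>d \<kappa> j\<bar>) = \<bar>real (\<kappa> j) - real (Suc L)\<bar>" by (simp add: d_def)
          then show ?thesis unfolding tj using a by (simp add: abs_mult)
        qed
        then show ?thesis by (simp add: vec_eq_iff)
      qed
      ultimately have "(\<lambda>j. nat \<bar>d \<kappa> j\<bar>) \<in> index_set a V" unfolding index_set_def by auto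
      then show ?thesis by (intro poly_space_cmult) (rule poly_space_prod[OF _ a q(1)])
    qed
  qed
  moreover have "P (\<chi> j. cos (t $ j)) = F (cvec t)" for t
  proof -
    have "poly (q (nat \<bar>d \<kappa> j\<bar>)) (complex_of_real (cos (t $ j))) = cos (of_int (d \<kappa> j) * cvec t $ j)" for \<kappa> j
    proof -
      have "poly (q (nat \<bar>d \<kappa> j\<bar>)) (complex_of_real (cos (t $ j))) = cos (of_nat (nat \<bar>d \<kappa> j\<bar>) * complex_of_real (t $ j))"
        unfolding q(2) by (simp add: cos_of_real)
      also have "\<dots> = cos (of_int (d \<kappa> j) * complex_of_real (t $ j))"
        by (cases "0 \<le> d \<kappa> j") auto
      finally show ?thesis by simp
    qed
    then show ?thesis unfolding P_def cosF by simp
  qed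
  ultimately show ?thesis using that by blast
qed

section \<open>Periodization\<close>

definition lattice_point :: "real \<Rightarrow> complex^'m \<Rightarrow> ('m \<Rightarrow> int) \<Rightarrow> complex^'m" where
  "lattice_point a \<tau> n = (\<chi> j. of_real a * (\<tau> $ j + 2 * of_real pi * of_int (n j)))"

text \<open>The sum of \<open>h\<close> over the translates of \<open>a \<tau>\<close> by the lattice of vectors with coordinates in \<open>2 pi a \<int>\<close>, a function of \<open>\<tau>\<close> with period \<open>2 pi\<close>.\<close>

definition periodization :: "real \<Rightarrow> (complex^'m \<Rightarrow> complex) \<Rightarrow> complex^'m \<Rightarrow> complex" where
  "periodization a h \<tau> = (\<Sum>\<^sub>\<infinity>n\<in>UNIV. h (lattice_point a \<tau> n))"

lemma summable_norm_bound_infsum: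
  fixes f :: "'a \<Rightarrow> complex"
  assumes "g summable_on A" "\<And>x. x \<in> A \<Longrightarrow> norm (f x) \<le> g x"
  shows "f summable_on A" "norm (infsum f A) \<le> infsum g A"
proof -
  show s: "f summable_on A"
    by (rule abs_summable_summable, rule Infinite_Sum.abs_summable_on_comparison_test'[OF assms])
  show "norm (infsum f A) \<le> infsum g A"
    by (rule norm_infsum_le[OF has_sum_infsum[OF s] has_sum_infsum[OF assms(1)] assms(2)])
qed

context pi_body
begin

context
  fixes h :: "complex^'m \<Rightarrow> complex" and C a :: real and M :: nat
  assumes hol: "line_holomorphic h" and even: "\<And>j z. h (flip j z) = h z" and C: "0 < C"
    and hb: "\<And>z. norm (h z) \<le> C * (\<Prod>j\<in>UNIV. 1 / (1 + norm (z $ j)) ^ (M + 3)) * exp (dual_norm V (cvec (imv z)))"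
    and a: "1 \<le> a"
begin

text \<open>Two of the \<open>M + 3\<close> orders of decay suffice for summability. The bound is uniform for bounded real parts, as is needed for holomorphy, and gives the type
\<open>a V\<close>.\<close>

lemma lattice_term_bound:
  assumes R: "\<And>j. \<bar>Re (\<tau> $ j)\<bar> \<le> R" "0 \<le> R"
  shows "norm (h (lattice_point a \<tau> n)) \<le> C * ((1 + R)\<^sup>2) ^ CARD('m) * exp (a * dual_norm V (cvec (imv \<tau>))) * lattice_weight n"
proof -
  let ?p = "lattice_point a \<tau> n"
  have one: "1 / (1 + norm (?p $ j)) ^ (M + 3) \<le> (1 + R)\<^sup>2 * (1 / (1 + real_of_int \<bar>n j\<bar>)\<^sup>2)" for j
  proof -
    define s where "s = 1 + norm (?p $ j)"
    have s1: "1 \<le> s" by (simp add: s_def)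
    have "2 * pi * \<bar>real_of_int (n j)\<bar> \<le> \<bar>Re (\<tau> $ j) + 2 * pi * real_of_int (n j)\<bar> + \<bar>Re (\<tau> $ j)\<bar>"
      using abs_triangle_ineq4[of "Re (\<tau> $ j) + 2 * pi * real_of_int (n j)" "Re (\<tau> $ j)"] by (simp add: abs_mult)
    moreover have "1 * \<bar>real_of_int (n j)\<bar> \<le> 2 * pi * \<bar>real_of_int (n j)\<bar>"
      using pi_ge_two by (intro mult_right_mono) auto
    moreover have "\<bar>Re (\<tau> $ j) + 2 * pi * real_of_int (n j)\<bar> \<le> norm (?p $ j)"
    proof -
      have "Re (?p $ j) = a * (Re (\<tau> $ j) + 2 * pi * real_of_int (n j))" by (simp add: lattice_point_def)
      moreover have "1 * \<bar>Re (\<tau> $ j) + 2 * pi * real_of_int (n j)\<bar> \<le> a * \<bar>Re (\<tau> $ j) + 2 * pi * real_of_int (n j)\<bar>"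
        using a by (intro mult_right_mono) auto
      ultimately show ?thesis using abs_Re_le_cmod[of "?p $ j"] a by (simp add: abs_mult)
    qed
    ultimately have "1 + \<bar>real_of_int (n j)\<bar> \<le> s + R" using R(1)[of j] by (simp add: s_def)
    also have "\<dots> \<le> (1 + R) * s" using s1 R(2) mult_left_mono[of 1 s R] by (simp add: algebra_simps)
    finally have "(1 + \<bar>real_of_int (n j)\<bar>)\<^sup>2 \<le> ((1 + R) * s)\<^sup>2" by (intro power_mono) auto
    moreover have "1 / s ^ (M + 3) \<le> 1 / s\<^sup>2" using s1 by (intro divide_left_mono power_increasing) auto
    moreover have "1 / s\<^sup>2 \<le> (1 + R)\<^sup>2 * (1 / (1 + \<bar>real_of_int (n j)\<bar>)\<^sup>2)"

    proof -
      have "(1 + \<bar>real_of_int (n j)\<bar>)\<^sup>2 \<le> (1 + R)\<^sup>2 * s\<^sup>2"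
        using calculation(1) unfolding power_mult_distrib .
      moreover have "0 < s\<^sup>2" "0 < (1 + \<bar>real_of_int (n j)\<bar>)\<^sup>2" using s1 by auto
      ultimately show ?thesis by (simp add: divide_simps mult.commute)
    qed
    ultimately show ?thesis by (simp add: s_def)
  qed
  have "cvec (imv ?p) = of_real a *s cvec (imv \<tau>)" by (simp add: vec_eq_iff lattice_point_def)
  then have d: "dual_norm V (cvec (imv ?p)) \<le> a * dual_norm V (cvec (imv \<tau>))"
    using dual_norm_scale[of "of_real a" "cvec (imv \<tau>)"] a by simp
  have "norm (h ?p) \<le> C * (\<Prod>j\<in>UNIV. 1 / (1 + norm (?p $ j)) ^ (M + 3)) * exp (dual_norm V (cvec (imv ?p)))" by (rule hb)
  also have "\<dots> \<le> C * (\<Prod>j\<in>UNIV. (1 + R)\<^sup>2 * (1 / (1 + real_of_int \<bar>n j\<bar>)\<^sup>2)) * exp (a * dual_norm V (cvec (imv \<tau>)))"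
    using one d C by (intro mult_mono mult_left_mono prod_mono) (auto intro!: mult_nonneg_nonneg prod_nonneg)
  also have "\<dots> = C * ((1 + R)\<^sup>2) ^ CARD('m) * exp (a * dual_norm V (cvec (imv \<tau>))) * lattice_weight n"
    by (simp only: prod.distrib prod_constant lattice_weight_def mult_ac)
  finally show ?thesis .
qed

lemma periodization_summable: "(\<lambda>n. h (lattice_point a \<tau> n)) summable_on UNIV"
proof -
  define R where "R = (\<Sum>j\<in>UNIV. \<bar>Re (\<tau> $ j)\<bar>)"
  have "\<bar>Re (\<tau> $ j)\<bar> \<le> R" "0 \<le> R" for j
    unfolding R_def by (auto intro!: member_le_sum sum_nonneg)
  from summable_norm_bound_infsum(1)[OF summable_on_cmult_right[OF lattice_weight_summable] lattice_term_bound[OF this]]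
  show ?thesis .
qed

lemma periodization_shift: "periodization a h (\<chi> j. \<tau> $ j + 2 * of_real pi * of_int (k j)) = periodization a h \<tau>"
proof -
  have "lattice_point a (\<chi> j. \<tau> $ j + 2 * of_real pi * of_int (k j)) n = lattice_point a \<tau> (\<lambda>j. n j + k j)" for n
    by (simp add: lattice_point_def vec_eq_iff algebra_simps)
  moreover have "bij_betw (\<lambda>n j. n j + k j) (UNIV :: ('m \<Rightarrow> int) set) UNIV"
    by (rule bij_betw_byWitness[where f'="\<lambda>n j. n j - k j"]) auto
  ultimately show ?thesis unfolding periodization_def
    using infsum_reindex_bij_betw[of "\<lambda>n j. n j + k j" UNIV UNIV "\<lambda>n. h (lattice_point a \<tau> n)"] by simp
qed

lemma periodization_periodic:
  "periodization a h (upd_coord \<tau> j (w + 2 * of_real pi)) = periodization a h (upd_coord \<tau> j w)"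
proof -
  have "upd_coord \<tau> j (w + 2 * of_real pi) = (\<chi> i. upd_coord \<tau> j w $ i + 2 * of_real pi * of_int (if i = j then 1 else 0))"
    by (simp add: vec_eq_iff upd_coord_def)
  then show ?thesis by (simp only: periodization_shift)
qed

lemma periodization_even: "periodization a h (flip j \<tau>) = periodization a h \<tau>"
proof -
  define \<phi> where "\<phi> n = (\<lambda>i. if i = j then - n i else n i)" for n :: "'m \<Rightarrow> int"
  have "lattice_point a (flip j \<tau>) n = flip j (lattice_point a \<tau> (\<phi> n))" for n
    by (simp add: lattice_point_def flip_def vec_eq_iff \<phi>_def algebra_simps)
  moreover have "bij_betw \<phi> UNIV UNIV"
    by (rule bij_betw_byWitness[where f'=\<phi>]) (auto simp: \<phi>_def)
  ultimately show ?thesis unfolding periodization_def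
    using infsum_reindex_bij_betw[of \<phi> UNIV UNIV "\<lambda>n. h (lattice_point a \<tau> n)"] by (simp add: even)
qed

text \<open>By periodicity the real parts may be taken in \<open>[0, 2 pi]\<close>.\<close>

lemma periodization_bound:
  "norm (periodization a h \<tau>) \<le> (C * ((1 + 2 * pi)\<^sup>2) ^ CARD('m) * infsum (lattice_weight :: ('m \<Rightarrow> int) \<Rightarrow> real) UNIV) * exp (a * dual_norm V (cvec (imv \<tau>)))"
proof -
  define k where "k j = - \<lfloor>Re (\<tau> $ j) / (2 * pi)\<rfloor>" for j
  define \<sigma> where "\<sigma> = (\<chi> j. \<tau> $ j + 2 * of_real pi * of_int (k j))"
  have P: "periodization a h \<tau> = periodization a h \<sigma>" unfolding \<sigma>_def by (rule periodization_shift[symmetric])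
  have im: "imv \<sigma> = imv \<tau>" by (simp add: vec_eq_iff \<sigma>_def)
  have re: "\<bar>Re (\<sigma> $ j)\<bar> \<le> 2 * pi" for j
  proof -
    define x where "x = Re (\<tau> $ j) / (2 * pi)"
    have "Re (\<sigma> $ j) = 2 * pi * (x - \<lfloor>x\<rfloor>)" by (simp add: \<sigma>_def k_def x_def field_simps)
    moreover have "\<bar>x - \<lfloor>x\<rfloor>\<bar> \<le> 1" by linarith
    ultimately show ?thesis by (simp add: abs_mult mult_left_le)
  qed
  have "0 \<le> 2 * pi" by simp
  note sb = summable_norm_bound_infsum(2)[OF summable_on_cmult_right[OF lattice_weight_summable] lattice_term_bound[OF re this]]
  have "norm (periodization a h \<sigma>) \<le> (\<Sum>\<^sub>\<infinity>n\<in>(UNIV :: ('m \<Rightarrow> int) set). C * ((1 + 2 * pi)\<^sup>2) ^ CARD('m) * exp (a * dual_norm V (cvec (imv \<sigma>))) * lattice_weight n)"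
    unfolding periodization_def using sb .
  also have "\<dots> = C * ((1 + 2 * pi)\<^sup>2) ^ CARD('m) * exp (a * dual_norm V (cvec (imv \<sigma>))) * infsum lattice_weight (UNIV :: ('m \<Rightarrow> int) set)"
    by (rule infsum_cmult_right')
  finally show ?thesis unfolding P im by (simp add: mult_ac)
qed

lemma periodization_holomorphic: "(\<lambda>w. periodization a h (upd_coord \<tau> j w)) holomorphic_on UNIV"
proof -
  have "(\<lambda>w. periodization a h (upd_coord \<tau> j w)) field_differentiable at w0" for w0
  proof -
    define r where "r = norm w0 + 1"
    define R where "R = r + (\<Sum>i\<in>UNIV. \<bar>Re (\<tau> $ i)\<bar>)"
    define d where "d = dual_norm V (cvec (imv (upd_coord \<tau> j 0))) + r * dual_norm V 1"
    define K where "K = C * ((1 + R)\<^sup>2) ^ CARD('m) * exp (a * d)"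
    have r: "0 < r" by (simp add: r_def add_nonneg_pos)
    have bound: "norm (h (lattice_point a (upd_coord \<tau> j w) n)) \<le> K * lattice_weight n" if w: "w \<in> cball 0 r" for n w
    proof -
      have nw: "norm w \<le> r" using w by simp
      have Ri: "\<bar>Re (upd_coord \<tau> j w $ i)\<bar> \<le> R" for i
      proof (cases "i = j")
        case True
        have "\<bar>Re w\<bar> \<le> r" using abs_Re_le_cmod[of w] nw by linarith
        then show ?thesis using True by (simp add: upd_coord_def R_def sum_nonneg add_increasing2)
      next
        case False
        have "\<bar>Re (\<tau> $ i)\<bar> \<le> (\<Sum>i\<in>UNIV. \<bar>Re (\<tau> $ i)\<bar>)" by (rule member_le_sum) auto
        then show ?thesis using False r by (simp add: upd_coord_def R_def)
      qed
      have R0: "0 \<le> R" using r by (simp add: R_def sum_nonneg)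
      have "cvec (imv (upd_coord \<tau> j w)) = cvec (imv (upd_coord \<tau> j 0)) + cvec (axis j (Im w)) * 1"
        by (simp add: vec_eq_iff upd_coord_def axis_def)
      moreover have "dual_norm V (cvec (axis j (Im w)) * 1) \<le> r * dual_norm V 1"
        by (rule dual_norm_hadamard) (use abs_Im_le_cmod[of w] nw r in \<open>auto simp: axis_def\<close>)
      ultimately have "dual_norm V (cvec (imv (upd_coord \<tau> j w))) \<le> d"
        using dual_norm_triangle[of "cvec (imv (upd_coord \<tau> j 0))" "cvec (axis j (Im w)) * 1"] by (simp add: d_def)
      then have "exp (a * dual_norm V (cvec (imv (upd_coord \<tau> j w)))) \<le> exp (a * d)" using a by simp
      then have "C * ((1 + R)\<^sup>2) ^ CARD('m) * exp (a * dual_norm V (cvec (imv (upd_coord \<tau> j w)))) * lattice_weight n \<le> K * lattice_weight n"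
        unfolding K_def using C lattice_weight_nonneg by (intro mult_right_mono mult_left_mono) auto
      then show ?thesis using lattice_term_bound[OF Ri R0, of n] by linarith
    qed
    have u: "uniform_limit (cball 0 r) (\<lambda>X w. \<Sum>n\<in>X. h (lattice_point a (upd_coord \<tau> j w) n))
        (\<lambda>w. periodization a h (upd_coord \<tau> j w)) (finite_subsets_at_top UNIV)"
      unfolding periodization_def
      by (rule Weierstrass_m_test_general[OF bound summable_on_cmult_right[OF lattice_weight_summable]])
    have fin: "(\<lambda>w. \<Sum>n\<in>X. h (lattice_point a (upd_coord \<tau> j w) n)) holomorphic_on UNIV" for X
    proof (rule holomorphic_on_sum)
      fix n
      define z where "z = lattice_point a (upd_coord \<tau> j 0) n"
      have "lattice_point a (upd_coord \<tau> j w) n = z + w *s axis j (of_real a)" for w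
        by (simp add: z_def vec_eq_iff lattice_point_def upd_coord_def axis_def algebra_simps)
      then show "(\<lambda>w. h (lattice_point a (upd_coord \<tau> j w) n)) holomorphic_on UNIV"
        using hol unfolding line_holomorphic_def by simp
    qed
    have "(\<lambda>w. periodization a h (upd_coord \<tau> j w)) holomorphic_on ball 0 r"
    proof (rule holomorphic_uniform_limit[OF _ u])
      show "eventually (\<lambda>X. continuous_on (cball 0 r) (\<lambda>w. \<Sum>n\<in>X. h (lattice_point a (upd_coord \<tau> j w) n)) \<and>
          (\<lambda>w. \<Sum>n\<in>X. h (lattice_point a (upd_coord \<tau> j w) n)) holomorphic_on ball 0 r) (finite_subsets_at_top UNIV)"
        using fin by (intro always_eventually allI conjI)
          (auto intro: holomorphic_on_subset continuous_on_subset[OF holomorphic_on_imp_continuous_on])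
    qed auto
    then show ?thesis by (rule holomorphic_on_imp_differentiable_at) (auto simp: r_def)
  qed
  then show ?thesis by (simp add: holomorphic_on_def field_differentiable_at_within)
qed

text \<open>For \<open>t\<close> in the period cell every term with \<open>n \<noteq> 0\<close> is evaluated at a point whose coordinates are at least as large as those of \<open>t\<close>, and
of size at least \<open>a\<close> in some coordinate. Of the \<open>M + 3\<close> orders of decay, \<open>M\<close> are kept as decay in \<open>t\<close>, two make the lattice sum
converge and one gives the factor \<open>1 / a\<close>.\<close>

lemma periodization_close:
  assumes t: "\<And>j. \<bar>t $ j\<bar> \<le> pi * a"
  shows "norm (periodization a h (cvec ((1 / a) *\<^sub>R t)) - h (cvec t))
    \<le> C * infsum (lattice_weight :: ('m \<Rightarrow> int) \<Rightarrow> real) UNIV / a * (\<Prod>j\<in>UNIV. 1 / (1 + \<bar>t $ j\<bar>) ^ M)"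
proof -
  define \<tau> where "\<tau> = cvec ((1 / a) *\<^sub>R t)"
  define D where "D = C / a * (\<Prod>j\<in>UNIV. 1 / (1 + \<bar>t $ j\<bar>) ^ M)"
  have a0: "0 < a" using a by simp
  have D: "0 \<le> D" using C a by (simp add: D_def prod_nonneg)
  have pt: "lattice_point a \<tau> n = cvec (\<chi> j. t $ j + 2 * pi * a * real_of_int (n j))" for n
    using a0 by (simp add: vec_eq_iff lattice_point_def \<tau>_def field_simps)
  have p0: "lattice_point a \<tau> (\<lambda>_. 0) = cvec t" unfolding pt by (simp add: vec_eq_iff)
  have tb: "norm (h (lattice_point a \<tau> n)) \<le> D * lattice_weight n" if n: "n \<noteq> (\<lambda>_. 0)" for n
  proof -
    define x where "x j = t $ j + 2 * pi * a * real_of_int (n j)" for j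
    (* |t_j| is at most half of the period 2 pi a *)
    have x0: "pi * a * \<bar>real_of_int (n j)\<bar> \<le> \<bar>x j\<bar>" if nj: "n j \<noteq> 0" for j
    proof -
      have "2 * pi * a * \<bar>real_of_int (n j)\<bar> \<le> \<bar>x j\<bar> + \<bar>t $ j\<bar>"
        using abs_triangle_ineq4[of "x j" "t $ j"] a by (simp add: x_def abs_mult)
      moreover have "pi * a * 1 \<le> pi * a * \<bar>real_of_int (n j)\<bar>" using nj a by (intro mult_left_mono) auto
      ultimately show ?thesis using t[of j] by linarith
    qed
    have pa: "a \<le> pi * a" using a pi_ge_two by simp
    have xa: "\<bar>t $ j\<bar> \<le> \<bar>x j\<bar>" "\<bar>real_of_int (n j)\<bar> \<le> \<bar>x j\<bar>" "n j \<noteq> 0 \<Longrightarrow> a \<le> \<bar>x j\<bar>" for j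
    proof -
      have 1: "pi * a * 1 \<le> pi * a * \<bar>real_of_int (n j)\<bar>" if "n j \<noteq> 0" using that a by (intro mult_left_mono) auto
      have "1 \<le> pi * a" using pa a by linarith
      then have 2: "1 * \<bar>real_of_int (n j)\<bar> \<le> pi * a * \<bar>real_of_int (n j)\<bar>" by (intro mult_right_mono) auto
      show "\<bar>t $ j\<bar> \<le> \<bar>x j\<bar>"
      proof (cases "n j = 0")
        case False then show ?thesis using x0[OF False] 1[OF False] t[of j] by linarith
      qed (simp add: x_def)
      show "\<bar>real_of_int (n j)\<bar> \<le> \<bar>x j\<bar>"
      proof (cases "n j = 0")
        case False then show ?thesis using x0[OF False] 2 by linarith
      qed simp
      show "a \<le> \<bar>x j\<bar>" if "n j \<noteq> 0" using x0[OF that] 1[OF that] pa by linarith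
    qed
    have f: "1 / (1 + \<bar>x j\<bar>) ^ (M + 3) \<le> (1 / (1 + \<bar>t $ j\<bar>) ^ M * (1 / (1 + real_of_int \<bar>n j\<bar>)\<^sup>2)) * (if n j = 0 then 1 else 1 / a)" for j
    proof -
      let ?s = "1 + \<bar>x j\<bar>"
      have "1 / ?s ^ (M + 3) = 1 / ?s ^ M * (1 / ?s\<^sup>2) * (1 / ?s)" by (simp add: power_add power2_eq_square power3_eq_cube)
      also have "\<dots> \<le> 1 / (1 + \<bar>t $ j\<bar>) ^ M * (1 / (1 + real_of_int \<bar>n j\<bar>)\<^sup>2) * (if n j = 0 then 1 else 1 / a)"
      proof (intro mult_mono)
        show "1 / ?s ^ M \<le> 1 / (1 + \<bar>t $ j\<bar>) ^ M"
          using xa(1)[of j] by (intro divide_left_mono power_mono mult_pos_pos zero_less_power) auto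
        show "1 / ?s\<^sup>2 \<le> 1 / (1 + real_of_int \<bar>n j\<bar>)\<^sup>2"
          using xa(2)[of j] by (intro divide_left_mono power_mono mult_pos_pos zero_less_power) auto
        show "1 / ?s \<le> (if n j = 0 then 1 else 1 / a)"
        proof (cases "n j = 0")
          case False
          have "1 / ?s \<le> 1 / a" using xa(3)[OF False] a0 by (intro divide_left_mono) auto
          then show ?thesis using False by simp
        qed simp
      qed auto
      finally show ?thesis .
    qed
    obtain j0 where j0: "n j0 \<noteq> 0" using n by auto
    have g: "(\<Prod>j\<in>UNIV. if n j = 0 then 1 else 1 / a) \<le> 1 / a"
    proof -
      have "(\<Prod>j\<in>UNIV. if n j = 0 then 1 else 1 / a) = (if n j0 = 0 then 1 else 1 / a) * (\<Prod>j\<in>UNIV - {j0}. if n j = 0 then 1 else 1 / a)"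
        by (rule prod.remove) auto
      also have "\<dots> \<le> 1 / a * 1" using a j0 by (intro mult_mono prod_le_1) (auto intro!: prod_nonneg split: if_splits)
      finally show ?thesis by simp
    qed
    have i0: "imv (lattice_point a \<tau> n) = 0" unfolding pt by simp
    have d0: "dual_norm V (cvec (0 :: real^'m)) \<le> 0"
      by (rule dual_norm_least) simp
    have "norm (h (lattice_point a \<tau> n)) \<le> C * (\<Prod>j\<in>UNIV. 1 / (1 + \<bar>x j\<bar>) ^ (M + 3)) * exp (dual_norm V (cvec (0 :: real^'m)))"
      using hb[of "lattice_point a \<tau> n"] unfolding i0 unfolding pt by (simp only: cvec_nth vec_lambda_beta norm_of_real x_def)
    also have "\<dots> \<le> C * (\<Prod>j\<in>UNIV. 1 / (1 + \<bar>x j\<bar>) ^ (M + 3)) * 1"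
      using d0 C by (intro mult_left_mono mult_nonneg_nonneg prod_nonneg) auto
    also have "\<dots> \<le> C * (\<Prod>j\<in>UNIV. (1 / (1 + \<bar>t $ j\<bar>) ^ M * (1 / (1 + real_of_int \<bar>n j\<bar>)\<^sup>2)) * (if n j = 0 then 1 else 1 / a)) * 1"
      using f C by (intro mult_right_mono mult_left_mono prod_mono) auto
    also have "\<dots> = C * ((\<Prod>j\<in>UNIV. 1 / (1 + \<bar>t $ j\<bar>) ^ M) * lattice_weight n) * (\<Prod>j\<in>UNIV. if n j = 0 then 1 else 1 / a)"
      by (simp only: prod.distrib lattice_weight_def mult_ac mult_1_right)
    also have "\<dots> \<le> C * ((\<Prod>j\<in>UNIV. 1 / (1 + \<bar>t $ j\<bar>) ^ M) * lattice_weight n) * (1 / a)"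
      using g C lattice_weight_nonneg by (intro mult_left_mono mult_nonneg_nonneg prod_nonneg) auto
    also have "\<dots> = D * lattice_weight n" by (simp add: D_def)
    finally show ?thesis .
  qed
  have s: "(\<lambda>n. h (lattice_point a \<tau> n)) summable_on UNIV" by (rule periodization_summable)
  have "periodization a h \<tau> = infsum (\<lambda>n. h (lattice_point a \<tau> n)) ({\<lambda>_. 0} \<union> - {\<lambda>_. 0})"
    unfolding periodization_def by (rule arg_cong2[where f=infsum]) auto
  also have "\<dots> = infsum (\<lambda>n. h (lattice_point a \<tau> n)) {\<lambda>_. 0} + infsum (\<lambda>n. h (lattice_point a \<tau> n)) (- {\<lambda>_. 0})"
    by (rule infsum_Un_disjoint) (use summable_on_subset_banach[OF s] in auto)
  finally have e: "periodization a h \<tau> - h (cvec t) = infsum (\<lambda>n. h (lattice_point a \<tau> n)) (- {\<lambda>_. 0})"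
    by (simp add: p0)
  have ws: "(\<lambda>n. D * lattice_weight n) summable_on - {\<lambda>_::'m. 0::int}"
    by (rule summable_on_subset_banach[OF summable_on_cmult_right[OF lattice_weight_summable]]) auto
  have "norm (periodization a h \<tau> - h (cvec t)) \<le> infsum (\<lambda>n. D * lattice_weight n) (- {\<lambda>_::'m. 0::int})"
    unfolding e by (rule summable_norm_bound_infsum(2)[OF ws]) (use tb in auto)
  also have "\<dots> \<le> infsum (\<lambda>n. D * lattice_weight n) (UNIV :: ('m \<Rightarrow> int) set)"
    using D by (intro infsum_mono2 ws summable_on_cmult_right lattice_weight_summable) (auto intro!: mult_nonneg_nonneg lattice_weight_nonneg)
  also have "\<dots> = D * infsum lattice_weight (UNIV :: ('m \<Rightarrow> int) set)" by (rule infsum_cmult_right')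
  finally show ?thesis by (simp add: \<tau>_def D_def mult_ac)
qed

lemma periodized_polynomial:
  obtains P where "P \<in> poly_space a V"
    "\<And>t. (\<And>j. \<bar>t $ j\<bar> \<le> pi * a) \<Longrightarrow> norm (P (\<chi> j. cos (t $ j / a)) - h (cvec t))
       \<le> C * infsum (lattice_weight :: ('m \<Rightarrow> int) \<Rightarrow> real) UNIV / a * (\<Prod>j\<in>UNIV. 1 / (1 + \<bar>t $ j\<bar>) ^ M)"
proof -
  have V: "pi_body V" by unfold_locales
  have a0: "0 < a" using a by simp
  obtain P where P: "P \<in> poly_space a V" "\<And>t. P (\<chi> j. cos (t $ j)) = periodization a h (cvec t)"
    by (rule even_periodic_is_polynomial_in_cos[OF V a0 periodization_holomorphic periodization_periodic periodization_bound periodization_even]) blast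
  show ?thesis
  proof (rule that[OF P(1)])
    fix t :: "real^'m" assume "\<And>j. \<bar>t $ j\<bar> \<le> pi * a"
    moreover have "P (\<chi> j. cos (t $ j / a)) = periodization a h (cvec ((1 / a) *\<^sub>R t))"
      using P(2)[of "(1 / a) *\<^sub>R t"] by simp
    ultimately show "norm (P (\<chi> j. cos (t $ j / a)) - h (cvec t))
       \<le> C * infsum (lattice_weight :: ('m \<Rightarrow> int) \<Rightarrow> real) UNIV / a * (\<Prod>j\<in>UNIV. 1 / (1 + \<bar>t $ j\<bar>) ^ M)"
      using periodization_close by simp
  qed
qed

end

end

section \<open>The lower bound\<close>

lemma nn_integral_inverse_square_finite: "(\<integral>\<^sup>+s. ennreal (1 / (1 + \<bar>s\<bar>)\<^sup>2) \<partial>(lborel :: real measure)) < \<infinity>"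
proof -
  have i: "integrable lborel (\<lambda>x::real. inverse (1 + x\<^sup>2))"
    using integrable_inverse_1_plus_square by (simp add: set_integrable_def einterval_def)
  have "(\<integral>\<^sup>+s. ennreal (1 / (1 + \<bar>s\<bar>)\<^sup>2) \<partial>(lborel :: real measure)) \<le> (\<integral>\<^sup>+s. ennreal (norm (inverse (1 + s\<^sup>2))) \<partial>(lborel :: real measure))"
  proof (intro nn_integral_mono ennreal_leI)
    fix s :: real
    have "(1 + \<bar>s\<bar>)\<^sup>2 = 1 + s\<^sup>2 + 2 * \<bar>s\<bar>" by (simp add: power2_eq_square algebra_simps)
    moreover have "0 < 1 + s\<^sup>2" by (simp add: add_pos_nonneg)
    ultimately have "1 / (1 + \<bar>s\<bar>)\<^sup>2 \<le> 1 / (1 + s\<^sup>2)" by (intro divide_left_mono) auto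
    then show "1 / (1 + \<bar>s\<bar>)\<^sup>2 \<le> norm (inverse (1 + s\<^sup>2))" by (simp add: inverse_eq_divide)
  qed
  also have "\<dots> < \<infinity>" using i unfolding integrable_iff_bounded by blast
  finally show ?thesis .
qed

lemma decay_weight_integral_finite:
  fixes l :: "'m::finite \<Rightarrow> real"
  assumes l: "\<And>j. 0 \<le> l j" and M: "\<And>j. 2 * l j + 2 \<le> real M * p" and p: "1 \<le> p" and K: "0 \<le> K"
  shows "(\<integral>\<^sup>+t. ennreal ((K * (\<Prod>j\<in>UNIV. 1 / (1 + \<bar>t $ j\<bar>) ^ M)) powr p) * power_weight l t \<partial>lborel) < \<infinity>"
proof -
  have "(\<integral>\<^sup>+t. ennreal ((K * (\<Prod>j\<in>UNIV. 1 / (1 + \<bar>t $ j\<bar>) ^ M)) powr p) * power_weight l t \<partial>(lborel :: (real^'m) measure))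
    \<le> (\<integral>\<^sup>+t. ennreal (K powr p) * (\<Prod>j\<in>UNIV. ennreal (1 / (1 + \<bar>t $ j\<bar>)\<^sup>2)) \<partial>(lborel :: (real^'m) measure))"
  proof (rule nn_integral_mono)
    fix t :: "real^'m"
    have one: "(1 / (1 + \<bar>t $ j\<bar>) ^ M) powr p * \<bar>t $ j\<bar> powr (2 * l j) \<le> 1 / (1 + \<bar>t $ j\<bar>)\<^sup>2" for j
    proof -
      define s where "s = 1 + \<bar>t $ j\<bar>"
      have s: "1 \<le> s" by (simp add: s_def)
      have "(1 / s ^ M) = s powr (- real M)" using s by (simp add: powr_minus powr_realpow divide_inverse)
      then have "(1 / s ^ M) powr p = s powr (- (real M * p))" by (simp add: powr_powr)
      moreover have "\<bar>t $ j\<bar> powr (2 * l j) \<le> s powr (2 * l j)" using l by (intro powr_mono2) (auto simp: s_def)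
      ultimately have "(1 / s ^ M) powr p * \<bar>t $ j\<bar> powr (2 * l j) \<le> s powr (- (real M * p)) * s powr (2 * l j)"
        by (simp add: mult_left_mono)
      also have "\<dots> = s powr (2 * l j - real M * p)" by (simp add: powr_add[symmetric])
      also have "\<dots> \<le> s powr (- 2)" using s M[of j] by (intro powr_mono) auto
      also have "\<dots> = 1 / s\<^sup>2" using s by (simp add: powr_minus powr_numeral divide_inverse)
      finally show ?thesis by (simp add: s_def)
    qed
    have e: "(\<Prod>j\<in>UNIV. 1 / (1 + \<bar>t $ j\<bar>) ^ M) powr p = (\<Prod>j\<in>UNIV. (1 / (1 + \<bar>t $ j\<bar>) ^ M) powr p)"
      by (rule prod_powr_distrib)
    have "ennreal ((K * (\<Prod>j\<in>UNIV. 1 / (1 + \<bar>t $ j\<bar>) ^ M)) powr p) * power_weight l t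
      = ennreal (K powr p * (\<Prod>j\<in>UNIV. (1 / (1 + \<bar>t $ j\<bar>) ^ M) powr p * \<bar>t $ j\<bar> powr (2 * l j)))"
      using K by (simp add: power_weight_def prod_ennreal ennreal_mult'[symmetric] powr_mult prod_nonneg e prod.distrib mult.assoc)
    also have "\<dots> \<le> ennreal (K powr p * (\<Prod>j\<in>UNIV. 1 / (1 + \<bar>t $ j\<bar>)\<^sup>2))"
      using one by (intro ennreal_leI mult_left_mono prod_mono) auto
    also have "\<dots> = ennreal (K powr p) * (\<Prod>j\<in>UNIV. ennreal (1 / (1 + \<bar>t $ j\<bar>)\<^sup>2))"
      by (simp add: prod_ennreal ennreal_mult' prod_nonneg)
    finally show "ennreal ((K * (\<Prod>j\<in>UNIV. 1 / (1 + \<bar>t $ j\<bar>) ^ M)) powr p) * power_weight l t \<le> \<dots>" .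
  qed
  also have "\<dots> = ennreal (K powr p) * (\<integral>\<^sup>+t. (\<Prod>j\<in>UNIV. ennreal (1 / (1 + \<bar>t $ j\<bar>)\<^sup>2)) \<partial>(lborel :: (real^'m) measure))"
    by (rule nn_integral_cmult) measurable
  also have "(\<integral>\<^sup>+t. (\<Prod>j\<in>UNIV. ennreal (1 / (1 + \<bar>t $ j\<bar>)\<^sup>2)) \<partial>(lborel :: (real^'m) measure)) = (\<Prod>j\<in>(UNIV::'m set). \<integral>\<^sup>+s. ennreal (1 / (1 + \<bar>s\<bar>)\<^sup>2) \<partial>lborel)"
    by (rule nn_integral_prod_coords[where \<phi>="\<lambda>_ s. ennreal (1 / (1 + \<bar>s\<bar>)\<^sup>2)"]) measurable
  also have "ennreal (K powr p) * \<dots> < \<infinity>"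
    using nn_integral_inverse_square_finite by (simp add: ennreal_mult_less_top less_top[symmetric] ennreal_prod_eq_top power_eq_top_ennreal power_less_top_ennreal ennreal_mult_eq_top_iff)
  finally show ?thesis .
qed

definition orthant :: "(real^'m) set" where "orthant = {t. \<forall>j. 0 < t $ j}"

lemma orthant_measurable [measurable]: "orthant \<in> sets (borel :: (real^'m) measure)"
proof -
  have "orthant = (\<Inter>j. {t::real^'m. 0 < t $ j})" by (auto simp: orthant_def)
  moreover have "open \<dots>" by (intro open_INT ballI open_Collect_less continuous_intros) auto
  ultimately show ?thesis by simp
qed

lemma orthant_integral:
  fixes g :: "real^'m \<Rightarrow> complex"
  assumes [measurable]: "g \<in> borel_measurable borel" and even: "\<And>j t. g (flip j t) = g t"
  shows "(\<integral>\<^sup>+t. ennreal (norm (g t) powr p) * power_weight l t \<partial>lborel)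
    = ennreal (2 ^ CARD('m)) * (\<integral>\<^sup>+t. ennreal (norm (g t) powr p) * power_weight l t * indicator orthant t \<partial>lborel)"
proof -
  have "power_weight l (flip j t) = power_weight l t" for j and t :: "real^'m"
    unfolding power_weight_def by (intro prod.cong) (auto simp: flip_def)
  then have "(\<integral>\<^sup>+t. ennreal (norm (g t) powr p) * power_weight l t \<partial>lborel)
    = 2 ^ CARD('m) * (\<integral>\<^sup>+t. ennreal (norm (g t) powr p) * power_weight l t * indicator {t. \<forall>j. 0 < t $ j} t \<partial>lborel)"
    using even by (intro nn_integral_flip_even) (auto simp: flip_def)
  then show ?thesis by (simp add: orthant_def ennreal_power[symmetric])
qed

lemma sine_weight_le: "0 \<le> \<beta> \<Longrightarrow> 0 < a \<Longrightarrow> sine_weight a \<beta> s \<le> ennreal (\<bar>s\<bar> powr (2 * \<beta>))"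
proof (cases "0 < s \<and> s < pi * a")
  case True
  assume b: "0 \<le> \<beta>" "0 < a"
  have sa: "0 < s / a" "s / a < pi" using True b by (auto simp: field_simps)
  have "a * sin (s / a) \<le> a * (s / a)" using b sa by (intro mult_left_mono sin_x_le_x) auto
  moreover have "0 \<le> a * sin (s / a)" using b sa by (simp add: sin_ge_zero)
  ultimately have "(a * sin (s / a)) powr (2 * \<beta>) \<le> \<bar>s\<bar> powr (2 * \<beta>)" using b True by (intro powr_mono2) auto
  then show ?thesis using True by (simp add: sine_weight_def ennreal_leI)
qed (auto simp: sine_weight_def indicator_def)

lemma scaled_sine_tendsto:
  assumes a: "filterlim a at_top sequentially"
  shows "(\<lambda>n. a n * sin (s / a n)) \<longlonglongrightarrow> (s::real)"
proof -
  have "((\<lambda>x. x * sin (s / x)) \<longlongrightarrow> s) at_top" by real_asymp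
  then show ?thesis using a by (rule filterlim_compose)
qed

lemma sine_weight_tendsto:
  assumes X: "filterlim X at_top sequentially" and s: "0 < s" and b: "b \<longlonglongrightarrow> \<beta>"
  shows "(\<lambda>n. sine_weight (X n) (b n) s) \<longlonglongrightarrow> ennreal (\<bar>s\<bar> powr (2 * \<beta>))"
proof -
  have "(\<lambda>n. ennreal ((X n * sin (s / X n)) powr (2 * b n))) \<longlonglongrightarrow> ennreal (s powr (2 * \<beta>))"
    using s by (intro tendsto_ennrealI tendsto_powr tendsto_mult tendsto_const scaled_sine_tendsto X b) auto
  moreover have "eventually (\<lambda>n. s < X n) sequentially" using X by (simp add: filterlim_at_top_dense)
  then have "eventually (\<lambda>n. ennreal ((X n * sin (s / X n)) powr (2 * b n)) = sine_weight (X n) (b n) s) sequentially"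
  proof eventually_elim
    case (elim n)
    then have "1 * X n < pi * X n" using s pi_gt_zero pi_ge_two by (intro mult_strict_right_mono) auto
    then have "s < pi * X n" using elim by linarith
    then have "s \<in> {0<..<pi * X n}" using s by simp
    then show ?case by (simp add: sine_weight_def)
  qed
  ultimately have "(\<lambda>n. sine_weight (X n) (b n) s) \<longlonglongrightarrow> ennreal (s powr (2 * \<beta>))" by (rule Lim_transform_eventually)
  then show ?thesis using s by simp
qed

text \<open>The exponents may vary with the scale, as they do in the upper bound.\<close>

lemma sine_weight_prod_tendsto:
  fixes t :: "real^'m"
  assumes X: "filterlim X at_top sequentially" and t: "\<And>j. 0 < t $ j" and b: "\<And>j. (\<lambda>n. b n j) \<longlonglongrightarrow> \<beta> j"
  shows "(\<lambda>n. \<Prod>j\<in>UNIV. sine_weight (X n) (b n j) (t $ j)) \<longlonglongrightarrow> power_weight \<beta> t"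
proof -
  have "finite S \<Longrightarrow> (\<lambda>n. \<Prod>j\<in>S. sine_weight (X n) (b n j) (t $ j)) \<longlonglongrightarrow> (\<Prod>j\<in>S. ennreal (\<bar>t $ j\<bar> powr (2 * \<beta> j)))" for S
  proof (induction S rule: finite_induct)
    case (insert j S)
    have "(\<lambda>n. sine_weight (X n) (b n j) (t $ j) * (\<Prod>j\<in>S. sine_weight (X n) (b n j) (t $ j)))
        \<longlonglongrightarrow> ennreal (\<bar>t $ j\<bar> powr (2 * \<beta> j)) * (\<Prod>j\<in>S. ennreal (\<bar>t $ j\<bar> powr (2 * \<beta> j)))"
      by (rule tendsto_mult_ennreal[OF sine_weight_tendsto[OF X t b] insert.IH]) (simp add: prod_ennreal)
    then show ?case using insert by simp
  qed simp
  then show ?thesis unfolding power_weight_def by simp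
qed

lemma eroot_surj: assumes p: "0 < p" shows "\<exists>x. eroot p x = y"
proof (cases y)
  case (real r)
  then have "eroot p (ennreal (r powr p)) = y" using p by (simp add: eroot_ennreal powr_powr)
  then show ?thesis by blast
next
  case top then show ?thesis by (intro exI[of _ top]) simp
qed

text \<open>A monotone function with open range is continuous; this is how continuity of the root at infinity is obtained.\<close>

lemma eroot_continuous: assumes p: "0 < p" shows "continuous_on UNIV (eroot p)"
proof (rule continuous_onI_mono)
  have "range (eroot p) = UNIV" using eroot_surj[OF p] by (metis rangeI UNIV_eq_I)
  then show "open (range (eroot p))" by simp
qed (rule eroot_mono[OF p])

lemma eroot_tendsto: assumes "0 < p" "(f \<longlongrightarrow> x) F" shows "((\<lambda>n. eroot p (f n)) \<longlongrightarrow> eroot p x) F"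
  by (rule continuous_on_tendsto_compose[OF eroot_continuous assms(2)]) (use assms in auto)

lemma inverse_ennreal_tendsto: "(f \<longlongrightarrow> (x::ennreal)) F \<Longrightarrow> ((\<lambda>n. inverse (f n)) \<longlongrightarrow> inverse x) F"
  using continuous_on_tendsto_compose[OF continuous_on_inverse_ennreal[OF continuous_on_id], of f x F UNIV] by simp

lemma ennreal_inverse_antimono: "(a::ennreal) \<le> b \<Longrightarrow> inverse b \<le> inverse a"
proof (cases "a = 0 \<or> b = top")
  case False
  assume le: "a \<le> b"
  then have "a \<noteq> top" using False by (auto simp: top_unique)
  then obtain x y where "a = ennreal x" "b = ennreal y" "0 < x" "0 < y"
    using False le by (cases a; cases b) (auto simp: less_le)
  then show ?thesis using le by (simp add: inverse_ennreal ennreal_leI)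
qed auto

lemma prod_mono_ennreal: "finite A \<Longrightarrow> (\<And>i. i \<in> A \<Longrightarrow> f i \<le> g i) \<Longrightarrow> prod f A \<le> (prod g A :: ennreal)"
  by (induction rule: finite_induct) (auto intro: mult_mono)

text \<open>The passage from the orthant to the whole space, in terms of reciprocals of norms; it produces the factor \<open>2 powr (m/p)\<close>.\<close>

lemma inverse_eroot_orthant:
  assumes "I = ennreal (2 ^ m) * J"
  shows "ennreal (2 powr (real m / p)) * inverse (eroot p I) = inverse (eroot p J)"
proof -
  define c where "c = 2 powr (real m / p)"
  have "eroot p I = ennreal c * eroot p J"
    unfolding assms c_def by (subst eroot_cmult) (auto simp: powr_realpow[symmetric] powr_powr)
  then have "inverse (eroot p I) = inverse (ennreal c) * inverse (eroot p J)"
    by (simp add: ennreal_inverse_mult' c_def)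
  moreover have "ennreal c * inverse (ennreal c) = 1"
    by (simp add: c_def inverse_ennreal ennreal_mult'[symmetric])
  ultimately show ?thesis unfolding c_def[symmetric] by (metis mult.assoc mult_1)
qed

text \<open>The quantity whose limit as \<open>a\<close> tends to infinity is to be found.\<close>

definition scaled_const :: "(real^'m) set \<Rightarrow> real \<Rightarrow> ('m \<Rightarrow> real) \<Rightarrow> real \<Rightarrow> ennreal" where
  "scaled_const V p l a = ennreal (a powr (- ((real CARD('m) + 2 * (\<Sum>j\<in>UNIV. l j)) / p)))
         * nikolskii (poly_space a V) p (jacobi_weight l) cube"

text \<open>The quotient of a single polynomial, with its norm rewritten by the cosine substitution.\<close>

lemma scaled_const_ge:
  fixes V :: "(real^'m) set"
  assumes P: "P \<in> poly_space a V" and x: "x \<in> cube" "P x \<noteq> 0" and a: "0 < a" and p: "1 \<le> p" and l: "\<And>j. 0 \<le> l j"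
  shows "ennreal (norm (P x)) * inverse (eroot p (\<integral>\<^sup>+t. ennreal (norm (P (\<chi> j. cos (t $ j / a))) powr p) * (\<Prod>j\<in>UNIV. sine_weight a (l j) (t $ j)) \<partial>lborel))
    \<le> scaled_const V p l a"
proof -
  define \<gamma> where "\<gamma> = real CARD('m) + 2 * (\<Sum>j\<in>UNIV. l j)"
  have Pc: "continuous_on UNIV P" by (rule poly_space_continuous[OF P])
  then have [measurable]: "P \<in> borel_measurable borel" by (rule borel_measurable_continuous_onI)
  define I where "I = (\<integral>\<^sup>+x. ennreal (norm (P x) powr p) * jacobi_weight l x * indicator cube x \<partial>lborel)"
  have w: "wnorm p (jacobi_weight l) cube P = eroot p I" unfolding I_def by (rule wnorm_eroot) measurable
  have J: "(\<integral>\<^sup>+t. ennreal (norm (P (\<chi> j. cos (t $ j / a))) powr p) * (\<Prod>j\<in>UNIV. sine_weight a (l j) (t $ j)) \<partial>lborel)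
     = ennreal (a powr \<gamma>) * I"
    unfolding I_def \<gamma>_def by (rule cube_integral_scaled[OF l a, symmetric]) measurable
  have "eroot p (ennreal (a powr \<gamma>) * I) = ennreal (a powr (\<gamma> / p)) * eroot p I"
    using a by (subst eroot_cmult) (auto simp: powr_powr)
  moreover have "inverse (ennreal (a powr (\<gamma> / p)) * eroot p I) = ennreal (a powr (- (\<gamma> / p))) * inverse (eroot p I)"
    using a by (subst ennreal_inverse_mult') (auto simp: powr_minus inverse_ennreal)
  ultimately have "ennreal (norm (P x)) * inverse (eroot p (ennreal (a powr \<gamma>) * I))
    = ennreal (a powr (- (\<gamma> / p))) * (ennreal (norm (P x)) / wnorm p (jacobi_weight l) cube P)"
    by (simp add: w divide_ennreal_def mult_ac)
  also have "\<dots> \<le> ennreal (a powr (- (\<gamma> / p))) * (Linf_norm cube P / wnorm p (jacobi_weight l) cube P)"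
    by (intro mult_left_mono divide_right_mono_ennreal Linf_norm_ge Pc x) auto
  also have "\<dots> \<le> ennreal (a powr (- (\<gamma> / p))) * nikolskii (poly_space a V) p (jacobi_weight l) cube"
    unfolding nikolskii_def by (intro mult_left_mono SUP_upper) (use P x in \<open>auto simp: nonzero_on_def\<close>)
  finally show ?thesis unfolding J scaled_const_def \<gamma>_def .
qed

context pi_body
begin

text \<open>The polynomials obtained by periodizing \<open>h\<close> converge to \<open>h\<close>, and the sine weights to the power weight, pointwise on the orthant. The integrands
are dominated by the power weight times the p-th power of a multiple of \<open>\<Prod>j. 1 / (1 + |t\<^sub>j|)^M\<close>, which is integrable by the choice of \<open>M\<close>.\<close>

text \<open>The function is approximated by even decaying ones with the same value at zero, whose integrals exceed that of \<open>f\<close> by a factor \<open>1 / \<theta>\<close> at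
most; then \<open>\<theta> \<rightarrow> 1\<close>.\<close>

lemma liminf_scaled_const_ge_decaying:
  fixes l :: "'m \<Rightarrow> real" and X :: "nat \<Rightarrow> real"
  assumes h: "even_decaying V (M + 3) h" and h0: "h 0 \<noteq> 0" and p: "1 \<le> p" and l: "\<And>j. 0 \<le> l j"
    and M: "\<And>j. 2 * l j + 2 \<le> real M * p" and X: "filterlim X at_top sequentially"
  defines "I \<equiv> (\<integral>\<^sup>+t. ennreal (norm (h (cvec t)) powr p) * power_weight l t \<partial>lborel)"
  shows "ennreal (2 powr (real CARD('m) / p)) * (ennreal (norm (h 0)) * inverse (eroot p I)) \<le> liminf (\<lambda>n. scaled_const V p l (X n))"
    and "I < \<infinity>"
proof -
  have hol: "line_holomorphic h" and even: "\<And>j z. h (flip j z) = h z" and hm[measurable]: "(\<lambda>t. h (cvec t)) \<in> borel_measurable borel"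
    using h by (auto simp: even_decaying_def)
  obtain C where C: "0 < C" and hb: "\<And>z. norm (h z) \<le> C * (\<Prod>j\<in>UNIV. 1 / (1 + norm (z $ j)) ^ (M + 3)) * exp (dual_norm V (cvec (imv z)))"
    using h unfolding even_decaying_def by blast
  define C' where "C' = C * infsum (lattice_weight :: ('m \<Rightarrow> int) \<Rightarrow> real) UNIV"
  have C': "0 \<le> C'" unfolding C'_def using C by (simp add: infsum_nonneg lattice_weight_nonneg)
  define T where "T t = (\<Prod>j\<in>UNIV. 1 / (1 + \<bar>t $ j\<bar>) ^ M)" for t :: "real^'m"
  have T0: "0 \<le> T t" for t by (simp add: T_def prod_nonneg)
  have hT: "norm (h (cvec t)) \<le> C * T t" for t
  proof -
    have d0: "dual_norm V (cvec (0 :: real^'m)) \<le> 0" by (rule dual_norm_least) simp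
    have "norm (h (cvec t)) \<le> C * (\<Prod>j\<in>UNIV. 1 / (1 + \<bar>t $ j\<bar>) ^ (M + 3)) * exp (dual_norm V (cvec (0 :: real^'m)))"
      using hb[of "cvec t"] by simp
    also have "\<dots> \<le> C * (\<Prod>j\<in>UNIV. 1 / (1 + \<bar>t $ j\<bar>) ^ M) * 1"
      using d0 C by (intro mult_mono mult_left_mono prod_mono) (auto intro!: divide_left_mono power_increasing mult_nonneg_nonneg prod_nonneg)
    finally show ?thesis by (simp add: T_def)
  qed
  have "\<exists>P. P \<in> poly_space (X n) V \<and> (\<forall>t. (\<forall>j. \<bar>t $ j\<bar> \<le> pi * X n) \<longrightarrow> norm (P (\<chi> j. cos (t $ j / X n)) - h (cvec t)) \<le> C' / X n * T t)"
    if "1 \<le> X n" for n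
    using periodized_polynomial[OF hol even C hb that] unfolding C'_def T_def by metis
  then obtain P where P: "\<And>n. 1 \<le> X n \<Longrightarrow> P n \<in> poly_space (X n) V"
    and Ph: "\<And>n t. 1 \<le> X n \<Longrightarrow> (\<And>j. \<bar>t $ j\<bar> \<le> pi * X n) \<Longrightarrow> norm (P n (\<chi> j. cos (t $ j / X n)) - h (cvec t)) \<le> C' / X n * T t"
    by metis
  (* finitely many indices n with X n < 1 may occur; there the zero polynomial serves *)
  define Q where "Q n = (if 1 \<le> X n then P n else (\<lambda>x. 0))" for n
  have Qm[measurable]: "Q n \<in> borel_measurable borel" for n
    unfolding Q_def using P[of n] poly_space_continuous borel_measurable_continuous_onI by auto
  define u where "u n t = ennreal (norm (Q n (\<chi> j. cos (t $ j / X n))) powr p) * (\<Prod>j\<in>UNIV. sine_weight (X n) (l j) (t $ j))" for n t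
  define J where "J = (\<integral>\<^sup>+t. ennreal (norm (h (cvec t)) powr p) * power_weight l t * indicator orthant t \<partial>lborel)"
  define W where "W t = ennreal (((C + C') * T t) powr p) * power_weight l t" for t
  have Wm[measurable]: "W \<in> borel_measurable borel" unfolding W_def T_def by measurable
  have Wfin: "(\<integral>\<^sup>+t. W t \<partial>lborel) < \<infinity>"
    unfolding W_def T_def by (rule decay_weight_integral_finite[OF l M p]) (use C C' in auto)
  have ev1: "eventually (\<lambda>n. 1 \<le> X n) sequentially" using X by (simp add: filterlim_at_top)
  have Qh: "norm (Q n (\<chi> j. cos (t $ j / X n)) - h (cvec t)) \<le> C' / X n * T t"
    if "1 \<le> X n" "\<And>j. \<bar>t $ j\<bar> \<le> pi * X n" for n t
    using Ph[OF that] that(1) by (simp add: Q_def)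
  have uW: "u n t \<le> W t" for n t
  proof (cases "1 \<le> X n \<and> (\<forall>j. 0 < t $ j \<and> t $ j < pi * X n)")
    case True
    have "norm (Q n (\<chi> j. cos (t $ j / X n))) \<le> norm (Q n (\<chi> j. cos (t $ j / X n)) - h (cvec t)) + norm (h (cvec t))"
      by (metis diff_add_cancel norm_triangle_ineq)
    also have "\<dots> \<le> C' / X n * T t + C * T t"
      using True by (intro add_mono Qh hT) (auto simp: abs_of_pos intro: less_imp_le)
    also have "C' / X n * T t \<le> C' * T t"
      using True C' T0[of t] by (intro mult_right_mono) (auto simp: divide_le_eq mult_le_cancel_left1)
    finally have "norm (Q n (\<chi> j. cos (t $ j / X n))) powr p \<le> ((C + C') * T t) powr p"
      using p by (intro powr_mono2) (auto simp: algebra_simps)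
    moreover have "(\<Prod>j\<in>UNIV. sine_weight (X n) (l j) (t $ j)) \<le> power_weight l t"
      unfolding power_weight_def using True l by (intro prod_mono_ennreal sine_weight_le) simp_all
    ultimately show ?thesis unfolding u_def W_def by (intro mult_mono ennreal_leI) auto
  next
    case False
    have "u n t = 0"
    proof (cases "1 \<le> X n")
      case True
      then obtain j where "\<not> (0 < t $ j \<and> t $ j < pi * X n)" using False by blast
      then have "sine_weight (X n) (l j) (t $ j) = 0" by (auto simp: sine_weight_def indicator_def)
      then have "(\<Prod>j\<in>UNIV. sine_weight (X n) (l j) (t $ j)) = 0" by (intro prod_zero) auto
      then show ?thesis by (simp add: u_def)
    next
      case False then show ?thesis using p by (simp add: u_def Q_def)
    qed
    then show ?thesis by simp
  qed
  have Qlim: "(\<lambda>n. Q n (\<chi> j. cos (t $ j / X n))) \<longlonglongrightarrow> h (cvec t)" for t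
  proof -
    have lim0: "(\<lambda>n. C' / X n * T t) \<longlonglongrightarrow> 0 * T t"
      by (intro tendsto_mult tendsto_const tendsto_divide_0[OF tendsto_const] filterlim_at_top_imp_at_infinity X)
    have "eventually (\<lambda>n. (\<Sum>j\<in>UNIV. \<bar>t $ j\<bar>) \<le> X n) sequentially" using X by (simp add: filterlim_at_top)
    then have "eventually (\<lambda>n. norm (Q n (\<chi> j. cos (t $ j / X n)) - h (cvec t)) \<le> C' / X n * T t) sequentially"
      using ev1
    proof eventually_elim
      case (elim n)
      have "\<bar>t $ j\<bar> \<le> pi * X n" for j
      proof -
        have "\<bar>t $ j\<bar> \<le> (\<Sum>j\<in>UNIV. \<bar>t $ j\<bar>)" by (rule member_le_sum) auto
        also have "\<dots> \<le> 1 * X n" using elim by simp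
        also have "\<dots> \<le> pi * X n" using elim pi_ge_two by (intro mult_right_mono) auto
        finally show ?thesis .
      qed
      with elim show ?case by (intro Qh) auto
    qed
    then have "(\<lambda>n. Q n (\<chi> j. cos (t $ j / X n)) - h (cvec t)) \<longlonglongrightarrow> 0"
      by (rule Lim_null_comparison) (use lim0 in simp)
    then show ?thesis by (rule Lim_null[THEN iffD2])
  qed
  have ulim: "(\<lambda>n. u n t) \<longlonglongrightarrow> ennreal (norm (h (cvec t)) powr p) * power_weight l t * indicator orthant t" for t
  proof (cases "t \<in> orthant")
    case True
    then have tp: "0 < t $ j" for j by (simp add: orthant_def)
    have wt: "power_weight l t < top" unfolding power_weight_def by (simp add: prod_ennreal)
    have "(\<lambda>n. \<Prod>j\<in>UNIV. sine_weight (X n) (l j) (t $ j)) \<longlonglongrightarrow> power_weight l t"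
      by (rule sine_weight_prod_tendsto[OF X tp tendsto_const])
    moreover have "(\<lambda>n. ennreal (norm (Q n (\<chi> j. cos (t $ j / X n))) powr p)) \<longlonglongrightarrow> ennreal (norm (h (cvec t)) powr p)"
      using p by (intro tendsto_ennrealI tendsto_powr2 tendsto_norm Qlim tendsto_const) auto
    ultimately show ?thesis unfolding u_def using True wt
      by (auto intro!: tendsto_mult_ennreal)
  next
    case False
    then obtain j where "\<not> 0 < t $ j" by (auto simp: orthant_def)
    then have "sine_weight (X n) (l j) (t $ j) = 0" for n by (auto simp: sine_weight_def indicator_def)
    then have "u n t = 0" for n unfolding u_def by (subst prod_zero) auto
    then show ?thesis using False by simp
  qed
  have lim: "(\<lambda>n. \<integral>\<^sup>+t. u n t \<partial>lborel) \<longlonglongrightarrow> J"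
    unfolding J_def
  proof (rule nn_integral_dominated_convergence[where w=W])
    show "u n \<in> borel_measurable lborel" for n unfolding u_def by measurable
  qed (use uW ulim Wfin in auto)
  have IJ: "I = ennreal (2 ^ CARD('m)) * J"
    unfolding I_def J_def
  proof (rule orthant_integral[OF hm])
    fix j and t :: "real^'m"
    have "cvec (flip j t) = flip j (cvec t)" by (simp add: vec_eq_iff flip_def)
    then show "h (cvec (flip j t)) = h (cvec t)" by (simp add: even)
  qed
  have "I \<le> (\<integral>\<^sup>+t. W t \<partial>lborel)" unfolding I_def W_def
  proof (intro nn_integral_mono mult_right_mono ennreal_leI powr_mono2)
    fix t :: "real^'m"
    have "C * T t \<le> (C + C') * T t" using C' T0 by (intro mult_right_mono) auto
    then show "norm (h (cvec t)) \<le> (C + C') * T t" using hT[of t] by linarith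
  qed (use p in auto)
  then show "I < \<infinity>" using Wfin by (rule order_le_less_trans)
  have p0: "0 < p" using p by simp
  define v where "v = ennreal (norm (h 0)) * inverse (eroot p J)"
  have one: "Q n (\<chi> j. cos ((0::real^'m) $ j / X n)) = Q n 1" for n
    by (rule arg_cong[where f="Q n"]) (simp add: vec_eq_iff)
  have c0: "cvec (0::real^'m) = 0" by (simp add: vec_eq_iff)
  have Q1: "(\<lambda>n. Q n 1) \<longlonglongrightarrow> h 0" using Qlim[of 0] unfolding one c0 .
  have "(\<lambda>n. ennreal (norm (Q n 1)) * inverse (eroot p (\<integral>\<^sup>+t. u n t \<partial>lborel))) \<longlonglongrightarrow> v"
    unfolding v_def
    by (intro tendsto_mult_ennreal tendsto_ennrealI tendsto_norm Q1 inverse_ennreal_tendsto eroot_tendsto[OF p0 lim]) (use h0 in auto)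
  then have "v = liminf (\<lambda>n. ennreal (norm (Q n 1)) * inverse (eroot p (\<integral>\<^sup>+t. u n t \<partial>lborel)))"
    by (simp add: lim_imp_Liminf)
  also have "\<dots> \<le> liminf (\<lambda>n. scaled_const V p l (X n))"
  proof (rule Liminf_mono)
    have "eventually (\<lambda>n. Q n 1 \<noteq> 0) sequentially" using Q1 h0 by (rule tendsto_imp_eventually_ne)
    then show "eventually (\<lambda>n. ennreal (norm (Q n 1)) * inverse (eroot p (\<integral>\<^sup>+t. u n t \<partial>lborel)) \<le> scaled_const V p l (X n)) sequentially"
      using ev1
    proof eventually_elim
      case (elim n)
      have "Q n \<in> poly_space (X n) V" using P[of n] elim by (simp add: Q_def)
      moreover have "(1 :: real^'m) \<in> cube" by (simp add: cube_def)
      ultimately show ?case unfolding u_def using elim by (intro scaled_const_ge p l) auto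
    qed
  qed
  finally have "v \<le> liminf (\<lambda>n. scaled_const V p l (X n))" .
  moreover have "ennreal (2 powr (real CARD('m) / p)) * (ennreal (norm (h 0)) * inverse (eroot p I)) = v"
    unfolding v_def inverse_eroot_orthant[OF IJ, of p, symmetric] by (simp add: mult_ac)
  ultimately show "ennreal (2 powr (real CARD('m) / p)) * (ennreal (norm (h 0)) * inverse (eroot p I)) \<le> liminf (\<lambda>n. scaled_const V p l (X n))"
    by simp
qed

lemma decay_exponent_exists:
  fixes l :: "'m \<Rightarrow> real"
  assumes p: "1 \<le> p" and l: "\<And>j. 0 \<le> l j"
  obtains M :: nat where "\<And>j. 2 * l j + 2 \<le> real M * p"
proof -
  obtain M :: nat where M: "(\<Sum>j\<in>UNIV. 2 * l j + 2) \<le> real M" using real_arch_simple by blast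
  have "2 * l j + 2 \<le> real M * p" for j
  proof -
    have "2 * l j + 2 \<le> (\<Sum>j\<in>UNIV. 2 * l j + 2)" by (rule member_le_sum) (use l in auto)
    also have "\<dots> \<le> real M * 1" using M by simp
    also have "\<dots> \<le> real M * p" using p by (intro mult_left_mono) auto
    finally show ?thesis .
  qed
  then show ?thesis by (rule that)
qed

lemma liminf_scaled_const_ge:
  fixes l :: "'m \<Rightarrow> real" and X :: "nat \<Rightarrow> real"
  assumes f: "f \<in> exp_type V" and p: "1 \<le> p" and l: "\<And>j. 0 \<le> l j" and X: "filterlim X at_top sequentially"
  defines "I \<equiv> (\<integral>\<^sup>+t. ennreal (norm (f (cvec t)) powr p) * power_weight l t \<partial>lborel)"
  assumes fin: "I < \<infinity>"
  shows "ennreal (2 powr (real CARD('m) / p)) * (ennreal (norm (f 0)) * inverse (eroot p I)) \<le> liminf (\<lambda>n. scaled_const V p l (X n))"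
proof (cases "f 0 = 0")
  case False
  obtain M :: nat where M: "\<And>j. 2 * l j + 2 \<le> real M * p" by (rule decay_exponent_exists[where l=l, OF p l]) blast
  define c where "c = ennreal (2 powr (real CARD('m) / p)) * (ennreal (norm (f 0)) * inverse (eroot p I))"
  let ?L = "liminf (\<lambda>n. scaled_const V p l (X n))"
  have key: "ennreal (\<theta> powr (1 / p)) * c \<le> ?L" if \<theta>: "0 < \<theta>" "\<theta> < 1" for \<theta>
  proof -
    obtain h where h: "even_decaying V (M + 3) h" "h 0 = f 0"
      and hI: "ennreal \<theta> * (\<integral>\<^sup>+t. ennreal (norm (h (cvec t)) powr p) * power_weight l t \<partial>lborel) \<le> I"
      using even_decaying_approximation[where l=l and q="M + 3", OF f p l fin[unfolded I_def] \<theta>] unfolding I_def by blast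
    define H where "H = (\<integral>\<^sup>+t. ennreal (norm (h (cvec t)) powr p) * power_weight l t \<partial>lborel)"
    have "eroot p (ennreal \<theta> * H) \<le> eroot p I" using hI p unfolding H_def by (intro eroot_mono) auto
    then have "ennreal (\<theta> powr (1 / p)) * eroot p H \<le> eroot p I" using \<theta> by (simp add: eroot_cmult)
    then have "inverse (eroot p I) \<le> inverse (ennreal (\<theta> powr (1 / p)) * eroot p H)" by (rule ennreal_inverse_antimono)
    also have "\<dots> = inverse (ennreal (\<theta> powr (1 / p))) * inverse (eroot p H)"
      using \<theta> by (intro ennreal_inverse_mult') auto
    finally have "ennreal (\<theta> powr (1 / p)) * inverse (eroot p I) \<le> ennreal (\<theta> powr (1 / p)) * (inverse (ennreal (\<theta> powr (1 / p))) * inverse (eroot p H))"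
      by (rule mult_left_mono) simp
    also have "\<dots> = inverse (eroot p H)"
      using \<theta> by (simp add: mult.assoc[symmetric] inverse_ennreal ennreal_mult'[symmetric])
    finally have "ennreal (2 powr (real CARD('m) / p)) * (ennreal (norm (f 0)) * (ennreal (\<theta> powr (1 / p)) * inverse (eroot p I)))
      \<le> ennreal (2 powr (real CARD('m) / p)) * (ennreal (norm (f 0)) * inverse (eroot p H))"
      by (intro mult_left_mono) auto
    also have "\<dots> \<le> ?L"
      using liminf_scaled_const_ge_decaying(1)[where l=l, OF h(1) _ p l M X] False h(2) unfolding H_def by simp
    finally show ?thesis by (simp add: c_def mult_ac)
  qed
  have "((\<lambda>\<theta>::real. ennreal (\<theta> powr (1 / p)) * c) \<longlongrightarrow> ennreal (1 powr (1 / p)) * c) (at_left 1)"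
    using p by (intro tendsto_mult_ennreal tendsto_ennrealI tendsto_powr tendsto_const tendsto_ident_at) auto
  moreover have "eventually (\<lambda>\<theta>::real. ennreal (\<theta> powr (1 / p)) * c \<le> ?L) (at_left 1)"
    using key by (auto intro!: eventually_at_leftI[of 0 1])
  ultimately have "ennreal (1 powr (1 / p)) * c \<le> ?L" by (rule tendsto_upperbound) simp
  then show ?thesis by (simp add: c_def)
qed simp

text \<open>Positivity prevents the normalized near-extremal polynomials of the upper bound from having unbounded norms.\<close>

lemma scaled_const_liminf_pos:
  fixes l :: "'m \<Rightarrow> real"
  assumes p: "1 \<le> p" and l: "\<And>j. 0 \<le> l j" and X: "filterlim X at_top sequentially"
  shows "0 < liminf (\<lambda>n. scaled_const V p l (X n))"
proof -
  obtain M :: nat where M: "\<And>j. 2 * l j + 2 \<le> real M * p" by (rule decay_exponent_exists[where l=l, OF p l]) blast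
  obtain h where h: "even_decaying V (M + 3) h" "h 0 = 1" by (rule even_decaying_exists) blast
  define H where "H = (\<integral>\<^sup>+t. ennreal (norm (h (cvec t)) powr p) * power_weight l t \<partial>lborel)"
  have h0: "h 0 \<noteq> 0" using h by simp
  note * = liminf_scaled_const_ge_decaying[where l=l, OF h(1) h0 p l M X, folded H_def]
  have "eroot p H \<noteq> top" using *(2) by (simp add: eroot_def)
  then have "0 < ennreal (2 powr (real CARD('m) / p)) * (ennreal (norm (h 0)) * inverse (eroot p H))"
    using h by (simp add: ennreal_zero_less_mult_iff ennreal_inverse_positive)
  then show ?thesis using *(1) by (rule less_le_trans)
qed

end

section \<open>The upper bound\<close>

lemma ennreal_inverse_inverse [simp]: "inverse (inverse x) = (x::ennreal)"
proof (cases x)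
  case (real r)
  show ?thesis
  proof (cases "r = 0")
    case False
    then have "0 < r" using real by simp
    then show ?thesis using real by (simp add: inverse_ennreal)
  qed (use real in simp)
qed simp

text \<open>The values of \<open>A\<close> and their limit may be infinite, so they are truncated at \<open>n + 1\<close> before being lowered by the factor \<open>1 - 1 / (n + 2)\<close>.\<close>

lemma real_approximation_from_below:
  fixes A :: "nat \<Rightarrow> ennreal"
  assumes pos: "\<And>n. 0 < A n" and lim: "A \<longlonglongrightarrow> S"
  obtains s :: "nat \<Rightarrow> real" where "\<And>n. 0 < s n" "\<And>n. ennreal (s n) < A n" "(\<lambda>n. ennreal (s n)) \<longlonglongrightarrow> S"
proof -
  define M where "M n = min (A n) (of_nat (Suc n))" for n
  have Mtop: "M n < top" for n by (simp add: M_def min_less_iff_disj of_nat_less_top)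
  have M0: "0 < M n" for n using pos[of n] by (simp add: M_def add_pos_nonneg)
  define s where "s n = enn2real (M n) * (1 - 1 / (real n + 2))" for n
  have q: "0 < 1 - 1 / (real n + 2)" "1 - 1 / (real n + 2) < 1" for n by (simp_all add: divide_less_eq)
  have r: "0 < enn2real (M n)" for n using M0[of n] Mtop[of n] by (simp add: enn2real_positive_iff)
  have sM: "ennreal (s n) < M n" for n
  proof -
    have "s n < enn2real (M n)" using q(2)[of n] r[of n] by (simp add: s_def)
    then have "ennreal (s n) < ennreal (enn2real (M n))" using r[of n] by (simp add: ennreal_lessI)
    then show ?thesis using Mtop[of n] by simp
  qed
  have "M \<longlonglongrightarrow> min S top" unfolding M_def
    by (intro tendsto_min lim) (use LIMSEQ_Suc[OF of_nat_tendsto_top_ennreal] in simp)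
  moreover have "(\<lambda>n. 1 - 1 / (real n + 2)) \<longlonglongrightarrow> 1" by real_asymp
  ultimately have "(\<lambda>n. M n * ennreal (1 - 1 / (real n + 2))) \<longlonglongrightarrow> min S top * ennreal 1"
    by (intro tendsto_mult_ennreal tendsto_ennrealI) auto
  moreover have "M n * ennreal (1 - 1 / (real n + 2)) = ennreal (s n)" for n
  proof -
    have "ennreal (s n) = ennreal (enn2real (M n)) * ennreal (1 - 1 / (real n + 2))"
      unfolding s_def using q[of n] by (intro ennreal_mult'') simp
    then show ?thesis using Mtop[of n] by simp
  qed
  ultimately have "(\<lambda>n. ennreal (s n)) \<longlonglongrightarrow> S" by simp
  moreover have "0 < s n" for n unfolding s_def by (rule mult_pos_pos[OF r q(1)])
  moreover have "ennreal (s n) < A n" for n using sM[of n] by (simp add: M_def)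
  ultimately show ?thesis using that by blast
qed

context pi_body
begin

lemma dual_norm_bounded: obtains D where "\<And>z. norm z \<le> R \<Longrightarrow> dual_norm V z \<le> D"
proof -
  have "bounded V" using body compact_imp_bounded unfolding convex_body_def by blast
  then obtain B where B: "\<And>t. t \<in> V \<Longrightarrow> norm t \<le> B" unfolding bounded_iff by blast
  have "dual_norm V z \<le> (\<Sum>j\<in>(UNIV::'m set). \<bar>B\<bar> * \<bar>R\<bar>)" if z: "norm z \<le> R" for z
  proof (intro dual_norm_least sum_norm_le)
    fix t j assume t: "t \<in> V"
    have "\<bar>t $ j\<bar> \<le> \<bar>B\<bar>" using component_le_norm_cart[of t j] B[OF t] by linarith
    moreover have "norm (z $ j) \<le> \<bar>R\<bar>" using Finite_Cartesian_Product.norm_nth_le[of z j] z by linarith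
    ultimately show "norm (complex_of_real (t $ j) * z $ j) \<le> \<bar>B\<bar> * \<bar>R\<bar>"
      by (simp add: norm_mult mult_mono)
  qed
  then show ?thesis by (rule that)
qed

text \<open>Exponents in \<open>a V\<close> give exponential type \<open>V\<close> for \<open>cos (z / a)\<close>, with a constant that depends on the coefficients. The
Phragmen-Lindelof estimate replaces this constant by the bound of \<open>Q\<close> on the cube, since \<open>cos\<close> maps real points into the cube.\<close>

lemma cos_extension:
  assumes Q: "Q \<in> poly_space a V" and b: "\<And>x. x \<in> cube \<Longrightarrow> norm (Q x) \<le> C" and C: "0 < C" and a: "0 < a"
  obtains f where "entire f" "\<And>t. f (cvec t) = Q (\<chi> j. cos (t $ j / a))"
    "\<And>z. norm (f z) \<le> C * exp (dual_norm V (cvec (imv z)))"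
proof -
  obtain c where c: "Q = (\<lambda>x. \<Sum>k\<in>index_set a V. c k * (\<Prod>j\<in>UNIV. complex_of_real (x $ j) ^ k j))"
    using Q unfolding poly_space_def index_set_def by blast
  define f where "f z = (\<Sum>k\<in>index_set a V. c k * (\<Prod>j\<in>UNIV. cos (z $ j / complex_of_real a) ^ k j))" for z :: "complex^'m"
  have ent: "entire f" unfolding f_def
    by (intro entire_sum entire_mult entire_const entire_prod
        entire_coordinate[where \<phi>="\<lambda>w. cos (w / complex_of_real a) ^ k j" for k j] holomorphic_intros) (use a in auto)
  have fQ: "f (cvec t) = Q (\<chi> j. cos (t $ j / a))" for t
    by (simp add: f_def c flip: of_real_divide cos_of_real)
  (* the exponents are a t for some t in V, so the product has type V *)
  have mon: "norm (\<Prod>j\<in>UNIV. cos (z $ j / complex_of_real a) ^ k j) \<le> exp (dual_norm V z)"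
    if k: "k \<in> index_set a V" for k and z :: "complex^'m"
  proof -
    obtain t where t: "t \<in> V" "\<And>j. real (k j) = a * t $ j" using k by (auto simp: index_set_def vec_eq_iff)
    have "norm (\<Prod>j\<in>UNIV. cos (z $ j / complex_of_real a) ^ k j) = (\<Prod>j\<in>UNIV. norm (cos (z $ j / complex_of_real a)) ^ k j)"
      by (simp add: prod_norm[symmetric] norm_power)
    also have "\<dots> \<le> (\<Prod>j\<in>UNIV. exp (\<bar>t $ j\<bar> * \<bar>imv z $ j\<bar>))"
    proof (intro prod_mono conjI zero_le_power norm_ge_zero)
      fix j
      have "norm (cos (z $ j / complex_of_real a)) \<le> exp (\<bar>Im (z $ j)\<bar> / a)"
        using cmod_cos_le_exp[of 1 "z $ j / complex_of_real a"] a by (simp add: abs_divide)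
      then have "norm (cos (z $ j / complex_of_real a)) ^ k j \<le> exp (\<bar>Im (z $ j)\<bar> / a) ^ k j" by (rule power_mono) simp
      also have "\<dots> = exp (real (k j) * (\<bar>Im (z $ j)\<bar> / a))" by (rule exp_of_nat_mult[symmetric])
      also have "real (k j) * (\<bar>Im (z $ j)\<bar> / a) = t $ j * \<bar>Im (z $ j)\<bar>" using a by (simp add: t(2))
      also have "exp \<dots> \<le> exp (\<bar>t $ j\<bar> * \<bar>imv z $ j\<bar>)" by (simp add: mult_right_mono)
      finally show "norm (cos (z $ j / complex_of_real a)) ^ k j \<le> exp (\<bar>t $ j\<bar> * \<bar>imv z $ j\<bar>)" .
    qed
    also have "\<dots> = exp (\<Sum>j\<in>UNIV. \<bar>t $ j\<bar> * \<bar>imv z $ j\<bar>)" by (simp add: exp_sum)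
    also have "\<dots> \<le> exp (dual_norm V z)"
      using abs_pairing_le_dual_norm[OF t(1), of "imv z"] dual_norm_Im_le[of z] by simp
    finally show ?thesis .
  qed
  have growth: "norm (f z) \<le> (\<Sum>k\<in>index_set a V. norm (c k)) * exp (1 * dual_norm V z)" for z
    unfolding f_def sum_distrib_right
    by (rule sum_norm_le) (use mon in \<open>simp add: norm_mult mult_left_mono\<close>)
  have "norm (f (cvec t)) \<le> C * (1 + norm t) ^ 0" for t
    unfolding fQ by (simp, rule b) (simp add: cube_def)
  then have "norm (f z) \<le> C * exp (dual_norm V (cvec (imv z)))" for z
    using phragmen_lindelof[OF entire_imp_line_holomorphic[OF ent] growth, of C 0 z] C by simp
  then show ?thesis using that ent fQ by blast
qed

text \<open>A polynomial \<open>h\<close> with quotient above \<open>s\<close> is translated so that a point \<open>y\<close>, at which it nearly attains its maximum, moves to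
the vertex, and is divided by \<open>h y\<close>. As the fibre measures exist for positive exponents only, the translation belongs to the
exponents \<open>l\<^sub>j + \<epsilon>\<close>; passing from \<open>l\<close> to these does not increase the norm of \<open>h\<close>, because \<open>1 - x\<^sub>j^2 \<le> 1\<close>, but the natural
scaling becomes \<open>m + 2 * sum l + 2 m \<epsilon>\<close>, whence the extra power of \<open>a\<close>.\<close>

lemma near_extremal:
  fixes l :: "'m \<Rightarrow> real"
  assumes a: "0 < a" and p: "1 \<le> p" and l: "\<And>j. 0 \<le> l j" and \<epsilon>: "0 < \<epsilon>"
    and s: "ennreal s < scaled_const V p l a" "0 < s"
  obtains Q where "Q \<in> poly_space a V" "Q 1 = 1" "\<And>x. x \<in> cube \<Longrightarrow> norm (Q x) \<le> 2"
    "eroot p (\<integral>\<^sup>+t. ennreal (norm (Q (\<chi> j. cos (t $ j / a))) powr p) * (\<Prod>j\<in>UNIV. sine_weight a (l j + \<epsilon>) (t $ j)) \<partial>lborel)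
      \<le> ennreal (a powr (2 * real CARD('m) * \<epsilon> / p) / s)"
proof -
  define \<gamma> where "\<gamma> = real CARD('m) + 2 * (\<Sum>j\<in>UNIV. l j)"
  define c where "c = a powr (- (\<gamma> / p))"
  have c: "0 < c" using a by (simp add: c_def)
  define \<mu> where "\<mu> j = l j + \<epsilon>" for j
  have \<mu>: "\<And>j. 0 < \<mu> j" using l \<epsilon> by (simp add: \<mu>_def add_nonneg_pos)
  have "ennreal s < (SUP h\<in>nonzero_on cube (poly_space a V). ennreal c * (Linf_norm cube h / wnorm p (jacobi_weight l) cube h))"
    using s(1) unfolding scaled_const_def nikolskii_def SUP_mult_left_ennreal c_def \<gamma>_def .
  then obtain h where h: "h \<in> nonzero_on cube (poly_space a V)"
    and hs: "ennreal s < ennreal c * (Linf_norm cube h / wnorm p (jacobi_weight l) cube h)"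
    unfolding less_SUP_iff by blast
  have hP: "h \<in> poly_space a V" using h by (simp add: nonzero_on_def)
  have hc: "continuous_on UNIV h" by (rule poly_space_continuous[OF hP])
  then have [measurable]: "h \<in> borel_measurable borel" by (rule borel_measurable_continuous_onI)
  obtain x0 where x0: "x0 \<in> cube" "\<And>x. x \<in> cube \<Longrightarrow> norm (h x) \<le> norm (h x0)"
  proof -
    have "(0::real^'m) \<in> cube" by (simp add: cube_def)
    then have "\<exists>x\<in>(cube::(real^'m) set). \<forall>y\<in>cube. norm (h y) \<le> norm (h x)"
      by (intro continuous_attains_sup cube_compact continuous_on_norm continuous_on_subset[OF hc]) auto
    then show ?thesis using that by blast
  qed
  define B where "B = norm (h x0)"
  have B: "0 < B"
  proof -
    obtain x where "x \<in> cube" "h x \<noteq> 0" using h by (auto simp: nonzero_on_def)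
    then show ?thesis using x0(2)[of x] by (auto simp: B_def)
  qed
  define E where "E = (\<integral>\<^sup>+x. ennreal (norm (h x) powr p) * jacobi_weight l x * indicator cube x \<partial>lborel)"
  have w: "wnorm p (jacobi_weight l) cube h = eroot p E" unfolding E_def by (rule wnorm_eroot) measurable
  have "Linf_norm cube h \<le> ennreal B"
    by (rule Linf_norm_le[OF hc]) (simp add: B_def x0(2) open_cube_subset)
  then have "ennreal c * (Linf_norm cube h / eroot p E) \<le> ennreal c * (ennreal B / eroot p E)"
    by (intro mult_left_mono divide_right_mono_ennreal) auto
  with hs have sB: "ennreal s < ennreal c * (ennreal B / eroot p E)" unfolding w by (rule less_le_trans)
  have "eroot p E \<noteq> top" using sB by (auto simp: divide_ennreal_def)
  then obtain e where e: "eroot p E = ennreal e" "0 \<le> e" by (cases "eroot p E") auto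
  have se: "s * e < c * B"
  proof (cases "e = 0")
    case True then show ?thesis using c B by simp
  next
    case False
    then have "ennreal c * (ennreal B / eroot p E) = ennreal (c * B / e)"
      using e B c by (simp add: divide_ennreal ennreal_mult'[symmetric])
    then have "s < c * B / e" using sB s(2) by (simp add: ennreal_less_iff)
    then show ?thesis using False e(2) by (simp add: pos_less_divide_eq)
  qed
  (* a value below the maximum that still gives the quotient s and at least half of the maximum *)
  define B' where "B' = max (B / 2) (s * e / c)"
  have B': "B' < B" using se B c by (simp add: B'_def pos_divide_less_eq mult.commute)
  have "open {z. B' < norm (h z)}" by (intro open_Collect_less continuous_intros hc)
  (* an interior point: generalized translation by boundary points degenerates *)
  then obtain y where y: "B' < norm (h y)" "y \<in> open_cube"
    using cube_point_near[OF x0(1), of "{z. B' < norm (h z)}"] B' by (auto simp: B_def)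
  have hy: "B \<le> 2 * norm (h y)" "s * e \<le> c * norm (h y)" "0 < norm (h y)"
    using y(1) B c by (auto simp: B'_def pos_divide_less_eq mult.commute)
  obtain P' where P': "P' \<in> poly_space a V" "\<And>x. x \<in> cube \<Longrightarrow> P' x = gtrans \<mu> y h x"
    using gtrans_poly[where \<mu>=\<mu>, OF pi_body_axioms hP a \<mu> y(2)] by blast
  define Q where "Q x = inverse (h y) * P' x" for x
  have Qp: "Q \<in> poly_space a V" unfolding Q_def by (rule poly_space_cmult[OF P'(1)])
  have one: "(1::real^'m) \<in> cube" by (simp add: cube_def)
  have Q1: "Q 1 = 1" using P'(2)[OF one] hy by (simp add: Q_def gtrans_one[where \<mu>=\<mu>, OF \<mu>])
  have nQ: "norm (Q x) = norm (gtrans \<mu> y h x) / norm (h y)" if "x \<in> cube" for x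
    by (simp add: Q_def P'(2)[OF that] norm_mult norm_inverse divide_inverse mult.commute)
  have hB: "norm (h x) \<le> B" if "x \<in> cube" for x using x0(2)[OF that] by (simp add: B_def)
  have Q2: "norm (Q x) \<le> 2" if x: "x \<in> cube" for x
  proof -
    have "norm (gtrans \<mu> y h x) \<le> B"
      by (rule gtrans_integrable(2)[where \<mu>=\<mu>, OF \<mu> hc hB x open_cube_subset[OF y(2)]])
    also have "\<dots> \<le> 2 * norm (h y)" by (rule hy)
    finally show ?thesis using hy(3) by (simp add: nQ[OF x] divide_le_eq)
  qed
  have [measurable]: "Q \<in> borel_measurable borel" by (rule borel_measurable_continuous_onI[OF poly_space_continuous[OF Qp]])
  have [measurable]: "P' \<in> borel_measurable borel" by (rule borel_measurable_continuous_onI[OF poly_space_continuous[OF P'(1)]])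
  define I where "I = (\<integral>\<^sup>+x. ennreal (norm (Q x) powr p) * jacobi_weight \<mu> x * indicator cube x \<partial>lborel)"
  have "I = (\<integral>\<^sup>+x. ennreal (norm (h y) powr - p) * (ennreal (norm (P' x) powr p) * jacobi_weight \<mu> x * indicator open_cube x) \<partial>lborel)"
    unfolding I_def
  proof (intro nn_integral_cong)
    fix x :: "real^'m"
    show "ennreal (norm (Q x) powr p) * jacobi_weight \<mu> x * indicator cube x
      = ennreal (norm (h y) powr - p) * (ennreal (norm (P' x) powr p) * jacobi_weight \<mu> x * indicator open_cube x)"
    proof (cases "x \<in> open_cube")
      case True
      then have xc: "x \<in> cube" by (rule open_cube_subset)
      have "norm (Q x) = inverse (norm (h y)) * norm (P' x)" by (simp add: Q_def norm_mult norm_inverse)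
      then have "norm (Q x) powr p = norm (h y) powr - p * norm (P' x) powr p"
        using hy(3) by (simp add: powr_mult inverse_powr powr_minus)
      then show ?thesis using True xc by (simp add: ennreal_mult' mult.assoc)
    next
      case False
      then show ?thesis using jacobi_weight_boundary[of x \<mu>] by (cases "x \<in> cube") auto
    qed
  qed
  also have "\<dots> = ennreal (norm (h y) powr - p) * (\<integral>\<^sup>+x. ennreal (norm (P' x) powr p) * jacobi_weight \<mu> x * indicator open_cube x \<partial>lborel)"
    by (rule nn_integral_cmult) measurable
  also have "(\<integral>\<^sup>+x. ennreal (norm (P' x) powr p) * jacobi_weight \<mu> x * indicator open_cube x \<partial>lborel)
    = (\<integral>\<^sup>+x. ennreal (norm (gtrans \<mu> y h x) powr p) * jacobi_weight \<mu> x * indicator open_cube x \<partial>lborel)"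
    by (intro nn_integral_cong) (simp add: P'(2) open_cube_subset indicator_def)
  also have "\<dots> \<le> (\<integral>\<^sup>+x. ennreal (norm (h x) powr p) * jacobi_weight \<mu> x * indicator open_cube x \<partial>lborel)"
    by (rule gtrans_contraction[where \<mu>=\<mu>, OF \<mu> hc hB y(2) p])
  also have "\<dots> \<le> E" unfolding E_def
  proof (rule nn_integral_mono)
    fix x :: "real^'m"
    show "ennreal (norm (h x) powr p) * jacobi_weight \<mu> x * indicator open_cube x \<le> ennreal (norm (h x) powr p) * jacobi_weight l x * indicator cube x"
    proof (cases "x \<in> open_cube")
      case True
      have "jacobi_weight \<mu> x \<le> jacobi_weight l x" unfolding jacobi_weight_def
      proof (intro prod_mono_ennreal ennreal_leI)
        fix j
        have "0 < 1 - (x $ j)\<^sup>2" using open_cube_sq[OF True] by simp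
        then show "(1 - (x $ j)\<^sup>2) powr (\<mu> j - 1 / 2) \<le> (1 - (x $ j)\<^sup>2) powr (l j - 1 / 2)"
          using \<epsilon> by (intro powr_mono') (auto simp: \<mu>_def)
      qed simp
      then show ?thesis using True open_cube_subset[OF True] by (simp add: mult_left_mono)
    qed simp
  qed
  finally have IE: "I \<le> ennreal (norm (h y) powr - p) * E" by (simp add: mult_left_mono)
  have p0: "0 < p" using p by simp
  have "eroot p I \<le> eroot p (ennreal (norm (h y) powr - p) * E)" by (rule eroot_mono[OF p0 IE])
  also have "\<dots> = ennreal (norm (h y) powr - 1) * ennreal e"
    using hy(3) p0 by (subst eroot_cmult) (auto simp: powr_powr e)
  also have "\<dots> = ennreal (e / norm (h y))"
    using hy(3) e(2) by (simp add: powr_minus ennreal_mult'[symmetric] divide_inverse mult.commute)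
  also have "\<dots> \<le> ennreal (c / s)"
  proof (rule ennreal_leI)
    have "e * s \<le> c * norm (h y)" using hy(2) by (simp add: mult.commute)
    then show "e / norm (h y) \<le> c / s" using hy(3) s(2) by (simp add: frac_le_eq divide_le_eq pos_le_divide_eq mult.commute)
  qed
  finally have Ic: "eroot p I \<le> ennreal (c / s)" .
  define \<sigma> where "\<sigma> = \<gamma> + 2 * real CARD('m) * \<epsilon>"
  have \<sigma>: "real CARD('m) + 2 * (\<Sum>j\<in>UNIV. \<mu> j) = \<sigma>"
    by (simp add: \<sigma>_def \<gamma>_def \<mu>_def sum.distrib algebra_simps)
  have "(\<integral>\<^sup>+t. ennreal (norm (Q (\<chi> j. cos (t $ j / a))) powr p) * (\<Prod>j\<in>UNIV. sine_weight a (\<mu> j) (t $ j)) \<partial>lborel) = ennreal (a powr \<sigma>) * I"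
    unfolding I_def \<sigma>[symmetric] by (rule cube_integral_scaled[where \<beta>=\<mu>, symmetric]) (use a \<mu> in \<open>auto intro: less_imp_le\<close>)
  then have "eroot p (\<integral>\<^sup>+t. ennreal (norm (Q (\<chi> j. cos (t $ j / a))) powr p) * (\<Prod>j\<in>UNIV. sine_weight a (\<mu> j) (t $ j)) \<partial>lborel)
    = ennreal (a powr (\<sigma> / p)) * eroot p I"
    using a by (simp add: eroot_cmult powr_powr)
  also have "\<dots> \<le> ennreal (a powr (\<sigma> / p)) * ennreal (c / s)" by (intro mult_left_mono Ic) simp
  also have "\<dots> = ennreal (a powr (2 * real CARD('m) * \<epsilon> / p) / s)"
  proof -
    have "a powr (\<sigma> / p) * c = a powr (2 * real CARD('m) * \<epsilon> / p)"
      by (simp add: c_def \<sigma>_def powr_add[symmetric] add_divide_distrib)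
    then show ?thesis using s(2) by (simp add: ennreal_mult'[symmetric])
  qed
  finally show ?thesis using that[OF Qp Q1 Q2] by (simp add: \<mu>_def)
qed

text \<open>With \<open>\<epsilon> = a^(-2)\<close> the extra factor \<open>a powr (2 m \<epsilon> / p)\<close> of the near-extremal polynomials tends to one. Their entire extensions are
locally bounded, and Fatou's lemma on the orthant bounds the norm of the limit function.\<close>

lemma scaled_const_limit_le:
  fixes l :: "'m \<Rightarrow> real" and Y :: "nat \<Rightarrow> real"
  assumes p: "1 \<le> p" and l: "\<And>j. 0 \<le> l j" and Y: "filterlim Y at_top sequentially" and Y1: "\<And>n. 1 \<le> Y n"
    and lim: "(\<lambda>n. scaled_const V p l (Y n)) \<longlonglongrightarrow> S" and S: "0 < S" and pos: "\<And>n. 0 < scaled_const V p l (Y n)"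
  obtains f where "f \<in> exp_type V" "f 0 = 1" "(\<integral>\<^sup>+t. ennreal (norm (f (cvec t)) powr p) * power_weight l t \<partial>lborel) < \<infinity>"
    "S \<le> ennreal (2 powr (real CARD('m) / p)) * inverse (eroot p (\<integral>\<^sup>+t. ennreal (norm (f (cvec t)) powr p) * power_weight l t \<partial>lborel))"
proof -
  have p0: "0 < p" using p by simp
  have Y0: "0 < Y n" for n using Y1[of n] by linarith
  obtain s :: "nat \<Rightarrow> real" where s: "\<And>n. 0 < s n" "\<And>n. ennreal (s n) < scaled_const V p l (Y n)" "(\<lambda>n. ennreal (s n)) \<longlonglongrightarrow> S"
    using real_approximation_from_below[OF pos lim] by blast
  define \<epsilon> where "\<epsilon> n = 1 / (Y n)\<^sup>2" for n
  have \<epsilon>: "0 < \<epsilon> n" for n using Y0[of n] by (simp add: \<epsilon>_def)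
  define \<delta> where "\<delta> n = Y n powr (2 * real CARD('m) * \<epsilon> n / p)" for n
  define ok where "ok n Q \<longleftrightarrow> Q \<in> poly_space (Y n) V \<and> Q 1 = 1 \<and> (\<forall>x\<in>cube. norm (Q x) \<le> 2) \<and>
      eroot p (\<integral>\<^sup>+t. ennreal (norm (Q (\<chi> j. cos (t $ j / Y n))) powr p) * (\<Prod>j\<in>UNIV. sine_weight (Y n) (l j + \<epsilon> n) (t $ j)) \<partial>lborel) \<le> ennreal (\<delta> n / s n)"
    for n and Q :: "real^'m \<Rightarrow> complex"
  have "\<exists>Q. ok n Q" for n
  proof (rule near_extremal[where l=l, OF Y0[of n] p l \<epsilon>[of n] s(2,1)[of n]])
    fix Q
    assume "Q \<in> poly_space (Y n) V" "Q 1 = 1" "\<And>x. x \<in> cube \<Longrightarrow> norm (Q x) \<le> 2"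
      "eroot p (\<integral>\<^sup>+t. ennreal (norm (Q (\<chi> j. cos (t $ j / Y n))) powr p) * (\<Prod>j\<in>UNIV. sine_weight (Y n) (l j + \<epsilon> n) (t $ j)) \<partial>lborel)
        \<le> ennreal (Y n powr (2 * real CARD('m) * \<epsilon> n / p) / s n)"
    then have "ok n Q" unfolding ok_def \<delta>_def by simp
    then show "\<exists>Q. ok n Q" by (rule exI[of "ok n" Q])
  qed
  then have "\<forall>n. \<exists>Q. ok n Q" ..
  then have "\<exists>Q. \<forall>n. ok n (Q n)" by (rule choice)
  then obtain Q where okQ: "\<forall>n. ok n (Q n)" ..
  have Q: "Q n \<in> poly_space (Y n) V" "Q n 1 = 1" "x \<in> cube \<Longrightarrow> norm (Q n x) \<le> 2"
    and Qi: "eroot p (\<integral>\<^sup>+t. ennreal (norm (Q n (\<chi> j. cos (t $ j / Y n))) powr p) * (\<Prod>j\<in>UNIV. sine_weight (Y n) (l j + \<epsilon> n) (t $ j)) \<partial>lborel) \<le> ennreal (\<delta> n / s n)" for n x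
    using okQ[rule_format, of n] unfolding ok_def by blast+
  define ext where "ext n F \<longleftrightarrow> entire F \<and> (\<forall>t. F (cvec t) = Q n (\<chi> j. cos (t $ j / Y n)))
      \<and> (\<forall>z. norm (F z) \<le> 2 * exp (dual_norm V (cvec (imv z))))" for n F
  have "\<exists>F. ext n F" for n
  proof (rule cos_extension[OF Q(1)[of n] Q(3)[of _ n] _ Y0[of n]])
    fix F
    assume "entire F" "\<And>t. F (cvec t) = Q n (\<chi> j. cos (t $ j / Y n))"
      "\<And>z. norm (F z) \<le> 2 * exp (dual_norm V (cvec (imv z)))"
    then have "ext n F" unfolding ext_def by blast
    then show "\<exists>F. ext n F" by (rule exI[of "ext n" F])
  qed simp_all
  then have "\<forall>n. \<exists>F. ext n F" ..
  then have "\<exists>F. \<forall>n. ext n (F n)" by (rule choice)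
  then obtain F where extF: "\<forall>n. ext n (F n)" ..
  have F: "entire (F n)" "F n (cvec t) = Q n (\<chi> j. cos (t $ j / Y n))"
    and Fb: "norm (F n z) \<le> 2 * exp (dual_norm V (cvec (imv z)))" for n t z
    using extF[rule_format, of n] unfolding ext_def by blast+
  have "\<exists>M. \<forall>n z. norm z \<le> R \<longrightarrow> norm (F n z) \<le> M" for R
  proof -
    obtain D where D: "\<And>z. norm z \<le> R \<Longrightarrow> dual_norm V z \<le> D" using dual_norm_bounded[of R] by blast
    have "norm (F n z) \<le> 2 * exp D" if "norm z \<le> R" for n z
    proof -
      have "dual_norm V (cvec (imv z)) \<le> D" using dual_norm_Im_le[of z] D[OF that] by linarith
      then show ?thesis using Fb[of n z] by (meson exp_le_cancel_iff mult_left_mono order_trans zero_le_numeral)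
    qed
    then show ?thesis by blast
  qed
  then obtain r f where r: "strict_mono (r :: nat \<Rightarrow> nat)" and f: "entire f" "\<And>z. (\<lambda>n. F (r n) z) \<longlonglongrightarrow> f z"
    by (rule entire_locally_bounded_limit[of F, OF F(1)]) blast+
  have fb: "norm (f z) \<le> 2 * exp (dual_norm V (cvec (imv z)))" for z
    using tendsto_norm[OF f(2)] by (rule LIMSEQ_le_const2) (use Fb in blast)
  have fV: "f \<in> exp_type V" unfolding exp_type_def
  proof (intro CollectI conjI f(1) allI impI exI[of _ 2])
    fix \<epsilon>' :: real and z :: "complex^'m" assume "0 < \<epsilon>'"
    then have "0 \<le> \<epsilon>' * dual_norm V z" using dual_norm_nonneg[of z] by simp
    then have "dual_norm V (cvec (imv z)) \<le> (1 + \<epsilon>') * dual_norm V z"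
      using dual_norm_Im_le[of z] by (simp add: distrib_right)
    then show "norm (f z) \<le> 2 * exp ((1 + \<epsilon>') * dual_norm V z)"
      using fb[of z] by (meson exp_le_cancel_iff mult_left_mono order_trans zero_le_numeral)
  qed simp
  have F0: "F n 0 = 1" for n
  proof -
    have "F n (cvec 0) = Q n 1" unfolding F(2) by (rule arg_cong[where f="Q n"]) (simp add: vec_eq_iff)
    moreover have "cvec (0::real^'m) = 0" by (simp add: vec_eq_iff)
    ultimately show ?thesis using Q(2) by simp
  qed
  have f0: "f 0 = 1" using LIMSEQ_unique[OF f(2)[of 0], of 1] by (simp add: F0)
  have feven: "f (cvec (flip j t)) = f (cvec t)" for j t
  proof -
    have "(\<chi> i. cos (flip j t $ i / Y n)) = (\<chi> i. cos (t $ i / Y n))" for n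
      by (simp add: vec_eq_iff flip_def)
    then have "F n (cvec (flip j t)) = F n (cvec t)" for n by (simp add: F(2))
    then show ?thesis using f(2)[of "cvec (flip j t)"] f(2)[of "cvec t"] LIMSEQ_unique by simp
  qed
  have cm: "(\<lambda>t. g (cvec t)) \<in> borel_measurable borel" if "entire g" for g :: "complex^'m \<Rightarrow> complex"
  proof (rule borel_measurable_continuous_onI)
    have "continuous_on UNIV (cvec :: real^'m \<Rightarrow> complex^'m)" unfolding cvec_def by (intro continuous_intros)
    then show "continuous_on UNIV (\<lambda>t. g (cvec t))"
      using continuous_on_compose2[OF entire_imp_continuous[OF that], of UNIV cvec] by blast
  qed
  have [measurable]: "(\<lambda>t. f (cvec t)) \<in> borel_measurable borel" "(\<lambda>t. F n (cvec t)) \<in> borel_measurable borel" for n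
    by (rule cm[OF f(1)], rule cm[OF F(1)])
  define I where "I = (\<integral>\<^sup>+t. ennreal (norm (f (cvec t)) powr p) * power_weight l t \<partial>lborel)"
  define J where "J = (\<integral>\<^sup>+t. ennreal (norm (f (cvec t)) powr p) * power_weight l t * indicator orthant t \<partial>lborel)"
  have IJ: "I = ennreal (2 ^ CARD('m)) * J" unfolding I_def J_def by (rule orthant_integral) (use feven in measurable)
  define u where "u n t = ennreal (norm (F (r n) (cvec t)) powr p) * (\<Prod>j\<in>UNIV. sine_weight (Y (r n)) (l j + \<epsilon> (r n)) (t $ j))" for n and t :: "real^'m"
  have um[measurable]: "u n \<in> borel_measurable borel" for n unfolding u_def by measurable
  have uI: "eroot p (\<integral>\<^sup>+t. u n t \<partial>lborel) \<le> ennreal (\<delta> (r n) / s (r n))" for n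
    unfolding u_def F(2) by (rule Qi)
  have rtop: "filterlim r at_top sequentially" using r by (rule filterlim_subseq)
  have Yr: "filterlim (\<lambda>n. Y (r n)) at_top sequentially" using Y rtop by (rule filterlim_compose)
  have "((\<lambda>y::real. 1 / y\<^sup>2) \<longlongrightarrow> 0) at_top" by real_asymp
  then have \<epsilon>0: "(\<lambda>n. \<epsilon> (r n)) \<longlonglongrightarrow> 0" unfolding \<epsilon>_def using Yr by (rule filterlim_compose)
  have "((\<lambda>y::real. y powr (k * (1 / y\<^sup>2))) \<longlongrightarrow> 1) at_top" for k :: real by real_asymp
  then have "(\<lambda>n. Y (r n) powr ((2 * real CARD('m) / p) * (1 / (Y (r n))\<^sup>2))) \<longlonglongrightarrow> 1" using Yr by (rule filterlim_compose)
  then have \<delta>1: "(\<lambda>n. \<delta> (r n)) \<longlonglongrightarrow> 1" by (simp add: \<delta>_def \<epsilon>_def mult.commute)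
  have ulim: "(\<lambda>n. u n t) \<longlonglongrightarrow> ennreal (norm (f (cvec t)) powr p) * power_weight l t" if "t \<in> orthant" for t
  proof -
    have t: "0 < t $ j" for j using that by (simp add: orthant_def)
    have b: "(\<lambda>n. l j + \<epsilon> (r n)) \<longlonglongrightarrow> l j" for j using tendsto_add[OF tendsto_const \<epsilon>0, of "l j"] by simp
    have "(\<lambda>n. \<Prod>j\<in>UNIV. sine_weight (Y (r n)) (l j + \<epsilon> (r n)) (t $ j)) \<longlonglongrightarrow> power_weight l t"
      by (rule sine_weight_prod_tendsto[OF Yr t b])
    moreover have "(\<lambda>n. ennreal (norm (F (r n) (cvec t)) powr p)) \<longlonglongrightarrow> ennreal (norm (f (cvec t)) powr p)"
      using p0 by (intro tendsto_ennrealI tendsto_powr2 tendsto_norm f(2) tendsto_const) auto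
    moreover have "power_weight l t < top" unfolding power_weight_def by (simp add: prod_ennreal)
    ultimately show ?thesis unfolding u_def by (intro tendsto_mult_ennreal) auto
  qed
  have "J \<le> (\<integral>\<^sup>+t. liminf (\<lambda>n. u n t) \<partial>lborel)" unfolding J_def
  proof (rule nn_integral_mono)
    fix t :: "real^'m"
    show "ennreal (norm (f (cvec t)) powr p) * power_weight l t * indicator orthant t \<le> liminf (\<lambda>n. u n t)"
      using lim_imp_Liminf[OF sequentially_bot ulim[of t]] by (cases "t \<in> orthant") auto
  qed
  also have "\<dots> \<le> liminf (\<lambda>n. \<integral>\<^sup>+t. u n t \<partial>lborel)" by (rule nn_integral_liminf) simp
  finally have "eroot p J \<le> eroot p (liminf (\<lambda>n. \<integral>\<^sup>+t. u n t \<partial>lborel))" by (rule eroot_mono[OF p0])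
  also have "\<dots> = liminf (\<lambda>n. eroot p (\<integral>\<^sup>+t. u n t \<partial>lborel))"
    by (rule Liminf_compose_continuous_mono[symmetric, OF eroot_continuous[OF p0]]) (auto intro!: monoI eroot_mono[OF p0])
  also have "\<dots> \<le> liminf (\<lambda>n. ennreal (\<delta> (r n) / s (r n)))"
    by (intro Liminf_mono always_eventually allI uI)
  also have "(\<lambda>n. ennreal (\<delta> (r n) / s (r n))) = (\<lambda>n. ennreal (\<delta> (r n)) * inverse (ennreal (s (r n))))"
    using s(1) by (simp add: inverse_ennreal ennreal_mult'[symmetric] \<delta>_def divide_inverse)
  also have "liminf (\<lambda>n. ennreal (\<delta> (r n)) * inverse (ennreal (s (r n)))) = inverse S"
  proof -
    have "(\<lambda>n. inverse (ennreal (s (r n)))) \<longlonglongrightarrow> inverse S"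
      using filterlim_compose[OF inverse_ennreal_tendsto[OF s(3)] rtop] .
    then have "(\<lambda>n. ennreal (\<delta> (r n)) * inverse (ennreal (s (r n)))) \<longlonglongrightarrow> ennreal 1 * inverse S"
      using \<delta>1 by (intro tendsto_mult_ennreal tendsto_ennrealI) auto
    then show ?thesis by (simp add: lim_imp_Liminf)
  qed
  finally have JS: "eroot p J \<le> inverse S" .
  have "S \<le> inverse (eroot p J)" using ennreal_inverse_antimono[OF JS] by simp
  then have "S \<le> ennreal (2 powr (real CARD('m) / p)) * inverse (eroot p I)"
    by (simp add: inverse_eroot_orthant[OF IJ])
  moreover have "I < \<infinity>"
  proof -
    have "eroot p J \<noteq> top" using JS S by (auto simp: top_unique)
    then have "J \<noteq> top" by auto
    then show ?thesis by (simp add: IJ ennreal_mult_less_top less_top)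
  qed
  ultimately show ?thesis using that[OF fV f0] by (simp add: I_def)
qed

text \<open>A subsequence along which the upper limit is attained, with finitely many terms dropped.\<close>

lemma limsup_scaled_const_le:
  fixes l :: "'m \<Rightarrow> real" and X :: "nat \<Rightarrow> real"
  assumes p: "1 \<le> p" and l: "\<And>j. 0 \<le> l j" and X: "filterlim X at_top sequentially"
  obtains f where "f \<in> exp_type V" "f 0 = 1" "(\<integral>\<^sup>+t. ennreal (norm (f (cvec t)) powr p) * power_weight l t \<partial>lborel) < \<infinity>"
    "limsup (\<lambda>n. scaled_const V p l (X n)) \<le> ennreal (2 powr (real CARD('m) / p)) * inverse (eroot p (\<integral>\<^sup>+t. ennreal (norm (f (cvec t)) powr p) * power_weight l t \<partial>lborel))"
proof -
  define A where "A n = scaled_const V p l (X n)" for n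
  define S where "S = limsup A"
  have "0 < liminf A" unfolding A_def by (rule scaled_const_liminf_pos[where l=l, OF p l X])
  also have "liminf A \<le> S" unfolding S_def by (rule Liminf_le_Limsup) simp
  finally have S: "0 < S" .
  obtain r where r: "strict_mono (r :: nat \<Rightarrow> nat)" "(A \<circ> r) \<longlonglongrightarrow> S" using limsup_subseq_lim[of A] unfolding S_def by blast
  have Xr: "filterlim (\<lambda>n. X (r n)) at_top sequentially" using X filterlim_subseq[OF r(1)] by (rule filterlim_compose)
  have "eventually (\<lambda>n. 1 \<le> X (r n)) sequentially" using Xr by (simp add: filterlim_at_top)
  moreover have "eventually (\<lambda>n. 0 < A (r n)) sequentially" using order_tendstoD(1)[OF r(2) S] by simp
  ultimately have "eventually (\<lambda>n. 1 \<le> X (r n) \<and> 0 < A (r n)) sequentially" by eventually_elim simp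
  then obtain N where N: "\<And>n. N \<le> n \<Longrightarrow> 1 \<le> X (r n) \<and> 0 < A (r n)" unfolding eventually_sequentially by blast
  define Y where "Y n = X (r (n + N))" for n
  have Yt: "filterlim Y at_top sequentially" unfolding Y_def
    using Xr filterlim_add_const_nat_at_top by (rule filterlim_compose)
  have Yl: "(\<lambda>n. scaled_const V p l (Y n)) \<longlonglongrightarrow> S"
    using LIMSEQ_ignore_initial_segment[OF r(2), of N] by (simp add: Y_def A_def)
  have Y1: "1 \<le> Y n" "0 < scaled_const V p l (Y n)" for n using N[of "n + N"] by (simp_all add: Y_def A_def)
  have A: "A = (\<lambda>n. scaled_const V p l (X n))" by (simp add: A_def fun_eq_iff)
  show ?thesis
    by (rule scaled_const_limit_le[where l=l and Y=Y and S=S, OF p l Yt Y1(1) Yl S Y1(2)])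
      (rule that, assumption+, simp add: S_def A)
qed

end

section \<open>The limit relation\<close>

theorem theorem1p3:
  fixes V :: "(real^'m) set" and p :: real and l :: "'m \<Rightarrow> real"
  assumes "convex_body V" and "centrally_symmetric V" and "Pi_condition V"
    and "1 \<le> p" and "\<And>j. 0 \<le> l j"
  shows
    "((\<lambda>a::real. ennreal (a powr (- ((real CARD('m) + 2 * (\<Sum>j\<in>UNIV. l j)) / p)))
         * nikolskii (poly_space a V) p (jacobi_weight l) cube)
       \<longlongrightarrow> ennreal (2 powr (real CARD('m) / p))
         * nikolskii_at 0 (exp_type_real V \<inter> wLp p (power_weight l) UNIV) p (power_weight l) UNIV)
      at_top
     \<and>
     (\<exists>f0 \<in> (exp_type_real V \<inter> wLp p (power_weight l) UNIV) - {\<lambda>t. 0}.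
       ((\<lambda>a::real. ennreal (a powr (- ((real CARD('m) + 2 * (\<Sum>j\<in>UNIV. l j)) / p)))
           * nikolskii (poly_space a V) p (jacobi_weight l) cube)
         \<longlongrightarrow> ennreal (2 powr (real CARD('m) / p))
           * (ennreal (norm (f0 0)) / wnorm p (power_weight l) UNIV f0))
        at_top)"
proof -
  interpret pi_body V using assms(1-3) by unfold_locales
  have p: "1 \<le> p" and l: "\<And>j. 0 \<le> l j" by (rule assms)+
  let ?B = "exp_type_real V \<inter> wLp p (power_weight l) UNIV"
  define c where "c = ennreal (2 powr (real CARD('m) / p))"
  define I where "I f = (\<integral>\<^sup>+t. ennreal (norm (f (cvec t)) powr p) * power_weight l t \<partial>lborel)" for f :: "complex^'m \<Rightarrow> complex"
  define ratio where "ratio g = ennreal (norm (g 0)) / wnorm p (power_weight l) UNIV g" for g :: "real^'m \<Rightarrow> complex"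
  define L where "L = c * nikolskii_at 0 ?B p (power_weight l) UNIV"
  have c0: "cvec (0::real^'m) = 0" by (simp add: vec_eq_iff)
  have meas: "(\<lambda>t. f (cvec t)) \<in> borel_measurable borel" if "f \<in> exp_type V" for f
  proof (rule borel_measurable_continuous_onI)
    have "continuous_on UNIV (cvec :: real^'m \<Rightarrow> complex^'m)" unfolding cvec_def by (intro continuous_intros)
    moreover have "continuous_on UNIV f" using that unfolding exp_type_def by (blast intro: entire_imp_continuous)
    ultimately show "continuous_on UNIV (\<lambda>t. f (cvec t))" using continuous_on_compose2[of UNIV f UNIV cvec] by blast
  qed
  have wn: "wnorm p (power_weight l) UNIV (\<lambda>t. f (cvec t)) = eroot p (I f)" if f: "f \<in> exp_type V" for f
  proof -
    note [measurable] = meas[OF f]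
    show ?thesis unfolding I_def by (subst wnorm_eroot) auto
  qed
  have rat: "ratio (\<lambda>t. f (cvec t)) = ennreal (norm (f 0)) * inverse (eroot p (I f))" if "f \<in> exp_type V" for f
    by (simp add: ratio_def wn[OF that] c0 divide_ennreal_def)
  have inB: "(\<lambda>t. f (cvec t)) \<in> ?B" if f: "f \<in> exp_type V" and fin: "I f < \<infinity>" for f
  proof -
    have "(\<lambda>t. f (cvec t)) \<in> exp_type_real V" using f unfolding exp_type_real_def cvec_def by blast
    moreover have "eroot p (I f) < \<infinity>" using fin by (simp add: eroot_def)
    moreover have "(\<lambda>t. f (cvec t)) \<in> borel_measurable (lebesgue_on UNIV)"
      using measurable_completion[of "\<lambda>t. f (cvec t)" lborel borel] meas[OF f]
      by (intro measurable_restrict_space1) simp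
    ultimately show ?thesis using wn[OF f] by (simp add: wLp_def)
  qed
  have fromB: "\<exists>f\<in>exp_type V. g = (\<lambda>t. f (cvec t)) \<and> I f < \<infinity>" if g: "g \<in> ?B" for g
  proof -
    obtain f where f: "f \<in> exp_type V" "g = (\<lambda>t. f (cvec t))"
      using g unfolding exp_type_real_def cvec_def by blast
    have "eroot p (I f) < \<infinity>" using g unfolding f(2) by (simp add: wLp_def wn[OF f(1)])
    then have "I f < \<infinity>" by (cases "I f = top") (auto simp: less_top)
    then show ?thesis using f by blast
  qed
  (* every admissible function gives a lower bound, hence so does their supremum *)
  have low: "L \<le> liminf (\<lambda>n. scaled_const V p l (X n))" if X: "filterlim X at_top sequentially" for X
    unfolding L_def nikolskii_at_def SUP_mult_left_ennreal
  proof (rule SUP_least)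
    fix g assume "g \<in> nonzero_on UNIV ?B"
    then obtain f where f: "f \<in> exp_type V" "g = (\<lambda>t. f (cvec t))" "I f < \<infinity>"
      using fromB unfolding nonzero_on_def by blast
    show "c * (ennreal (norm (g 0)) / wnorm p (power_weight l) UNIV g) \<le> liminf (\<lambda>n. scaled_const V p l (X n))"
      using liminf_scaled_const_ge[where l=l, OF f(1) p l X] f(3) rat[OF f(1)]
      unfolding c_def I_def f(2) ratio_def by simp
  qed
  have up: "\<exists>g \<in> ?B - {\<lambda>t. 0}. limsup (\<lambda>n. scaled_const V p l (X n)) \<le> c * ratio g \<and> c * ratio g \<le> L"
    if X: "filterlim X at_top sequentially" for X
  proof -
    obtain f where f: "f \<in> exp_type V" "f 0 = 1" "I f < \<infinity>"
      and S: "limsup (\<lambda>n. scaled_const V p l (X n)) \<le> c * inverse (eroot p (I f))"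
      unfolding I_def c_def by (rule limsup_scaled_const_le[where l=l, OF p l X]) blast
    define g where "g = (\<lambda>t. f (cvec t))"
    have gB: "g \<in> ?B" unfolding g_def by (rule inB[OF f(1,3)])
    have g0: "g 0 \<noteq> 0" by (simp add: g_def c0 f(2))
    then have "g \<in> nonzero_on UNIV ?B" using gB unfolding nonzero_on_def by blast
    then have "c * ratio g \<le> L" unfolding L_def nikolskii_at_def ratio_def
      by (intro mult_left_mono SUP_upper) auto
    moreover have "g \<noteq> (\<lambda>t. 0)" using g0 by auto
    moreover have "limsup (\<lambda>n. scaled_const V p l (X n)) \<le> c * ratio g"
      using S rat[OF f(1)] f(2) by (simp add: g_def)
    ultimately show ?thesis using gB by blast
  qed
  have lim: "(scaled_const V p l \<longlongrightarrow> L) at_top"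
  proof (rule tendsto_at_topI_sequentially)
    fix X :: "nat \<Rightarrow> real" assume X: "filterlim X at_top sequentially"
    have "limsup (\<lambda>n. scaled_const V p l (X n)) \<le> L" using up[OF X] order_trans by blast
    moreover have "liminf (\<lambda>n. scaled_const V p l (X n)) \<le> limsup (\<lambda>n. scaled_const V p l (X n))"
      by (rule Liminf_le_Limsup) simp
    ultimately have "liminf (\<lambda>n. scaled_const V p l (X n)) = L" "limsup (\<lambda>n. scaled_const V p l (X n)) = L"
      using low[OF X] by (auto intro: antisym)
    then show "(\<lambda>n. scaled_const V p l (X n)) \<longlonglongrightarrow> L" by (intro Liminf_eq_Limsup) auto
  qed
  obtain f0 where f0: "f0 \<in> ?B - {\<lambda>t. 0}" "L = c * ratio f0"
  proof -
    have X: "filterlim real at_top sequentially" by (rule filterlim_real_sequentially)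
    obtain g where g: "g \<in> ?B - {\<lambda>t. 0}" "limsup (\<lambda>n. scaled_const V p l (real n)) \<le> c * ratio g" "c * ratio g \<le> L"
      using up[OF X] by blast
    have "liminf (\<lambda>n. scaled_const V p l (real n)) \<le> limsup (\<lambda>n. scaled_const V p l (real n))"
      by (rule Liminf_le_Limsup) simp
    then have "L = c * ratio g" using low[OF X] g by (intro antisym) auto
    then show ?thesis using that g(1) by blast
  qed
  have "(scaled_const V p l \<longlongrightarrow> c * ratio f0) at_top" using lim unfolding f0(2) .
  with lim show ?thesis
    unfolding scaled_const_def[abs_def] L_def ratio_def c_def by (intro conjI bexI[of _ f0] f0(1))
qed

end
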